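(* Assume the Riemann Hypothesis. There is an absolute constant $C>0$ such that for every integer $N\ge 2$, \[ \max_{y \in [2, N]} \left\vert \sum_{1\le n\le y} \Bigl[ R(n) - (2\psi(n)-n) \Bigr] e^{-n/N} \right\vert \le C\, N\log^3 N, \] where $R(n) = \sum_{h_1+h_2=n} \Lambda(h_1)\Lambda(h_2)$ (sum over positive integers $h_1,h_2$) and $\psi(x)=\sum_{m\leq x} \Lambda(m)$.
   Context: $\Lambda$ denotes the von Mangoldt function. *)

theory Defs
  imports "HOL-Complex_Analysis.Complex_Analysis" "HOL-Number_Theory.Prime_Powers"
    "HOL-Real_Asymp.Real_Asymp"
begin

(* zeta_continuation f: f is the analytic continuation to the punctured plane of
   the sum of n^(-s) over n >= 1.  Its value at the pole 1 is unconstrained. *)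
definition zeta_continuation :: "(complex \<Rightarrow> complex) \<Rightarrow> bool" where
  "zeta_continuation f \<longleftrightarrow>
     f holomorphic_on - {1} \<and>
     (\<forall>s. Re s > 1 \<longrightarrow> (\<lambda>n. 1 / of_nat (Suc n) powr s) sums f s)"

definition riemann_zeta :: "complex \<Rightarrow> complex" where
  "riemann_zeta = (SOME f. zeta_continuation f)"

definition riemann_hypothesis :: bool where
  "riemann_hypothesis \<longleftrightarrow>
     (\<forall>s. riemann_zeta s = 0 \<and> 0 < Re s \<and> Re s < 1 \<longrightarrow> Re s = 1 / 2)"

definition chebyshev_psi :: "real \<Rightarrow> real" where
  "chebyshev_psi x = (\<Sum>m\<in>{m. 1 \<le> m \<and> real m \<le> x}. mangoldt m)"

definition goldbach_R :: "nat \<Rightarrow> real" where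
  "goldbach_R n =
     (\<Sum>(h1, h2)\<in>{(h1, h2). 1 \<le> h1 \<and> 1 \<le> h2 \<and> h1 + h2 = n}. mangoldt h1 * mangoldt h2)"

(* The choice in riemann_zeta is justified by zeta_continuation_exists and
   zeta_continuation_unique below.  Existence is shown for the Hurwitz zeta function
   Z(s,a), a >= 1, extending G(s,a) = (s-1) Z(s,a) to the left one unit strip at a time:
     G(s,a) = a^(1-s) + (s-1) * (integral over t in [0,1] of (1-t) G(s+1,a+t)). *)

definition zterm :: "real \<Rightarrow> complex \<Rightarrow> complex" where
  "zterm x s = exp (- s * of_real (ln x))"

lemma zterm_1 [simp]: "zterm 1 s = 1"
  by (simp add: zterm_def)

lemma norm_zterm: "x > 0 \<Longrightarrow> norm (zterm x s) = x powr (- Re s)"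
  by (simp add: zterm_def powr_def)

lemma zterm_of_nat: "1 / of_nat (Suc n) powr s = zterm (real n + 1) s"
proof -
  have "of_nat (Suc n) = complex_of_real (real n + 1)" by simp
  then have "of_nat (Suc n) powr s = exp (s * of_real (ln (real n + 1)))"
    by (metis Ln_of_real add.commute add_pos_nonneg exp_not_eq_zero of_nat_0_le_iff of_nat_Suc
        of_nat_neq_0 powr_def zero_less_one)
  then show ?thesis
    by (simp add: zterm_def exp_minus field_simps)
qed

lemma zterm_split: "x > 0 \<Longrightarrow> zterm x (s - 1) = of_real x * zterm x s"
proof -
  assume "x > 0"
  then have "exp (complex_of_real (ln x)) = of_real x"
    by (metis exp_ln exp_of_real)
  then show ?thesis
    by (simp add: zterm_def algebra_simps flip: exp_add)
       (simp add: exp_add exp_diff exp_minus field_simps)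
qed

lemma zterm_deriv_s:
  "((\<lambda>s. zterm x s) has_field_derivative (- of_real (ln x) * zterm x s)) (at s)"
  unfolding zterm_def by (auto intro!: derivative_eq_intros)

lemma zterm_deriv_x:
  assumes "x + t > 0"
  shows "((\<lambda>t. zterm (x + t) s) has_vector_derivative (- s * zterm (x + t) (s + 1)))
           (at t within A)"
proof -
  have "zterm (x + t) s = of_real (x + t) * zterm (x + t) (s + 1)"
    using zterm_split[OF assms, of "s + 1"] by simp
  then have eq: "zterm (x + t) (s + 1) = zterm (x + t) s / of_real (x + t)"
    using assms by (auto simp: field_simps simp flip: of_real_add)
  have "((\<lambda>t. complex_of_real (ln (x + t))) has_vector_derivative of_real (1 / (x + t)))
          (at t within A)"
    by (intro has_vector_derivative_of_real)
       (use assms in \<open>auto intro!: derivative_eq_intros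
          simp flip: has_real_derivative_iff_has_vector_derivative\<close>)
  then have "((\<lambda>t. - s * complex_of_real (ln (x + t))) has_vector_derivative
               (- s * of_real (1 / (x + t)))) (at t within A)"
    by (rule has_vector_derivative_mult_right)
  from field_vector_diff_chain_within[OF this, of exp "exp (- s * of_real (ln (x + t)))"]
  have "(exp \<circ> (\<lambda>t. - s * complex_of_real (ln (x + t))) has_vector_derivative
          (- s * of_real (1 / (x + t))) * exp (- s * of_real (ln (x + t)))) (at t within A)"
    by (simp add: has_field_derivative_at_within)
  then show ?thesis
    unfolding eq by (simp add: zterm_def o_def divide_simps)
qed

lemma continuous_on_zterm [continuous_intros]:
  assumes "continuous_on S f" "continuous_on S g" "\<And>z. z \<in> S \<Longrightarrow> f z > 0"
  shows "continuous_on S (\<lambda>z. zterm (f z) (g z))"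
  unfolding zterm_def using assms by (intro continuous_intros) force+

definition zgood :: "real \<Rightarrow> (complex \<Rightarrow> real \<Rightarrow> complex) \<Rightarrow> bool" where
  "zgood c G \<longleftrightarrow> (\<exists>G'.
     continuous_on ({s. Re s > c} \<times> {1..}) (\<lambda>(s, a). G s a) \<and>
     continuous_on ({s. Re s > c} \<times> {1..}) (\<lambda>(s, a). G' s a) \<and>
     (\<forall>s a. Re s > c \<longrightarrow> a \<ge> 1 \<longrightarrow> ((\<lambda>s. G s a) has_field_derivative G' s a) (at s)))"

definition hzeta_sum :: "complex \<Rightarrow> real \<Rightarrow> complex" where
  "hzeta_sum s a = (\<Sum>n. zterm (real n + a) s)"

definition hzeta_step :: "(complex \<Rightarrow> real \<Rightarrow> complex) \<Rightarrow> complex \<Rightarrow> real \<Rightarrow> complex" where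
  "hzeta_step G s a =
     zterm a (s - 1) + (s - 1) * integral {0..1} (\<lambda>t. of_real (1 - t) * G (s + 1) (a + t))"

lemma zgood_step:
  assumes "zgood c G"
  shows "zgood (c - 1) (hzeta_step G)"
proof -
  obtain G' where G: "continuous_on ({s. Re s > c} \<times> {1..}) (\<lambda>(s, a). G s a)"
    and G': "continuous_on ({s. Re s > c} \<times> {1..}) (\<lambda>(s, a). G' s a)"
    and D: "\<And>s a. Re s > c \<Longrightarrow> a \<ge> 1 \<Longrightarrow> ((\<lambda>s. G s a) has_field_derivative G' s a) (at s)"
    using assms unfolding zgood_def by blast
  define U where "U = {s. Re s > c - 1}"
  have cont: "continuous_on ((U \<times> {1..}) \<times> cbox 0 1)
      (\<lambda>(z, t). of_real (1 - t) * H (fst z + 1) (snd z + t))"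
    if "continuous_on ({s. Re s > c} \<times> {1..}) (\<lambda>(s, a). H s a)" for H :: "complex \<Rightarrow> real \<Rightarrow> complex"
  proof -
    have "continuous_on ((U \<times> {1..}) \<times> cbox 0 1)
        (\<lambda>w. (\<lambda>(s, a). H s a) (fst (fst w) + 1, snd (fst w) + snd w))"
      by (rule continuous_on_compose2[OF that])
         (auto intro!: continuous_intros simp: U_def)
    then show ?thesis
      by (auto intro!: continuous_intros simp: case_prod_unfold)
  qed
  have contI: "continuous_on (U \<times> {1..})
      (\<lambda>(s, a). integral {0..1} (\<lambda>t. of_real (1 - t) * H (s + 1) (a + t)))"
    if "continuous_on ({s. Re s > c} \<times> {1..}) (\<lambda>(s, a). H s a)" for H :: "complex \<Rightarrow> real \<Rightarrow> complex"
    using integral_continuous_on_param[OF cont[OF that]] by (simp add: case_prod_unfold)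
  have contp: "continuous_on (U \<times> {1..}) (\<lambda>(s, a). zterm a (s - 1))"
    by (auto intro!: continuous_intros simp: case_prod_unfold)
  have contl: "continuous_on (U \<times> {1..}) (\<lambda>(s, a). complex_of_real (ln a))"
    by (force intro!: continuous_intros simp: case_prod_unfold)
  define I where "I H s a = integral {0..1} (\<lambda>t. complex_of_real (1 - t) * H (s + 1) (a + t))"
    for H :: "complex \<Rightarrow> real \<Rightarrow> complex" and s a
  have DI: "((\<lambda>s. I G s a) has_field_derivative I G' s a) (at s)" if "s \<in> U" "a \<ge> 1" for s a
  proof -
    have "((\<lambda>s. integral (cbox 0 1) (\<lambda>t. complex_of_real (1 - t) * G (s + 1) (a + t)))
            has_field_derivative
            integral (cbox 0 1) (\<lambda>t. complex_of_real (1 - t) * G' (s + 1) (a + t))) (at s within U)"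
    proof (rule leibniz_rule_field_derivative)
      fix x :: complex and t :: real assume "x \<in> U" "t \<in> cbox 0 1"
      then have "((\<lambda>s. G s (a + t)) has_field_derivative G' (x + 1) (a + t)) (at (x + 1))"
        using that by (intro D) (auto simp: U_def)
      then have "((\<lambda>s. G (s + 1) (a + t)) has_field_derivative G' (x + 1) (a + t)) (at x within U)"
        by (simp add: DERIV_shift has_field_derivative_at_within)
      then show "((\<lambda>s. complex_of_real (1 - t) * G (s + 1) (a + t)) has_field_derivative
          complex_of_real (1 - t) * G' (x + 1) (a + t)) (at x within U)"
        by (rule DERIV_cmult)
    next
      fix x assume x: "x \<in> U"
      have "continuous_on (cbox 0 1)
          (\<lambda>t. (\<lambda>(z, t). of_real (1 - t) * G (fst z + 1) (snd z + t)) ((x, a), t))"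
        by (rule continuous_on_compose2[OF cont[OF G]])
           (use x that in \<open>auto intro!: continuous_intros\<close>)
      then show "(\<lambda>t. complex_of_real (1 - t) * G (x + 1) (a + t)) integrable_on cbox 0 1"
        by (intro integrable_continuous) auto
    next
      have "continuous_on (U \<times> cbox 0 1)
          (\<lambda>w. (\<lambda>(z, t). of_real (1 - t) * G' (fst z + 1) (snd z + t)) ((fst w, a), snd w))"
        by (rule continuous_on_compose2[OF cont[OF G']])
           (use that in \<open>auto intro!: continuous_intros\<close>)
      then show "continuous_on (U \<times> cbox 0 1)
          (\<lambda>(x, t). complex_of_real (1 - t) * G' (x + 1) (a + t))"
        by (simp add: case_prod_unfold)
    next
      show "convex U"
        unfolding U_def by (rule convex_halfspace_Re_gt)
    qed (use that in auto)
    moreover have "at s within U = at s"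
      using that by (intro at_within_open) (auto simp: U_def open_halfspace_Re_gt)
    ultimately show ?thesis
      by (simp only: I_def interval_cbox)
  qed
  define H where "H s a = - of_real (ln a) * zterm a (s - 1) + (I G s a + (s - 1) * I G' s a)" for s a
  show ?thesis
    unfolding zgood_def U_def[symmetric]
  proof (rule exI[of _ H], intro conjI allI impI)
    have c1: "continuous_on (U \<times> {1..}) (\<lambda>z. I G (fst z) (snd z))"
      and c2: "continuous_on (U \<times> {1..}) (\<lambda>z. I G' (fst z) (snd z))"
      using contI[OF G] contI[OF G'] unfolding I_def case_prod_unfold by blast+
    show "continuous_on (U \<times> {1..}) (\<lambda>(s, a). hzeta_step G s a)"
      unfolding hzeta_step_def I_def[symmetric] case_prod_unfold
      by (rule continuous_on_add continuous_on_mult c1 continuous_intros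
            contp[unfolded case_prod_unfold])+
    show "continuous_on (U \<times> {1..}) (\<lambda>(s, a). H s a)"
      unfolding H_def case_prod_unfold
      by (rule continuous_on_add continuous_on_mult continuous_on_minus c1 c2 continuous_intros
            contp[unfolded case_prod_unfold] contl[unfolded case_prod_unfold])+
  next
    fix s and a :: real assume s: "Re s > c - 1" and a: "a \<ge> 1"
    have 1: "((\<lambda>s. zterm a (s - 1)) has_field_derivative - of_real (ln a) * zterm a (s - 1)) (at s)"
      using zterm_deriv_s[of a "s + (-1)"] DERIV_shift[of "zterm a" _ s "-1"] by simp
    have 2: "((\<lambda>s. I G s a) has_field_derivative I G' s a) (at s)"
      using s a by (intro DI) (auto simp: U_def)
    show "((\<lambda>s. hzeta_step G s a) has_field_derivative H s a) (at s)"
      unfolding hzeta_step_def I_def[symmetric] H_def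
    proof -
      have "((\<lambda>s. s - 1) has_field_derivative 1) (at s)"
        by (auto intro!: derivative_eq_intros)
      from DERIV_add[OF 1 DERIV_mult[OF this 2]]
      show "((\<lambda>s. zterm a (s - 1) + (s - 1) * I G s a) has_field_derivative
          - of_real (ln a) * zterm a (s - 1) + (I G s a + (s - 1) * I G' s a)) (at s)"
        by (simp add: algebra_simps)
    qed
  qed
qed

lemma zterm_bound:
  assumes "c \<le> Re s" "c \<ge> 0" "a \<ge> 1"
  shows "norm (zterm (real n + a) s) \<le> (real n + 1) powr (- c)"
proof -
  have "norm (zterm (real n + a) s) = (real n + a) powr (- Re s)"
    using assms by (intro norm_zterm) auto
  also have "\<dots> \<le> (real n + a) powr (- c)"
    using assms by (intro powr_mono) auto
  also have "\<dots> \<le> (real n + 1) powr (- c)"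
    using assms by (intro powr_mono2') auto
  finally show ?thesis .
qed

lemma zterm_log_bound:
  assumes "c \<le> Re s" "c > 1" "a \<ge> 1"
  shows "norm (- of_real (ln (real n + a)) * zterm (real n + a) s)
          \<le> 2 / (c - 1) * (real n + 1) powr (- ((c + 1) / 2))"
proof -
  define d where "d = (c - 1) / 2"
  have d: "d > 0" "c = 2 * d + 1" using assms by (auto simp: d_def field_simps)
  have "norm (- of_real (ln (real n + a)) * zterm (real n + a) s)
      = ln (real n + a) * (real n + a) powr (- Re s)"
    using assms by (simp add: norm_mult norm_zterm)
  also have "\<dots> \<le> ((real n + a) powr d / d) * (real n + a) powr (- c)"
    using assms d by (intro mult_mono ln_powr_bound powr_mono) auto
  also have "\<dots> = (real n + a) powr (d - c) / d"
    using assms by (simp add: powr_add[symmetric])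
  also have "\<dots> \<le> (real n + 1) powr (d - c) / d"
    using assms d by (intro divide_right_mono powr_mono2') auto
  also have "\<dots> = 2 / (c - 1) * (real n + 1) powr (- ((c + 1) / 2))"
  proof -
    have "d - c = - ((c + 1) / 2)" by (simp add: d_def field_simps)
    then show ?thesis by (simp add: d_def)
  qed
  finally show ?thesis .
qed

lemma summable_shifted_powr: "c > 1 \<Longrightarrow> summable (\<lambda>n. (real n + 1) powr (- c))"
proof -
  assume "c > 1"
  then have "summable (\<lambda>n. real n powr (- c))"
    by (simp add: summable_real_powr_iff)
  then have "summable (\<lambda>n. real (Suc n) powr (- c))"
    by (subst summable_Suc_iff)
  then show ?thesis by (simp add: add.commute)
qed

lemma zterm_sums:
  assumes "Re s > 1" "a \<ge> 1"
  shows "(\<lambda>n. zterm (real n + a) s) sums hzeta_sum s a"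
proof -
  have "summable (\<lambda>n. zterm (real n + a) s)"
    by (rule summable_comparison_test'[OF summable_shifted_powr[OF assms(1)]])
       (use assms in \<open>auto intro!: zterm_bound\<close>)
  then show ?thesis by (simp add: hzeta_sum_def summable_sums)
qed

lemma zgood_sum: "zgood 1 hzeta_sum"
proof -
  define H where "H s a = (\<Sum>n. - of_real (ln (real n + a)) * zterm (real n + a) s)" for s and a :: real
  define V where "V c = {s. Re s > c}" for c :: real
  have u1: "uniform_limit (V c \<times> {1..}) (\<lambda>N (s, a). \<Sum>n<N. zterm (real n + a) s)
      (\<lambda>(s, a). hzeta_sum s a) sequentially" if "c > 1" for c
    unfolding case_prod_unfold hzeta_sum_def
    by (rule Weierstrass_m_test[OF _ summable_shifted_powr[OF that]])
       (use that in \<open>auto intro!: zterm_bound simp: V_def\<close>)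
  have u2: "uniform_limit (V c \<times> {1..})
      (\<lambda>N (s, a). \<Sum>n<N. - of_real (ln (real n + a)) * zterm (real n + a) s)
      (\<lambda>(s, a). H s a) sequentially" if "c > 1" for c
    unfolding case_prod_unfold H_def
  proof (rule Weierstrass_m_test)
    show "summable (\<lambda>n. 2 / (c - 1) * (real n + 1) powr (- ((c + 1) / 2)))"
      using that by (intro summable_mult summable_shifted_powr) auto
    show "norm (- of_real (ln (real n + snd z)) * zterm (real n + snd z) (fst z))
        \<le> 2 / (c - 1) * (real n + 1) powr (- ((c + 1) / 2))" if "z \<in> V c \<times> {1..}" for n z
      using that \<open>c > 1\<close> by (intro zterm_log_bound) (auto simp: V_def)
  qed
  have c1: "continuous_on (V c \<times> {1..}) (\<lambda>(s, a). hzeta_sum s a)" if "c > 1" for c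
    by (rule uniform_limit_theorem[OF _ u1[OF that]])
       (auto intro!: always_eventually continuous_intros simp: case_prod_unfold)
  have c2: "continuous_on (V c \<times> {1..}) (\<lambda>(s, a). H s a)" if "c > 1" for c
    by (rule uniform_limit_theorem[OF _ u2[OF that]])
       (force intro!: always_eventually continuous_intros simp: case_prod_unfold)+
  have local: "continuous_on (V 1 \<times> {1..}) f"
    if "\<And>c. c > 1 \<Longrightarrow> continuous_on (V c \<times> {1..}) f" for f :: "complex \<times> real \<Rightarrow> complex"
    unfolding continuous_on_eq_continuous_within
  proof
    fix z :: "complex \<times> real" assume z: "z \<in> V 1 \<times> {1..}"
    define c where "c = (1 + Re (fst z)) / 2"
    have c: "c > 1" "Re (fst z) > c" using z by (auto simp: c_def V_def)
    have "at z within (V 1 \<times> {1..}) = at z within (V c \<times> {1..})"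
      by (rule at_within_nhd[of _ "V c \<times> UNIV"])
         (use c z in \<open>auto simp: V_def intro!: open_Times open_halfspace_Re_gt\<close>)
    moreover have "continuous (at z within (V c \<times> {1..})) f"
      using that[OF c(1)] z c by (auto simp: continuous_on_eq_continuous_within V_def)
    ultimately show "continuous (at z within (V 1 \<times> {1..})) f" by simp
  qed
  have D: "((\<lambda>s. hzeta_sum s a) has_field_derivative H s a) (at s)" if "Re s > 1" "a \<ge> 1" for s a
  proof -
    define c where "c = (1 + Re s) / 2"
    have c: "c > 1" "s \<in> V c" using that by (auto simp: c_def V_def)
    have "open (V c)" "convex (V c)"
      unfolding V_def by (rule open_halfspace_Re_gt convex_halfspace_Re_gt)+
    show ?thesis
      unfolding hzeta_sum_def H_def
    proof (rule has_field_derivative_series'(2)[of "V c"])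
      show "uniformly_convergent_on (V c)
          (\<lambda>N s. \<Sum>n<N. - of_real (ln (real n + a)) * zterm (real n + a) s)"
        using uniform_limit_compose'[OF u2[OF c(1)], of "\<lambda>s. (s, a)" "V c"] that
        by (auto simp: uniformly_convergent_on_def)
      show "summable (\<lambda>n. zterm (real n + a) s)"
        using zterm_sums that by (auto simp: sums_iff)
      show "s \<in> interior (V c)"
        using c \<open>open (V c)\<close> by (simp add: interior_open)
    qed (use c \<open>convex (V c)\<close> zterm_deriv_s in \<open>auto intro: has_field_derivative_at_within simp del: mult_minus_left\<close>)
  qed
  show ?thesis
    unfolding zgood_def
    using local[OF c1] local[OF c2] D unfolding V_def by blast
qed

lemma zterm_integral:
  assumes "x > 0"
  shows "((\<lambda>t. of_real (1 - t) * ((s - 1) * s * zterm (x + t) (s + 1))) has_integral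
           ((s - 1) * zterm x s - (zterm x (s - 1) - zterm (x + 1) (s - 1)))) {0..1}"
proof -
  define h where "h t = - (s - 1) * (complex_of_real (1 - t) * zterm (x + t) s) + zterm (x + t) (s - 1)" for t
  have "(h has_vector_derivative of_real (1 - t) * ((s - 1) * s * zterm (x + t) (s + 1))) (at t within {0..1})"
    if "t \<in> {0..1}" for t
  proof -
    have 1: "((\<lambda>t. complex_of_real (1 - t)) has_vector_derivative of_real (-1)) (at t within {0..1})"
      by (intro has_vector_derivative_of_real)
         (auto intro!: derivative_eq_intros simp flip: has_real_derivative_iff_has_vector_derivative)
    have 2: "((\<lambda>t. zterm (x + t) s) has_vector_derivative (- s * zterm (x + t) (s + 1))) (at t within {0..1})"
      by (rule zterm_deriv_x) (use assms that in auto)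
    have 3: "((\<lambda>t. zterm (x + t) (s - 1)) has_vector_derivative (- (s - 1) * zterm (x + t) s)) (at t within {0..1})"
      using zterm_deriv_x[of x t "s - 1"] assms that by auto
    have "(h has_vector_derivative (- (s - 1) * (of_real (1 - t) * (- s * zterm (x + t) (s + 1)) + of_real (- 1) * zterm (x + t) s)
            + - (s - 1) * zterm (x + t) s)) (at t within {0..1})"
      unfolding h_def
      by (intro has_vector_derivative_add has_vector_derivative_mult_right has_vector_derivative_mult 1 2 3)
    then show ?thesis
      by (simp add: algebra_simps)
  qed
  from fundamental_theorem_of_calculus[OF _ this]
  have "((\<lambda>t. of_real (1 - t) * ((s - 1) * s * zterm (x + t) (s + 1))) has_integral (h 1 - h 0)) {0..1}"
    by simp
  then show ?thesis by (simp add: h_def algebra_simps)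
qed

lemma hzeta_step_sum:
  assumes s: "Re s > 1" and a: "a \<ge> 1"
  shows "hzeta_step (\<lambda>s a. (s - 1) * hzeta_sum s a) s a = (s - 1) * hzeta_sum s a"
proof -
  define f where "f n t = complex_of_real (1 - t) * ((s - 1) * s * zterm (real n + a + t) (s + 1))" for n t
  define g where "g t = complex_of_real (1 - t) * ((s - 1) * s * hzeta_sum (s + 1) (a + t))" for t
  have u: "uniform_limit (cbox 0 1) (\<lambda>N t. \<Sum>n<N. f n t) g sequentially"
  proof -
    have "uniform_limit (cbox 0 1) (\<lambda>N t. \<Sum>n<N. f n t) (\<lambda>t. \<Sum>n. f n t) sequentially"
    proof (rule Weierstrass_m_test)
      show "summable (\<lambda>n. norm ((s - 1) * s) * (real n + 1) powr (- Re s))"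
        by (intro summable_mult summable_shifted_powr s)
      fix n and t :: real assume t: "t \<in> cbox 0 1"
      have "norm (f n t) = \<bar>1 - t\<bar> * (norm ((s - 1) * s) * norm (zterm (real n + (a + t)) (s + 1)))"
        by (simp add: f_def norm_mult add.assoc del: of_real_diff)
      also have "\<dots> \<le> 1 * (norm ((s - 1) * s) * (real n + 1) powr (- Re s))"
        using t s a by (intro mult_mono mult_left_mono zterm_bound) auto
      finally show "norm (f n t) \<le> norm ((s - 1) * s) * (real n + 1) powr (- Re s)" by simp
    qed
    moreover have "(\<Sum>n. f n t) = g t" if "t \<in> cbox 0 1" for t
    proof -
      have "(\<lambda>n. zterm (real n + (a + t)) (s + 1)) sums hzeta_sum (s + 1) (a + t)"
        using s a that by (intro zterm_sums) auto
      then have "(\<lambda>n. complex_of_real (1 - t) * ((s - 1) * s * zterm (real n + (a + t)) (s + 1))) sums g t"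
        unfolding g_def by (intro sums_mult)
      then show ?thesis by (simp add: f_def sums_iff add.assoc)
    qed
    ultimately show ?thesis
      by (subst (asm) uniform_limit_cong') auto
  qed
  have c: "continuous_on (cbox 0 1) (\<lambda>t. \<Sum>n<N. f n t)" for N
    unfolding f_def using a by (auto intro!: continuous_intros)
  obtain I J where I: "\<And>N. ((\<lambda>t. \<Sum>n<N. f n t) has_integral I N) (cbox 0 1)"
    and J: "(g has_integral J) (cbox 0 1)" and lim: "I \<longlonglongrightarrow> J"
    using uniform_limit_integral_cbox[OF u c] by auto
  define w where "w n = (s - 1) * zterm (real n + a) s
      - (zterm (real n + a) (s - 1) - zterm (real (Suc n) + a) (s - 1))" for n
  have "((\<lambda>t. \<Sum>n<N. f n t) has_integral (\<Sum>n<N. w n)) (cbox 0 1)" for N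
  proof (intro has_integral_sum)
    fix n
    have "(f n has_integral w n) {0..1}"
      using zterm_integral[of "real n + a" s] a unfolding f_def w_def by (simp add: ac_simps)
    then show "(f n has_integral w n) (cbox 0 1)" by simp
  qed auto
  with I have "I N = (\<Sum>n<N. w n)" for N
    using has_integral_unique by blast
  then have "I = (\<lambda>N. \<Sum>n<N. w n)" by (rule ext)
  with lim have "w sums J" unfolding sums_def by simp
  moreover have "w sums ((s - 1) * hzeta_sum s a - (zterm (real 0 + a) (s - 1) - 0))"
    unfolding w_def
  proof (rule sums_diff[OF sums_mult[OF zterm_sums[OF s a]] telescope_sums'])
    show "(\<lambda>n. zterm (real n + a) (s - 1)) \<longlonglongrightarrow> 0"
    proof (rule tendsto_norm_zero_cancel)
      have "(\<lambda>n. (real n + a) powr (- (Re s - 1))) \<longlonglongrightarrow> 0"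
        using s a by real_asymp
      then show "(\<lambda>n. norm (zterm (real n + a) (s - 1))) \<longlonglongrightarrow> 0"
        using a by (simp add: norm_zterm)
    qed
  qed
  ultimately have J2: "J = (s - 1) * hzeta_sum s a - zterm a (s - 1)"
    using sums_unique2 by fastforce
  have "integral {0..1} g = J"
    using J by (simp add: integral_unique)
  moreover have "integral {0..1} g = (s - 1) * integral {0..1} (\<lambda>t. of_real (1 - t) * ((s + 1 - 1) * hzeta_sum (s + 1) (a + t)))"
    unfolding g_def by (simp only: integral_mult_right[symmetric]) (simp add: algebra_simps)
  ultimately show ?thesis
    unfolding hzeta_step_def J2 by (simp add: algebra_simps)
qed

primrec hzeta_ext :: "nat \<Rightarrow> complex \<Rightarrow> real \<Rightarrow> complex" where
  "hzeta_ext 0 = (\<lambda>s a. (s - 1) * hzeta_sum s a)"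
| "hzeta_ext (Suc k) = hzeta_step (hzeta_ext k)"

lemma zgood_ext: "zgood (1 - real k) (hzeta_ext k)"
proof (induction k)
  case 0
  obtain H where "continuous_on ({s. Re s > 1} \<times> {1..}) (\<lambda>z. hzeta_sum (fst z) (snd z))"
     "continuous_on ({s. Re s > 1} \<times> {1..}) (\<lambda>z. H (fst z) (snd z))"
     "\<And>s a. Re s > 1 \<Longrightarrow> a \<ge> 1 \<Longrightarrow> ((\<lambda>s. hzeta_sum s a) has_field_derivative H s a) (at s)"
    using zgood_sum unfolding zgood_def case_prod_unfold by blast
  then show ?case
    unfolding zgood_def case_prod_unfold
    by (intro exI[of _ "\<lambda>s a. hzeta_sum s a + (s - 1) * H s a"])
       (auto intro!: continuous_intros derivative_eq_intros)
next
  case (Suc k)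
  then show ?case using zgood_step[OF Suc] by (simp add: algebra_simps)
qed

lemma hzeta_ext_Suc:
  "Re s > 1 - real k \<Longrightarrow> a \<ge> 1 \<Longrightarrow> hzeta_ext (Suc k) s a = hzeta_ext k s a"
proof (induction k arbitrary: s a)
  case 0
  then show ?case using hzeta_step_sum by simp
next
  case (Suc k)
  have "integral {0..1} (\<lambda>t. of_real (1 - t) * hzeta_ext (Suc k) (s + 1) (a + t))
      = integral {0..1} (\<lambda>t. of_real (1 - t) * hzeta_ext k (s + 1) (a + t))"
    using Suc.prems by (intro integral_cong) (subst Suc.IH, auto)
  then show ?case
    by (simp only: hzeta_ext.simps(2) hzeta_step_def)
qed

lemma hzeta_ext_le:
  "k \<le> m \<Longrightarrow> Re s > 1 - real k \<Longrightarrow> a \<ge> 1 \<Longrightarrow> hzeta_ext m s a = hzeta_ext k s a"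
proof (induction m rule: dec_induct)
  case base
  show ?case by (rule refl)
next
  case (step m)
  then have "hzeta_ext (Suc m) s a = hzeta_ext m s a"
    by (intro hzeta_ext_Suc) auto
  then show ?case using step by simp
qed

lemma zeta_continuation_exists: "\<exists>f. zeta_continuation f"
proof -
  define g where "g s = hzeta_ext (nat (\<lfloor>1 - Re s\<rfloor> + 1)) s 1 / (s - 1)" for s
  have g_eq: "g s = hzeta_ext k s 1 / (s - 1)" if "Re s > 1 - real k" for s k
  proof -
    define m where "m = nat (\<lfloor>1 - Re s\<rfloor> + 1)"
    have "Re s > 1 - real m" unfolding m_def by linarith
    then have "hzeta_ext m s 1 = hzeta_ext (max m k) s 1"
      and "hzeta_ext k s 1 = hzeta_ext (max m k) s 1"
      using that by (auto intro!: hzeta_ext_le[symmetric])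
    then show ?thesis by (simp add: g_def m_def)
  qed
  have "g field_differentiable at s" if "s \<noteq> 1" for s
  proof -
    obtain k :: nat where k: "1 - Re s < real k" using reals_Archimedean2 by blast
    define V where "V = {s. Re s > 1 - real k} - {1}"
    have "open V"
      unfolding V_def by (intro open_Diff open_halfspace_Re_gt) auto
    have "s \<in> V" using k that by (auto simp: V_def)
    have "(\<lambda>s. hzeta_ext k s 1) field_differentiable at s"
    proof -
      obtain H where "\<And>s a. Re s > 1 - real k \<Longrightarrow> a \<ge> 1 \<Longrightarrow>
          ((\<lambda>s. hzeta_ext k s a) has_field_derivative H s a) (at s)"
        using zgood_ext[of k] unfolding zgood_def by blast
      then show ?thesis
        using k unfolding field_differentiable_def by (metis add.commute diff_less_eq order_refl)
    qed
    then have "(\<lambda>s. hzeta_ext k s 1 / (s - 1)) field_differentiable at s"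
      using that by (auto intro!: derivative_intros)
    then obtain D where "((\<lambda>s. hzeta_ext k s 1 / (s - 1)) has_field_derivative D) (at s)"
      unfolding field_differentiable_def by blast
    then have "(g has_field_derivative D) (at s)"
      by (rule has_field_derivative_transform_within_open[OF _ \<open>open V\<close> \<open>s \<in> V\<close>])
         (use g_eq in \<open>auto simp: V_def\<close>)
    then show ?thesis
      unfolding field_differentiable_def by blast
  qed
  then have "g holomorphic_on - {1}"
    by (auto simp: holomorphic_on_def intro: field_differentiable_at_within)
  moreover have "(\<lambda>n. 1 / of_nat (Suc n) powr s) sums g s" if "Re s > 1" for s
  proof -
    have "g s = hzeta_sum s 1" using g_eq[of 0 s] that by auto
    then show ?thesis using zterm_sums[OF that, of 1] by (simp add: zterm_of_nat del: of_nat_Suc)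
  qed
  ultimately show ?thesis unfolding zeta_continuation_def by blast
qed

lemma zeta_continuation_unique:
  assumes "zeta_continuation f" "zeta_continuation g" "s \<noteq> 1"
  shows "f s = g s"
proof (rule analytic_continuation_open[of "{s. Re s > 1}" "- {1}" f g])
  have "(2 :: complex) \<in> {s. Re s > 1}" by simp
  then show "{s. Re s > 1} \<noteq> {}" by blast
  show "connected (- {1 :: complex})"
    by (rule connected_punctured_universe) simp
  show "f z = g z" if "z \<in> {s. Re s > 1}" for z
    using assms that unfolding zeta_continuation_def by (auto intro: sums_unique2)
qed (use assms in \<open>auto simp: zeta_continuation_def open_halfspace_Re_gt\<close>)

lemma zeta_continuation_riemann_zeta: "zeta_continuation riemann_zeta"
  unfolding riemann_zeta_def using zeta_continuation_exists by (rule someI_ex)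

lemma holomorphic_riemann_zeta: "riemann_zeta holomorphic_on - {1}"
  using zeta_continuation_riemann_zeta unfolding zeta_continuation_def by blast

lemma sums_riemann_zeta: "Re s > 1 \<Longrightarrow> (\<lambda>n. 1 / of_nat (Suc n) powr s) sums riemann_zeta s"
  using zeta_continuation_riemann_zeta unfolding zeta_continuation_def by blast

end

(* Put L(n) = Lambda(n) - 1 and M(n) = psi(n) - n.  Then R(n) - 2 psi(n) + n = (L * L)(n) - 2 Lambda(n) + 1,
   and partial summation removes the weights exp(-n/N), so it suffices to bound
   S(k) = sum over n <= k of (L * L)(n) for k <= N.  As power series, S = (1 - x) M^2, and
   2 (1 - x) = sum over j < J of 2^(-j) (1 - x^h)^2 + 2^(1-J) (1 - x^(2^J)) with h = 2^j.  So S is a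
   weighted sum of self-convolutions of the differences M(n) - M(n - h), and Cauchy-Schwarz leaves the
   mean-square bound  sum over n < X of (M(n) - M(n - h))^2 << h X (log X)^2.

   Under RH this comes from writing the once-integrated error term as an integral of Re f'/f,
   f(s) = (s - 1) zeta(s), along Re s = 1/2 + a with a about 1/log X.  To the right of the critical line
   every zero contributes nonnegatively to Re f'/f, so Re f'/f >= -C log(|t| + 2); a Poisson-type kernel
   whose integral is known by shifting the line to the right turns this one-sided bound into
   a bound for the integral of |Re f'/f| over unit intervals, with no information on individual zeros. *)
theory Submission imports Defs "HOL-Probability.Probability" begin

text \<open>Only the real part of \<open>f'/f\<close> has a one-sided bound, so the explicit formula
  must be written with it. Reflection makes this possible: on \<open>Re s = 1/2 + a\<close> the
  conjugate of \<open>f'/f\<close> agrees with a function holomorphic to the left of the line, and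
  pushing that half of the integral to minus infinity leaves a linear polynomial
  \<open>\<alpha> x - \<beta>\<close>, which second differences annihilate. Integrating the error
  term once makes the kernel \<open>x^(s+1) / (s (s+1))\<close> absolutely integrable; a unit
  difference undoes the smoothing, being the piecewise linear interpolation of \<open>M\<close> plus
  1/2. For a step \<open>h\<close> at height \<open>X\<close> the frequencies are cut at
  \<open>|t| = T = X / h\<close>, where the low-frequency bound \<open>h^2 T\<close> and the
  high-frequency bound \<open>X^2 / T\<close> meet at \<open>h X\<close>. Of the two logarithms in
  the mean square, one comes from averages of \<open>|Re f'/f|\<close> near a given height and one
  from its average over the whole frequency range; the third logarithm of the theorem counts the
  dyadic scales.\<close>

subsection \<open>Lower bounds for the real part of a logarithmic derivative\<close>

text \<open>Borel-Caratheodory followed by Cauchy's inequality: \<open>L = log (g / g c)\<close>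
  exists because \<open>g\<close> has no zeros, and its real part stays below \<open>A\<close>; so
  \<open>L\<close> is bounded on a smaller disc, and its derivative \<open>g'/g\<close> on a still
  smaller one.\<close>

lemma log_deriv_bound:
  fixes g :: "complex \<Rightarrow> complex"
  assumes hol: "g holomorphic_on ball c R" and nz: "\<And>z. z \<in> ball c R \<Longrightarrow> g z \<noteq> 0"
    and bd: "\<And>z. z \<in> ball c R \<Longrightarrow> norm (g z) < exp A * norm (g c)"
    and r: "0 \<le> r" "r < R" and s: "dist c s \<le> r"
  shows "norm (deriv g s / g s) \<le> 8 * A * R / (R - r)\<^sup>2"
proof -
  have R: "R > 0" using r by simp
  have c: "c \<in> ball c R" using R by simp
  have A: "A > 0"
  proof (rule ccontr)
    assume "\<not> A > 0"
    then have "exp A * norm (g c) \<le> 1 * norm (g c)" by (intro mult_right_mono) auto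
    then show False using bd[OF c] by simp
  qed
  obtain h where h: "h holomorphic_on ball c R" and hg: "\<And>z. z \<in> ball c R \<Longrightarrow> exp (h z) = g z"
    by (rule holomorphic_logarithm_exists[OF convex_ball open_ball hol nz c]) auto
  define L where "L z = h z - h c" for z
  have L: "L holomorphic_on ball c R" unfolding L_def by (intro holomorphic_intros h)
  have ReL: "Re (L z) < A" if "z \<in> ball c R" for z
  proof -
    have "exp (Re (h z)) < exp (A + Re (h c))"
      using bd[OF that] hg[OF that] hg[OF c] by (metis norm_exp_eq_Re exp_add)
    then show ?thesis by (simp add: L_def)
  qed
  have nzd: "2 * of_real A - L z \<noteq> 0" if "z \<in> ball c R" for z
    using ReL[OF that] A by (auto simp: complex_eq_iff)
  \<comment> \<open>The Moebius map \<open>w / (2 A - w)\<close> sends the half-plane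
    \<open>Re w < A\<close> into the unit disc and fixes 0, which brings \<open>L\<close> within
    reach of the Schwarz lemma.\<close>
  define p where "p z = L (c + of_real R * z) / (2 * of_real A - L (c + of_real R * z))" for z
  have inb: "c + of_real R * z \<in> ball c R" if "norm z < 1" for z :: complex
    using that R by (simp add: dist_norm norm_mult)
  have p: "norm (p z) \<le> norm z" if z: "norm z < 1" for z
  proof (rule Schwarz_Lemma(1)[OF _ _ _ z])
    show "p holomorphic_on ball 0 1"
    proof -
      have "(\<lambda>z. L (c + of_real R * z)) holomorphic_on ball 0 1"
        by (rule holomorphic_on_compose_gen[of "\<lambda>z. c + of_real R * z" "ball 0 1" L "ball c R", unfolded o_def])
           (use L inb in \<open>auto intro!: holomorphic_intros\<close>)
      then show ?thesis unfolding p_def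
        by (intro holomorphic_intros) (use nzd inb in auto)
    qed
    show "p 0 = 0" by (simp add: p_def L_def)
    fix w :: complex assume w: "norm w < 1"
    define l where "l = L (c + of_real R * w)"
    have l: "Re l < A" "2 * of_real A - l \<noteq> 0" using ReL nzd inb[OF w] by (auto simp: l_def)
    have "(norm l)\<^sup>2 < (norm (2 * of_real A - l))\<^sup>2"
    proof -
      have "(Re l)\<^sup>2 < (2 * A - Re l)\<^sup>2"
      proof -
        have "(2 * A - Re l)\<^sup>2 - (Re l)\<^sup>2 = 4 * A * (A - Re l)" by (simp add: power2_eq_square algebra_simps)
        moreover have "4 * A * (A - Re l) > 0" using l A by simp
        ultimately show ?thesis by linarith
      qed
      then show ?thesis by (simp add: cmod_power2)
    qed
    then have "norm l < norm (2 * of_real A - l)" by (rule power2_less_imp_less) simp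
    then show "norm (p w) < 1" using l(2) unfolding p_def l_def[symmetric]
      by (simp add: norm_divide)
  qed
  \<comment> \<open>The midpoint between \<open>r\<close> and \<open>R\<close>: one half of the gap
    is spent on bounding \<open>L\<close>, the other on the Cauchy estimate for its
    derivative.\<close>
  define q where "q = (R + r) / 2"
  have q: "r < q" "q < R" "0 < q" using r by (auto simp: q_def)
  have Lb: "norm (L z) \<le> 2 * A * q / (R - q)" if z: "dist c z \<le> q" for z
  proof -
    define w where "w = (z - c) / of_real R"
    have zw: "z = c + of_real R * w" using R by (simp add: w_def)
    have nw: "norm w \<le> q / R" using z R by (simp add: w_def norm_divide dist_norm norm_minus_commute divide_right_mono)
    also have "\<dots> < 1" using q R by simp
    finally have w1: "norm w < 1" .
    have "norm (p w) \<le> q / R" using p[OF w1] nw by linarith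
    moreover have pL: "p w * (2 * of_real A - L z) = L z"
      using nzd[of z] inb[OF w1] by (simp add: p_def zw)
    ultimately have "norm (L z) \<le> q / R * norm (2 * of_real A - L z)"
      by (metis mult_right_mono norm_ge_zero norm_mult)
    also have "\<dots> \<le> q / R * (2 * A + norm (L z))"
    proof (intro mult_left_mono)
      show "norm (2 * of_real A - L z) \<le> 2 * A + norm (L z)"
        using norm_triangle_ineq4[of "2 * of_real A" "L z"] A by (simp add: norm_mult)
    qed (use q R in auto)
    finally have "R * norm (L z) \<le> q * (2 * A + norm (L z))" using R by (simp add: field_simps)
    then have "(R - q) * norm (L z) \<le> 2 * A * q" by (simp add: algebra_simps)
    then show ?thesis using q by (simp add: field_simps)
  qed
  have sub: "ball s (q - r) \<subseteq> ball c R" "cball s (q - r) \<subseteq> ball c R"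
    and sub2: "\<And>z. dist s z \<le> q - r \<Longrightarrow> dist c z \<le> q"
    using s q by (auto simp: dist_norm) (smt (verit) dist_norm dist_triangle norm_minus_commute)+
  have "norm ((deriv ^^ 1) L s) \<le> fact 1 * (2 * A * q / (R - q)) / (q - r) ^ 1"
    by (rule Cauchy_inequality)
       (use q sub sub2 Lb L in \<open>auto intro: holomorphic_on_subset holomorphic_on_imp_continuous_on simp: dist_norm\<close>)
  then have 1: "norm (deriv L s) \<le> 2 * A * q / (R - q) / (q - r)" by simp
  have sb: "s \<in> ball c R" using s r by simp
  have "(h has_field_derivative deriv h s) (at s)"
    using h sb by (auto intro: holomorphic_derivI)
  then have "((\<lambda>z. exp (h z)) has_field_derivative exp (h s) * deriv h s) (at s)"
    and dL: "(L has_field_derivative deriv h s) (at s)"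
    unfolding L_def by (auto intro!: derivative_eq_intros)
  then have "(g has_field_derivative exp (h s) * deriv h s) (at s)"
    using has_field_derivative_transform_within_open[OF _ open_ball sb] hg by blast
  then have "deriv g s = exp (h s) * deriv h s" by (rule DERIV_imp_deriv)
  then have "deriv g s / g s = deriv L s"
    using hg[OF sb] nz[OF sb] DERIV_imp_deriv[OF dL] by (simp add: field_simps)
  then have "norm (deriv g s / g s) \<le> 2 * A * q / (R - q) / (q - r)" using 1 by simp
  also have "\<dots> = 8 * A * q / (R - r)\<^sup>2"
    using r by (simp add: q_def power2_eq_square divide_simps)
  also have "\<dots> \<le> 8 * A * R / (R - r)\<^sup>2"
    using q A by (intro divide_right_mono mult_left_mono) auto
  finally show ?thesis .
qed

lemma norm_le_sphere_bound:
  fixes f :: "complex \<Rightarrow> complex"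
  assumes f: "f holomorphic_on ball c R'" "R < R'" and "\<And>z. dist c z = R \<Longrightarrow> norm (f z) \<le> M" "dist c z \<le> R"
  shows "norm (f z) \<le> M"
proof (rule maximum_modulus_frontier[of f "cball c R"])
  have "cball c R \<subseteq> ball c R'" using f(2) by auto
  with f(1) have "f holomorphic_on cball c R" by (rule holomorphic_on_subset)
  then show "f holomorphic_on interior (cball c R)" "continuous_on (closure (cball c R)) f"
    by (auto intro: holomorphic_on_subset holomorphic_on_imp_continuous_on)
qed (use assms in \<open>auto simp: sphere_def\<close>)

(* Zeros within R/3 of the centre are divided out one at a time: each division halves the
   bound on the outer circle and keeps the value at the centre, so the process stops, and
   each zero contributes a nonnegative amount to Re (f'/f). *)
lemma Re_log_deriv_ge:
  fixes f :: "complex \<Rightarrow> complex"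
  assumes "f holomorphic_on ball c R'" "R < R'"
    and "\<And>z. dist c z = R \<Longrightarrow> norm (f z) \<le> M"
    and "M < 2 ^ k * norm (f c)" "M < exp A * norm (f c)" "A > 0"
    and "\<And>z. dist c z < R / 3 \<Longrightarrow> f z = 0 \<Longrightarrow> Re z \<le> \<beta>"
    and "dist c s \<le> r" "0 \<le> r" "r < R / 3" "\<beta> < Re s"
  shows "Re (deriv f s / f s) \<ge> - (8 * A * (R / 3) / (R / 3 - r)\<^sup>2)"
  using assms
proof (induction k arbitrary: f M)
  \<comment> \<open>With no halving left, \<open>M < norm (f c)\<close> contradicts the maximum
    modulus principle.\<close>
  case (0 f M)
  have "norm (f c) \<le> M"
    by (rule norm_le_sphere_bound[of f c R' R]) (use "0.prems" in auto)
  then show ?case using "0.prems" by simp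
next
  case (Suc k f M)
  note P = Suc.prems
  have R: "R > 0" using P by simp
  have mm: "norm (f z) \<le> M" if "dist c z \<le> R" for z
    by (rule norm_le_sphere_bound[OF P(1-3)]) (use that in auto)
  have M0: "M \<ge> 0" using order_trans[OF norm_ge_zero mm[of c]] R by simp
  have fc: "f c \<noteq> 0" using P(4) M0 by auto
  show ?case
  proof (cases "\<exists>\<rho>. dist c \<rho> < R / 3 \<and> f \<rho> = 0")
    case False
    have "norm (deriv f s / f s) \<le> 8 * A * (R / 3) / (R / 3 - r)\<^sup>2"
    proof (rule log_deriv_bound[where c = c])
      show "f holomorphic_on ball c (R / 3)"
        by (rule holomorphic_on_subset[OF P(1)]) (use P R in auto)
      show "norm (f z) < exp A * norm (f c)" if "z \<in> ball c (R / 3)" for z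
        using mm[of z] that P(5) R by auto
    qed (use False P in auto)
    then show ?thesis using abs_Re_le_cmod[of "deriv f s / f s"] by linarith
  next
    case True
    then obtain \<rho> where \<rho>: "dist c \<rho> < R / 3" "f \<rho> = 0" by blast
    have rc: "\<rho> \<noteq> c" using \<rho> fc by auto
    \<comment> \<open>The factor \<open>c - \<rho>\<close> normalises the quotient so that
      \<open>g c = f c\<close>; at \<open>\<rho>\<close> the removable singularity receives its
      limit value.\<close>
    define g where "g z = (if z = \<rho> then deriv f \<rho> else (f z - f \<rho>) / (z - \<rho>)) * (c - \<rho>)" for z
    have ghol: "g holomorphic_on ball c R'"
      unfolding g_def
      by (intro holomorphic_on_mult pole_lemma P) (use \<rho> P R in \<open>auto simp: interior_open intro: holomorphic_intros\<close>)
    have fg: "f z = g z * ((z - \<rho>) / (c - \<rho>))" for z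
      using rc \<rho> by (auto simp: g_def)
    have gc: "g c = f c" using fg[of c] rc by simp
    have IH: "Re (deriv g s / g s) \<ge> - (8 * A * (R / 3) / (R / 3 - r)\<^sup>2)"
    proof (rule Suc.IH[OF ghol P(2), of "M / 2"])
      fix z assume z: "dist c z = R"
      \<comment> \<open>A point of the outer circle has distance at least \<open>R - R/3\<close>
        from \<open>\<rho>\<close>, and \<open>c\<close> has distance less than \<open>R/3\<close>:
        the source of the halving.\<close>
      have "2 * norm (c - \<rho>) \<le> norm (z - \<rho>)"
        using z \<rho>(1) dist_triangle[of c z \<rho>] by (simp add: dist_norm norm_minus_commute)
      then have "norm (g z) * 2 \<le> norm (g z) * (norm (z - \<rho>) / norm (c - \<rho>))"
        using rc by (intro mult_left_mono) (auto simp: field_simps)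
      also have "\<dots> = norm (f z)" by (subst fg) (simp add: norm_mult norm_divide)
      also have "\<dots> \<le> M" using P z by auto
      finally show "norm (g z) \<le> M / 2" by simp
    next
      fix z assume "dist c z < R / 3" "g z = 0"
      then show "Re z \<le> \<beta>" using P(7)[of z] fg[of z] by simp
    next
      show "M / 2 < exp A * norm (g c)" using P(5) M0 by (simp add: gc)
    qed (use P gc in auto)
    have sb: "s \<in> ball c R'" using P R by auto
    have "dist c s < R / 3" using P by linarith
    then have fs: "f s \<noteq> 0" using P(7)[of s] P(11) by fastforce
    then have gs: "g s \<noteq> 0" and sr: "s \<noteq> \<rho>" using fg[of s] \<rho> by auto
    have "(g has_field_derivative deriv g s) (at s)"
      using ghol sb by (auto intro: holomorphic_derivI)
    then have "((\<lambda>z. g z * ((z - \<rho>) / (c - \<rho>))) has_field_derivative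
        deriv g s * ((s - \<rho>) / (c - \<rho>)) + g s * (1 / (c - \<rho>))) (at s)"
      using rc by (auto intro!: derivative_eq_intros simp: add_divide_distrib)
    moreover have "f = (\<lambda>z. g z * ((z - \<rho>) / (c - \<rho>)))" using fg by (intro ext)
    ultimately have df: "deriv f s = deriv g s * ((s - \<rho>) / (c - \<rho>)) + g s * (1 / (c - \<rho>))"
      using DERIV_imp_deriv by metis
    then have eq: "deriv f s / f s = deriv g s / g s + 1 / (s - \<rho>)"
      unfolding df fg[of s] using gs sr rc by (simp add: divide_simps)
    have "Re (1 / (s - \<rho>)) \<ge> 0"
      using P(7)[OF \<rho>] P(11) by (simp add: Re_divide)
    then show ?thesis using IH unfolding eq by simp
  qed
qed

subsection \<open>Vertical line integrals of the Perron kernel\<close>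

lemma lborel_inverse_square:
  fixes b :: real
  assumes b: "b > 0"
  shows "integrable lborel (\<lambda>t. 1 / (b\<^sup>2 + t\<^sup>2))" "(LINT t|lborel. 1 / (b\<^sup>2 + t\<^sup>2)) = pi / b"
proof -
  have 1: "integrable lborel (\<lambda>t::real. 1 / (1 + t\<^sup>2))" "(LINT t|lborel. 1 / (1 + t\<^sup>2)) = (pi::real)"
    using integrable_inverse_1_plus_square LBINT_inverse_1_plus_square
    by (simp_all add: set_integrable_def interval_lebesgue_integral_def set_lebesgue_integral_def inverse_eq_divide)
  have sc: "1 / (b\<^sup>2 + (0 + b * x)\<^sup>2) = (1 / b\<^sup>2) * (1 / (1 + x\<^sup>2))" for x
  proof -
    have "b\<^sup>2 + (0 + b * x)\<^sup>2 = b\<^sup>2 * (1 + x\<^sup>2)" by (simp add: power_mult_distrib algebra_simps)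
    then show ?thesis by simp
  qed
  have "integrable lborel (\<lambda>x. 1 / (b\<^sup>2 + (0 + b * x)\<^sup>2))"
    unfolding sc by (intro integrable_mult_right 1)
  then show "integrable lborel (\<lambda>t. 1 / (b\<^sup>2 + t\<^sup>2))"
    using lborel_integrable_real_affine_iff[of b "\<lambda>t. 1 / (b\<^sup>2 + t\<^sup>2)" 0] b by simp
  have "(LINT t|lborel. 1 / (b\<^sup>2 + t\<^sup>2)) = \<bar>b\<bar> *\<^sub>R (LINT x|lborel. 1 / (b\<^sup>2 + (0 + b * x)\<^sup>2))"
    using b by (intro lborel_integral_real_affine) auto
  also have "\<dots> = pi / b"
    unfolding sc integral_mult_right_zero 1(2) using b by (simp add: power2_eq_square)
  finally show "(LINT t|lborel. 1 / (b\<^sup>2 + t\<^sup>2)) = pi / b" .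
qed

text \<open>Contour integrals deliver gauge integrals over \<open>[-T, T]\<close>; this is the
  passage from them to the Lebesgue integral over the whole line.\<close>

lemma tendsto_symmetric_integral:
  fixes f :: "real \<Rightarrow> 'a :: euclidean_space"
  assumes f: "integrable lborel f"
  shows "((\<lambda>T. integral {-T..T} f) \<longlongrightarrow> integral\<^sup>L lborel f) at_top"
proof -
  have "((\<lambda>T. LINT t|lborel. indicat_real {-T..T} t *\<^sub>R f t) \<longlongrightarrow> integral\<^sup>L lborel f) at_top"
  proof (rule integral_dominated_convergence_at_top[where w = "\<lambda>t. norm (f t)"])
    show "AE t in lborel. ((\<lambda>T. indicat_real {-T..T} t *\<^sub>R f t) \<longlongrightarrow> f t) at_top"
    proof (rule AE_I2)
      fix t :: real
      have "\<forall>\<^sub>F T in at_top. indicat_real {-T..T} t *\<^sub>R f t = f t"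
        using eventually_ge_at_top[of "\<bar>t\<bar>"] by eventually_elim (auto simp: indicator_def)
      then show "((\<lambda>T. indicat_real {-T..T} t *\<^sub>R f t) \<longlongrightarrow> f t) at_top"
        by (rule tendsto_eventually)
    qed
    show "\<forall>\<^sub>F T in at_top. AE t in lborel. norm (indicat_real {-T..T} t *\<^sub>R f t) \<le> norm (f t)"
      by (intro always_eventually allI AE_I2) (auto simp: indicator_def)
  qed (use f in auto)
  moreover have "(LINT t|lborel. indicat_real {-T..T} t *\<^sub>R f t) = integral {-T..T} f" for T
  proof -
    have "set_integrable lborel {-T..T} f"
      using f unfolding set_integrable_def by (intro integrable_mult_indicator) auto
    from set_borel_integral_eq_integral(2)[OF this] show ?thesis
      by (simp add: set_lebesgue_integral_def)
  qed
  ultimately show ?thesis by simp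
qed

text \<open>The horizontal sides of the rectangle are controlled by \<open>w T\<close> and vanish in
  the limit, while \<open>J\<close> collects the residues. The majorant is asked for only on the two
  lines and for \<open>|t| > T0\<close>, so that poles may lie in the strip at height at most
  \<open>T0\<close>.\<close>

lemma vertical_line_shift:
  fixes g :: "complex \<Rightarrow> complex" and w :: "real \<Rightarrow> real"
  assumes ab: "\<alpha> < \<beta>" and T0: "T0 \<ge> 0"
    and J: "\<And>T. T > T0 \<Longrightarrow> (g has_contour_integral J) (rectpath (Complex \<alpha> (-T)) (Complex \<beta> T))"
    and ca: "continuous_on UNIV (\<lambda>t. g (Complex \<alpha> t))"
    and cb: "continuous_on UNIV (\<lambda>t. g (Complex \<beta> t))"
    and w: "integrable lborel w" "(w \<longlongrightarrow> 0) at_top" "\<And>t. w (-t) = w t"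
    and bd: "\<And>u t. \<alpha> \<le> u \<Longrightarrow> u \<le> \<beta> \<Longrightarrow> u = \<alpha> \<or> u = \<beta> \<or> \<bar>t\<bar> > T0 \<Longrightarrow> norm (g (Complex u t)) \<le> w t"
  shows "integrable lborel (\<lambda>t. g (Complex \<alpha> t))" "integrable lborel (\<lambda>t. g (Complex \<beta> t))"
    and "(LINT t|lborel. g (Complex \<beta> t)) - (LINT t|lborel. g (Complex \<alpha> t)) = J / \<i>"
proof -
  have m: "(\<lambda>t. g (Complex u t)) \<in> borel_measurable lborel" if "u = \<alpha> \<or> u = \<beta>" for u
    using that ca cb by (auto intro: borel_measurable_continuous_onI)
  have i: "integrable lborel (\<lambda>t. g (Complex u t))" if "u = \<alpha> \<or> u = \<beta>" for u
  proof (rule Bochner_Integration.integrable_bound[OF w(1) m[OF that]], rule AE_I2)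
    fix t show "norm (g (Complex u t)) \<le> norm (w t)"
      using bd[of u t] that ab by (auto intro: order_trans[OF _ abs_ge_self])
  qed
  show ia: "integrable lborel (\<lambda>t. g (Complex \<alpha> t))" and ib: "integrable lborel (\<lambda>t. g (Complex \<beta> t))"
    using i by auto
  define H where "H T = \<i> * (integral {-T..T} (\<lambda>t. g (Complex \<beta> t)) - integral {-T..T} (\<lambda>t. g (Complex \<alpha> t)))" for T
  have lim1: "(H \<longlongrightarrow> \<i> * ((LINT t|lborel. g (Complex \<beta> t)) - (LINT t|lborel. g (Complex \<alpha> t)))) at_top"
    unfolding H_def by (intro tendsto_intros tendsto_symmetric_integral ia ib)
  have "norm (J - H T) \<le> 2 * ((\<beta> - \<alpha>) * w T)" if T: "T > T0" for T
  proof -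
    define a1 a2 a3 a4 where "a1 = Complex \<alpha> (-T)" and "a2 = Complex \<beta> (-T)"
      and "a3 = Complex \<beta> T" and "a4 = Complex \<alpha> T"
    have jj: "(g has_contour_integral J) (linepath a1 a2 +++ linepath a2 a3 +++ linepath a3 a4 +++ linepath a4 a1)"
      using J[OF T] by (simp add: rectpath_def a1_def a2_def a3_def a4_def Let_def)
    then have con: "g contour_integrable_on (linepath a1 a2 +++ linepath a2 a3 +++ linepath a3 a4 +++ linepath a4 a1)"
      unfolding contour_integrable_on_def by blast
    have c1: "g contour_integrable_on linepath a1 a2" and c3: "g contour_integrable_on linepath a3 a4"
      using con by (auto dest!: contour_integrable_joinD1 contour_integrable_joinD2)
    have eq: "contour_integral (linepath a1 a2) g + contour_integral (linepath a2 a3) g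
       + contour_integral (linepath a3 a4) g + contour_integral (linepath a4 a1) g = J"
      using has_chain_integral_chain_integral4[OF jj] by simp
    have v2: "contour_integral (linepath a2 a3) g = \<i> * integral {-T..T} (\<lambda>t. g (Complex \<beta> t))"
      by (rule contour_integral_linepath_same_Re) (use T T0 in \<open>auto simp: a2_def a3_def\<close>)
    have v4: "contour_integral (linepath a1 a4) g = \<i> * integral {-T..T} (\<lambda>t. g (Complex \<alpha> t))"
      by (rule contour_integral_linepath_same_Re) (use T T0 in \<open>auto simp: a1_def a4_def\<close>)
    have "continuous_on (closed_segment a4 a1) g"
    proof -
      have "continuous_on (closed_segment a4 a1) (\<lambda>z. g (Complex \<alpha> (Im z)))"
        by (rule continuous_on_compose2[OF ca]) (auto intro!: continuous_intros)
      moreover have "Complex \<alpha> (Im z) = z" if "z \<in> closed_segment a4 a1" for z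
        using that by (auto simp: closed_segment_same_Re a4_def a1_def complex_eq_iff)
      ultimately show ?thesis by (auto cong: continuous_on_cong)
    qed
    then have v4': "contour_integral (linepath a4 a1) g = - contour_integral (linepath a1 a4) g"
      by (rule contour_integral_reverse_linepath)
    have w0: "w T \<ge> 0" using order_trans[OF norm_ge_zero bd[of \<alpha> T]] ab by simp
    have n1: "norm (contour_integral (linepath a1 a2) g) \<le> w T * norm (a2 - a1)"
    proof (rule contour_integral_bound_linepath[OF c1 w0])
      fix z assume z: "z \<in> closed_segment a1 a2"
      have "closed_segment a1 a2 = {z. Im z = -T \<and> Re z \<in> closed_segment \<alpha> \<beta>}"
        using closed_segment_same_Im[of a1 a2] by (simp add: a1_def a2_def)
      then have "z = Complex (Re z) (-T)" "\<alpha> \<le> Re z" "Re z \<le> \<beta>"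
        using ab z by (auto simp: complex_eq_iff closed_segment_eq_real_ivl)
      then show "norm (g z) \<le> w T" using bd[of "Re z" "-T"] T T0 w(3)[of T] by auto
    qed
    have n3: "norm (contour_integral (linepath a3 a4) g) \<le> w T * norm (a4 - a3)"
    proof (rule contour_integral_bound_linepath[OF c3 w0])
      fix z assume z: "z \<in> closed_segment a3 a4"
      have "closed_segment a3 a4 = {z. Im z = T \<and> Re z \<in> closed_segment \<beta> \<alpha>}"
        using closed_segment_same_Im[of a3 a4] by (simp add: a3_def a4_def)
      then have "z = Complex (Re z) T" "\<alpha> \<le> Re z" "Re z \<le> \<beta>"
        using ab z by (auto simp: complex_eq_iff closed_segment_eq_real_ivl)
      then show "norm (g z) \<le> w T" using bd[of "Re z" T] T T0 by auto
    qed
    have d: "norm (a2 - a1) = \<beta> - \<alpha>" "norm (a4 - a3) = \<beta> - \<alpha>"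
      using ab by (auto simp: a1_def a2_def a3_def a4_def cmod_def)
    have "J - H T = contour_integral (linepath a1 a2) g + contour_integral (linepath a3 a4) g"
      using eq v2 v4 v4' by (simp add: H_def algebra_simps)
    then have "norm (J - H T) \<le> norm (contour_integral (linepath a1 a2) g) + norm (contour_integral (linepath a3 a4) g)"
      by (simp add: norm_triangle_ineq)
    then show ?thesis using n1 n3 d by (simp add: algebra_simps)
  qed
  then have ev: "\<forall>\<^sub>F T in at_top. norm (J - H T) \<le> 2 * ((\<beta> - \<alpha>) * w T)"
    by (rule eventually_mono[OF eventually_gt_at_top[of T0], rotated])
  have "((\<lambda>T. 2 * ((\<beta> - \<alpha>) * w T)) \<longlongrightarrow> 2 * ((\<beta> - \<alpha>) * 0)) at_top"
    by (intro tendsto_intros w)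
  then have "((\<lambda>T. J - H T) \<longlongrightarrow> 0) at_top"
    by (intro Lim_null_comparison[OF ev]) simp
  then have "((\<lambda>T. J - (J - H T)) \<longlongrightarrow> J - 0) at_top" by (intro tendsto_intros)
  then have "(H \<longlongrightarrow> J) at_top" by simp
  with lim1 have "\<i> * ((LINT t|lborel. g (Complex \<beta> t)) - (LINT t|lborel. g (Complex \<alpha> t))) = J"
    using tendsto_unique trivial_limit_at_top_linorder by blast
  then show "(LINT t|lborel. g (Complex \<beta> t)) - (LINT t|lborel. g (Complex \<alpha> t)) = J / \<i>"
    by (metis complex_i_not_zero nonzero_mult_div_cancel_left)
qed

lemma vertical_line_shift_holomorphic:
  fixes g :: "complex \<Rightarrow> complex" and w :: "real \<Rightarrow> real"
  assumes ab: "\<alpha> < \<beta>" and S: "g holomorphic_on S" "convex S"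
    and sub: "\<And>s. \<alpha> \<le> Re s \<Longrightarrow> Re s \<le> \<beta> \<Longrightarrow> s \<in> S"
    and w: "integrable lborel w" "(w \<longlongrightarrow> 0) at_top" "\<And>t. w (-t) = w t"
    and bd: "\<And>u t. \<alpha> \<le> u \<Longrightarrow> u \<le> \<beta> \<Longrightarrow> norm (g (Complex u t)) \<le> w t"
  shows "integrable lborel (\<lambda>t. g (Complex \<alpha> t))" "integrable lborel (\<lambda>t. g (Complex \<beta> t))"
    and "(LINT t|lborel. g (Complex \<beta> t)) = (LINT t|lborel. g (Complex \<alpha> t))"
proof -
  have c: "continuous_on UNIV (\<lambda>t. g (Complex u t))" if "\<alpha> \<le> u" "u \<le> \<beta>" for u
    by (rule continuous_on_compose2[OF holomorphic_on_imp_continuous_on[OF S(1)]])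
       (use sub that in \<open>auto intro!: continuous_intros simp: Complex_eq\<close>)
  have J: "(g has_contour_integral 0) (rectpath (Complex \<alpha> (-T)) (Complex \<beta> T))" if "T > 0" for T
  proof (rule Cauchy_theorem_convex_simple[OF S])
    have "path_image (rectpath (Complex \<alpha> (-T)) (Complex \<beta> T)) \<subseteq> cbox (Complex \<alpha> (-T)) (Complex \<beta> T)"
      using ab that by (intro path_image_rectpath_subset_cbox) auto
    also have "\<dots> \<subseteq> S" using sub by (auto simp: in_cbox_complex_iff)
    finally show "path_image (rectpath (Complex \<alpha> (-T)) (Complex \<beta> T)) \<subseteq> S" .
  qed auto
  note * = vertical_line_shift[OF ab order_refl J c c w, simplified]
  show "integrable lborel (\<lambda>t. g (Complex \<alpha> t))" "integrable lborel (\<lambda>t. g (Complex \<beta> t))"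
     "(LINT t|lborel. g (Complex \<beta> t)) = (LINT t|lborel. g (Complex \<alpha> t))"
    using * ab bd by (auto simp: less_imp_le)
qed

lemma norm_Complex_ge: "\<bar>u\<bar> \<le> norm (Complex u t)" "\<bar>t\<bar> \<le> norm (Complex u t)"
  using abs_Re_le_cmod[of "Complex u t"] abs_Im_le_cmod[of "Complex u t"] by auto

lemma norm_s_s1:
  assumes "u > 0"
  shows "u\<^sup>2 + t\<^sup>2 \<le> norm (Complex u t * (Complex u t + 1))"
proof -
  have "u\<^sup>2 + t\<^sup>2 = norm (Complex u t) * norm (Complex u t)"
    by (simp add: cmod_def power2_eq_square[symmetric])
  also have "\<dots> \<le> norm (Complex u t) * norm (Complex u t + 1)"
    using assms by (intro mult_left_mono) (auto simp: cmod_def power2_eq_square algebra_simps)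
  finally show ?thesis by (simp add: norm_mult)
qed

lemma s_s1_nonzero:
  assumes "Re s > 0 \<or> Re s < -1"
  shows "s \<noteq> 0" "s + 1 \<noteq> 0"
  using assms by (auto simp: complex_eq_iff)

text \<open>Here \<open>G\<close> is meant to contain the power of \<open>x\<close> already. As it
  stays bounded to the right, the integral over \<open>Re s = B\<close> is at most
  \<open>K pi / B\<close>, and no pole of the kernel is met on the way.\<close>

lemma perron_right:
  fixes G :: "complex \<Rightarrow> complex"
  assumes G: "G holomorphic_on {s. Re s > c}" "c < \<sigma>" "0 < \<sigma>" "0 \<le> c"
    and bd: "\<And>s. Re s \<ge> \<sigma> \<Longrightarrow> norm (G s) \<le> K"
  shows "integrable lborel (\<lambda>t. G (Complex \<sigma> t) / (Complex \<sigma> t * (Complex \<sigma> t + 1)))"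
    and "(LINT t|lborel. G (Complex \<sigma> t) / (Complex \<sigma> t * (Complex \<sigma> t + 1))) = 0"
proof -
  define g where "g s = G s / (s * (s + 1))" for s
  have K: "K \<ge> 0" using order_trans[OF norm_ge_zero bd[of "of_real \<sigma>"]] by simp
  have gb: "norm (g (Complex u t)) \<le> K * (1 / (v\<^sup>2 + t\<^sup>2))" if "\<sigma> \<le> u" "0 < v" "v \<le> u" for u t v
  proof -
    have pos: "v\<^sup>2 + t\<^sup>2 > 0" using that assms by (intro add_pos_nonneg) auto
    have "v\<^sup>2 + t\<^sup>2 \<le> u\<^sup>2 + t\<^sup>2" using that by (intro add_right_mono power_mono) auto
    also have "\<dots> \<le> norm (Complex u t * (Complex u t + 1))" using that by (intro norm_s_s1) auto
    finally have "norm (G (Complex u t)) / norm (Complex u t * (Complex u t + 1)) \<le> K / (v\<^sup>2 + t\<^sup>2)"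
      using bd[of "Complex u t"] that pos K by (intro frac_le) auto
    then show ?thesis by (simp add: g_def norm_divide norm_mult)
  qed
  have ghol: "g holomorphic_on {s. Re s > c}"
    unfolding g_def using assms
    by (intro holomorphic_intros) (use s_s1_nonzero in auto)
  have sh: "integrable lborel (\<lambda>t. g (Complex \<sigma> t)) \<and> integrable lborel (\<lambda>t. g (Complex B t)) \<and>
      (LINT t|lborel. g (Complex B t)) = (LINT t|lborel. g (Complex \<sigma> t))" if "B > \<sigma>" for B
  proof -
    have l: "((\<lambda>t. K * (1 / (\<sigma>\<^sup>2 + t\<^sup>2))) \<longlongrightarrow> 0) at_top" by real_asymp
    show ?thesis
    proof -
      have wi: "integrable lborel (\<lambda>t. K * (1 / (\<sigma>\<^sup>2 + t\<^sup>2)))"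
        using assms by (intro integrable_mult_right lborel_inverse_square) simp
      have e: "K * (1 / (\<sigma>\<^sup>2 + (-t)\<^sup>2)) = K * (1 / (\<sigma>\<^sup>2 + t\<^sup>2))" for t :: real by simp
      have sub: "s \<in> {s. Re s > c}" if "\<sigma> \<le> Re s" "Re s \<le> B" for s using that assms by simp
      have b: "norm (g (Complex u t)) \<le> K * (1 / (\<sigma>\<^sup>2 + t\<^sup>2))" if "\<sigma> \<le> u" "u \<le> B" for u t
        using gb[of u \<sigma> t] that assms by simp
      note V = vertical_line_shift_holomorphic[OF that ghol convex_halfspace_Re_gt sub wi l e b]
      show ?thesis using V by blast
    qed
  qed
  then show "integrable lborel (\<lambda>t. G (Complex \<sigma> t) / (Complex \<sigma> t * (Complex \<sigma> t + 1)))"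
    using sh[of "\<sigma> + 1"] by (simp add: g_def)
  have le: "norm (LINT t|lborel. g (Complex \<sigma> t)) \<le> K * (pi / B)" if "B > \<sigma>" for B
  proof -
    have "norm (LINT t|lborel. g (Complex B t)) \<le> (LINT t|lborel. K * (1 / (B\<^sup>2 + t\<^sup>2)))"
    proof (rule Bochner_Integration.integral_norm_bound_integral)
      show "integrable lborel (\<lambda>t. K * (1 / (B\<^sup>2 + t\<^sup>2)))"
        using that assms by (intro integrable_mult_right lborel_inverse_square) simp
    qed (use sh[OF that] that assms gb[of B B] in auto)
    also have "\<dots> = K * (pi / B)"
      using that assms by (subst integral_mult_right_zero) (simp add: lborel_inverse_square)
    finally show ?thesis using sh[OF that] by simp
  qed
  have "((\<lambda>B. K * (pi / B)) \<longlongrightarrow> 0) at_top" by real_asymp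
  moreover have "\<forall>\<^sub>F B in at_top. norm (LINT t|lborel. g (Complex \<sigma> t)) \<le> K * (pi / B)"
    using eventually_gt_at_top[of \<sigma>] by (rule eventually_mono) (rule le)
  ultimately have "norm (LINT t|lborel. g (Complex \<sigma> t)) \<le> 0"
    by (intro tendsto_lowerbound) auto
  then show "(LINT t|lborel. G (Complex \<sigma> t) / (Complex \<sigma> t * (Complex \<sigma> t + 1))) = 0"
    by (simp add: g_def)
qed

text \<open>The factor \<open>x^(s+1)\<close>, written \<open>zterm x (- (s + 1))\<close>, is at
  most 1 once \<open>Re s \<le> -1\<close>, so the line can be pushed to minus infinity; on the way
  it passes the poles of \<open>1 / (s (s + 1))\<close> at 0 and -1.\<close>

lemma perron_left:
  fixes G :: "complex \<Rightarrow> complex"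
  assumes G: "G holomorphic_on {s. Re s < c}" "\<sigma> < c" "0 < \<sigma>" and x: "x \<ge> 1"
    and bd: "\<And>s. Re s \<le> \<sigma> \<Longrightarrow> norm (G s) \<le> K"
  shows "integrable lborel (\<lambda>t. G (Complex \<sigma> t) * zterm x (- (Complex \<sigma> t + 1)) / (Complex \<sigma> t * (Complex \<sigma> t + 1)))"
    and "(LINT t|lborel. G (Complex \<sigma> t) * zterm x (- (Complex \<sigma> t + 1)) / (Complex \<sigma> t * (Complex \<sigma> t + 1)))
           = 2 * pi * (x * G 0 - G (-1))"
proof -
  define q where "q s = G s * zterm x (- (s + 1))" for s
  define g where "g s = q s / (s * (s + 1))" for s
  have K: "K \<ge> 0" using order_trans[OF norm_ge_zero bd[of 0]] assms by simp
  \<comment> \<open>Chosen so that \<open>m / 2 * (1 + t^2)\<close> lies below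
    \<open>|s (s + 1)|\<close> on both vertical lines and on the horizontal sides; one majorant then
    serves all of them.\<close>
  define m where "m = min 1 (\<sigma>\<^sup>2)"
  have m: "0 < m" "m \<le> 1" "m \<le> \<sigma>\<^sup>2" using assms by (auto simp: m_def)
  have qb: "norm (q (Complex u t)) \<le> K * x powr (u + 1)" if "u \<le> \<sigma>" for u t
  proof -
    have "norm (q (Complex u t)) = norm (G (Complex u t)) * x powr (u + 1)"
      using x by (simp add: q_def norm_mult norm_zterm add.commute)
    then show ?thesis using bd[of "Complex u t"] that by (simp add: mult_right_mono)
  qed
  have qhol: "q holomorphic_on {s. Re s < c}"
    unfolding q_def zterm_def by (intro holomorphic_intros G)
  have q0: "q 0 = x * G 0" "q (-1) = G (-1)"
    using x by (auto simp: q_def zterm_def exp_of_real)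
  \<comment> \<open>To the left of -1 the smaller factor of the denominator is \<open>s + 1\<close>,
    with real part \<open>1 - B\<close>; hence the scale \<open>B - 1\<close>.\<close>
  have left: "norm (g (Complex (-B) t)) \<le> K * (1 / ((B - 1)\<^sup>2 + t\<^sup>2))" if "B > 1" for B t
  proof -
    have "(B - 1)\<^sup>2 + t\<^sup>2 = norm (Complex (-B) t + 1) * norm (Complex (-B) t + 1)"
      by (simp add: cmod_def power2_eq_square[symmetric] power2_commute)
    also have "\<dots> \<le> norm (Complex (-B) t) * norm (Complex (-B) t + 1)"
    proof (rule mult_right_mono)
      show "norm (Complex (-B) t + 1) \<le> norm (Complex (-B) t)"
        using that by (simp add: cmod_def power2_eq_square algebra_simps)
    qed simp
    finally have 1: "(B - 1)\<^sup>2 + t\<^sup>2 \<le> norm (Complex (-B) t * (Complex (-B) t + 1))" by (simp add: norm_mult)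
    have 2: "(B - 1)\<^sup>2 + t\<^sup>2 > 0" using that by (intro add_pos_nonneg) auto
    have "norm (q (Complex (-B) t)) \<le> K * x powr (-B + 1)" using qb[of "-B" t] that assms by simp
    also have "\<dots> \<le> K * 1" using powr_mono[of "-B + 1" 0 x] x that K by (intro mult_left_mono) auto
    finally have "norm (q (Complex (-B) t)) / norm (Complex (-B) t * (Complex (-B) t + 1)) \<le> K / ((B - 1)\<^sup>2 + t\<^sup>2)"
      using 1 2 K by (intro frac_le) auto
    then show ?thesis by (simp add: g_def norm_divide norm_mult)
  qed
  define L where "L = K * x powr (\<sigma> + 1) * (2 / m)"
  have L: "L \<ge> 0" using K m by (simp add: L_def)
  have gb: "norm (g (Complex u t)) \<le> L * (1 / (1\<^sup>2 + t\<^sup>2))" 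
    if u: "-B \<le> u" "u \<le> \<sigma>" "u = -B \<or> u = \<sigma> \<or> \<bar>t\<bar> > 1" and B: "B > 2" for B u t
  proof -
    have pos: "1\<^sup>2 + t\<^sup>2 > 0" by (intro add_pos_nonneg) auto
    have "m / 2 * (1 + t\<^sup>2) \<le> norm (Complex u t * (Complex u t + 1))"
    proof -
      consider "u = - B" | "u = \<sigma>" | "\<bar>t\<bar> > 1" using u by blast
      then show ?thesis
      proof cases
        case 1
        have "norm (Complex u t) \<ge> norm (Complex (-1) t)" "norm (Complex u t + 1) \<ge> norm (Complex (-1) t)"
          using 1 B mult_mono[of 1 B 1 B] mult_mono[of 1 "B - 1" 1 "B - 1"]
          by (auto simp: cmod_def power2_eq_square algebra_simps)
        then have "norm (Complex (-1) t) * norm (Complex (-1) t) \<le> norm (Complex u t) * norm (Complex u t + 1)"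
          by (intro mult_mono) auto
        moreover have "norm (Complex (-1) t) * norm (Complex (-1) t) = 1 + t\<^sup>2"
          by (simp add: cmod_def power2_eq_square[symmetric])
        moreover have "m / 2 * (1 + t\<^sup>2) \<le> 1 * (1 + t\<^sup>2)" using m by (intro mult_right_mono) auto
        ultimately show ?thesis by (simp add: norm_mult)
      next
        case 2
        have "m / 2 * (1 + t\<^sup>2) \<le> m * 1 + 1 * t\<^sup>2"
          using m mult_right_mono[of m 2 "t\<^sup>2"] by (simp add: algebra_simps)
        also have "\<dots> \<le> \<sigma>\<^sup>2 + t\<^sup>2" using m by simp
        also have "\<dots> \<le> norm (Complex u t * (Complex u t + 1))" using 2 assms by (simp add: norm_s_s1)
        finally show ?thesis .
      next
        case 3
        have t2: "t\<^sup>2 \<ge> 1" using 3 by (metis abs_1 less_imp_le one_power2 power2_abs power_mono zero_le_one)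
        have "m / 2 * (1 + t\<^sup>2) \<le> 1 / 2 * (1 + t\<^sup>2)" using m by (intro mult_right_mono) auto
        also have "\<dots> \<le> \<bar>t\<bar> * \<bar>t\<bar>" using t2 by (simp add: power2_eq_square[symmetric])
        also have "\<dots> \<le> norm (Complex u t) * norm (Complex u t + 1)"
          using norm_Complex_ge(2)[of t u] norm_Complex_ge(2)[of t "u + 1"]
          by (intro mult_mono) (auto simp: Complex_eq algebra_simps)
        finally show ?thesis by (simp add: norm_mult)
      qed
    qed
    moreover have "norm (q (Complex u t)) \<le> K * x powr (\<sigma> + 1)"
    proof -
      have "norm (q (Complex u t)) \<le> K * x powr (u + 1)" using qb u by simp
      also have "\<dots> \<le> K * x powr (\<sigma> + 1)" using u x K by (intro mult_left_mono powr_mono) auto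
      finally show ?thesis .
    qed
    ultimately have "norm (q (Complex u t)) / norm (Complex u t * (Complex u t + 1)) \<le> K * x powr (\<sigma> + 1) / (m / 2 * (1 + t\<^sup>2))"
      using K m pos by (intro frac_le) auto
    then show ?thesis by (simp add: g_def norm_divide norm_mult L_def field_simps)
  qed
  have cont: "continuous_on UNIV (\<lambda>t. g (Complex u t))" if "u = \<sigma> \<or> u < -1" for u
  proof -
    have "continuous_on UNIV (\<lambda>t. q (Complex u t))"
      by (rule continuous_on_compose2[OF holomorphic_on_imp_continuous_on[OF qhol]])
         (use that assms in \<open>auto intro!: continuous_intros simp: Complex_eq\<close>)
    then show ?thesis unfolding g_def
      by (intro continuous_intros)
         (use that assms s_s1_nonzero[of "Complex u t" for t] in \<open>auto simp: Complex_eq intro!: continuous_intros\<close>)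
  qed
  have J: "(g has_contour_integral 2 * pi * \<i> * (q 0 - q (-1))) (rectpath (Complex (-B) (-T)) (Complex \<sigma> T))"
    if B: "B > 2" and T: "T > 1" for B T
  proof -
    let ?\<gamma> = "rectpath (Complex (-B) (-T)) (Complex \<sigma> T)"
    have in0: "0 \<in> box (Complex (-B) (-T)) (Complex \<sigma> T)" "-1 \<in> box (Complex (-B) (-T)) (Complex \<sigma> T)"
      using B T assms by (auto simp: in_box_complex_iff)
    have pim: "path_image ?\<gamma> \<subseteq> cbox (Complex (-B) (-T)) (Complex \<sigma> T) - box (Complex (-B) (-T)) (Complex \<sigma> T)"
      using path_image_rectpath_cbox_minus_box[of "Complex (-B) (-T)" "Complex \<sigma> T"] B T assms by simp
    have sub: "path_image ?\<gamma> \<subseteq> {s. Re s < c}"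
      using pim G(2) by (fastforce simp: in_cbox_complex_iff)
    have "((\<lambda>w. q w / (w - z)) has_contour_integral complex_of_real (2 * pi) * \<i> * winding_number ?\<gamma> z * q z) ?\<gamma>"
      if "z \<in> box (Complex (-B) (-T)) (Complex \<sigma> T)" for z
    proof (rule Cauchy_integral_formula_convex_simple[OF _ qhol])
      show "convex {s. Re s < c}" by (rule convex_halfspace_Re_lt)
      have "open {s. Re s < c}" by (rule open_halfspace_Re_lt)
      then show "z \<in> interior {s. Re s < c}" using that G(2) by (simp add: interior_open in_box_complex_iff)
      show "path_image ?\<gamma> \<subseteq> {s. Re s < c} - {z}" using sub pim that by blast
    qed auto
    from this[OF in0(1)] this[OF in0(2)]
    have 1: "((\<lambda>w. q w / w) has_contour_integral 2 * pi * \<i> * q 0) ?\<gamma>"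
      and 2: "((\<lambda>w. q w / (w + 1)) has_contour_integral 2 * pi * \<i> * q (-1)) ?\<gamma>"
      by (simp_all add: winding_number_rectpath[OF in0(1)] winding_number_rectpath[OF in0(2)])
    \<comment> \<open>Partial fractions of the kernel reduce the two residues to two instances of
      Cauchy's integral formula.\<close>
    have "((\<lambda>w. q w / w - q w / (w + 1)) has_contour_integral 2 * pi * \<i> * q 0 - 2 * pi * \<i> * q (-1)) ?\<gamma>"
      by (rule has_contour_integral_diff[OF 1 2])
    then have "(g has_contour_integral 2 * pi * \<i> * q 0 - 2 * pi * \<i> * q (-1)) ?\<gamma>"
    proof (rule has_contour_integral_eq)
      fix z assume "z \<in> path_image ?\<gamma>"
      then have "z \<noteq> 0" "z \<noteq> -1" using pim in0 by auto
      then have "z \<noteq> 0" "z + 1 \<noteq> 0" by (auto simp: add_eq_0_iff2)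
      then show "q z / z - q z / (z + 1) = g z" by (simp add: g_def field_simps)
    qed
    then show ?thesis by (simp add: algebra_simps)
  qed
  have l: "((\<lambda>t. L * (1 / (1\<^sup>2 + t\<^sup>2))) \<longlongrightarrow> 0) at_top" by real_asymp
  have sh: "integrable lborel (\<lambda>t. g (Complex (-B) t)) \<and> integrable lborel (\<lambda>t. g (Complex \<sigma> t)) \<and>
     (LINT t|lborel. g (Complex \<sigma> t)) - (LINT t|lborel. g (Complex (-B) t)) = 2 * pi * (x * G 0 - G (-1))"
    if B: "B > 2" for B
  proof -
    have ab: "-B < \<sigma>" using B assms by simp
    have wi: "integrable lborel (\<lambda>t. L * (1 / (1\<^sup>2 + t\<^sup>2)))" by (intro integrable_mult_right lborel_inverse_square) simp
    have e: "L * (1 / (1\<^sup>2 + (-t)\<^sup>2)) = L * (1 / (1\<^sup>2 + t\<^sup>2))" for t :: real by simp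
    have c1: "continuous_on UNIV (\<lambda>t. g (Complex (-B) t))" "continuous_on UNIV (\<lambda>t. g (Complex \<sigma> t))"
      using cont B by auto
    note V = vertical_line_shift[OF ab zero_le_one J[OF B] c1 wi l e gb[OF _ _ _ B]]
    have c: "a * \<i> * b / \<i> = a * b" for a b :: complex
    proof -
      have "a * \<i> * b = a * b * \<i>" by (simp only: mult_ac)
      then show ?thesis by (simp only: nonzero_mult_div_cancel_right[OF complex_i_not_zero])
    qed
    have "2 * pi * \<i> * (q 0 - q (-1)) / \<i> = 2 * pi * (x * G 0 - G (-1))" unfolding c q0 by (rule refl)
    with V(3) have "(LINT t|lborel. g (Complex \<sigma> t)) - (LINT t|lborel. g (Complex (-B) t)) = 2 * pi * (x * G 0 - G (-1))"
      by (rule trans)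
    with V(1,2) show ?thesis by (intro conjI)
  qed
  then show "integrable lborel (\<lambda>t. G (Complex \<sigma> t) * zterm x (- (Complex \<sigma> t + 1)) / (Complex \<sigma> t * (Complex \<sigma> t + 1)))"
    using sh[of 3] by (simp add: g_def q_def)
  let ?D = "(LINT t|lborel. g (Complex \<sigma> t)) - 2 * pi * (x * G 0 - G (-1))"
  have le: "norm ?D \<le> K * (pi / (B - 1))" if "B > 2" for B
  proof -
    have "norm (LINT t|lborel. g (Complex (-B) t)) \<le> (LINT t|lborel. K * (1 / ((B - 1)\<^sup>2 + t\<^sup>2)))"
    proof (rule Bochner_Integration.integral_norm_bound_integral)
      show "integrable lborel (\<lambda>t. K * (1 / ((B - 1)\<^sup>2 + t\<^sup>2)))"
        using that by (intro integrable_mult_right lborel_inverse_square) simp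
    qed (use sh[OF that] that left in auto)
    also have "\<dots> = K * (pi / (B - 1))"
      using that by (subst integral_mult_right_zero) (simp add: lborel_inverse_square)
    also have "(LINT t|lborel. g (Complex (-B) t)) = ?D" using sh[OF that] by (simp add: algebra_simps)
    finally show ?thesis .
  qed
  have "((\<lambda>B. K * (pi / (B - 1))) \<longlongrightarrow> 0) at_top" by real_asymp
  moreover have "\<forall>\<^sub>F B in at_top. norm ?D \<le> K * (pi / (B - 1))"
    using eventually_gt_at_top[of 2] by (rule eventually_mono) (rule le)
  ultimately have "norm ?D \<le> 0"
    by (intro tendsto_lowerbound) auto
  then show "(LINT t|lborel. G (Complex \<sigma> t) * zterm x (- (Complex \<sigma> t + 1)) / (Complex \<sigma> t * (Complex \<sigma> t + 1)))
           = 2 * pi * (x * G 0 - G (-1))"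
    by (simp add: g_def q_def)
qed

subsection \<open>Dyadic decomposition of a convolution\<close>

text \<open>Let \<open>d j\<close> be the coefficient of \<open>X^k\<close> in
  \<open>(1 - X^(2^j)) M^2\<close>. The identity \<open>(1 - u)^2 = 2 (1 - u) - (1 - u^2)\<close> at
  \<open>u = X^(2^j)\<close> makes the \<open>j\<close>-th self-convolution equal to
  \<open>2 d j - d (j + 1)\<close>, and with weights \<open>2^(-j)\<close> this telescopes from
  \<open>d 0\<close>, the sum wanted, to \<open>d J\<close>, where \<open>k < 2^J\<close> makes the
  factor \<open>1 - X^(2^J)\<close> invisible.\<close>

lemma dyadic_convolution_identity:
  fixes b m :: "nat \<Rightarrow> real"
  assumes b0: "b 0 = 0" and m: "\<And>n. m n = (\<Sum>i\<le>n. b i)" and k: "k < 2 ^ J"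
  shows "2 * (\<Sum>n\<le>k. \<Sum>i\<le>n. b i * b (n - i)) =
     (\<Sum>j<J. (1/2) ^ j * (\<Sum>x\<le>k. (m x - m (x - 2 ^ j)) * (m (k - x) - m (k - x - 2 ^ j))))
     + 2 * (1/2) ^ J * (\<Sum>x\<le>k. m x * m (k - x))"
proof -
  define B where "B = Abs_fps b"
  define M where "M = Abs_fps m"
  define S where "S = Abs_fps (\<lambda>k. \<Sum>n\<le>k. \<Sum>i\<le>n. b i * b (n - i))"
  define D where "D h = Abs_fps (\<lambda>x. m x - m (x - h))" for h :: nat
  have m0: "m 0 = 0" using b0 m by simp
  have MB: "M * (1 - fps_X) = B"
  proof (rule fps_ext)
    fix n show "fps_nth (M * (1 - fps_X)) n = fps_nth B n"
      by (cases n) (auto simp: M_def B_def algebra_simps m)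
  qed
  have SB: "S * (1 - fps_X) = B * B"
  proof (rule fps_ext)
    fix n
    have BB: "fps_nth (B * B) n = (\<Sum>i\<le>n. b i * b (n - i))" for n
      by (simp add: B_def fps_mult_nth atLeast0AtMost)
    show "fps_nth (S * (1 - fps_X)) n = fps_nth (B * B) n"
      unfolding BB by (cases n) (auto simp: S_def algebra_simps)
  qed
  \<comment> \<open>Truncated subtraction is harmless: for \<open>x < h\<close> it yields
    \<open>m 0 = 0\<close>, which is what multiplication by \<open>1 - X^h\<close> expects
    there.\<close>
  have DM: "D h = M * (1 - fps_X ^ h)" for h
    by (rule fps_ext) (auto simp: D_def M_def algebra_simps fps_mult_fps_X_power_nonzero m0
         fps_X_power_mult_right_nth)
  define C where "C = fps_nth (M * M)"
  define d where "d j = C k - (if k < 2 ^ j then 0 else C (k - 2 ^ j))" for j :: nat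
  have "S * (1 - fps_X) = M * M * (1 - fps_X) * (1 - fps_X)"
    using SB MB by (metis mult.commute mult.left_commute)
  then have SC: "S = M * M * (1 - fps_X)"
  proof -
    have "fps_nth (1 - fps_X :: real fps) 0 \<noteq> 0" by simp
    then have "(1 - fps_X :: real fps) \<noteq> 0" by fastforce
    then show ?thesis using \<open>S * (1 - fps_X) = M * M * (1 - fps_X) * (1 - fps_X)\<close> by simp
  qed
  have S: "fps_nth S k = d 0"
    unfolding SC d_def C_def by (cases k) (auto simp: algebra_simps)
  have conv: "(\<Sum>x\<le>k. (m x - m (x - 2 ^ j)) * (m (k - x) - m (k - x - 2 ^ j))) = 2 * d j - d (Suc j)" for j
  proof -
    have "(\<Sum>x\<le>k. (m x - m (x - 2 ^ j)) * (m (k - x) - m (k - x - 2 ^ j))) = fps_nth (D (2 ^ j) * D (2 ^ j)) k"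
      by (simp add: D_def fps_mult_nth atLeast0AtMost)
    also have "D (2 ^ j) * D (2 ^ j) = M * M - 2 * (M * M * fps_X ^ (2 ^ j)) + M * M * fps_X ^ (2 ^ Suc j)"
    proof -
      define u where "u = (fps_X :: real fps) ^ (2 ^ j)"
      have "fps_X ^ (2 ^ Suc j) = u * u" by (simp add: u_def mult_2 power_add)
      then show ?thesis unfolding DM u_def[symmetric] by (simp add: algebra_simps)
    qed
    also have "fps_nth \<dots> k = C k - 2 * (if k < 2 ^ j then 0 else C (k - 2 ^ j)) + (if k < 2 ^ Suc j then 0 else C (k - 2 ^ Suc j))"
      by (simp add: C_def fps_X_power_mult_right_nth fps_numeral_nth numeral_fps_const del: power_Suc)
    also have "\<dots> = 2 * d j - d (Suc j)" by (simp add: d_def)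
    finally show ?thesis .
  qed
  have tel: "(\<Sum>j<J. (1/2) ^ j * (2 * d j - d (Suc j))) = 2 * d 0 - 2 * (1/2) ^ J * d J" for J
    by (induction J) (auto simp: algebra_simps)
  have "d J = (\<Sum>x\<le>k. m x * m (k - x))"
    using k by (simp add: d_def C_def M_def fps_mult_nth atLeast0AtMost)
  then show ?thesis
    unfolding conv using S tel[of J] by (simp add: S_def)
qed

lemma abs_self_convolution_le:
  fixes u :: "nat \<Rightarrow> real"
  shows "\<bar>\<Sum>x\<le>k. u x * u (k - x)\<bar> \<le> (\<Sum>x\<le>k. (u x)\<^sup>2)"
proof -
  have "\<bar>\<Sum>x\<le>k. u x * u (k - x)\<bar> \<le> (\<Sum>x\<le>k. \<bar>u x * u (k - x)\<bar>)" by (rule sum_abs)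
  also have "\<dots> \<le> (\<Sum>x\<le>k. ((u x)\<^sup>2 + (u (k - x))\<^sup>2) / 2)"
  proof (rule sum_mono)
    fix x
    show "\<bar>u x * u (k - x)\<bar> \<le> ((u x)\<^sup>2 + (u (k - x))\<^sup>2) / 2"
      using sum_squares_bound[of "\<bar>u x\<bar>" "\<bar>u (k - x)\<bar>"] by (simp add: abs_mult)
  qed
  also have "\<dots> = ((\<Sum>x\<le>k. (u x)\<^sup>2) + (\<Sum>x\<le>k. (u (k - x))\<^sup>2)) / 2"
    by (simp add: sum.distrib flip: sum_divide_distrib)
  also have "(\<Sum>x\<le>k. (u (k - x))\<^sup>2) = (\<Sum>x\<le>k. (u x)\<^sup>2)"
    using sum.nat_diff_reindex[of "\<lambda>x. (u x)\<^sup>2" "Suc k"] by (simp add: lessThan_Suc_atMost)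
  finally show ?thesis by simp
qed

subsection \<open>The logarithmic derivative of zeta\<close>

text \<open>The Dirichlet series of \<open>-zeta'/zeta\<close> on \<open>Re s > 1\<close>;
  \<open>zterm x s\<close> is the power \<open>x^(-s)\<close>.\<close>

definition mangoldt_series :: "complex \<Rightarrow> complex" where
  "mangoldt_series s = (\<Sum>n. mangoldt (Suc n) * zterm (real n + 1) s)"

lemma zterm_mult: "x > 0 \<Longrightarrow> y > 0 \<Longrightarrow> zterm (x * y) s = zterm x s * zterm y s"
  by (simp add: zterm_def ln_mult ring_distribs flip: exp_add)

lemma mangoldt_zterm_bound:
  assumes "c \<le> Re s" "c > 1"
  shows "norm (mangoldt (Suc n) * zterm (real n + 1) s) \<le> 2 / (c - 1) * (real n + 1) powr (- ((c + 1) / 2))"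
proof -
  have "mangoldt (Suc n) \<le> ln (real n + 1)"
    using mangoldt_le[of "Suc n"] by (simp add: add.commute)
  then have "norm (mangoldt (Suc n) * zterm (real n + 1) s) \<le> norm (- of_real (ln (real n + 1)) * zterm (real n + 1) s)"
    by (auto simp: norm_mult intro!: mult_right_mono)
  also have "\<dots> \<le> 2 / (c - 1) * (real n + 1) powr (- ((c + 1) / 2))"
    using assms by (intro zterm_log_bound) auto
  finally show ?thesis .
qed

lemma summable_log_bound: "c > 1 \<Longrightarrow> summable (\<lambda>n. 2 / (c - 1) * (real n + 1) powr (- ((c + 1) / 2)))"
  by (intro summable_mult summable_shifted_powr) auto

lemma mangoldt_series_summable_norm:
  "Re s > 1 \<Longrightarrow> summable (\<lambda>n. norm (mangoldt (Suc n) * zterm (real n + 1) s))"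
  by (rule summable_comparison_test'[OF summable_log_bound[of "Re s"]])
     (use mangoldt_zterm_bound in auto)

lemma mangoldt_series_sums:
  "Re s > 1 \<Longrightarrow> (\<lambda>n. mangoldt (Suc n) * zterm (real n + 1) s) sums mangoldt_series s"
  unfolding mangoldt_series_def
  by (rule summable_sums[OF summable_norm_cancel[OF mangoldt_series_summable_norm]])

lemma mangoldt_series_bounded:
  assumes "c > 1"
  obtains K where "\<And>s. Re s \<ge> c \<Longrightarrow> norm (mangoldt_series s) \<le> K"
proof
  fix s :: complex assume "Re s \<ge> c"
  then show "norm (mangoldt_series s) \<le> (\<Sum>n. 2 / (c - 1) * (real n + 1) powr (- ((c + 1) / 2)))"
    unfolding mangoldt_series_def
    by (intro norm_suminf_le summable_log_bound mangoldt_zterm_bound assms)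
qed

lemma hzeta_sum_deriv:
  assumes s: "Re s > 1"
  shows "((\<lambda>s. hzeta_sum s 1) has_field_derivative (\<Sum>n. - of_real (ln (real n + 1)) * zterm (real n + 1) s)) (at s)"
proof -
  define c where "c = (1 + Re s) / 2"
  define V where "V = {s. Re s > c}"
  have c: "c > 1" "s \<in> V" using s by (auto simp: c_def V_def)
  have V: "open V" "convex V"
    unfolding V_def by (rule open_halfspace_Re_gt convex_halfspace_Re_gt)+
  show ?thesis
    unfolding hzeta_sum_def
  proof (rule has_field_derivative_series'(2)[of V])
    show "uniformly_convergent_on V (\<lambda>N s. \<Sum>n<N. - of_real (ln (real n + 1)) * zterm (real n + 1) s)"
      unfolding uniformly_convergent_on_def
    proof (rule exI, rule Weierstrass_m_test[OF _ summable_log_bound[OF c(1)]])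
      fix n s assume "s \<in> V"
      then show "norm (- of_real (ln (real n + 1)) * zterm (real n + 1) s) \<le> 2 / (c - 1) * (real n + 1) powr (- ((c + 1) / 2))"
        using c by (intro zterm_log_bound[of c s 1 n]) (auto simp: V_def)
    qed
    show "summable (\<lambda>n. zterm (real n + 1) s)"
      using zterm_sums[OF s, of 1] by (auto simp: sums_iff)
    show "s \<in> interior V" using c V by (simp add: interior_open)
  qed (use c V zterm_deriv_s in \<open>auto intro: has_field_derivative_at_within simp del: mult_minus_left\<close>)
qed

text \<open>Absolute convergence turns the product into a sum over pairs \<open>(d, m)\<close>;
  collecting the pairs with \<open>d m = n\<close> leaves the divisor sum of
  \<open>mangoldt\<close>, which is \<open>ln n\<close>.\<close>

lemma hzeta_sum_mult_mangoldt_series: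
  assumes s: "Re s > 1"
  shows "hzeta_sum s 1 * mangoldt_series s = (\<Sum>n. of_real (ln (real n + 1)) * zterm (real n + 1) s)"
proof -
  define P where "P = {1::nat..}"
  define A where "A d = mangoldt d * zterm (real d) s" for d :: nat
  define B where "B m = zterm (real m) s" for m :: nat
  have bij: "bij_betw Suc UNIV P"
    by (auto simp: P_def bij_betw_def image_iff Suc_le_eq gr0_conv_Suc)
  have nsA: "summable (\<lambda>n. norm (A (Suc n)))"
    using mangoldt_series_summable_norm[OF s] by (simp add: A_def add.commute)
  have nsB: "summable (\<lambda>n. norm (B (Suc n)))"
  proof -
    have "summable (\<lambda>n. norm (zterm (real n + 1) s))"
      by (rule summable_comparison_test'[OF summable_shifted_powr[OF s]])
         (use s zterm_bound[of "Re s" s 1] in auto)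
    then show ?thesis by (simp add: B_def add.commute)
  qed
  have sA: "(A has_sum mangoldt_series s) P" and aA: "(\<lambda>n. norm (A n)) summable_on P"
  proof -
    have "((\<lambda>n. A (Suc n)) has_sum mangoldt_series s) UNIV"
      by (rule norm_summable_imp_has_sum[OF nsA])
         (use mangoldt_series_sums[OF s] in \<open>simp add: A_def add.commute\<close>)
    then show "(A has_sum mangoldt_series s) P"
      using has_sum_reindex_bij_betw[OF bij, of A] by simp
    have "(\<lambda>n. norm (A (Suc n))) summable_on UNIV"
      by (rule norm_summable_imp_summable_on) (use nsA in simp)
    then show "(\<lambda>n. norm (A n)) summable_on P"
      using summable_on_reindex_bij_betw[OF bij, of "\<lambda>n. norm (A n)"] by simp
  qed
  have sB: "(B has_sum hzeta_sum s 1) P" and aB: "(\<lambda>n. norm (B n)) summable_on P"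
  proof -
    have "((\<lambda>n. B (Suc n)) has_sum hzeta_sum s 1) UNIV"
      by (rule norm_summable_imp_has_sum[OF nsB])
         (use zterm_sums[OF s, of 1] in \<open>simp add: B_def add.commute\<close>)
    then show "(B has_sum hzeta_sum s 1) P"
      using has_sum_reindex_bij_betw[OF bij, of B] by simp
    have "(\<lambda>n. norm (B (Suc n))) summable_on UNIV"
      by (rule norm_summable_imp_summable_on) (use nsB in simp)
    then show "(\<lambda>n. norm (B n)) summable_on P"
      using summable_on_reindex_bij_betw[OF bij, of "\<lambda>n. norm (B n)"] by simp
  qed
  define F where "F = (\<lambda>(d, m). A d * B m)"
  have absF: "(\<lambda>x. norm (F x)) summable_on (P \<times> P)"
    unfolding Infinite_Sum.abs_summable_on_Sigma_iff
  proof (intro conjI ballI)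
    fix d
    show "(\<lambda>m. norm (F (d, m))) summable_on P"
      using summable_on_cmult_right[OF aB, of "norm (A d)"] by (simp add: F_def norm_mult)
  next
    have "(\<lambda>d. norm (A d) * (\<Sum>\<^sub>\<infinity>m\<in>P. norm (B m))) summable_on P"
      by (rule summable_on_cmult_left[OF aA])
    moreover have "(\<Sum>\<^sub>\<infinity>m\<in>P. norm (F (d, m))) = norm (A d) * (\<Sum>\<^sub>\<infinity>m\<in>P. norm (B m))" for d
      by (simp add: F_def norm_mult infsum_cmult_right')
    ultimately show "(\<lambda>d. norm (\<Sum>\<^sub>\<infinity>m\<in>P. norm (F (d, m)))) summable_on P"
      by (simp add: abs_mult infsum_nonneg)
  qed
  then have sF: "F summable_on (P \<times> P)" by (rule Infinite_Sum.abs_summable_summable)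
  have "infsum F (P \<times> P) = (\<Sum>\<^sub>\<infinity>d\<in>P. \<Sum>\<^sub>\<infinity>m\<in>P. F (d, m))"
    by (rule infsum_Sigma_banach[OF sF, symmetric])
  also have "\<dots> = (\<Sum>\<^sub>\<infinity>d\<in>P. A d * hzeta_sum s 1)"
    using infsumI[OF sB] by (simp add: F_def infsum_cmult_right')
  also have "\<dots> = mangoldt_series s * hzeta_sum s 1"
    using infsumI[OF sA] by (simp add: infsum_cmult_left')
  finally have 1: "infsum F (P \<times> P) = mangoldt_series s * hzeta_sum s 1" .
  define Dv where "Dv n = {d. d dvd n}" for n :: nat
  define h where "h = (\<lambda>(n, d). (d, n div d :: nat))"
  have bh: "bij_betw h (Sigma P Dv) (P \<times> P)"
    unfolding h_def
    by (rule bij_betwI[of _ _ _ "\<lambda>(d, m). (d * m, d)"])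
       (auto simp: P_def Dv_def Suc_le_eq dvd_pos_nat div_greater_zero_iff dvd_imp_le)
  have Fh: "F (h (n, d)) = mangoldt d * zterm (real n) s" if "n \<in> P" "d \<in> Dv n" for n d
  proof -
    from that obtain m where n: "n = d * m" by (auto simp: Dv_def)
    then have "d > 0" "m > 0" using that by (auto simp: P_def)
    then show ?thesis using zterm_mult[of "real d" "real m" s] by (simp add: F_def h_def A_def B_def n)
  qed
  have sFh: "(\<lambda>x. F (h x)) summable_on Sigma P Dv"
    using summable_on_reindex_bij_betw[OF bh, of F] sF by simp
  have "infsum F (P \<times> P) = (\<Sum>\<^sub>\<infinity>x\<in>Sigma P Dv. F (h x))"
    by (rule infsum_reindex_bij_betw[OF bh, symmetric])
  also have "\<dots> = (\<Sum>\<^sub>\<infinity>n\<in>P. \<Sum>\<^sub>\<infinity>d\<in>Dv n. F (h (n, d)))"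
    by (rule infsum_Sigma_banach[OF sFh, symmetric])
  also have "\<dots> = (\<Sum>\<^sub>\<infinity>n\<in>P. of_real (ln (real n)) * zterm (real n) s)"
  proof (rule infsum_cong)
    fix n assume n: "n \<in> P"
    then have fin: "finite (Dv n)" by (auto simp: P_def Dv_def)
    have "(\<Sum>\<^sub>\<infinity>d\<in>Dv n. F (h (n, d))) = (\<Sum>d\<in>Dv n. mangoldt d * zterm (real n) s)"
      using fin n Fh by (simp cong: sum.cong)
    also have "\<dots> = (\<Sum>d | d dvd n. mangoldt d) * zterm (real n) s"
      by (simp add: sum_distrib_right Dv_def)
    also have "(\<Sum>d | d dvd n. mangoldt d) = (of_real (ln (real n)) :: complex)"
      using n by (intro mangoldt_sum) (auto simp: P_def)
    finally show "(\<Sum>\<^sub>\<infinity>d\<in>Dv n. F (h (n, d))) = of_real (ln (real n)) * zterm (real n) s" .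
  qed
  also have "\<dots> = (\<Sum>\<^sub>\<infinity>n. of_real (ln (real (Suc n))) * zterm (real (Suc n)) s)"
    by (rule infsum_reindex_bij_betw[OF bij, symmetric])
  also have "\<dots> = (\<Sum>n. of_real (ln (real n + 1)) * zterm (real n + 1) s)"
  proof -
    have "summable (\<lambda>n. norm (of_real (ln (real n + 1)) * zterm (real n + 1) s))"
      by (rule summable_comparison_test'[OF summable_log_bound[OF s]])
         (use s zterm_log_bound[of "Re s" s 1] in auto)
    from norm_summable_imp_has_sum[OF this summable_sums[OF summable_norm_cancel[OF this]]]
    show ?thesis by (simp add: infsumI add.commute)
  qed
  finally show ?thesis using 1 by (simp add: mult.commute)
qed

lemma deriv_hzeta_sum:
  "Re s > 1 \<Longrightarrow> ((\<lambda>s. hzeta_sum s 1) has_field_derivative - (hzeta_sum s 1 * mangoldt_series s)) (at s)"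
proof -
  assume s: "Re s > 1"
  have "summable (\<lambda>n. of_real (ln (real n + 1)) * zterm (real n + 1) s)"
    by (rule summable_comparison_test'[OF summable_log_bound[OF s]])
       (use s zterm_log_bound[of "Re s" s 1] in auto)
  then have "(\<Sum>n. - of_real (ln (real n + 1)) * zterm (real n + 1) s) = - (hzeta_sum s 1 * mangoldt_series s)"
    unfolding hzeta_sum_mult_mangoldt_series[OF s] by (simp add: suminf_minus)
  then show ?thesis using hzeta_sum_deriv[OF s] by simp
qed

(* (s - 1) zeta(s), with the pole at 1 removed; the index 5 makes it holomorphic for Re s > -4. *)
definition zeta1 :: "complex \<Rightarrow> complex" where
  "zeta1 s = hzeta_ext 5 s 1"

lemma zeta1_holomorphic: "zeta1 holomorphic_on {s. Re s > -4}"
proof -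
  obtain H where "\<And>s a. Re s > -4 \<Longrightarrow> a \<ge> 1 \<Longrightarrow> ((\<lambda>s. hzeta_ext 5 s a) has_field_derivative H s a) (at s)"
    using zgood_ext[of 5] unfolding zgood_def by auto
  then have "(zeta1 has_field_derivative H s 1) (at s)" if "Re s > -4" for s
    using that unfolding zeta1_def by (metis order_refl)
  then have "zeta1 field_differentiable at s" if "Re s > -4" for s
    using that unfolding field_differentiable_def by blast
  then show ?thesis
    by (intro holomorphic_onI) (auto intro: field_differentiable_at_within)
qed

lemma zeta1_eq_hzeta_sum: "Re s > 1 \<Longrightarrow> zeta1 s = (s - 1) * hzeta_sum s 1"
  using hzeta_ext_le[of 0 5 s 1] by (simp add: zeta1_def)

text \<open>At \<open>s = 1\<close> the recursion step loses its integral term and only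
  \<open>1^0\<close> remains; this is the residue of zeta at its pole.\<close>

lemma zeta1_1 [simp]: "zeta1 1 = 1"
proof -
  have "zeta1 1 = hzeta_ext (Suc 4) 1 1" by (simp add: zeta1_def)
  then show ?thesis by (simp only: hzeta_ext.simps(2)) (simp add: hzeta_step_def)
qed

text \<open>The identity theorem carries the hypothesis on the chosen continuation
  \<open>riemann_zeta\<close> over to the zeros of \<open>zeta1\<close>.\<close>

lemma riemann_zeta_eq_zeta1:
  assumes "Re s > -4" "s \<noteq> 1"
  shows "riemann_zeta s = zeta1 s / (s - 1)"
proof (rule analytic_continuation_open[of "{s. Re s > 1}" "{s. Re s > -4} - {1}" riemann_zeta "\<lambda>s. zeta1 s / (s - 1)"])
  have "(2 :: complex) \<in> {s. Re s > 1}" by simp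
  then show "{s. Re s > 1} \<noteq> {}" by blast
  show "connected ({s. Re s > -4} - {1})"
    by (intro connected_open_delete convex_connected convex_halfspace_Re_gt open_halfspace_Re_gt) simp
  show "riemann_zeta holomorphic_on {s. Re s > -4} - {1}"
    by (rule holomorphic_on_subset[OF holomorphic_riemann_zeta]) auto
  show "(\<lambda>s. zeta1 s / (s - 1)) holomorphic_on {s. Re s > -4} - {1}"
    by (intro holomorphic_intros holomorphic_on_subset[OF zeta1_holomorphic]) auto
  show "riemann_zeta z = zeta1 z / (z - 1)" if "z \<in> {s. Re s > 1}" for z
  proof -
    have z: "Re z > 1" "z \<noteq> 1" using that by auto
    have "(\<lambda>n. zterm (real n + 1) z) sums riemann_zeta z"
      using sums_riemann_zeta[OF z(1)] unfolding zterm_of_nat .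
    then have "riemann_zeta z = hzeta_sum z 1" using zterm_sums[OF z(1), of 1] sums_unique2 by simp
    then show ?thesis using z by (simp add: zeta1_eq_hzeta_sum)
  qed
qed (use assms in \<open>auto simp: open_halfspace_Re_gt intro!: open_Diff\<close>)

(* zeta'/zeta without its pole: zlog s = zeta'(s)/zeta(s) + 1/(s - 1). *)
definition zlog :: "complex \<Rightarrow> complex" where
  "zlog s = deriv zeta1 s / zeta1 s"

section \<open>Non-vanishing of zeta on the closed half-plane Re s >= 1\<close>

lemma deriv_zeta1:
  assumes s: "Re s > 1"
  shows "deriv zeta1 s = hzeta_sum s 1 - zeta1 s * mangoldt_series s"
proof -
  have "((\<lambda>s. (s - 1) * hzeta_sum s 1) has_field_derivative
      1 * hzeta_sum s 1 + (- (hzeta_sum s 1 * mangoldt_series s)) * (s - 1)) (at s)"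
    by (rule DERIV_mult[OF _ deriv_hzeta_sum[OF s]]) (auto intro!: derivative_eq_intros)
  then have "(zeta1 has_field_derivative 1 * hzeta_sum s 1 + (- (hzeta_sum s 1 * mangoldt_series s)) * (s - 1)) (at s)"
    by (rule has_field_derivative_transform_within_open[OF _ open_halfspace_Re_gt[of 1]])
       (use s in \<open>auto simp: zeta1_eq_hzeta_sum\<close>)
  from DERIV_imp_deriv[OF this] show ?thesis using s by (simp add: zeta1_eq_hzeta_sum)
qed

text \<open>The order of vanishing is read off along the ray to the right, where for zeta the
  Dirichlet series is at hand. Order 0 is included, so that the limit also exists at points not
  known to be zeros.\<close>

lemma log_deriv_at_zero:
  fixes f :: "complex \<Rightarrow> complex"
  assumes f: "f holomorphic_on S" "open S" "connected S" "z \<in> S" "w \<in> S" "f w \<noteq> 0"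
  obtains n :: nat where "((\<lambda>e. of_real e * (deriv f (z + of_real e) / f (z + of_real e))) \<longlongrightarrow> of_nat n) (at_right 0)"
    "f z = 0 \<Longrightarrow> n > 0" "\<forall>\<^sub>F e in at_right 0. f (z + of_real e) \<noteq> 0"
proof -
  obtain g r and n :: nat where g: "g holomorphic_on ball z r" "r > 0" "ball z r \<subseteq> S"
    and fg: "\<And>w. w \<in> ball z r \<Longrightarrow> f w = (w - z) ^ n * g w" "\<And>w. w \<in> ball z r \<Longrightarrow> g w \<noteq> 0"
    and n0: "f z = 0 \<Longrightarrow> n > 0"
  proof (cases "f z = 0")
    case True
    \<comment> \<open>The point \<open>w\<close> rules out an identically vanishing
      \<open>f\<close>, so the zero has finite order.\<close>
    have nc: "\<not> f constant_on S" using True f(4-6) unfolding constant_on_def by metis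
    show ?thesis
    proof (rule holomorphic_factor_zero_nonconstant[OF f(1-4) True nc])
      fix g r and n :: nat
      assume A: "0 < n" "0 < r" "ball z r \<subseteq> S" "g holomorphic_on ball z r"
        "\<And>w. w \<in> ball z r \<Longrightarrow> f w = (w - z) ^ n * g w" "\<And>w. w \<in> ball z r \<Longrightarrow> g w \<noteq> 0"
      show ?thesis by (rule that[OF A(4,2,3,5,6,1)])
    qed
  next
    case False
    have "continuous_on S f" using f(1) by (rule holomorphic_on_imp_continuous_on)
    then have "open (S \<inter> f -` (- {0}))"
      using f(2) by (intro continuous_open_preimage) auto
    moreover have "z \<in> S \<inter> f -` (- {0})" using False f(4) by simp
    ultimately obtain r where r: "r > 0" "ball z r \<subseteq> S \<inter> f -` (- {0})"
      by (rule openE)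
    show ?thesis
      by (rule that[of f r 0]) (use r False holomorphic_on_subset[OF f(1), of "ball z r"] in auto)
  qed
  have ev: "\<forall>\<^sub>F e in at_right 0. e > 0 \<and> e < r"
    using g(2) by (auto simp: eventually_at_right_field)
  have key: "of_real e * (deriv f (z + of_real e) / f (z + of_real e)) = of_nat n + of_real e * (deriv g (z + of_real e) / g (z + of_real e))"
    "f (z + of_real e) \<noteq> 0" if e: "e > 0 \<and> e < r" for e
  proof -
    define w where "w = z + of_real e"
    have w: "w \<in> ball z r" "w \<noteq> z" "w - z = of_real e" using e by (auto simp: w_def dist_norm)
    have "(g has_field_derivative deriv g w) (at w)"
      using g(1) w(1) by (auto intro: holomorphic_derivI)
    then have "((\<lambda>w. (w - z) ^ n * g w) has_field_derivative
        of_nat n * (w - z) ^ (n - 1) * g w + (w - z) ^ n * deriv g w) (at w)"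
      by (auto intro!: derivative_eq_intros simp: algebra_simps)
    then have "(f has_field_derivative of_nat n * (w - z) ^ (n - 1) * g w + (w - z) ^ n * deriv g w) (at w)"
      by (rule has_field_derivative_transform_within_open[OF _ open_ball w(1)]) (use fg in auto)
    then have df: "deriv f w = of_nat n * (w - z) ^ (n - 1) * g w + (w - z) ^ n * deriv g w"
      by (rule DERIV_imp_deriv)
    define d where "d = w - z"
    have d: "d \<noteq> 0" "d = of_real e" using w by (auto simp: d_def)
    have gw: "g w \<noteq> 0" "f w = d ^ n * g w" using fg w(1) by (auto simp: d_def)
    then have "f w \<noteq> 0" using d by simp
    then show "f (z + of_real e) \<noteq> 0" unfolding w_def .
    have "d * (deriv f w / f w) = of_nat n + d * (deriv g w / g w)"
      unfolding df gw(2) d_def[symmetric] using d(1) gw(1) by (cases n) (auto simp: field_simps)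
    then show "of_real e * (deriv f (z + of_real e) / f (z + of_real e)) = of_nat n + of_real e * (deriv g (z + of_real e) / g (z + of_real e))"
      unfolding d(2) w_def .
  qed
  have cont: "((\<lambda>e. deriv g (z + of_real e) / g (z + of_real e)) \<longlongrightarrow> deriv g z / g z) (at_right 0)"
  proof -
    have "(\<lambda>w. deriv g w / g w) holomorphic_on ball z r"
      by (intro holomorphic_intros g) (use fg in auto)
    then have "isCont (\<lambda>w. deriv g w / g w) z"
      using g(2) by (metis centre_in_ball continuous_on_eq_continuous_at holomorphic_on_imp_continuous_on open_ball)
    moreover have "((\<lambda>e. z + of_real e) \<longlongrightarrow> z + of_real 0) (at_right 0)"
      by (intro tendsto_intros)
    ultimately show ?thesis by (intro isCont_tendsto_compose[where g = "\<lambda>w. deriv g w / g w"]) auto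
  qed
  have "((\<lambda>e. of_nat n + of_real e * (deriv g (z + of_real e) / g (z + of_real e))) \<longlongrightarrow> of_nat n + of_real 0 * (deriv g z / g z)) (at_right 0)"
    by (intro tendsto_intros cont)
  then have "((\<lambda>e. of_real e * (deriv f (z + of_real e) / f (z + of_real e))) \<longlongrightarrow> of_nat n) (at_right 0)"
    by (subst tendsto_cong[OF eventually_mono[OF ev key(1)]]) auto
  moreover have "\<forall>\<^sub>F e in at_right 0. f (z + of_real e) \<noteq> 0"
    by (rule eventually_mono[OF ev key(2)])
  ultimately show ?thesis using that n0 by blast
qed

lemma zeta1_log_deriv_limit:
  assumes "Re z > -4"
  obtains n :: nat where "((\<lambda>e. of_real e * zlog (z + of_real e)) \<longlongrightarrow> of_nat n) (at_right 0)"
    "zeta1 z = 0 \<Longrightarrow> n > 0" "\<forall>\<^sub>F e in at_right 0. zeta1 (z + of_real e) \<noteq> 0"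
  \<comment> \<open>The point of nonvanishing supplied below is 1, where \<open>zeta1\<close> has
    the value 1.\<close>
  unfolding zlog_def
  by (rule log_deriv_at_zero[OF zeta1_holomorphic open_halfspace_Re_gt, of z 1])
     (use assms in \<open>auto intro: convex_connected convex_halfspace_Re_gt\<close>)

text \<open>At a zero, \<open>e * zlog (z + e)\<close> would tend to a positive multiplicity; but
  \<open>zlog\<close> is \<open>1 / (s - 1)\<close> minus a convergent Dirichlet series and stays
  bounded near \<open>z\<close>, so the limit is 0.\<close>

lemma zeta1_nonzero_Re_gt_1:
  assumes z: "Re z > 1"
  shows "zeta1 z \<noteq> 0"
proof
  assume 0: "zeta1 z = 0"
  obtain n :: nat where n: "((\<lambda>e. of_real e * zlog (z + of_real e)) \<longlongrightarrow> of_nat n) (at_right 0)"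
    and n0: "n > 0" and nz: "\<forall>\<^sub>F e in at_right 0. zeta1 (z + of_real e) \<noteq> 0"
    using zeta1_log_deriv_limit[of z] z 0 by auto
  obtain K where K: "\<And>s. Re s \<ge> Re z \<Longrightarrow> norm (mangoldt_series s) \<le> K"
    using mangoldt_series_bounded[OF z] by blast
  have "\<forall>\<^sub>F e in at_right 0. norm (of_real e * zlog (z + of_real e)) \<le> e * (1 / (Re z - 1) + K)"
    using nz eventually_at_right_less[of 0]
  proof eventually_elim
    fix e :: real assume e: "zeta1 (z + of_real e) \<noteq> 0" "0 < e"
    define s where "s = z + of_real e"
    have s: "Re s > 1" "Re s \<ge> Re z" "zeta1 s \<noteq> 0" using z e by (auto simp: s_def)
    then have s1: "s \<noteq> 1" by auto
    \<comment> \<open>Derived here only at points where \<open>zeta1\<close> is known not to vanish,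
      since the general formula \<open>zlog_eq\<close> rests on the present lemma.\<close>
    have "zlog s = 1 / (s - 1) - mangoldt_series s"
      using s(3) s1 unfolding zlog_def deriv_zeta1[OF s(1)] zeta1_eq_hzeta_sum[OF s(1)]
      by (simp add: divide_simps) (simp add: algebra_simps)
    moreover have "norm (1 / (s - 1)) \<le> 1 / (Re z - 1)"
    proof -
      have "Re z - 1 \<le> norm (s - 1)" using abs_Re_le_cmod[of "s - 1"] s by simp
      then show ?thesis using z by (auto simp: norm_divide intro!: divide_left_mono mult_pos_pos)
    qed
    ultimately have "norm (zlog s) \<le> 1 / (Re z - 1) + K"
      using K[OF s(2)] norm_triangle_ineq4[of "1 / (s - 1)" "mangoldt_series s"] by simp
    then show "norm (of_real e * zlog (z + of_real e)) \<le> e * (1 / (Re z - 1) + K)"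
      using e by (simp add: norm_mult s_def)
  qed
  moreover have "((\<lambda>e. e * (1 / (Re z - 1) + K)) \<longlongrightarrow> 0) (at_right 0)"
    by (intro tendsto_mult_left_zero tendsto_ident_at)
  ultimately have "((\<lambda>e. of_real e * zlog (z + of_real e)) \<longlongrightarrow> 0) (at_right 0)"
    by (rule Lim_null_comparison)
  with n have "(of_nat n :: complex) = 0" using tendsto_unique trivial_limit_at_right_real by blast
  then show False using n0 by simp
qed

lemma zlog_eq:
  assumes s: "Re s > 1"
  shows "zlog s = 1 / (s - 1) - mangoldt_series s"
proof -
  have "s \<noteq> 1" using s by auto
  then show ?thesis
    using zeta1_nonzero_Re_gt_1[OF s] unfolding zlog_def deriv_zeta1[OF s] zeta1_eq_hzeta_sum[OF s]
    by (simp add: divide_simps) (simp add: algebra_simps)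
qed

text \<open>Term by term this is \<open>3 + 4 cos \<theta> + cos (2 \<theta>) = 2 (1 + cos
  \<theta>)^2\<close>, with \<open>\<theta>\<close> equal to \<open>t\<close> times the logarithm of
  the index.\<close>

lemma Re_mangoldt_series_3_4_1:
  assumes \<sigma>: "\<sigma> > 1"
  shows "Re (3 * mangoldt_series (Complex \<sigma> 0) + 4 * mangoldt_series (Complex \<sigma> t) + mangoldt_series (Complex \<sigma> (2 * t))) \<ge> 0"
proof -
  let ?f = "\<lambda>t n. mangoldt (Suc n) * zterm (real n + 1) (Complex \<sigma> t)"
  have "(\<lambda>n. 3 * ?f 0 n + 4 * ?f t n + ?f (2 * t) n) sums
      (3 * mangoldt_series (Complex \<sigma> 0) + 4 * mangoldt_series (Complex \<sigma> t) + mangoldt_series (Complex \<sigma> (2 * t)))"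
    using \<sigma> by (intro sums_add sums_mult mangoldt_series_sums) auto
  then have "(\<lambda>n. Re (3 * ?f 0 n + 4 * ?f t n + ?f (2 * t) n)) sums
      Re (3 * mangoldt_series (Complex \<sigma> 0) + 4 * mangoldt_series (Complex \<sigma> t) + mangoldt_series (Complex \<sigma> (2 * t)))"
    by (rule sums_Re)
  moreover have "Re (3 * ?f 0 n + 4 * ?f t n + ?f (2 * t) n) \<ge> 0" for n
  proof -
    define \<theta> where "\<theta> = t * ln (real n + 1)"
    have z: "Re (?f u n) = mangoldt (Suc n) * (exp (- \<sigma> * ln (real n + 1)) * cos (u * ln (real n + 1)))" for u
      by (simp add: zterm_def Re_exp)
    have gen: "Re (3 * a + 4 * b + c) = 3 * Re a + 4 * Re b + Re c" for a b c by simp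
    have "Re (3 * ?f 0 n + 4 * ?f t n + ?f (2 * t) n)
        = 3 * Re (?f 0 n) + 4 * Re (?f t n) + Re (?f (2 * t) n)" by (rule gen)
    also have "\<dots> = mangoldt (Suc n) * exp (- \<sigma> * ln (real n + 1)) * (3 + 4 * cos \<theta> + cos (2 * \<theta>))"
      unfolding z by (simp add: \<theta>_def algebra_simps)
    also have "3 + 4 * cos \<theta> + cos (2 * \<theta>) = 2 * (1 + cos \<theta>)\<^sup>2"
      by (simp add: cos_double sin_squared_eq) (simp add: power2_eq_square algebra_simps)
    finally show ?thesis by (simp add: mangoldt_nonneg)
  qed
  ultimately show ?thesis by (rule sums_le[OF _ sums_zero, rotated]) 
qed

text \<open>Mertens' argument in terms of multiplicities: the 3-4-1 inequality at abscissa
  \<open>1 + e\<close>, multiplied by \<open>e\<close>, tends to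
  \<open>3 n0 + 4 n1 + n2 \<le> 3\<close>. The 3 is the contribution of the pole of zeta, and a zero
  at height \<open>t\<close> would mean \<open>n1 \<ge> 1\<close>.\<close>

lemma zeta1_nonzero_Re_1:
  assumes "Re z = 1"
  shows "zeta1 z \<noteq> 0"
proof (cases "Im z = 0")
  case True
  then have "z = 1" using assms by (simp add: complex_eq_iff)
  then show ?thesis by simp
next
  case False
  define t where "t = Im z"
  have t: "t \<noteq> 0" "z = Complex 1 t" using False assms by (auto simp: t_def complex_eq_iff)
  show ?thesis
  proof
    assume 0: "zeta1 z = 0"
    obtain n0 :: nat where n0: "((\<lambda>e. of_real e * zlog (Complex 1 0 + of_real e)) \<longlongrightarrow> of_nat n0) (at_right 0)"
      using zeta1_log_deriv_limit[of "Complex 1 0"] by auto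
    obtain n1 :: nat where n1: "((\<lambda>e. of_real e * zlog (Complex 1 t + of_real e)) \<longlongrightarrow> of_nat n1) (at_right 0)" "n1 > 0"
      using zeta1_log_deriv_limit[of "Complex 1 t"] 0 t by auto
    obtain n2 :: nat where n2: "((\<lambda>e. of_real e * zlog (Complex 1 (2 * t) + of_real e)) \<longlongrightarrow> of_nat n2) (at_right 0)"
      using zeta1_log_deriv_limit[of "Complex 1 (2 * t)"] by auto
    have "((\<lambda>e. Re (3 * (of_real e * zlog (Complex 1 0 + of_real e)) + 4 * (of_real e * zlog (Complex 1 t + of_real e))
          + (of_real e * zlog (Complex 1 (2 * t) + of_real e)))) \<longlongrightarrow> Re (3 * of_nat n0 + 4 * of_nat n1 + of_nat n2)) (at_right 0)"
      by (intro tendsto_intros n0 n1 n2)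
    moreover have "((\<lambda>e. 3 + e * (4 / \<bar>t\<bar> + 1 / \<bar>2 * t\<bar>)) \<longlongrightarrow> 3 + 0) (at_right 0)"
      by (intro tendsto_add tendsto_const tendsto_mult_left_zero tendsto_ident_at)
    moreover have "\<forall>\<^sub>F e in at_right 0. Re (3 * (of_real e * zlog (Complex 1 0 + of_real e)) + 4 * (of_real e * zlog (Complex 1 t + of_real e))
          + (of_real e * zlog (Complex 1 (2 * t) + of_real e))) \<le> 3 + e * (4 / \<bar>t\<bar> + 1 / \<bar>2 * t\<bar>)"
      using eventually_at_right_less[of 0]
    proof eventually_elim
      fix e :: real assume e: "0 < e"
      have c: "Complex 1 u + of_real e = Complex (1 + e) u" for u by (simp add: complex_eq_iff)
      have z: "zlog (Complex (1 + e) u) = 1 / Complex e u - mangoldt_series (Complex (1 + e) u)" for u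
      proof -
        have "Complex (1 + e) u - 1 = Complex e u" by (simp add: complex_eq_iff)
        then show ?thesis using zlog_eq[of "Complex (1 + e) u"] e by simp
      qed
      have b: "Re (1 / Complex e u) \<le> 1 / \<bar>u\<bar>" if "u \<noteq> 0" for u
      proof -
        have "Re (1 / Complex e u) \<le> norm (1 / Complex e u)" by (rule complex_Re_le_cmod)
        also have "\<dots> = 1 / norm (Complex e u)" by (simp only: norm_divide norm_one)
        also have "\<dots> \<le> 1 / \<bar>u\<bar>"
          using abs_Im_le_cmod[of "Complex e u"] that by (intro frac_le) auto
        finally show ?thesis .
      qed
      have b0: "Re (1 / Complex e 0) = 1 / e" using e by (simp add: Re_divide power2_eq_square)
      let ?S = "Re (3 * zlog (Complex (1 + e) 0) + 4 * zlog (Complex (1 + e) t) + zlog (Complex (1 + e) (2 * t)))"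
      have gen: "Re (3 * (a - a') + 4 * (b - b') + (c - c')) = 3 * Re a + 4 * Re b + Re c - Re (3 * a' + 4 * b' + c')"
        for a a' b b' c c' by simp
      have "?S = 3 * Re (1 / Complex e 0) + 4 * Re (1 / Complex e t) + Re (1 / Complex e (2 * t))
          - Re (3 * mangoldt_series (Complex (1 + e) 0) + 4 * mangoldt_series (Complex (1 + e) t) + mangoldt_series (Complex (1 + e) (2 * t)))"
        unfolding z by (rule gen)
      also have "\<dots> \<le> 3 / e + 4 / \<bar>t\<bar> + 1 / \<bar>2 * t\<bar>"
        using Re_mangoldt_series_3_4_1[of "1 + e" t] b[of t] b[of "2 * t"] b0 e t by simp
      finally have "e * ?S \<le> e * (3 / e + 4 / \<bar>t\<bar> + 1 / \<bar>2 * t\<bar>)" using e by (intro mult_left_mono) auto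
      then show "Re (3 * (of_real e * zlog (Complex 1 0 + of_real e)) + 4 * (of_real e * zlog (Complex 1 t + of_real e))
          + (of_real e * zlog (Complex 1 (2 * t) + of_real e))) \<le> 3 + e * (4 / \<bar>t\<bar> + 1 / \<bar>2 * t\<bar>)"
        unfolding c using e by (simp add: algebra_simps)
    qed
    ultimately have "Re (3 * of_nat n0 + 4 * of_nat n1 + of_nat n2) \<le> 3 + 0"
      by (intro tendsto_le[OF trivial_limit_at_right_real])
    then show False using n1(2) by simp
  qed
qed

subsection \<open>Weighted mean squares of Fourier transforms\<close>

lemma exp_abs_integrable: "integrable lborel (\<lambda>v::real. exp (- 2 * \<bar>v\<bar>))"
proof -
  have bd: "exp (- 2 * \<bar>v\<bar>) \<le> 1 / (1\<^sup>2 + v\<^sup>2)" for v :: real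
  proof -
    have "1 + v\<^sup>2 \<le> (1 + \<bar>v\<bar>)\<^sup>2" by (simp add: power2_eq_square algebra_simps)
    also have "\<dots> \<le> (exp \<bar>v\<bar>)\<^sup>2" using exp_ge_add_one_self[of "\<bar>v\<bar>"] by (intro power_mono) auto
    also have "\<dots> = exp (2 * \<bar>v\<bar>)" by (simp add: power2_eq_square flip: exp_add)
    finally have "1 / exp (2 * \<bar>v\<bar>) \<le> 1 / (1 + v\<^sup>2)"
      by (intro divide_left_mono) (auto intro!: mult_pos_pos add_pos_nonneg)
    then show ?thesis by (simp add: exp_minus inverse_eq_divide)
  qed
  show ?thesis
    by (rule Bochner_Integration.integrable_bound[OF lborel_inverse_square(1)[of 1]])
       (use bd in \<open>auto intro: order_trans[OF _ abs_ge_self]\<close>)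
qed

text \<open>The weight and its Fourier transform are both positive, and the transform is a Poisson
  kernel: the kind of kernel against which \<open>|Re f'/f|\<close> can be averaged, here the case
  \<open>b = 2\<close> of \<open>abs_Re_zlog_kernel_bound\<close>.\<close>

lemma laplace_kernel_integral:
  fixes \<tau> :: real
  shows "(LINT v|lborel. of_real (exp (- 2 * \<bar>v\<bar>)) * exp (\<i> * of_real (v * \<tau>))) = of_real (4 / (4 + \<tau>\<^sup>2))"
proof -
  define f where "f v = complex_of_real (exp (- 2 * \<bar>v\<bar>)) * exp (\<i> * of_real (v * \<tau>))" for v
  have nf: "norm (f v) = exp (- 2 * \<bar>v\<bar>)" for v
    by (simp add: f_def norm_mult)
  have fm: "f \<in> borel_measurable lborel" unfolding f_def by measurable
  have fi: "integrable lborel f"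
    by (rule Bochner_Integration.integrable_bound[OF exp_abs_integrable fm]) (simp add: nf)
  define a b where "a = \<i> * of_real \<tau> - 2" and "b = \<i> * of_real \<tau> + 2"
  have ab: "a \<noteq> 0" "b \<noteq> 0" by (auto simp: a_def b_def complex_eq_iff)
  have 1: "integral {-T..T} f = (exp (a * of_real T) - 1) / a + (1 - exp (- b * of_real T)) / b" if T: "T \<ge> 0" for T
  proof -
    have d: "((\<lambda>v. exp (c * of_real v) / c) has_vector_derivative exp (c * of_real v)) (at v within S)" if "c \<noteq> 0" for c :: complex and v S
    proof (rule has_vector_derivative_real_field)
      show "((\<lambda>z. exp (c * z) / c) has_field_derivative exp (c * of_real v)) (at (of_real v))"
        using that by (auto intro!: derivative_eq_intros)
    qed
    have p: "((\<lambda>v. exp (a * of_real v)) has_integral exp (a * of_real T) / a - exp (a * of_real 0) / a) {0..T}"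
      by (rule fundamental_theorem_of_calculus[OF T]) (rule d[OF ab(1)])
    have n: "((\<lambda>v. exp (b * of_real v)) has_integral exp (b * of_real 0) / b - exp (b * of_real (-T)) / b) {-T..0}"
      by (rule fundamental_theorem_of_calculus) (use T d[OF ab(2)] in auto)
    have "(f has_integral exp (a * of_real T) / a - exp (a * of_real 0) / a) {0..T}"
      by (rule has_integral_eq[OF _ p])
         (auto simp: f_def a_def exp_of_real[symmetric] algebra_simps simp flip: exp_add)
    moreover have "(f has_integral exp (b * of_real 0) / b - exp (b * of_real (-T)) / b) {-T..0}"
      by (rule has_integral_eq[OF _ n])
         (auto simp: f_def b_def exp_of_real[symmetric] algebra_simps simp flip: exp_add)
    ultimately have "(f has_integral (exp (b * of_real 0) / b - exp (b * of_real (-T)) / b) + (exp (a * of_real T) / a - exp (a * of_real 0) / a)) {-T..T}"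
      by (intro has_integral_combine[of "-T" 0 T]) (use T in auto)
    then show ?thesis by (simp add: integral_unique diff_divide_distrib)
  qed
  have lim: "((\<lambda>T. integral {-T..T} f) \<longlongrightarrow> integral\<^sup>L lborel f) at_top"
    by (rule tendsto_symmetric_integral[OF fi])
  have e: "((\<lambda>T. exp (c * of_real T)) \<longlongrightarrow> 0) at_top" if "Re c = -2" for c :: complex
  proof (rule tendsto_norm_zero_cancel)
    have "((\<lambda>T::real. exp (-2 * T)) \<longlongrightarrow> 0) at_top" by real_asymp
    then show "((\<lambda>T. norm (exp (c * of_real T))) \<longlongrightarrow> 0) at_top" using that by simp
  qed
  have "((\<lambda>T. (exp (a * of_real T) - 1) / a + (1 - exp (- b * of_real T)) / b) \<longlongrightarrow> (0 - 1) / a + (1 - 0) / b) at_top"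
    using ab by (intro tendsto_intros e) (auto simp: a_def b_def)
  then have "((\<lambda>T. integral {-T..T} f) \<longlongrightarrow> (0 - 1) / a + (1 - 0) / b) at_top"
    by (rule Lim_transform_eventually) (rule eventually_mono[OF eventually_ge_at_top[of 0]], simp add: 1)
  with lim have "integral\<^sup>L lborel f = (0 - 1) / a + (1 - 0) / b"
    using tendsto_unique trivial_limit_at_top_linorder by blast
  also have "\<dots> = (a - b) / (a * b)" using ab by (simp add: field_simps)
  also have "a * b = - (4 + of_real (\<tau>\<^sup>2))"
    by (simp add: a_def b_def algebra_simps power2_eq_square)
  also have "a - b = - 4" by (simp add: a_def b_def)
  also have "- 4 / - (4 + complex_of_real (\<tau>\<^sup>2)) = 4 / (4 + complex_of_real (\<tau>\<^sup>2))"
    by (rule minus_divide_divide)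
  finally show ?thesis unfolding f_def by simp
qed

lemma borel_measurable_cnj [measurable (raw)]:
  "f \<in> borel_measurable M \<Longrightarrow> (\<lambda>x. cnj (f x)) \<in> borel_measurable M"
  by (rule borel_measurable_continuous_on[where f = cnj]) (intro continuous_intros)

lemma fubini_dominated:
  fixes F :: "real \<Rightarrow> real \<Rightarrow> complex"
  assumes m: "(\<lambda>(x, y). F x y) \<in> borel_measurable (lborel \<Otimes>\<^sub>M lborel)"
    and a: "integrable lborel a" and b: "integrable lborel b"
    and bd: "\<And>x y. norm (F x y) \<le> a x * b y"
  shows "(LINT x|lborel. LINT y|lborel. F x y) = (LINT y|lborel. LINT x|lborel. F x y)"
proof -
  have my: "F x \<in> borel_measurable lborel" for x
    using measurable_Pair2[OF m, of x] by simp
  have iy: "integrable lborel (F x)" for x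
    by (rule Bochner_Integration.integrable_bound[OF integrable_mult_right[OF b, of "a x"] my])
       (use bd in \<open>auto intro: order_trans[OF _ abs_ge_self]\<close>)
  have "integrable (lborel \<Otimes>\<^sub>M lborel) (\<lambda>(x, y). F x y)"
  proof (rule lborel_pair.Fubini_integrable[OF m])
    show "AE x in lborel. integrable lborel (\<lambda>y. case (x, y) of (x, y) \<Rightarrow> F x y)"
      using iy by simp
    show "integrable lborel (\<lambda>x. LINT y|lborel. norm (case (x, y) of (x, y) \<Rightarrow> F x y))"
    proof (rule Bochner_Integration.integrable_bound[OF integrable_mult_left[OF a, of "LINT y|lborel. b y"]])
      show "(\<lambda>x. LINT y|lborel. norm (case (x, y) of (x, y) \<Rightarrow> F x y)) \<in> borel_measurable lborel"
        using m by measurable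
      show "AE x in lborel. norm (LINT y|lborel. norm (case (x, y) of (x, y) \<Rightarrow> F x y)) \<le> norm (a x * (LINT y|lborel. b y))"
      proof (rule AE_I2)
        fix x
        have "(LINT y|lborel. norm (F x y)) \<le> (LINT y|lborel. a x * b y)"
          using iy b bd by (intro integral_mono) auto
        then show "norm (LINT y|lborel. norm (case (x, y) of (x, y) \<Rightarrow> F x y)) \<le> norm (a x * (LINT y|lborel. b y))"
          by (simp add: integral_nonneg)
      qed
    qed
  qed
  then show ?thesis by (rule lborel_pair.Fubini_integral[symmetric])
qed

text \<open>A substitute for Plancherel adapted to an integrable \<open>q\<close>: the weight keeps
  the integral over \<open>v\<close> finite, expanding the square and exchanging integrals produces
  the kernel \<open>4 / (4 + (t - t')^2)\<close>, and taking norms inside leaves a quadratic form in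
  \<open>norm q\<close>.\<close>

lemma weighted_plancherel_bound:
  fixes q :: "real \<Rightarrow> complex"
  assumes q: "integrable lborel q"
  defines "Z \<equiv> (\<lambda>v. LINT t|lborel. q t * exp (\<i> * of_real (v * t)))"
  shows "continuous_on UNIV Z"
    and "integrable lborel (\<lambda>v. (norm (Z v))\<^sup>2 * exp (- 2 * \<bar>v\<bar>))"
    and "ennreal (LINT v|lborel. (norm (Z v))\<^sup>2 * exp (- 2 * \<bar>v\<bar>))
      \<le> (\<integral>\<^sup>+t. \<integral>\<^sup>+t'. ennreal (norm (q t) * norm (q t') * (4 / (4 + (t - t')\<^sup>2))) \<partial>lborel \<partial>lborel)"
proof -
  have qm [measurable]: "q \<in> borel_measurable lborel" using q by simp
  define Q where "Q = (LINT t|lborel. norm (q t))"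
  define w where "w v = exp (- 2 * \<bar>v\<bar>)" for v :: real
  have wi: "integrable lborel w" unfolding w_def by (rule exp_abs_integrable)
  have w0: "w v \<ge> 0" for v by (simp add: w_def)
  have iq: "integrable lborel (\<lambda>t. q t * exp (\<i> * of_real (v * t)))" for v
    by (rule Bochner_Integration.integrable_bound[OF q]) (auto simp: norm_mult)
  show cZ: "continuous_on UNIV Z"
    unfolding continuous_on_sequentially
  proof (intro allI impI ballI)
    fix x and a :: real assume "(\<forall>n. x n \<in> UNIV) \<and> x \<longlonglongrightarrow> a"
    then have x: "x \<longlonglongrightarrow> a" by simp
    show "(Z \<circ> x) \<longlonglongrightarrow> Z a"
      unfolding Z_def o_def
    proof (rule integral_dominated_convergence[where w = "\<lambda>t. norm (q t)"])
      show "AE t in lborel. (\<lambda>i. q t * exp (\<i> * of_real (x i * t))) \<longlonglongrightarrow> q t * exp (\<i> * of_real (a * t))"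
        by (intro AE_I2 tendsto_intros x)
    qed (use q in \<open>auto simp: norm_mult\<close>)
  qed
  then have Zm [measurable]: "Z \<in> borel_measurable lborel"
    by (auto intro: borel_measurable_continuous_onI)
  have Zb: "norm (Z v) \<le> Q" for v
  proof -
    have "norm (Z v) \<le> (LINT t|lborel. norm (q t * exp (\<i> * of_real (v * t))))"
      unfolding Z_def by (rule integral_norm_bound)
    then show ?thesis by (simp add: norm_mult Q_def)
  qed
  have Q0: "Q \<ge> 0" by (simp add: Q_def)
  show i1: "integrable lborel (\<lambda>v. (norm (Z v))\<^sup>2 * exp (- 2 * \<bar>v\<bar>))"
    unfolding w_def[symmetric]
  proof (rule Bochner_Integration.integrable_bound[OF integrable_mult_right[OF wi, of "Q\<^sup>2"]])
    show "(\<lambda>v. (norm (Z v))\<^sup>2 * w v) \<in> borel_measurable lborel"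
      using wi by measurable
    show "AE v in lborel. norm ((norm (Z v))\<^sup>2 * w v) \<le> norm (Q\<^sup>2 * w v)"
      using Zb w0 by (auto simp: abs_mult intro!: AE_I2 mult_right_mono power_mono)
  qed
  \<comment> \<open>The inner integral left after both exchanges of integration: the conjugate of
    \<open>q\<close> against the kernel centred at \<open>t\<close>.\<close>
  define J where "J t = (LINT t'|lborel. cnj (q t') * of_real (4 / (4 + (t - t')\<^sup>2)))" for t
  have step1: "(LINT v|lborel. of_real ((norm (Z v))\<^sup>2 * w v)) =
      (LINT t|lborel. q t * (LINT v|lborel. exp (\<i> * of_real (v * t)) * (of_real (w v) * cnj (Z v))))"
  proof -
    have "of_real ((norm (Z v))\<^sup>2 * w v) = (LINT t|lborel. q t * exp (\<i> * of_real (v * t)) * (of_real (w v) * cnj (Z v)))" for v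
    proof -
      have "of_real ((norm (Z v))\<^sup>2 * w v) = Z v * (of_real (w v) * cnj (Z v))"
        using complex_norm_square[of "Z v"] by simp
      also have "\<dots> = (LINT t|lborel. q t * exp (\<i> * of_real (v * t)) * (of_real (w v) * cnj (Z v)))"
        unfolding Z_def by simp
      finally show ?thesis .
    qed
    then have "(LINT v|lborel. of_real ((norm (Z v))\<^sup>2 * w v)) =
        (LINT v|lborel. LINT t|lborel. q t * exp (\<i> * of_real (v * t)) * (of_real (w v) * cnj (Z v)))"
      by (intro Bochner_Integration.integral_cong refl)
    also have "\<dots> = (LINT t|lborel. LINT v|lborel. q t * exp (\<i> * of_real (v * t)) * (of_real (w v) * cnj (Z v)))"
    proof (rule fubini_dominated[of _ "\<lambda>v. Q * w v" "\<lambda>t. norm (q t)"])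
      show "(\<lambda>(v, t). q t * exp (\<i> * of_real (v * t)) * (of_real (w v) * cnj (Z v))) \<in> borel_measurable (lborel \<Otimes>\<^sub>M lborel)"
        unfolding w_def by measurable
      show "norm (q t * exp (\<i> * of_real (v * t)) * (of_real (w v) * cnj (Z v))) \<le> Q * w v * norm (q t)" for v t
        using mult_left_mono[OF Zb[of v], of "norm (q t) * w v"] w0[of v] by (simp add: norm_mult mult_ac)
    qed (use wi q in auto)
    finally show ?thesis by (simp add: mult.assoc)
  qed
  have step2: "(LINT v|lborel. exp (\<i> * of_real (v * t)) * (of_real (w v) * cnj (Z v))) = J t" for t
  proof -
    have "cnj (Z v) = (LINT t'|lborel. cnj (q t') * exp (\<i> * of_real (- (v * t'))))" for v
      unfolding Z_def using Bochner_Integration.integral_cnj[of lborel "\<lambda>t. q t * exp (\<i> * of_real (v * t))"]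
      by (simp add: exp_cnj)
    then have "(LINT v|lborel. exp (\<i> * of_real (v * t)) * (of_real (w v) * cnj (Z v))) =
       (LINT v|lborel. LINT t'|lborel. exp (\<i> * of_real (v * t)) * (of_real (w v) * (cnj (q t') * exp (\<i> * of_real (- (v * t'))))))"
      by simp
    also have "\<dots> = (LINT t'|lborel. LINT v|lborel. exp (\<i> * of_real (v * t)) * (of_real (w v) * (cnj (q t') * exp (\<i> * of_real (- (v * t'))))))"
    proof (rule fubini_dominated[of _ w "\<lambda>t. norm (q t)"])
      show "(\<lambda>(v, t'). exp (\<i> * of_real (v * t)) * (of_real (w v) * (cnj (q t') * exp (\<i> * of_real (- (v * t')))))) \<in> borel_measurable (lborel \<Otimes>\<^sub>M lborel)"
        unfolding w_def by measurable
      show "norm (exp (\<i> * of_real (v * t)) * (of_real (w v) * (cnj (q t') * exp (\<i> * of_real (- (v * t')))))) \<le> w v * norm (q t')" for v t'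
        using w0[of v] by (simp add: norm_mult)
    qed (use wi q in auto)
    also have "\<dots> = J t"
      unfolding J_def
    proof (rule Bochner_Integration.integral_cong[OF refl])
      fix t'
      have "exp (\<i> * of_real (v * t)) * (of_real (w v) * (cnj (q t') * exp (\<i> * of_real (- (v * t')))))
          = cnj (q t') * (of_real (exp (- 2 * \<bar>v\<bar>)) * exp (\<i> * of_real (v * (t - t'))))" for v
        by (simp add: w_def algebra_simps exp_diff exp_minus field_simps)
      then show "(LINT v|lborel. exp (\<i> * of_real (v * t)) * (of_real (w v) * (cnj (q t') * exp (\<i> * of_real (- (v * t')))))) = cnj (q t') * of_real (4 / (4 + (t - t')\<^sup>2))"
        by (simp only: integral_mult_right_zero laplace_kernel_integral)
    qed
    finally show ?thesis .
  qed
  have k01: "0 \<le> 4 / (4 + (t - t')\<^sup>2)" "4 / (4 + (t - t')\<^sup>2) \<le> 1" for t t' :: real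
    by (auto intro!: divide_nonneg_pos add_pos_nonneg simp: divide_le_eq_1)
  have kpos: "4 + (t - t')\<^sup>2 > 0" for t t' :: real by (intro add_pos_nonneg) auto
  have nk: "norm (cnj (q t') * of_real (4 / (4 + (t - t')\<^sup>2))) = norm (q t') * (4 / (4 + (t - t')\<^sup>2))" for t t'
    using k01(1)[of t t'] by (simp only: norm_mult norm_of_real abs_of_nonneg complex_mod_cnj)
  have nk1: "norm (q t') * (4 / (4 + (t - t')\<^sup>2)) \<le> norm (q t')" for t t'
    using k01[of t t'] by (intro mult_right_le_one_le) auto
  have iJ: "integrable lborel (\<lambda>t'. cnj (q t') * of_real (4 / (4 + (t - t')\<^sup>2)))" for t
  proof (rule Bochner_Integration.integrable_bound[OF q])
    show "(\<lambda>t'. cnj (q t') * of_real (4 / (4 + (t - t')\<^sup>2))) \<in> borel_measurable lborel" by measurable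
    show "AE t' in lborel. norm (cnj (q t') * of_real (4 / (4 + (t - t')\<^sup>2))) \<le> norm (q t')"
      unfolding nk using nk1 by (intro AE_I2)
  qed
  have nJ: "ennreal (norm (J t)) \<le> (\<integral>\<^sup>+t'. ennreal (norm (q t') * (4 / (4 + (t - t')\<^sup>2))) \<partial>lborel)" for t
    using integral_norm_bound_ennreal[OF iJ[of t]] unfolding J_def nk .
  have Jm [measurable]: "J \<in> borel_measurable lborel" unfolding J_def by measurable
  have Jb: "norm (J t) \<le> Q" for t
  proof -
    have "norm (J t) \<le> (LINT t'|lborel. norm (q t'))"
      unfolding J_def
      by (rule Bochner_Integration.integral_norm_bound_integral[OF iJ])
         (use q in simp, unfold nk, rule nk1)
    then show ?thesis by (simp add: Q_def)
  qed
  have iqJ: "integrable lborel (\<lambda>t. q t * J t)"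
  proof (rule Bochner_Integration.integrable_bound[OF integrable_mult_right[OF integrable_norm[OF q], of Q]])
    show "AE t in lborel. norm (q t * J t) \<le> norm (Q * norm (q t))"
      using Jb Q0 by (intro AE_I2) (auto simp: norm_mult abs_mult mult.commute intro!: mult_right_mono)
  qed measurable
  have "ennreal (LINT v|lborel. (norm (Z v))\<^sup>2 * w v) = ennreal (norm (LINT v|lborel. complex_of_real ((norm (Z v))\<^sup>2 * w v)))"
  proof -
    have "(LINT v|lborel. (norm (Z v))\<^sup>2 * w v) \<ge> 0" using w0 by (intro Bochner_Integration.integral_nonneg) auto
    then show ?thesis
      using integral_complex_of_real[of lborel "\<lambda>v. (norm (Z v))\<^sup>2 * w v"] by (simp only: norm_of_real abs_of_nonneg)
  qed
  also have "(LINT v|lborel. complex_of_real ((norm (Z v))\<^sup>2 * w v)) = (LINT t|lborel. q t * J t)"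
    unfolding step1 step2 by (rule refl)
  also have "ennreal (norm (LINT t|lborel. q t * J t)) \<le> (\<integral>\<^sup>+t. ennreal (norm (q t * J t)) \<partial>lborel)"
    by (rule integral_norm_bound_ennreal[OF iqJ])
  also have "\<dots> \<le> (\<integral>\<^sup>+t. \<integral>\<^sup>+t'. ennreal (norm (q t) * norm (q t') * (4 / (4 + (t - t')\<^sup>2))) \<partial>lborel \<partial>lborel)"
  proof (rule nn_integral_mono)
    fix t
    have "ennreal (norm (q t * J t)) = ennreal (norm (q t)) * ennreal (norm (J t))"
      by (simp add: norm_mult ennreal_mult)
    also have "\<dots> \<le> ennreal (norm (q t)) * (\<integral>\<^sup>+t'. ennreal (norm (q t') * (4 / (4 + (t - t')\<^sup>2))) \<partial>lborel)"
      by (intro mult_left_mono nJ) auto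
    also have "\<dots> = (\<integral>\<^sup>+t'. ennreal (norm (q t)) * ennreal (norm (q t') * (4 / (4 + (t - t')\<^sup>2))) \<partial>lborel)"
      by (rule nn_integral_cmult[symmetric]) measurable
    also have "\<dots> = (\<integral>\<^sup>+t'. ennreal (norm (q t) * norm (q t') * (4 / (4 + (t - t')\<^sup>2))) \<partial>lborel)"
      using kpos[of t] by (intro nn_integral_cong) (simp add: less_imp_le mult.assoc flip: ennreal_mult)
    finally show "ennreal (norm (q t * J t)) \<le> (\<integral>\<^sup>+t'. ennreal (norm (q t) * norm (q t') * (4 / (4 + (t - t')\<^sup>2))) \<partial>lborel)" .
  qed
  finally show "ennreal (LINT v|lborel. (norm (Z v))\<^sup>2 * exp (- 2 * \<bar>v\<bar>))
      \<le> (\<integral>\<^sup>+t. \<integral>\<^sup>+t'. ennreal (norm (q t) * norm (q t') * (4 / (4 + (t - t')\<^sup>2))) \<partial>lborel \<partial>lborel)"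
    unfolding w_def .
qed

text \<open>A Schur test: \<open>2 c(t) c(t') \<le> c(t)^2 + c(t')^2\<close> makes the form
  diagonal, and the inner integral of \<open>p\<close> against the kernel is then bounded by
  \<open>\<Lambda>\<close>. The gain is that \<open>p\<close> occurs to the first power: it stands
  for \<open>|Re f'/f|\<close>, of which only averages are under control.\<close>

lemma kernel_symmetrization:
  fixes p c \<Lambda> :: "real \<Rightarrow> real"
  assumes [measurable]: "p \<in> borel_measurable lborel" "c \<in> borel_measurable lborel" "\<Lambda> \<in> borel_measurable lborel"
    and p: "\<And>t. p t \<ge> 0" and c: "\<And>t. c t \<ge> 0" and L0: "\<And>t. \<Lambda> t \<ge> 0"
    and L: "\<And>t. (\<integral>\<^sup>+t'. ennreal (p t' * (4 / (4 + (t - t')\<^sup>2))) \<partial>lborel) \<le> ennreal (\<Lambda> t)"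
  shows "(\<integral>\<^sup>+t. \<integral>\<^sup>+t'. ennreal ((c t * p t) * (c t' * p t') * (4 / (4 + (t - t')\<^sup>2))) \<partial>lborel \<partial>lborel)
      \<le> (\<integral>\<^sup>+t. ennreal ((c t)\<^sup>2 * p t * \<Lambda> t) \<partial>lborel)"
proof -
  define k where "k t t' = 4 / (4 + (t - t')\<^sup>2)" for t t' :: real
  have k0: "k t t' \<ge> 0" for t t' unfolding k_def by (intro divide_nonneg_pos add_pos_nonneg) auto
  have ks: "k t t' = k t' t" for t t' by (simp add: k_def power2_commute)
  have km [measurable]: "(\<lambda>(t, t'). k t t') \<in> borel_measurable (lborel \<Otimes>\<^sub>M lborel)" unfolding k_def by measurable
  define A where "A = (\<integral>\<^sup>+t. \<integral>\<^sup>+t'. ennreal ((c t)\<^sup>2 * p t * p t' * k t t') \<partial>lborel \<partial>lborel)"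
  have A': "(\<integral>\<^sup>+t. \<integral>\<^sup>+t'. ennreal ((c t')\<^sup>2 * p t' * p t * k t t') \<partial>lborel \<partial>lborel) = A"
  proof -
    have "(\<integral>\<^sup>+t. \<integral>\<^sup>+t'. ennreal ((c t')\<^sup>2 * p t' * p t * k t t') \<partial>lborel \<partial>lborel)
        = (\<integral>\<^sup>+t'. \<integral>\<^sup>+t. ennreal ((c t')\<^sup>2 * p t' * p t * k t t') \<partial>lborel \<partial>lborel)"
      by (rule lborel_pair.Fubini'[symmetric]) measurable
    then show ?thesis by (simp add: A_def ks)
  qed
  have gen: "2 * ennreal X \<le> ennreal Y1 + ennreal Y2" if "2 * X \<le> Y1 + Y2" "0 \<le> X" "0 \<le> Y1" "0 \<le> Y2" for X Y1 Y2
  proof -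
    have "2 * ennreal X = ennreal (2 * X)" using that by (simp add: ennreal_mult)
    also have "\<dots> \<le> ennreal (Y1 + Y2)" by (rule ennreal_leI) fact
    also have "\<dots> = ennreal Y1 + ennreal Y2" using that by simp
    finally show ?thesis .
  qed
  have "2 * (\<integral>\<^sup>+t. \<integral>\<^sup>+t'. ennreal ((c t * p t) * (c t' * p t') * k t t') \<partial>lborel \<partial>lborel)
      = (\<integral>\<^sup>+t. \<integral>\<^sup>+t'. 2 * ennreal ((c t * p t) * (c t' * p t') * k t t') \<partial>lborel \<partial>lborel)"
    by (subst nn_integral_cmult, measurable)+
  also have "\<dots> \<le> (\<integral>\<^sup>+t. \<integral>\<^sup>+t'. ennreal ((c t)\<^sup>2 * p t * p t' * k t t') + ennreal ((c t')\<^sup>2 * p t' * p t * k t t') \<partial>lborel \<partial>lborel)"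
  proof (intro nn_integral_mono)
    fix t t'
    have "2 * (c t * c t') * (p t * p t' * k t t') \<le> ((c t)\<^sup>2 + (c t')\<^sup>2) * (p t * p t' * k t t')"
      using p k0 sum_squares_bound[of "c t" "c t'"] by (intro mult_right_mono) auto
    then have "2 * ((c t * p t) * (c t' * p t') * k t t') \<le> (c t)\<^sup>2 * p t * p t' * k t t' + (c t')\<^sup>2 * p t' * p t * k t t'"
      by (simp add: algebra_simps)
    then show "2 * ennreal ((c t * p t) * (c t' * p t') * k t t') \<le> ennreal ((c t)\<^sup>2 * p t * p t' * k t t') + ennreal ((c t')\<^sup>2 * p t' * p t * k t t')"
      using p c k0 by (intro gen) auto
  qed
  also have "\<dots> = A + A"
    unfolding A'[symmetric] 
    by (subst nn_integral_add, measurable)+ (simp add: A_def A'[unfolded A_def])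
  finally have "2 * (\<integral>\<^sup>+t. \<integral>\<^sup>+t'. ennreal ((c t * p t) * (c t' * p t') * k t t') \<partial>lborel \<partial>lborel) \<le> 2 * A"
    by (simp add: mult_2)
  then have "(\<integral>\<^sup>+t. \<integral>\<^sup>+t'. ennreal ((c t * p t) * (c t' * p t') * k t t') \<partial>lborel \<partial>lborel) \<le> A"
    by (subst (asm) ennreal_mult_le_mult_iff) auto
  also have "A \<le> (\<integral>\<^sup>+t. ennreal ((c t)\<^sup>2 * p t * \<Lambda> t) \<partial>lborel)"
    unfolding A_def
  proof (rule nn_integral_mono)
    fix t
    have "(\<integral>\<^sup>+t'. ennreal ((c t)\<^sup>2 * p t * p t' * k t t') \<partial>lborel) = (\<integral>\<^sup>+t'. ennreal ((c t)\<^sup>2 * p t) * ennreal (p t' * k t t') \<partial>lborel)"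
      using p k0 by (intro nn_integral_cong) (simp add: mult.assoc flip: ennreal_mult)
    also have "\<dots> = ennreal ((c t)\<^sup>2 * p t) * (\<integral>\<^sup>+t'. ennreal (p t' * k t t') \<partial>lborel)"
      by (rule nn_integral_cmult) (unfold k_def, measurable)
    also have "\<dots> \<le> ennreal ((c t)\<^sup>2 * p t) * ennreal (\<Lambda> t)"
      using L[of t] by (intro mult_left_mono) (auto simp: k_def)
    also have "\<dots> = ennreal ((c t)\<^sup>2 * p t * \<Lambda> t)"
      using p L0 by (simp flip: ennreal_mult)
    finally show "(\<integral>\<^sup>+t'. ennreal ((c t)\<^sup>2 * p t * p t' * k t t') \<partial>lborel) \<le> ennreal ((c t)\<^sup>2 * p t * \<Lambda> t)" .
  qed
  finally show ?thesis by (simp add: k_def)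
qed

subsection \<open>Bounds for the logarithmic derivative under the Riemann Hypothesis\<close>

lemma zeta1_nonzero:
  assumes RH: "riemann_hypothesis" and z: "Re z > 1 / 2"
  shows "zeta1 z \<noteq> 0"
proof -
  consider "Re z > 1" | "Re z = 1" | "Re z < 1" by linarith
  then show ?thesis
  proof cases
    case 3
    show ?thesis
    proof
      assume "zeta1 z = 0"
      moreover have "z \<noteq> 1" using 3 by auto
      ultimately have "riemann_zeta z = 0" using riemann_zeta_eq_zeta1[of z] z by simp
      then have "Re z = 1 / 2" using RH 3 z unfolding riemann_hypothesis_def by auto
      then show False using z by simp
    qed
  qed (use zeta1_nonzero_Re_gt_1 zeta1_nonzero_Re_1 in auto)
qed

section \<open>Growth of zeta and pointwise bounds for its logarithmic derivative\<close>

lemma norm_add_one_le: "1 + norm (s + 1) \<le> 2 * (1 + norm s)" for s :: complex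
proof -
  have "norm (s + 1) \<le> norm s + norm (1 :: complex)" by (rule norm_triangle_ineq)
  then have "norm (s + 1) \<le> norm s + 1" by simp
  then have "1 + norm (s + 1) \<le> 1 + (norm s + 1)" by (rule add_left_mono)
  also have "\<dots> \<le> 2 * (1 + norm s)" by simp
  finally show ?thesis .
qed

text \<open>The induction follows the recursion behind \<open>hzeta_ext\<close>: a step costs one
  factor \<open>1 + norm s\<close> and, because the second argument moves by
  \<open>t \<le> 1\<close>, one factor \<open>a\<close>. The half unit kept from the abscissa
  \<open>1 - k\<close> makes the series of the base case uniformly bounded.\<close>

lemma hzeta_ext_growth:
  "\<exists>C\<ge>0. \<forall>s a. a \<ge> 1 \<longrightarrow> 3 / 2 - real k \<le> Re s \<longrightarrow> norm (hzeta_ext k s a) \<le> C * (1 + norm s) ^ (k + 1) * a ^ (k + 1)"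
proof (induction k)
  case 0
  define Z where "Z = (\<Sum>n. (real n + 1) powr (- (3 / 2)))"
  have sm: "summable (\<lambda>n. (real n + 1) powr (- (3 / 2)))" by (rule summable_shifted_powr) simp
  have Z: "Z \<ge> 0" unfolding Z_def by (intro suminf_nonneg sm) auto
  show ?case
  proof (intro exI[of _ Z] conjI allI impI Z)
    fix s :: complex and a :: real assume a: "a \<ge> 1" and s: "3 / 2 - real 0 \<le> Re s"
    have "norm (hzeta_sum s a) \<le> Z" unfolding hzeta_sum_def Z_def
      by (rule norm_suminf_le[OF _ sm]) (use a s in \<open>auto intro!: zterm_bound\<close>)
    moreover have "norm (s - 1) \<le> 1 + norm s" using norm_triangle_ineq4[of s 1] by simp
    ultimately have "norm (s - 1) * norm (hzeta_sum s a) \<le> (1 + norm s) * Z"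
      by (intro mult_mono) auto
    also have "\<dots> \<le> (1 + norm s) * Z * a" using mult_left_mono[of 1 a "(1 + norm s) * Z"] a Z by simp
    finally show "norm (hzeta_ext 0 s a) \<le> Z * (1 + norm s) ^ (0 + 1) * a ^ (0 + 1)"
      by (simp add: norm_mult mult.commute)
  qed
next
  case (Suc k)
  then obtain C where C: "C \<ge> 0" "\<And>s a. a \<ge> 1 \<Longrightarrow> 3 / 2 - real k \<le> Re s \<Longrightarrow> norm (hzeta_ext k s a) \<le> C * (1 + norm s) ^ (k + 1) * a ^ (k + 1)"
    by blast
  obtain G' where G': "continuous_on ({s. Re s > 1 - real k} \<times> {1..}) (\<lambda>(s, a). hzeta_ext k s a)"
    using zgood_ext[of k] unfolding zgood_def by blast
  show ?case
  proof (intro exI[of _ "1 + C * 2 ^ (k + 1) * 2 ^ (k + 1)"] conjI allI impI)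
    fix s :: complex and a :: real assume a: "a \<ge> 1" and s: "3 / 2 - real (Suc k) \<le> Re s"
    define M where "M = C * (2 * (1 + norm s)) ^ (k + 1) * (2 * a) ^ (k + 1)"
    have M: "M \<ge> 0" using C a by (simp add: M_def)
    have I: "norm (integral {0..1} (\<lambda>t. of_real (1 - t) * hzeta_ext k (s + 1) (a + t))) \<le> M * (1 - 0)"
    proof (rule integral_bound)
      have "continuous_on {0..1} (\<lambda>t. (\<lambda>(s, a). hzeta_ext k s a) (s + 1, a + t))"
        by (rule continuous_on_compose2[OF G']) (use a s in \<open>auto intro!: continuous_intros\<close>)
      then show "continuous_on {0..1} (\<lambda>t. of_real (1 - t) * hzeta_ext k (s + 1) (a + t))"
        by (auto intro!: continuous_intros)
      fix t :: real assume t: "t \<in> {0..1}"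
      have "norm (hzeta_ext k (s + 1) (a + t)) \<le> C * (1 + norm (s + 1)) ^ (k + 1) * (a + t) ^ (k + 1)"
        using a s t by (intro C) auto
      also have "\<dots> \<le> M"
      proof -
        have "1 + norm (s + 1) \<le> 2 * (1 + norm s)"
          by (rule norm_add_one_le)
        then show ?thesis unfolding M_def using C a t
          by (intro mult_mono power_mono) auto
      qed
      finally have "norm (hzeta_ext k (s + 1) (a + t)) \<le> M" .
      moreover have "norm (of_real (1 - t) :: complex) \<le> 1" using t by (simp del: of_real_diff)
      ultimately have "norm (of_real (1 - t) :: complex) * norm (hzeta_ext k (s + 1) (a + t)) \<le> 1 * M"
        by (intro mult_mono) auto
      then show "norm (of_real (1 - t) * hzeta_ext k (s + 1) (a + t)) \<le> M" by (simp add: norm_mult)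
    qed simp
    have "norm (zterm a (s - 1)) = a powr (1 - Re s)" using a by (simp add: norm_zterm)
    also have "\<dots> \<le> a powr real (Suc k + 1)" using a s by (intro powr_mono) auto
    also have "\<dots> = a ^ (Suc k + 1)" using a by (subst powr_realpow) auto
    also have "\<dots> \<le> (1 + norm s) ^ (Suc k + 1) * a ^ (Suc k + 1)"
      using mult_right_mono[of 1 "(1 + norm s) ^ (Suc k + 1)" "a ^ (Suc k + 1)"] a
      by (simp add: one_le_power del: power_Suc)
    finally have 1: "norm (zterm a (s - 1)) \<le> (1 + norm s) ^ (Suc k + 1) * a ^ (Suc k + 1)" .
    have "norm (s - 1) \<le> (1 + norm s) * a"
      using norm_triangle_ineq4[of s 1] a mult_left_mono[of 1 a "1 + norm s"] by simp
    then have "norm (s - 1) * norm (integral {0..1} (\<lambda>t. of_real (1 - t) * hzeta_ext k (s + 1) (a + t))) \<le> (1 + norm s) * a * M"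
      using I M a by (intro mult_mono) auto
    also have "\<dots> = C * 2 ^ (k + 1) * 2 ^ (k + 1) * ((1 + norm s) ^ (Suc k + 1) * a ^ (Suc k + 1))"
      unfolding M_def power_mult_distrib by (simp add: algebra_simps)
    finally have 2: "norm (s - 1) * norm (integral {0..1} (\<lambda>t. of_real (1 - t) * hzeta_ext k (s + 1) (a + t)))
        \<le> C * 2 ^ (k + 1) * 2 ^ (k + 1) * ((1 + norm s) ^ (Suc k + 1) * a ^ (Suc k + 1))" .
    have "norm (hzeta_ext (Suc k) s a) \<le> norm (zterm a (s - 1)) + norm (s - 1) * norm (integral {0..1} (\<lambda>t. of_real (1 - t) * hzeta_ext k (s + 1) (a + t)))"
      unfolding hzeta_ext.simps hzeta_step_def norm_mult[symmetric] by (rule norm_triangle_ineq)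
    also have "\<dots> \<le> (1 + C * 2 ^ (k + 1) * 2 ^ (k + 1)) * ((1 + norm s) ^ (Suc k + 1) * a ^ (Suc k + 1))"
      using 1 2 by (simp only: distrib_right mult_1_left)
    finally show "norm (hzeta_ext (Suc k) s a) \<le> (1 + C * 2 ^ (k + 1) * 2 ^ (k + 1)) * (1 + norm s) ^ (Suc k + 1) * a ^ (Suc k + 1)"
      by (simp add: mult.assoc)
  qed (use C in auto)
qed



lemma zlog_bounded_right:
  assumes c: "c > 1"
  obtains K where "K > 0" "\<And>s. Re s \<ge> c \<Longrightarrow> norm (zlog s) \<le> K"
proof -
  obtain K where K: "\<And>s. Re s \<ge> c \<Longrightarrow> norm (mangoldt_series s) \<le> K"
    using mangoldt_series_bounded[OF c] by blast
  have K0: "K \<ge> 0" using order_trans[OF norm_ge_zero K[of "of_real c"]] by simp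
  have "norm (zlog s) \<le> 1 / (c - 1) + K" if s: "Re s \<ge> c" for s
  proof -
    have "c - 1 \<le> norm (s - 1)" using abs_Re_le_cmod[of "s - 1"] s by simp
    then have "1 / norm (s - 1) \<le> 1 / (c - 1)" using c by (intro frac_le) auto
    then have "norm (1 / (s - 1)) \<le> 1 / (c - 1)" by (simp only: norm_divide norm_one)
    moreover have "zlog s = 1 / (s - 1) - mangoldt_series s" using s c by (intro zlog_eq) auto
    ultimately show ?thesis
      using K[OF s] norm_triangle_ineq4[of "1 / (s - 1)" "mangoldt_series s"] by simp
  qed
  moreover have "1 / (c - 1) + K > 0" using c K0 by (intro add_pos_nonneg) auto
  ultimately show ?thesis by (rule_tac that) auto
qed

text \<open>The terms after the leading 1 add up to at most 2/3 in norm: replacing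
  \<open>(n + 2)^2\<close> by the smaller product \<open>(n + 3/2) (n + 5/2)\<close> makes their sum
  telescope.\<close>

lemma norm_hzeta_sum_2_ge: "norm (hzeta_sum (Complex 2 t) 1) \<ge> 1 / 3"
proof -
  define f where "f n = zterm (real n + 1) (Complex 2 t)" for n
  have f: "f sums hzeta_sum (Complex 2 t) 1"
    unfolding f_def by (rule zterm_sums) auto
  have tel: "(\<lambda>n. 1 / (real n + 3 / 2) - 1 / (real (Suc n) + 3 / 2)) sums (1 / (real 0 + 3 / 2) - 0)"
    by (rule telescope_sums') real_asymp
  have "norm (\<Sum>n. f (Suc n)) \<le> (\<Sum>n. 1 / (real n + 3 / 2) - 1 / (real (Suc n) + 3 / 2))"
  proof (rule norm_suminf_le)
    fix n
    have "norm (f (Suc n)) = (real n + 2) powr (- 2)"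
      by (simp add: f_def norm_zterm add.commute)
    also have "\<dots> = 1 / (real n + 2)\<^sup>2"
      by (simp add: powr_minus inverse_eq_divide)
    also have "\<dots> \<le> 1 / ((real n + 3 / 2) * (real n + 5 / 2))"
    proof (rule frac_le)
      show "0 < (real n + 3 / 2) * (real n + 5 / 2)" by (intro mult_pos_pos add_nonneg_pos) auto
      show "(real n + 3 / 2) * (real n + 5 / 2) \<le> (real n + 2)\<^sup>2"
        by (simp add: power2_eq_square algebra_simps)
    qed auto
    also have "\<dots> = 1 / (real n + 3 / 2) - 1 / (real (Suc n) + 3 / 2)"
    proof -
      have "real n + 3 / 2 \<noteq> 0" "real n + 5 / 2 \<noteq> 0" by linarith+
      then show ?thesis by (simp add: field_simps)
    qed
    finally show "norm (f (Suc n)) \<le> 1 / (real n + 3 / 2) - 1 / (real (Suc n) + 3 / 2)" .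
  qed (use tel in \<open>simp add: sums_iff\<close>)
  also have "\<dots> = 2 / 3" using tel by (simp add: sums_iff)
  finally have "norm (\<Sum>n. f (Suc n)) \<le> 2 / 3" .
  moreover have "(\<Sum>n. f (Suc n)) = hzeta_sum (Complex 2 t) 1 - 1"
    using f suminf_split_head[of f] by (simp add: sums_iff) (simp add: f_def)
  ultimately have "norm (hzeta_sum (Complex 2 t) 1 - 1) \<le> 2 / 3" by simp
  then show ?thesis using norm_triangle_ineq2[of 1 "1 - hzeta_sum (Complex 2 t) 1"]
    by (simp add: norm_minus_commute)
qed

lemma norm_zeta1_2_ge: "norm (zeta1 (Complex 2 t)) \<ge> 1 / 3"
proof -
  have "1 \<le> norm (Complex 2 t - 1)" using abs_Re_le_cmod[of "Complex 2 t - 1"] by simp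
  then have "1 * (1 / 3) \<le> norm (Complex 2 t - 1) * norm (hzeta_sum (Complex 2 t) 1)"
    using norm_hzeta_sum_2_ge by (intro mult_mono) auto
  then show ?thesis by (simp add: zeta1_eq_hzeta_sum norm_mult)
qed

text \<open>Radius 5 is dictated by \<open>Re_log_deriv_ge\<close>: a third of it must exceed 3/2,
  the distance from \<open>2 + i t\<close> to the critical line. The disc lies in
  \<open>Re z \<ge> -3\<close>, inside the range \<open>Re z \<ge> -7/2\<close> of the growth bound
  for index 5.\<close>

lemma zeta1_growth:
  obtains C where "C \<ge> 1" "\<And>t z. dist (Complex 2 t) z \<le> 5 \<Longrightarrow> norm (zeta1 z) \<le> C * (\<bar>t\<bar> + 2) ^ 6"
proof -
  obtain C where C: "C \<ge> 0" "\<And>s a. a \<ge> 1 \<Longrightarrow> 3 / 2 - real 5 \<le> Re s \<Longrightarrow> norm (hzeta_ext 5 s a) \<le> C * (1 + norm s) ^ (5 + 1) * a ^ (5 + 1)"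
    using hzeta_ext_growth[of 5] by blast
  have "norm (zeta1 z) \<le> (C * 4 ^ 6 + 1) * (\<bar>t\<bar> + 2) ^ 6" if z: "dist (Complex 2 t) z \<le> 5" for t z
  proof -
    have "\<bar>2 - Re z\<bar> \<le> 5" using abs_Re_le_cmod[of "Complex 2 t - z"] z by (simp add: dist_norm)
    then have "norm (zeta1 z) \<le> C * (1 + norm z) ^ 6"
      using C(2)[of 1 z] by (simp add: zeta1_def)
    also have "\<dots> \<le> C * (4 * (\<bar>t\<bar> + 2)) ^ 6"
    proof (intro mult_left_mono power_mono)
      have "norm z \<le> norm (Complex 2 t) + dist (Complex 2 t) z"
        using norm_triangle_ineq4[of "Complex 2 t" "Complex 2 t - z"] by (simp add: dist_norm)
      also have "norm (Complex 2 t) \<le> 2 + \<bar>t\<bar>" using cmod_le[of "Complex 2 t"] by simp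
      finally show "1 + norm z \<le> 4 * (\<bar>t\<bar> + 2)" using z by simp
    qed (use C in auto)
    also have "\<dots> \<le> (C * 4 ^ 6 + 1) * (\<bar>t\<bar> + 2) ^ 6"
      unfolding power_mult_distrib[of 4] by (simp add: distrib_right)
    finally show ?thesis .
  qed
  then show ?thesis using C by (intro that[of "C * 4 ^ 6 + 1"]) auto
qed

lemma ln_2_le: "ln 2 \<le> ln (\<bar>t\<bar> + 2 :: real)"
  by simp

lemma zeta1_log_ratio:
  obtains C :: real and M A :: "real \<Rightarrow> real" where "C > 0"
    "\<And>t z. dist (Complex 2 t) z \<le> 5 \<Longrightarrow> norm (zeta1 z) \<le> M t"
    "\<And>t. M t < exp (A t) * norm (zeta1 (Complex 2 t))" "\<And>t. 0 < A t" "\<And>t. A t \<le> C * ln (\<bar>t\<bar> + 2)"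
proof -
  obtain C where C: "C \<ge> 1" "\<And>t z. dist (Complex 2 t) z \<le> 5 \<Longrightarrow> norm (zeta1 z) \<le> C * (\<bar>t\<bar> + 2) ^ 6"
    using zeta1_growth by blast
  \<comment> \<open>The factor 6 more than offsets the lower bound 1/3 for
    \<open>norm (zeta1 (Complex 2 t))\<close>, which makes the comparison with
    \<open>exp (A t)\<close> strict.\<close>
  define A where "A t = ln (6 * C) + 6 * ln (\<bar>t\<bar> + 2)" for t :: real
  have l6: "ln (6 * C) > 0" using C by simp
  have eA: "exp (A t) = 6 * C * (\<bar>t\<bar> + 2) ^ 6" for t
  proof -
    have "6 * ln (\<bar>t\<bar> + 2) = ln ((\<bar>t\<bar> + 2) ^ 6)" by (simp add: ln_realpow)
    then show ?thesis using C by (simp add: A_def exp_add)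
  qed
  show ?thesis
  proof (rule that[of "ln (6 * C) / ln 2 + 6" "\<lambda>t. C * (\<bar>t\<bar> + 2) ^ 6" A])
    show "0 < ln (6 * C) / ln 2 + 6" using l6 by (intro add_pos_pos) auto
    show "C * (\<bar>t\<bar> + 2) ^ 6 < exp (A t) * norm (zeta1 (Complex 2 t))" for t
    proof -
      have "0 < C * (\<bar>t\<bar> + 2) ^ 6" using C by (intro mult_pos_pos zero_less_power) auto
      then have "C * (\<bar>t\<bar> + 2) ^ 6 < exp (A t) * (1 / 3)" unfolding eA by simp
      also have "\<dots> \<le> exp (A t) * norm (zeta1 (Complex 2 t))"
        using norm_zeta1_2_ge by (intro mult_left_mono) auto
      finally show ?thesis .
    qed
    show "0 < A t" for t using l6 ln_2_le[of t] ln_2_less_1 by (simp add: A_def add_pos_nonneg)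
    show "A t \<le> (ln (6 * C) / ln 2 + 6) * ln (\<bar>t\<bar> + 2)" for t
    proof -
      have "ln (6 * C) / ln 2 * ln 2 \<le> ln (6 * C) / ln 2 * ln (\<bar>t\<bar> + 2)"
        using l6 ln_2_le[of t] by (intro mult_left_mono) auto
      then show ?thesis by (simp add: A_def algebra_simps)
    qed
  qed (use C in auto)
qed

text \<open>The disc of radius 5/3 about \<open>2 + i t\<close> reaches past the critical line by
  1/6, so the constant stays bounded as \<open>\<sigma>\<close> approaches 1/2; the zeros inside it
  have real part at most 1/2 and only raise \<open>Re zlog\<close>.\<close>

lemma Re_zlog_ge:
  assumes RH: "riemann_hypothesis"
  obtains C where "C > 0" "\<And>\<sigma> t. 1 / 2 < \<sigma> \<Longrightarrow> \<sigma> \<le> 2 \<Longrightarrow> Re (zlog (Complex \<sigma> t)) \<ge> - (C * ln (\<bar>t\<bar> + 2))"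
proof -
  obtain C :: real and M A :: "real \<Rightarrow> real" where C: "C > 0"
    and M: "\<And>t z. dist (Complex 2 t) z \<le> 5 \<Longrightarrow> norm (zeta1 z) \<le> M t"
    and A: "\<And>t. M t < exp (A t) * norm (zeta1 (Complex 2 t))" "\<And>t. 0 < A t" "\<And>t. A t \<le> C * ln (\<bar>t\<bar> + 2)"
    using zeta1_log_ratio by metis
  have "Re (zlog (Complex \<sigma> t)) \<ge> - (480 * C * ln (\<bar>t\<bar> + 2))" if \<sigma>: "1 / 2 < \<sigma>" "\<sigma> \<le> 2" for \<sigma> t
  proof -
    have n0: "norm (zeta1 (Complex 2 t)) > 0" using norm_zeta1_2_ge[of t] by linarith
    obtain k where "M t / norm (zeta1 (Complex 2 t)) < 2 ^ k" using real_arch_pow[of 2] by auto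
    then have k: "M t < 2 ^ k * norm (zeta1 (Complex 2 t))" using n0 by (simp add: field_simps)
    have sub: "zeta1 holomorphic_on ball (Complex 2 t) 6"
    proof (rule holomorphic_on_subset[OF zeta1_holomorphic], rule subsetI)
      fix z assume "z \<in> ball (Complex 2 t) 6"
      then have "\<bar>2 - Re z\<bar> < 6" using abs_Re_le_cmod[of "Complex 2 t - z"] by (simp add: dist_norm)
      then show "z \<in> {s. - 4 < Re s}" by simp
    qed
    have zz: "Re z \<le> 1 / 2" if "zeta1 z = 0" for z
      using zeta1_nonzero[OF RH, of z] that by force
    have d: "dist (Complex 2 t) (Complex \<sigma> t) \<le> 3 / 2"
      using \<sigma> by (simp add: dist_norm cmod_def)
    have "- (8 * A t * (5 / 3) / (5 / 3 - 3 / 2)\<^sup>2) \<le> Re (deriv zeta1 (Complex \<sigma> t) / zeta1 (Complex \<sigma> t))"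
      by (rule Re_log_deriv_ge[OF sub, of 5 "M t" k "A t" "1 / 2" _ "3 / 2"])
         (use M A k zz d \<sigma> in auto)
    moreover have "8 * A t * (5 / 3) / (5 / 3 - 3 / 2)\<^sup>2 = 480 * A t"
      by (simp add: power2_eq_square)
    ultimately show ?thesis using A(3)[of t] by (simp add: zlog_def)
  qed
  then show ?thesis using C by (intro that[of "480 * C"]) auto
qed

text \<open>A qualitative bound whose constant grows like \<open>1 / a^2\<close>. It justifies
  moving lines and interchanging limits and enters none of the quantitative estimates.\<close>

lemma norm_zlog_le:
  assumes RH: "riemann_hypothesis" and a: "0 < a" "a \<le> 1 / 2"
  obtains C where "C > 0" "\<And>\<sigma> t. 1 / 2 + a \<le> \<sigma> \<Longrightarrow> \<sigma> \<le> 2 \<Longrightarrow> norm (zlog (Complex \<sigma> t)) \<le> C * ln (\<bar>t\<bar> + 2)"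
proof -
  obtain C :: real and M A :: "real \<Rightarrow> real" where C: "C > 0"
    and M: "\<And>t z. dist (Complex 2 t) z \<le> 5 \<Longrightarrow> norm (zeta1 z) \<le> M t"
    and A: "\<And>t. M t < exp (A t) * norm (zeta1 (Complex 2 t))" "\<And>t. 0 < A t" "\<And>t. A t \<le> C * ln (\<bar>t\<bar> + 2)"
    using zeta1_log_ratio by metis
  have "norm (zlog (Complex \<sigma> t)) \<le> 12 * C / a\<^sup>2 * ln (\<bar>t\<bar> + 2)" if \<sigma>: "1 / 2 + a \<le> \<sigma>" "\<sigma> \<le> 2" for \<sigma> t
  proof -
    have re: "Re z > 1 / 2" if "z \<in> ball (Complex 2 t) (3 / 2)" for z
      using abs_Re_le_cmod[of "Complex 2 t - z"] that by (simp add: dist_norm)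
    have "norm (deriv zeta1 (Complex \<sigma> t) / zeta1 (Complex \<sigma> t)) \<le> 8 * A t * (3 / 2) / (3 / 2 - (3 / 2 - a))\<^sup>2"
    proof (rule log_deriv_bound[of zeta1 "Complex 2 t"])
      show "zeta1 holomorphic_on ball (Complex 2 t) (3 / 2)"
        by (rule holomorphic_on_subset[OF zeta1_holomorphic]) (use re in force)
      show "zeta1 z \<noteq> 0" if "z \<in> ball (Complex 2 t) (3 / 2)" for z
        by (rule zeta1_nonzero[OF RH re[OF that]])
      show "norm (zeta1 z) < exp (A t) * norm (zeta1 (Complex 2 t))" if "z \<in> ball (Complex 2 t) (3 / 2)" for z
        using le_less_trans[OF M[of t z] A(1)[of t]] that by simp
      show "dist (Complex 2 t) (Complex \<sigma> t) \<le> 3 / 2 - a"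
        using \<sigma> by (simp add: dist_norm cmod_def)
    qed (use a in auto)
    also have "\<dots> = 12 / a\<^sup>2 * A t" by simp
    also have "\<dots> \<le> 12 / a\<^sup>2 * (C * ln (\<bar>t\<bar> + 2))" using A(3) by (intro mult_left_mono) auto
    finally show ?thesis by (simp add: zlog_def mult.assoc)
  qed
  then show ?thesis using C a by (intro that[of "12 * C / a\<^sup>2"]) auto
qed

lemma zlog_holomorphic:
  assumes "riemann_hypothesis"
  shows "zlog holomorphic_on {s. Re s > 1 / 2}"
proof -
  have "zeta1 holomorphic_on {s. Re s > 1 / 2}"
    by (rule holomorphic_on_subset[OF zeta1_holomorphic]) auto
  then show ?thesis
    unfolding zlog_def using zeta1_nonzero[OF assms]
    by (intro holomorphic_on_divide holomorphic_deriv open_halfspace_Re_gt) auto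
qed

section \<open>Logarithms integrated against Poisson kernels, and the average of |Re f'/f|\<close>

lemma integrable_even_extension:
  fixes h :: "real \<Rightarrow> real"
  assumes h: "\<And>x. x \<ge> 0 \<Longrightarrow> (F has_real_derivative h x) (at x)" "\<And>x. x \<ge> 0 \<Longrightarrow> h x \<ge> 0"
    and F: "(F \<longlongrightarrow> T) at_top" and m: "h \<in> borel_measurable borel"
  shows "integrable lborel (\<lambda>x. h \<bar>x\<bar>)"
proof -
  define g where "g x = h x * indicator {0..} x" for x :: real
  have "(\<integral>\<^sup>+x. ennreal (h x) * indicator {0..} x \<partial>lborel) = ennreal (T - F 0)"
    by (rule nn_integral_FTC_atLeast[OF m h F])
  moreover have "(\<integral>\<^sup>+x. ennreal (h x) * indicator {0..} x \<partial>lborel) = (\<integral>\<^sup>+x. ennreal (norm (g x)) \<partial>lborel)"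
    using h(2) by (intro nn_integral_cong) (auto simp: g_def indicator_def)
  moreover have "g \<in> borel_measurable lborel" unfolding g_def using m by measurable
  ultimately have g: "integrable lborel g"
    by (intro integrableI_bounded) auto
  have g': "integrable lborel (\<lambda>x. g (- x))"
    using lborel_integrable_real_affine_iff[of "-1" g 0] g by simp
  show ?thesis
  proof (rule Bochner_Integration.integrable_bound[OF Bochner_Integration.integrable_add[OF g g']])
    show "AE x in lborel. norm (h \<bar>x\<bar>) \<le> norm (g x + g (- x))"
      using h(2) by (intro AE_I2) (auto simp: g_def indicator_def abs_if)
  qed (use m in auto)
qed

lemma integrable_log_weight_1: "integrable lborel (\<lambda>t::real. ln (1 + \<bar>t\<bar>) / (1 + t\<^sup>2))"
proof -
  have "integrable lborel (\<lambda>t::real. ln (1 + \<bar>t\<bar>) / (1 + \<bar>t\<bar>)\<^sup>2)"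
  proof (rule integrable_even_extension[of "\<lambda>t. - (ln (1 + t) + 1) / (1 + t)" "\<lambda>t. ln (1 + t) / (1 + t)\<^sup>2" 0])
    fix x :: real assume x: "x \<ge> 0"
    show "((\<lambda>t. - (ln (1 + t) + 1) / (1 + t)) has_real_derivative ln (1 + x) / (1 + x)\<^sup>2) (at x)"
      using x by (auto intro!: derivative_eq_intros simp: field_simps power2_eq_square)
    show "0 \<le> ln (1 + x) / (1 + x)\<^sup>2" using x by simp
  next
    show "((\<lambda>t::real. - (ln (1 + t) + 1) / (1 + t)) \<longlongrightarrow> 0) at_top" by real_asymp
  qed measurable
  then have i: "integrable lborel (\<lambda>t::real. 2 * (ln (1 + \<bar>t\<bar>) / (1 + \<bar>t\<bar>)\<^sup>2))"
    by (rule integrable_mult_right)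
  show ?thesis
  proof (rule Bochner_Integration.integrable_bound[OF i])
    have "norm (ln (1 + \<bar>t\<bar>) / (1 + t\<^sup>2)) \<le> norm (2 * (ln (1 + \<bar>t\<bar>) / (1 + \<bar>t\<bar>)\<^sup>2))" for t :: real
    proof -
      have "(1 + \<bar>t\<bar>)\<^sup>2 \<le> 2 * (1 + t\<^sup>2)"
        using zero_le_power2[of "1 - \<bar>t\<bar>"] by (simp add: power2_eq_square algebra_simps)
      moreover have "0 < (1 + \<bar>t\<bar>)\<^sup>2" "0 < 1 + t\<^sup>2" by (auto intro!: add_pos_nonneg)
      ultimately have "ln (1 + \<bar>t\<bar>) / (1 + t\<^sup>2) \<le> 2 * (ln (1 + \<bar>t\<bar>) / (1 + \<bar>t\<bar>)\<^sup>2)"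
        using mult_left_mono[of "(1 + \<bar>t\<bar>)\<^sup>2" "2 * (1 + t\<^sup>2)" "ln (1 + \<bar>t\<bar>)"] by (simp add: field_simps)
      moreover have "ln (1 + \<bar>t\<bar>) / (1 + t\<^sup>2) \<ge> 0" by simp
      ultimately show ?thesis by simp
    qed
    then show "AE t::real in lborel. norm (ln (1 + \<bar>t\<bar>) / (1 + t\<^sup>2)) \<le> norm (2 * (ln (1 + \<bar>t\<bar>) / (1 + \<bar>t\<bar>)\<^sup>2))"
      by (intro AE_I2)
  qed measurable
qed

lemma log_weight_scaled:
  fixes b :: real
  assumes b: "b > 0"
  shows "integrable lborel (\<lambda>t. ln (1 + \<bar>t\<bar> / b) / (b\<^sup>2 + t\<^sup>2))"
    "(LINT t|lborel. ln (1 + \<bar>t\<bar> / b) / (b\<^sup>2 + t\<^sup>2)) = (LINT t|lborel. ln (1 + \<bar>t\<bar>) / (1 + t\<^sup>2)) / b"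
proof -
  have sc: "ln (1 + \<bar>0 + b * x\<bar> / b) / (b\<^sup>2 + (0 + b * x)\<^sup>2) = (1 / b\<^sup>2) * (ln (1 + \<bar>x\<bar>) / (1 + x\<^sup>2))" for x
  proof -
    have "b\<^sup>2 + (0 + b * x)\<^sup>2 = b\<^sup>2 * (1 + x\<^sup>2)" by (simp add: power_mult_distrib algebra_simps)
    then show ?thesis using b by (simp add: abs_mult)
  qed
  have "integrable lborel (\<lambda>x. ln (1 + \<bar>0 + b * x\<bar> / b) / (b\<^sup>2 + (0 + b * x)\<^sup>2))"
    unfolding sc by (intro integrable_mult_right integrable_log_weight_1)
  then show "integrable lborel (\<lambda>t. ln (1 + \<bar>t\<bar> / b) / (b\<^sup>2 + t\<^sup>2))"
    using lborel_integrable_real_affine_iff[of b "\<lambda>t. ln (1 + \<bar>t\<bar> / b) / (b\<^sup>2 + t\<^sup>2)" 0] b by simp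
  have "(LINT t|lborel. ln (1 + \<bar>t\<bar> / b) / (b\<^sup>2 + t\<^sup>2)) = \<bar>b\<bar> *\<^sub>R (LINT x|lborel. ln (1 + \<bar>0 + b * x\<bar> / b) / (b\<^sup>2 + (0 + b * x)\<^sup>2))"
    using b by (intro lborel_integral_real_affine) auto
  also have "\<dots> = (LINT t|lborel. ln (1 + \<bar>t\<bar>) / (1 + t\<^sup>2)) / b"
    unfolding sc integral_mult_right_zero using b by (simp add: power2_eq_square)
  finally show "(LINT t|lborel. ln (1 + \<bar>t\<bar> / b) / (b\<^sup>2 + t\<^sup>2)) = (LINT t|lborel. ln (1 + \<bar>t\<bar>) / (1 + t\<^sup>2)) / b" .
qed

text \<open>The inequality \<open>|t| + 2 \<le> (b + 2) (1 + |t| / b)\<close> separates the size of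
  \<open>b\<close> from a part that scales with \<open>b\<close>; this is how the integral acquires
  the form \<open>ln b / b\<close>.\<close>

lemma log_weight_le:
  fixes b t :: real
  assumes b: "b > 0"
  shows "ln (\<bar>t\<bar> + 2) / (b\<^sup>2 + t\<^sup>2) \<le> ln (b + 2) * (1 / (b\<^sup>2 + t\<^sup>2)) + ln (1 + \<bar>t\<bar> / b) / (b\<^sup>2 + t\<^sup>2)"
proof -
  have "\<bar>t\<bar> + 2 \<le> (b + 2) * (1 + \<bar>t\<bar> / b)" using b by (simp add: field_simps)
  then have "ln (\<bar>t\<bar> + 2) \<le> ln ((b + 2) * (1 + \<bar>t\<bar> / b))" by (subst ln_le_cancel_iff) auto
  also have "\<dots> = ln (b + 2) + ln (1 + \<bar>t\<bar> / b)" using b by (intro ln_mult_pos) (auto intro!: add_pos_nonneg)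
  finally have "ln (\<bar>t\<bar> + 2) / (b\<^sup>2 + t\<^sup>2) \<le> (ln (b + 2) + ln (1 + \<bar>t\<bar> / b)) / (b\<^sup>2 + t\<^sup>2)"
    by (intro divide_right_mono) auto
  then show ?thesis by (simp add: add_divide_distrib)
qed

lemma integrable_log_weight:
  fixes b :: real
  assumes b: "b > 0"
  shows "integrable lborel (\<lambda>t. ln (\<bar>t\<bar> + 2) / (b\<^sup>2 + t\<^sup>2))"
proof (rule Bochner_Integration.integrable_bound)
  show "integrable lborel (\<lambda>t. ln (b + 2) * (1 / (b\<^sup>2 + t\<^sup>2)) + ln (1 + \<bar>t\<bar> / b) / (b\<^sup>2 + t\<^sup>2))"
    by (intro Bochner_Integration.integrable_add integrable_mult_right lborel_inverse_square(1) log_weight_scaled(1) b)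
  have "norm (ln (\<bar>t\<bar> + 2) / (b\<^sup>2 + t\<^sup>2)) \<le> norm (ln (b + 2) * (1 / (b\<^sup>2 + t\<^sup>2)) + ln (1 + \<bar>t\<bar> / b) / (b\<^sup>2 + t\<^sup>2))" for t
  proof -
    have "ln (\<bar>t\<bar> + 2) / (b\<^sup>2 + t\<^sup>2) \<ge> 0" by simp
    with log_weight_le[OF b, of t] show ?thesis unfolding real_norm_def by linarith
  qed
  then show "AE t in lborel. norm (ln (\<bar>t\<bar> + 2) / (b\<^sup>2 + t\<^sup>2)) \<le> norm (ln (b + 2) * (1 / (b\<^sup>2 + t\<^sup>2)) + ln (1 + \<bar>t\<bar> / b) / (b\<^sup>2 + t\<^sup>2))"
    by (intro AE_I2)
qed measurable

lemma log_weight_integral_le: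
  obtains K :: real where "K > 0" "\<And>b. b \<ge> 2 \<Longrightarrow> (LINT t|lborel. ln (\<bar>t\<bar> + 2) / (b\<^sup>2 + t\<^sup>2)) \<le> K * ln b / b"
proof -
  define K0 where "K0 = (LINT t|lborel. ln (1 + \<bar>t\<bar>) / (1 + t\<^sup>2 :: real))"
  have K0: "K0 \<ge> 0" unfolding K0_def by (intro Bochner_Integration.integral_nonneg) simp
  have "(LINT t|lborel. ln (\<bar>t\<bar> + 2) / (b\<^sup>2 + t\<^sup>2)) \<le> (2 * pi + K0 / ln 2) * ln b / b" if b: "b \<ge> 2" for b :: real
  proof -
    have b0: "b > 0" using b by simp
    have "(LINT t|lborel. ln (\<bar>t\<bar> + 2) / (b\<^sup>2 + t\<^sup>2)) \<le>
        (LINT t|lborel. ln (b + 2) * (1 / (b\<^sup>2 + t\<^sup>2)) + ln (1 + \<bar>t\<bar> / b) / (b\<^sup>2 + t\<^sup>2))"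
      by (intro integral_mono log_weight_le integrable_log_weight Bochner_Integration.integrable_add
          integrable_mult_right lborel_inverse_square(1) log_weight_scaled(1) b0)
    also have "\<dots> = ln (b + 2) * (pi / b) + K0 / b"
      using b0 by (subst Bochner_Integration.integral_add)
        (auto simp del: times_divide_eq_right simp: lborel_inverse_square log_weight_scaled K0_def intro!: integrable_mult_right)
    also have "\<dots> \<le> (2 * ln b) * (pi / b) + (K0 / ln 2 * ln b) / b"
    proof (intro add_mono mult_right_mono divide_right_mono)
      have "b + 2 \<le> b * b" using mult_right_mono[of 2 b b] b by linarith
      then have "ln (b + 2) \<le> ln (b * b)" using b by (subst ln_le_cancel_iff) auto
      also have "\<dots> = 2 * ln b" using b by (subst ln_mult) auto
      finally show "ln (b + 2) \<le> 2 * ln b" .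
      have "K0 / ln 2 * ln 2 \<le> K0 / ln 2 * ln b" using b K0 by (intro mult_left_mono) auto
      then show "K0 \<le> K0 / ln 2 * ln b" by simp
    qed (use b in auto)
    also have "\<dots> = (2 * pi + K0 / ln 2) * ln b / b" by (simp add: algebra_simps add_divide_distrib)
    finally show ?thesis .
  qed
  then show ?thesis using K0 by (intro that[of "2 * pi + K0 / ln 2"]) (auto intro!: add_pos_nonneg)
qed

lemma ln_shift_le: "ln (\<bar>t + u\<bar> + 2) \<le> ln (\<bar>u\<bar> + 2) + ln (\<bar>t\<bar> + 2 :: real)"
proof -
  have "\<bar>t + u\<bar> + 2 \<le> (\<bar>u\<bar> + 2) * (\<bar>t\<bar> + 2)"
  proof -
    have "(\<bar>u\<bar> + 2) * (\<bar>t\<bar> + 2) = \<bar>u\<bar> * \<bar>t\<bar> + 2 * \<bar>u\<bar> + 2 * \<bar>t\<bar> + 4" by (simp add: algebra_simps)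
    moreover have "0 \<le> \<bar>u\<bar> * \<bar>t\<bar>" by simp
    ultimately show ?thesis using abs_triangle_ineq[of t u] by linarith
  qed
  then have "ln (\<bar>t + u\<bar> + 2) \<le> ln ((\<bar>u\<bar> + 2) * (\<bar>t\<bar> + 2))" by (subst ln_le_cancel_iff) auto
  also have "\<dots> = ln (\<bar>u\<bar> + 2) + ln (\<bar>t\<bar> + 2)" by (intro ln_mult_pos) auto
  finally show ?thesis .
qed

text \<open>The constant is independent of \<open>a\<close>, so the line may approach 1/2 as
  \<open>x\<close> grows. It is used twice: \<open>b = 2\<close> bounds the average near a height
  \<open>t0\<close> by the logarithm of \<open>t0\<close>, and \<open>t0 = 0\<close> with large
  \<open>b\<close> gives the decay \<open>ln b / b\<close> over the whole range.\<close>

lemma abs_Re_zlog_kernel_bound: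
  assumes RH: "riemann_hypothesis"
  obtains C where "C > 0"
    "\<And>a b t0. 0 < a \<Longrightarrow> a \<le> 1 / 2 \<Longrightarrow> b \<ge> 2 \<Longrightarrow>
       integrable lborel (\<lambda>t. \<bar>Re (zlog (Complex (1 / 2 + a) t))\<bar> / (b\<^sup>2 + (t - t0)\<^sup>2))"
    "\<And>a b t0. 0 < a \<Longrightarrow> a \<le> 1 / 2 \<Longrightarrow> b \<ge> 2 \<Longrightarrow>
       (LINT t|lborel. \<bar>Re (zlog (Complex (1 / 2 + a) t))\<bar> / (b\<^sup>2 + (t - t0)\<^sup>2)) \<le> C * (ln (\<bar>t0\<bar> + 2) + ln b) / b"
proof -
  obtain C1 where C1: "C1 > 0" "\<And>\<sigma> t. 1 / 2 < \<sigma> \<Longrightarrow> \<sigma> \<le> 2 \<Longrightarrow> Re (zlog (Complex \<sigma> t)) \<ge> - (C1 * ln (\<bar>t\<bar> + 2))"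
    using Re_zlog_ge[OF RH] by blast
  obtain K where K: "K > 0" "\<And>s. Re s \<ge> 3 / 2 \<Longrightarrow> norm (zlog s) \<le> K"
    using zlog_bounded_right[of "3 / 2"] by auto
  obtain K2 :: real where K2: "K2 > 0" "\<And>b. b \<ge> 2 \<Longrightarrow> (LINT t|lborel. ln (\<bar>t\<bar> + 2) / (b\<^sup>2 + t\<^sup>2)) \<le> K2 * ln b / b"
    using log_weight_integral_le by blast
  define C where "C = 2 * pi * K / ln 2 + 2 * C1 * pi + 2 * C1 * K2"
  have C0: "C > 0" using C1 K K2 by (simp add: C_def add_pos_pos)
  have main: "integrable lborel (\<lambda>t. \<bar>Re (zlog (Complex (1 / 2 + a) (t + t0)))\<bar> / (b\<^sup>2 + t\<^sup>2)) \<and>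
      (LINT t|lborel. \<bar>Re (zlog (Complex (1 / 2 + a) (t + t0)))\<bar> / (b\<^sup>2 + t\<^sup>2)) \<le> C * (ln (\<bar>t0\<bar> + 2) + ln b) / b"
    if a: "0 < a" "a \<le> 1 / 2" and b: "b \<ge> 2" for a b t0
  proof -
    define \<sigma> where "\<sigma> = 1 / 2 + a"
    obtain Ca where Ca: "Ca > 0" "\<And>\<sigma> t. 1 / 2 + a \<le> \<sigma> \<Longrightarrow> \<sigma> \<le> 2 \<Longrightarrow> norm (zlog (Complex \<sigma> t)) \<le> Ca * ln (\<bar>t\<bar> + 2)"
      using norm_zlog_le[OF RH a] by blast
    \<comment> \<open>On \<open>Re s = \<sigma>\<close> the denominator equals
      \<open>b^2 + t^2\<close>: the Poisson kernel is the trace of a rational function with poles at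
      \<open>\<sigma> + b\<close> and \<open>\<sigma> - b\<close>. For \<open>b \<ge> 2\<close>
      these lie outside the strip up to \<open>\<sigma> + 1\<close>, and on its right edge
      \<open>zlog\<close> is bounded.\<close>
    define g where "g s = zlog (s + \<i> * of_real t0) / (of_real (b\<^sup>2) - (s - of_real \<sigma>)\<^sup>2)" for s
    \<comment> \<open>An open strip slightly wider than the region of the shift:
      \<open>\<sigma> - a / 2\<close> still exceeds 1/2, and
      \<open>|Re s - \<sigma>| < 2 \<le> b\<close> keeps the denominator away from 0.\<close>
    define S where "S = {s. \<sigma> - a / 2 < Re s} \<inter> {s. Re s < \<sigma> + 3 / 2}"
    define w where "w t = Ca * (ln (\<bar>t0\<bar> + 2) * (1 / ((b / 2)\<^sup>2 + t\<^sup>2)) + ln (\<bar>t\<bar> + 2) / ((b / 2)\<^sup>2 + t\<^sup>2))" for t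
    have shift: "Complex u t + \<i> * of_real t0 = Complex u (t + t0)" for u t by (simp add: complex_eq_iff)
    have Reden: "Re (of_real (b\<^sup>2) - (s - of_real \<sigma>)\<^sup>2) = b\<^sup>2 - (Re s - \<sigma>)\<^sup>2 + (Im s)\<^sup>2" for s
      by (simp add: power2_eq_square)
    have b4: "4 \<le> b\<^sup>2" using power_mono[of 2 b 2] b by simp
    have hol: "g holomorphic_on S"
      unfolding g_def
    proof (intro holomorphic_intros)
      show "(\<lambda>s. zlog (s + \<i> * of_real t0)) holomorphic_on S"
        by (rule holomorphic_on_compose_gen[OF _ zlog_holomorphic[OF RH], unfolded o_def])
           (use a in \<open>auto simp: S_def \<sigma>_def intro!: holomorphic_intros\<close>)
      fix s assume s: "s \<in> S"
      have "\<bar>Re s - \<sigma>\<bar> < 2" using s a by (auto simp: S_def)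
      then have "(Re s - \<sigma>)\<^sup>2 < 2\<^sup>2" by (intro power2_strict_mono) auto
      then have "b\<^sup>2 - (Re s - \<sigma>)\<^sup>2 + (Im s)\<^sup>2 > 0" using b4 by (simp add: add_pos_nonneg)
      then show "of_real (b\<^sup>2) - (s - of_real \<sigma>)\<^sup>2 \<noteq> 0" using Reden[of s] by (metis less_irrefl zero_complex.sel(1))
    qed
    have conv: "convex S" unfolding S_def by (intro convex_Int convex_halfspace_Re_gt convex_halfspace_Re_lt)
    have sub: "s \<in> S" if "\<sigma> \<le> Re s" "Re s \<le> \<sigma> + 1" for s using that a by (auto simp: S_def)
    have den: "(b / 2)\<^sup>2 + t\<^sup>2 \<le> norm (of_real (b\<^sup>2) - (Complex u t - of_real \<sigma>)\<^sup>2)" if u: "\<sigma> \<le> u" "u \<le> \<sigma> + 1" for u t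
    proof -
      have "(u - \<sigma>)\<^sup>2 \<le> 1\<^sup>2" using u by (intro power_mono) auto
      then have "(b / 2)\<^sup>2 + t\<^sup>2 \<le> b\<^sup>2 - (u - \<sigma>)\<^sup>2 + t\<^sup>2" using b4 by (simp add: power_divide)
      also have "\<dots> \<le> norm (of_real (b\<^sup>2) - (Complex u t - of_real \<sigma>)\<^sup>2)"
        using Reden[of "Complex u t"] complex_Re_le_cmod[of "of_real (b\<^sup>2) - (Complex u t - of_real \<sigma>)\<^sup>2"] by simp
      finally show ?thesis .
    qed
    have denpos: "0 < (b / 2)\<^sup>2 + t\<^sup>2" for t using b by (intro add_pos_nonneg) auto
    have bd: "norm (g (Complex u t)) \<le> w t" if u: "\<sigma> \<le> u" "u \<le> \<sigma> + 1" for u t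
    proof -
      have "norm (zlog (Complex u (t + t0))) \<le> Ca * ln (\<bar>t + t0\<bar> + 2)"
        using u a by (intro Ca) (auto simp: \<sigma>_def)
      also have "\<dots> \<le> Ca * (ln (\<bar>t0\<bar> + 2) + ln (\<bar>t\<bar> + 2))"
        using Ca ln_shift_le[of t t0] by (intro mult_left_mono) auto
      finally have "norm (zlog (Complex u (t + t0))) / norm (of_real (b\<^sup>2) - (Complex u t - of_real \<sigma>)\<^sup>2)
          \<le> Ca * (ln (\<bar>t0\<bar> + 2) + ln (\<bar>t\<bar> + 2)) / ((b / 2)\<^sup>2 + t\<^sup>2)"
        using den[OF u, of t] denpos[of t] Ca by (intro frac_le) auto
      then show ?thesis by (simp add: g_def shift norm_divide w_def add_divide_distrib distrib_left)
    qed
    have wi: "integrable lborel w"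
      unfolding w_def using b
      by (intro integrable_mult_right Bochner_Integration.integrable_add lborel_inverse_square integrable_log_weight) auto
    have wl: "(w \<longlongrightarrow> 0) at_top"
    proof -
      have b2: "b / 2 > 0" using b by simp
      have "((\<lambda>t. 1 / (c\<^sup>2 + t\<^sup>2)) \<longlongrightarrow> 0) at_top" if "c > 0" for c :: real using that by real_asymp
      note l1 = this[OF b2]
      have "((\<lambda>t. ln (\<bar>t\<bar> + 2) / (c\<^sup>2 + t\<^sup>2)) \<longlongrightarrow> 0) at_top" if "c > 0" for c :: real using that by real_asymp
      note l2 = this[OF b2]
      have "(w \<longlongrightarrow> Ca * (ln (\<bar>t0\<bar> + 2) * 0 + 0)) at_top"
        unfolding w_def by (intro tendsto_intros l1 l2)
      then show ?thesis by simp
    qed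
    have we: "w (- t) = w t" for t by (simp add: w_def)
    have lt: "\<sigma> < \<sigma> + 1" by simp
    note V = vertical_line_shift_holomorphic[OF lt hol conv sub wi wl we bd]
    have n1: "norm (LINT t|lborel. g (Complex (\<sigma> + 1) t)) \<le> (LINT t|lborel. K * (1 / ((b / 2)\<^sup>2 + t\<^sup>2)))"
    proof (rule Bochner_Integration.integral_norm_bound_integral[OF V(2)])
      show "integrable lborel (\<lambda>t. K * (1 / ((b / 2)\<^sup>2 + t\<^sup>2)))"
        using b by (intro integrable_mult_right lborel_inverse_square) auto
      fix t
      have "norm (zlog (Complex (\<sigma> + 1) (t + t0))) \<le> K" using a by (intro K) (auto simp: \<sigma>_def)
      then have "norm (zlog (Complex (\<sigma> + 1) (t + t0))) / norm (of_real (b\<^sup>2) - (Complex (\<sigma> + 1) t - of_real \<sigma>)\<^sup>2)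
          \<le> K / ((b / 2)\<^sup>2 + t\<^sup>2)"
        using den[of "\<sigma> + 1" t] denpos[of t] K by (intro frac_le) auto
      then show "norm (g (Complex (\<sigma> + 1) t)) \<le> K * (1 / ((b / 2)\<^sup>2 + t\<^sup>2))"
        by (simp add: g_def shift norm_divide)
    qed
    also have "\<dots> = 2 * pi * K / b"
      unfolding integral_mult_right_zero using b by (subst lborel_inverse_square) auto
    finally have n1: "norm (LINT t|lborel. g (Complex \<sigma> t)) \<le> 2 * pi * K / b" using V(3) by simp
    define p where "p t = Re (zlog (Complex \<sigma> (t + t0)))" for t
    have gp: "Re (g (Complex \<sigma> t)) = p t / (b\<^sup>2 + t\<^sup>2)" for t
    proof -
      have "of_real (b\<^sup>2) - (Complex \<sigma> t - of_real \<sigma>)\<^sup>2 = of_real (b\<^sup>2 + t\<^sup>2)"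
        by (simp add: complex_eq_iff power2_eq_square)
      then show ?thesis unfolding g_def shift p_def by (simp only: Re_divide_of_real)
    qed
    have ip: "integrable lborel (\<lambda>t. p t / (b\<^sup>2 + t\<^sup>2))"
      using integrable_Re[OF V(1)] unfolding gp .
    have le: "(LINT t|lborel. p t / (b\<^sup>2 + t\<^sup>2)) \<le> 2 * pi * K / b"
      using n1 integral_Re[OF V(1)] complex_Re_le_cmod[of "LINT t|lborel. g (Complex \<sigma> t)"] unfolding gp by simp
    have b0: "b > 0" using b by simp
    have pos: "b\<^sup>2 + t\<^sup>2 > 0" for t using b by (intro add_pos_nonneg) auto
    have il: "integrable lborel (\<lambda>t. 2 * C1 * (ln (\<bar>t0\<bar> + 2) * (1 / (b\<^sup>2 + t\<^sup>2)) + ln (\<bar>t\<bar> + 2) / (b\<^sup>2 + t\<^sup>2)))"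
      by (intro integrable_mult_right Bochner_Integration.integrable_add lborel_inverse_square integrable_log_weight b0)
    have ile: "(LINT t|lborel. 2 * C1 * (ln (\<bar>t0\<bar> + 2) * (1 / (b\<^sup>2 + t\<^sup>2)) + ln (\<bar>t\<bar> + 2) / (b\<^sup>2 + t\<^sup>2)))
        \<le> 2 * C1 * (ln (\<bar>t0\<bar> + 2) * (pi / b) + K2 * ln b / b)"
    proof -
      have "(LINT t|lborel. ln (\<bar>t0\<bar> + 2) * (1 / (b\<^sup>2 + t\<^sup>2)) + ln (\<bar>t\<bar> + 2) / (b\<^sup>2 + t\<^sup>2))
          = ln (\<bar>t0\<bar> + 2) * (pi / b) + (LINT t|lborel. ln (\<bar>t\<bar> + 2) / (b\<^sup>2 + t\<^sup>2))"
        by (subst Bochner_Integration.integral_add)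
           (auto simp only: integral_mult_right_zero lborel_inverse_square[OF b0] intro!: integrable_mult_right integrable_log_weight b0 lborel_inverse_square)
      then show ?thesis unfolding integral_mult_right_zero using C1 K2(2)[OF b] by simp
    qed
    \<comment> \<open>From \<open>p \<ge> - u\<close> with \<open>u \<ge> 0\<close> follows
      \<open>|p| \<le> p + 2 u\<close>. The integral of \<open>p\<close> is bounded above through
      the shifted line, and \<open>u\<close> is logarithmic.\<close>
    have pb: "\<bar>p t\<bar> / (b\<^sup>2 + t\<^sup>2) \<le> p t / (b\<^sup>2 + t\<^sup>2) + 2 * C1 * (ln (\<bar>t0\<bar> + 2) * (1 / (b\<^sup>2 + t\<^sup>2)) + ln (\<bar>t\<bar> + 2) / (b\<^sup>2 + t\<^sup>2))" for t
    proof -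
      have "p t \<ge> - (C1 * ln (\<bar>t + t0\<bar> + 2))" unfolding p_def using a by (intro C1) (auto simp: \<sigma>_def)
      moreover have "C1 * ln (\<bar>t + t0\<bar> + 2) \<le> C1 * (ln (\<bar>t0\<bar> + 2) + ln (\<bar>t\<bar> + 2))"
        using C1 ln_shift_le[of t t0] by (intro mult_left_mono) auto
      moreover have "0 \<le> C1 * (ln (\<bar>t0\<bar> + 2) + ln (\<bar>t\<bar> + 2))" using C1 by simp
      ultimately have "\<bar>p t\<bar> \<le> p t + 2 * (C1 * (ln (\<bar>t0\<bar> + 2) + ln (\<bar>t\<bar> + 2)))" by linarith
      then have "\<bar>p t\<bar> / (b\<^sup>2 + t\<^sup>2) \<le> (p t + 2 * (C1 * (ln (\<bar>t0\<bar> + 2) + ln (\<bar>t\<bar> + 2)))) / (b\<^sup>2 + t\<^sup>2)"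
        using pos[of t] by (intro divide_right_mono) auto
      then show ?thesis by (simp add: add_divide_distrib distrib_left mult.assoc)
    qed
    have ia: "integrable lborel (\<lambda>t. \<bar>p t\<bar> / (b\<^sup>2 + t\<^sup>2))"
      using integrable_abs[OF ip] pos by (simp add: abs_divide less_imp_le)
    have "(LINT t|lborel. \<bar>p t\<bar> / (b\<^sup>2 + t\<^sup>2)) \<le> (LINT t|lborel. p t / (b\<^sup>2 + t\<^sup>2) + 2 * C1 * (ln (\<bar>t0\<bar> + 2) * (1 / (b\<^sup>2 + t\<^sup>2)) + ln (\<bar>t\<bar> + 2) / (b\<^sup>2 + t\<^sup>2)))"
      by (intro integral_mono ia Bochner_Integration.integrable_add ip il pb)
    also have "\<dots> \<le> 2 * pi * K / b + 2 * C1 * (ln (\<bar>t0\<bar> + 2) * (pi / b) + K2 * ln b / b)"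
      using le ile by (subst Bochner_Integration.integral_add[OF ip il]) linarith
    also have "\<dots> \<le> C * (ln (\<bar>t0\<bar> + 2) + ln b) / b"
    proof -
      have l2: "0 < ln (2::real)" "ln 2 \<le> ln b" "0 \<le> ln b" "0 \<le> ln (\<bar>t0\<bar> + 2)" using b by auto
      have "2 * pi * K / ln 2 * ln 2 \<le> 2 * pi * K / ln 2 * ln b" using l2 K by (intro mult_left_mono) auto
      then have k: "2 * pi * K \<le> 2 * pi * K / ln 2 * ln b" using l2 by simp
      have nn: "0 \<le> 2 * pi * K / ln 2 * ln (\<bar>t0\<bar> + 2)" "0 \<le> 2 * C1 * pi * ln b" "0 \<le> 2 * C1 * K2 * ln (\<bar>t0\<bar> + 2)"
        using l2 K K2 C1 by (auto intro!: mult_nonneg_nonneg divide_nonneg_nonneg)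
      have "2 * pi * K + 2 * C1 * (ln (\<bar>t0\<bar> + 2) * pi + K2 * ln b) \<le> C * (ln (\<bar>t0\<bar> + 2) + ln b)"
        using k nn unfolding C_def by (simp only: distrib_left distrib_right mult_ac)
      then have "(2 * pi * K + 2 * C1 * (ln (\<bar>t0\<bar> + 2) * pi + K2 * ln b)) / b \<le> C * (ln (\<bar>t0\<bar> + 2) + ln b) / b"
        using b by (intro divide_right_mono) auto
      then show ?thesis by (simp add: add_divide_distrib distrib_left mult.assoc)
    qed
    finally show ?thesis using ia unfolding p_def \<sigma>_def by blast
  qed
  have tr: "integrable lborel (\<lambda>t. f (t + t0) / (b\<^sup>2 + t\<^sup>2)) \<longleftrightarrow> integrable lborel (\<lambda>t. f t / (b\<^sup>2 + (t - t0)\<^sup>2))"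
    "(LINT t|lborel. f (t + t0) / (b\<^sup>2 + t\<^sup>2)) = (LINT t|lborel. f t / (b\<^sup>2 + (t - t0)\<^sup>2))" for f :: "real \<Rightarrow> real" and b t0
    using lborel_integrable_real_affine_iff[of 1 "\<lambda>t. f t / (b\<^sup>2 + (t - t0)\<^sup>2)" t0]
      lborel_integral_real_affine[of 1 "\<lambda>t. f t / (b\<^sup>2 + (t - t0)\<^sup>2)" t0]
    by (simp_all add: add.commute)
  show ?thesis
    by (rule that[OF C0]) (use main tr[of "\<lambda>t. \<bar>Re (zlog (Complex (1 / 2 + a) t))\<bar>" for a] in auto)
qed

subsection \<open>The explicit formula for the smoothed error term\<close>

text \<open>The sum is the integral of \<open>psi\<close> from 0 to \<open>x\<close>. Subtracting
  \<open>(x - 1)^2 / 2\<close> rather than \<open>x^2 / 2\<close> matches exactly what the term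
  \<open>1 / (s - 1)\<close> contributes to the Perron integral, so no lower-order terms
  appear.\<close>

definition smoothed_psi_error :: "real \<Rightarrow> real" where
  "smoothed_psi_error x = (\<Sum>n<nat \<lfloor>x\<rfloor>. mangoldt (Suc n) * (x - real (Suc n))) - (x - 1)\<^sup>2 / 2"

text \<open>Since \<open>zterm x (- (s + 1))\<close> is \<open>x^(s+1)\<close>, this is the kernel
  of Perron's formula integrated once.\<close>

definition perron_kernel :: "real \<Rightarrow> complex \<Rightarrow> complex" where
  "perron_kernel x s = zterm x (- (s + 1)) / (s * (s + 1))"

text \<open>For these indices \<open>x / (n + 1) \<le> 1\<close>, so raising this ratio to the power
  \<open>Re s - 2 \<ge> 0\<close> can only decrease it: the term with the power of \<open>x\<close>
  attached is largest at abscissa 2.\<close>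

lemma mangoldt_tail_bound:
  assumes x: "x \<ge> 1" and s: "Re s \<ge> 2" and n: "nat \<lfloor>x\<rfloor> \<le> n"
  shows "norm (mangoldt (Suc n) * zterm (real n + 1) s * zterm x (- (s + 1)))
     \<le> norm (mangoldt (Suc n) * zterm (real n + 1) 2) * x powr 3"
proof -
  have xn: "x \<le> real n + 1" using n x by linarith
  have "(real n + 1) powr (- Re s) * x powr (Re s + 1) = (real n + 1) powr (- Re s) * (x powr 3 * x powr (Re s - 2))"
    by (simp add: add.commute flip: powr_add)
  also have "\<dots> \<le> (real n + 1) powr (- Re s) * (x powr 3 * (real n + 1) powr (Re s - 2))"
    using x s xn by (intro mult_left_mono powr_mono2) auto
  also have "\<dots> = (real n + 1) powr (- 2) * x powr 3"
    by (simp flip: powr_add)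
  finally have "(real n + 1) powr (- Re s) * x powr (Re s + 1) \<le> (real n + 1) powr (- 2) * x powr 3" .
  then have "mangoldt (Suc n) * ((real n + 1) powr (- Re s) * x powr (Re s + 1)) \<le> mangoldt (Suc n) * ((real n + 1) powr (- 2) * x powr 3)"
    by (intro mult_left_mono mangoldt_nonneg)
  then show ?thesis using x by (simp add: norm_mult norm_zterm mult.assoc add.commute)
qed

lemma zterm_quotient:
  assumes "x > 0" "m > 0"
  shows "zterm m s * zterm x (- (s + 1)) = of_real m * zterm (x / m) (- (s + 1))"
proof -
  have "zterm x (- (s + 1)) = zterm (x / m) (- (s + 1)) * zterm m (- (s + 1))"
    using zterm_mult[of "x / m" m] assms by simp
  moreover have "zterm m s * zterm m (- (s + 1)) = of_real m"
  proof -
    have "zterm m s * zterm m (- (s + 1)) = exp (of_real (ln m))"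
      by (simp add: zterm_def algebra_simps flip: exp_add)
    then show ?thesis using assms by (simp add: exp_of_real)
  qed
  ultimately show ?thesis by (simp add: mult_ac)
qed

text \<open>On this line \<open>zlog\<close> splits into \<open>1 / (s - 1)\<close>, the terms of
  the Dirichlet series up to \<open>x\<close>, and the tail. The tail stays bounded to the right and
  integrates to 0; the other pieces are elementary Perron integrals, evaluated by moving
  left.\<close>

lemma zlog_perron_integral_2:
  assumes x: "x \<ge> 1"
  shows "integrable lborel (\<lambda>t. zlog (Complex 2 t) * perron_kernel x (Complex 2 t))"
    "(LINT t|lborel. zlog (Complex 2 t) * perron_kernel x (Complex 2 t)) = - 2 * pi * smoothed_psi_error x"
proof -
  define N where "N = nat \<lfloor>x\<rfloor>"
  define f where "f n s = mangoldt (Suc n) * zterm (real n + 1) s" for n s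
  \<comment> \<open>By \<open>zlog_eq\<close> this is the tail of the Dirichlet series times
    \<open>x^(s+1)\<close>, hence bounded on \<open>Re s \<ge> 2\<close>, although its summands
    taken singly need not be.\<close>
  define G where "G s = (1 / (s - 1) - (\<Sum>n<N. f n s) - zlog s) * zterm x (- (s + 1))" for s
  define K where "K = (\<Sum>n. norm (f (n + N) 2) * x powr 3)"
  have z_hol: "zlog holomorphic_on {s. Re s > 1}"
  proof -
    have "zeta1 holomorphic_on {s. Re s > 1}" by (rule holomorphic_on_subset[OF zeta1_holomorphic]) auto
    then show ?thesis unfolding zlog_def using zeta1_nonzero_Re_gt_1
      by (intro holomorphic_on_divide holomorphic_deriv open_halfspace_Re_gt) auto
  qed
  have G_hol: "G holomorphic_on {s. Re s > 1}"
    unfolding G_def f_def zterm_def by (intro holomorphic_intros z_hol) auto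
  have sm: "summable (\<lambda>n. norm (f (n + N) 2) * x powr 3)"
    by (intro summable_mult2 summable_ignore_initial_segment)
       (use mangoldt_series_summable_norm[of 2] in \<open>simp add: f_def\<close>)
  have Gb: "norm (G s) \<le> K" if s: "Re s \<ge> 2" for s
  proof -
    have s1: "Re s > 1" using s by simp
    have "mangoldt_series s = (\<Sum>n. f (n + N) s) + (\<Sum>n<N. f n s)"
      using suminf_split_initial_segment[of "\<lambda>n. f n s" N] mangoldt_series_sums[OF s1]
      by (simp add: f_def sums_iff)
    then have "G s = (\<Sum>n. f (n + N) s) * zterm x (- (s + 1))"
      using zlog_eq[OF s1] by (simp add: G_def)
    also have "\<dots> = (\<Sum>n. f (n + N) s * zterm x (- (s + 1)))"
      using mangoldt_series_sums[OF s1]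
      by (intro suminf_mult2 summable_ignore_initial_segment) (simp add: f_def sums_iff)
    finally have "norm (G s) = norm (\<Sum>n. f (n + N) s * zterm x (- (s + 1)))" by simp
    also have "\<dots> \<le> K" unfolding K_def
    proof (rule norm_suminf_le[OF _ sm])
      fix n
      show "norm (f (n + N) s * zterm x (- (s + 1))) \<le> norm (f (n + N) 2) * x powr 3"
        using mangoldt_tail_bound[OF x s, of "n + N"] unfolding f_def N_def by simp
    qed
    finally show ?thesis .
  qed
  have P0: "integrable lborel (\<lambda>t. G (Complex 2 t) / (Complex 2 t * (Complex 2 t + 1)))"
    "(LINT t|lborel. G (Complex 2 t) / (Complex 2 t * (Complex 2 t + 1))) = 0"
    using perron_right[OF G_hol, of 2 K] Gb by auto
  have one: "(\<lambda>_. 1 :: complex) holomorphic_on {s. Re s < 3}" by (intro holomorphic_intros)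
  have PL: "integrable lborel (\<lambda>t. perron_kernel y (Complex \<sigma> t))"
    "(LINT t|lborel. perron_kernel y (Complex \<sigma> t)) = of_real (2 * pi * (y - 1))" if "y \<ge> 1" "0 < \<sigma>" "\<sigma> < 3" for y \<sigma>
    using perron_left[OF one, of \<sigma> y 1] that by (auto simp: perron_kernel_def)
  define T where "T n t = f n (Complex 2 t) * perron_kernel x (Complex 2 t)" for n t
  have Tn: "integrable lborel (T n) \<and> (LINT t|lborel. T n t) = of_real (2 * pi * (mangoldt (Suc n) * (x - real (Suc n))))" if n: "n < N" for n
  proof -
    have m: "real n + 1 \<le> x" using n x unfolding N_def by linarith
    have e: "T n t = (mangoldt (Suc n) * of_real (real n + 1)) * perron_kernel (x / (real n + 1)) (Complex 2 t)" for t
      using zterm_quotient[of x "real n + 1" "Complex 2 t"] x by (simp add: T_def f_def perron_kernel_def mult.assoc)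
    have y: "x / (real n + 1) \<ge> 1" using m by simp
    have "T n = (\<lambda>t. (mangoldt (Suc n) * of_real (real n + 1)) * perron_kernel (x / (real n + 1)) (Complex 2 t))"
      by (rule ext) (rule e)
    moreover have "mangoldt (Suc n) * of_real (real n + 1) * of_real (2 * pi * (x / (real n + 1) - 1))
        = (of_real (2 * pi * (mangoldt (Suc n) * (x - real (Suc n)))) :: complex)"
    proof -
      have "mangoldt (Suc n) * of_real (real n + 1) * of_real (2 * pi * (x / (real n + 1) - 1))
          = (of_real (mangoldt (Suc n) * (real n + 1) * (2 * pi * (x / (real n + 1) - 1))) :: complex)" by simp
      also have "mangoldt (Suc n) * (real n + 1) * (2 * pi * (x / (real n + 1) - 1)) = 2 * pi * (mangoldt (Suc n) * (x - real (Suc n)))"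
        by (simp add: field_simps)
      finally show ?thesis .
    qed
    ultimately show ?thesis
      using PL[OF y, of 2] by (simp only: integral_mult_right_zero) simp
  qed
  \<comment> \<open>From \<open>2 / ((s - 1) s (s + 1)) = 1 / ((s - 1) s) - 1 / (s (s + 1))\<close>;
    the first fraction is \<open>x\<close> times the kernel at \<open>s - 1\<close>, hence on the
    line of abscissa 1.\<close>
  define A where "A t = of_real x * perron_kernel x (Complex 1 t)" for t
  have A: "integrable lborel A" "(LINT t|lborel. A t) = of_real (x * (2 * pi * (x - 1)))"
    unfolding A_def using PL[OF x, of 1] by simp_all
  define B where "B t = perron_kernel x (Complex 2 t)" for t
  have B: "integrable lborel B" "(LINT t|lborel. B t) = of_real (2 * pi * (x - 1))"
    unfolding B_def using PL[OF x, of 2] by simp_all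
  have key: "zlog (Complex 2 t) * perron_kernel x (Complex 2 t)
      = (A t - B t) / 2 - (\<Sum>n<N. T n t) - G (Complex 2 t) / (Complex 2 t * (Complex 2 t + 1))" for t
  proof -
    define s where "s = Complex 2 t"
    have nz: "s \<noteq> 0" "s + 1 \<noteq> 0" "s - 1 \<noteq> 0" by (auto simp: s_def complex_eq_iff)
    have c1: "Complex 1 t = s - 1" by (simp add: s_def complex_eq_iff)
    have "zterm x (- s - 1) = of_real x * zterm x (- s)"
      using zterm_split[of x "- s"] x by simp
    then have At: "A t = zterm x (- (s + 1)) / ((s - 1) * s)"
      by (simp add: A_def perron_kernel_def c1)
    have Bt: "B t = zterm x (- (s + 1)) / (s * (s + 1))"
      by (simp add: B_def perron_kernel_def s_def)
    have "(A t - B t) / 2 = (1 / (s - 1)) * (zterm x (- (s + 1)) / (s * (s + 1)))"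
      unfolding At Bt using nz by (simp add: divide_simps) (simp add: algebra_simps)
    moreover have "(\<Sum>n<N. T n t) = (\<Sum>n<N. f n s) * (zterm x (- (s + 1)) / (s * (s + 1)))"
      by (simp add: T_def perron_kernel_def s_def sum_distrib_right sum_divide_distrib)
    moreover have "G s / (s * (s + 1)) = (1 / (s - 1) - (\<Sum>n<N. f n s) - zlog s) * (zterm x (- (s + 1)) / (s * (s + 1)))"
      by (simp add: G_def)
    ultimately show ?thesis
      unfolding s_def[symmetric] perron_kernel_def by (simp only: left_diff_distrib) simp
  qed
  have iS: "integrable lborel (\<lambda>t. \<Sum>n<N. T n t)"
    using Tn by (intro Bochner_Integration.integrable_sum) auto
  have iAB: "integrable lborel (\<lambda>t. (A t - B t) / 2)" using A B by simp
  show "integrable lborel (\<lambda>t. zlog (Complex 2 t) * perron_kernel x (Complex 2 t))"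
    unfolding key by (intro Bochner_Integration.integrable_diff iAB iS P0)
  have "(LINT t|lborel. zlog (Complex 2 t) * perron_kernel x (Complex 2 t))
      = (LINT t|lborel. (A t - B t) / 2) - (LINT t|lborel. (\<Sum>n<N. T n t)) - 0"
    unfolding key Bochner_Integration.integral_diff[OF Bochner_Integration.integrable_diff[OF iAB iS] P0(1)]
      Bochner_Integration.integral_diff[OF iAB iS] P0(2) by (rule refl)
  also have "(LINT t|lborel. (A t - B t) / 2) = of_real ((x * (2 * pi * (x - 1)) - 2 * pi * (x - 1)) / 2)"
    using A B by simp
  also have "(LINT t|lborel. (\<Sum>n<N. T n t)) = (\<Sum>n<N. of_real (2 * pi * (mangoldt (Suc n) * (x - real (Suc n)))))"
    using Tn by (subst Bochner_Integration.integral_sum) auto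
  also have "of_real ((x * (2 * pi * (x - 1)) - 2 * pi * (x - 1)) / 2)
      - (\<Sum>n<N. of_real (2 * pi * (mangoldt (Suc n) * (x - real (Suc n))))) - 0
      = (of_real ((x * (2 * pi * (x - 1)) - 2 * pi * (x - 1)) / 2 - (\<Sum>n<N. 2 * pi * (mangoldt (Suc n) * (x - real (Suc n))))) :: complex)"
    by (simp only: of_real_diff of_real_sum diff_0_right)
  also have "(x * (2 * pi * (x - 1)) - 2 * pi * (x - 1)) / 2 - (\<Sum>n<N. 2 * pi * (mangoldt (Suc n) * (x - real (Suc n))))
      = - 2 * pi * smoothed_psi_error x"
    unfolding smoothed_psi_error_def N_def sum_distrib_left[symmetric]
    by (simp add: power2_eq_square field_simps)
  finally show "(LINT t|lborel. zlog (Complex 2 t) * perron_kernel x (Complex 2 t)) = - 2 * pi * smoothed_psi_error x" .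
qed

lemma norm_perron_kernel_le:
  assumes "x \<ge> 1" "0 < v" "v \<le> u" "u + 1 \<le> m"
  shows "norm (perron_kernel x (Complex u t)) \<le> x powr m / (v\<^sup>2 + t\<^sup>2)"
proof -
  have "v\<^sup>2 + t\<^sup>2 \<le> u\<^sup>2 + t\<^sup>2" using assms by (intro add_right_mono power_mono) auto
  also have "\<dots> \<le> norm (Complex u t * (Complex u t + 1))" using assms by (intro norm_s_s1) auto
  finally have 1: "v\<^sup>2 + t\<^sup>2 \<le> norm (Complex u t * (Complex u t + 1))" .
  have 2: "0 < v\<^sup>2 + t\<^sup>2" using assms by (intro add_pos_nonneg) auto
  have "norm (zterm x (- (Complex u t + 1))) \<le> x powr m"
    using assms by (subst norm_zterm) (auto intro!: powr_mono)
  then have "norm (zterm x (- (Complex u t + 1))) / norm (Complex u t * (Complex u t + 1)) \<le> x powr m / (v\<^sup>2 + t\<^sup>2)"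
    using 1 2 by (intro frac_le) auto
  then show ?thesis by (simp add: perron_kernel_def norm_divide norm_mult)
qed

lemma log_weight_tendsto_0: "b > 0 \<Longrightarrow> ((\<lambda>t::real. c * (ln (\<bar>t\<bar> + 2) / (b\<^sup>2 + t\<^sup>2))) \<longlongrightarrow> 0) at_top"
  by real_asymp

lemma perron_kernel_holomorphic: "perron_kernel x holomorphic_on {s. Re s > 0}"
  unfolding perron_kernel_def zterm_def
  by (intro holomorphic_intros) (use s_s1_nonzero in auto)

text \<open>Under the Riemann Hypothesis \<open>zlog\<close> has no poles to the right of 1/2, so
  moving the line from 2 to \<open>1/2 + a\<close> leaves the integral unchanged.\<close>

lemma zlog_perron_integral:
  assumes RH: "riemann_hypothesis" and a: "0 < a" "a \<le> 1 / 2" and x: "x \<ge> 1"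
  shows "integrable lborel (\<lambda>t. zlog (Complex (1 / 2 + a) t) * perron_kernel x (Complex (1 / 2 + a) t))"
    "(LINT t|lborel. zlog (Complex (1 / 2 + a) t) * perron_kernel x (Complex (1 / 2 + a) t)) = - 2 * pi * smoothed_psi_error x"
proof -
  obtain C where C: "C > 0" "\<And>\<sigma> t. 1 / 2 + a \<le> \<sigma> \<Longrightarrow> \<sigma> \<le> 2 \<Longrightarrow> norm (zlog (Complex \<sigma> t)) \<le> C * ln (\<bar>t\<bar> + 2)"
    using norm_zlog_le[OF RH a] by blast
  define w where "w t = C * x powr 3 * (ln (\<bar>t\<bar> + 2) / ((1 / 2)\<^sup>2 + t\<^sup>2))" for t
  have lt: "1 / 2 + a < 2" using a by simp
  have hol: "(\<lambda>s. zlog s * perron_kernel x s) holomorphic_on {s. Re s > 1 / 2}"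
    by (intro holomorphic_on_mult zlog_holomorphic RH holomorphic_on_subset[OF perron_kernel_holomorphic]) auto
  have sub: "s \<in> {s. Re s > 1 / 2}" if "1 / 2 + a \<le> Re s" "Re s \<le> 2" for s using that a by simp
  have wi: "integrable lborel w" unfolding w_def by (intro integrable_mult_right integrable_log_weight) simp
  have wl: "(w \<longlongrightarrow> 0) at_top" unfolding w_def by (rule log_weight_tendsto_0) simp
  have we: "w (- t) = w t" for t by (simp add: w_def)
  have bd: "norm (zlog (Complex u t) * perron_kernel x (Complex u t)) \<le> w t" if "1 / 2 + a \<le> u" "u \<le> 2" for u t
  proof -
    have "norm (zlog (Complex u t)) * norm (perron_kernel x (Complex u t))
        \<le> (C * ln (\<bar>t\<bar> + 2)) * (x powr 3 / ((1 / 2)\<^sup>2 + t\<^sup>2))"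
      using that a x C by (intro mult_mono C norm_perron_kernel_le) auto
    then show ?thesis by (simp add: norm_mult w_def mult_ac)
  qed
  note V = vertical_line_shift_holomorphic[OF lt hol convex_halfspace_Re_gt sub wi wl we bd]
  show "integrable lborel (\<lambda>t. zlog (Complex (1 / 2 + a) t) * perron_kernel x (Complex (1 / 2 + a) t))" by (rule V(1))
  show "(LINT t|lborel. zlog (Complex (1 / 2 + a) t) * perron_kernel x (Complex (1 / 2 + a) t)) = - 2 * pi * smoothed_psi_error x"
    using V(3) zlog_perron_integral_2[OF x] by simp
qed

text \<open>On this line \<open>1 + 2 a - cnj s\<close> is \<open>s\<close> itself, so
  \<open>cnj (zlog s)\<close> is the boundary value of a function holomorphic on the left. Moving
  left meets only the poles of the kernel at 0 and -1, which is why \<open>x\<close> enters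
  linearly.\<close>

lemma cnj_zlog_perron_integral:
  assumes RH: "riemann_hypothesis" and a: "0 < a" "a \<le> 1 / 2" and x: "x \<ge> 1"
  shows "integrable lborel (\<lambda>t. cnj (zlog (Complex (1 / 2 + a) t)) * perron_kernel x (Complex (1 / 2 + a) t))"
    "(LINT t|lborel. cnj (zlog (Complex (1 / 2 + a) t)) * perron_kernel x (Complex (1 / 2 + a) t))
       = 2 * pi * (x * cnj (zlog (of_real (1 + 2 * a))) - cnj (zlog (of_real (2 + 2 * a))))"
proof -
  obtain C where C: "C > 0" "\<And>\<sigma> t. 1 / 2 + a \<le> \<sigma> \<Longrightarrow> \<sigma> \<le> 2 \<Longrightarrow> norm (zlog (Complex \<sigma> t)) \<le> C * ln (\<bar>t\<bar> + 2)"
    using norm_zlog_le[OF RH a] by blast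
  obtain K where K: "K > 0" "\<And>s. Re s \<ge> 1 + a \<Longrightarrow> norm (zlog s) \<le> K"
    using zlog_bounded_right[of "1 + a"] a by auto
  define G where "G s = cnj (zlog (of_real (1 + 2 * a) - cnj s))" for s
  have GC: "G (Complex u t) = cnj (zlog (Complex (1 + 2 * a - u) t))" for u t
  proof -
    have "of_real (1 + 2 * a) - cnj (Complex u t) = Complex (1 + 2 * a - u) t" by (simp add: complex_eq_iff)
    then show ?thesis by (simp add: G_def)
  qed
  have Ghol: "G holomorphic_on {s. Re s < 1 / 2 + 2 * a}"
  proof -
    have "(\<lambda>s. zlog (of_real (1 + 2 * a) - s)) holomorphic_on cnj ` {s. Re s < 1 / 2 + 2 * a}"
      by (rule holomorphic_on_compose_gen[OF _ zlog_holomorphic[OF RH], unfolded o_def])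
         (auto intro!: holomorphic_intros)
    then have "cnj \<circ> (\<lambda>s. zlog (of_real (1 + 2 * a) - s)) \<circ> cnj holomorphic_on {s. Re s < 1 / 2 + 2 * a}"
      by (rule holomorphic_on_compose_cnj_cnj) (rule open_halfspace_Re_lt)
    then show ?thesis by (simp add: G_def[abs_def] o_def)
  qed
  define S where "S = {s. Re s < 1 / 2 + 2 * a} \<inter> {s. Re s > 0}"
  define w where "w t = C * x powr 3 * (ln (\<bar>t\<bar> + 2) / (a\<^sup>2 + t\<^sup>2))" for t
  \<comment> \<open>The first move goes only to \<open>Re s = a\<close>: from there on the reflected
    argument has real part at least \<open>1 + a\<close>, where \<open>zlog\<close> is bounded, as
    \<open>perron_left\<close> requires.\<close>
  have lt: "a < 1 / 2 + a" by simp
  have hol: "(\<lambda>s. G s * perron_kernel x s) holomorphic_on S"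
    by (intro holomorphic_on_mult holomorphic_on_subset[OF Ghol] holomorphic_on_subset[OF perron_kernel_holomorphic]) (auto simp: S_def)
  have conv: "convex S" unfolding S_def by (intro convex_Int convex_halfspace_Re_gt convex_halfspace_Re_lt)
  have sub: "s \<in> S" if "a \<le> Re s" "Re s \<le> 1 / 2 + a" for s using that a by (simp add: S_def)
  have wi: "integrable lborel w" unfolding w_def using a by (intro integrable_mult_right integrable_log_weight) simp
  have wl: "(w \<longlongrightarrow> 0) at_top" unfolding w_def using a by (intro log_weight_tendsto_0) simp
  have we: "w (- t) = w t" for t by (simp add: w_def)
  have bd: "norm (G (Complex u t) * perron_kernel x (Complex u t)) \<le> w t" if "a \<le> u" "u \<le> 1 / 2 + a" for u t
  proof -
    have "norm (zlog (Complex (1 + 2 * a - u) t)) * norm (perron_kernel x (Complex u t))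
        \<le> (C * ln (\<bar>t\<bar> + 2)) * (x powr 3 / (a\<^sup>2 + t\<^sup>2))"
      using that a x C by (intro mult_mono C norm_perron_kernel_le) auto
    then show ?thesis by (simp add: norm_mult w_def mult_ac GC)
  qed
  note V = vertical_line_shift_holomorphic[OF lt hol conv sub wi wl we bd]
  have Gb: "norm (G s) \<le> K" if "Re s \<le> a" for s
    using K(2)[of "of_real (1 + 2 * a) - cnj s"] that by (simp add: G_def)
  have la: "a < 1 / 2 + 2 * a" using a by simp
  note P = perron_left[OF Ghol la a(1) x Gb]
  have G01: "G 0 = cnj (zlog (of_real (1 + 2 * a)))" "G (-1) = cnj (zlog (of_real (2 + 2 * a)))"
    by (simp_all add: G_def add.commute add.left_commute)
  have GG: "G (Complex (1 / 2 + a) t) = cnj (zlog (Complex (1 / 2 + a) t))" for t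
    by (simp add: GC)
  show "integrable lborel (\<lambda>t. cnj (zlog (Complex (1 / 2 + a) t)) * perron_kernel x (Complex (1 / 2 + a) t))"
    using V(2) unfolding GG .
  have "(LINT t|lborel. cnj (zlog (Complex (1 / 2 + a) t)) * perron_kernel x (Complex (1 / 2 + a) t))
      = (LINT t|lborel. G (Complex a t) * perron_kernel x (Complex a t))"
    using V(3) unfolding GG .
  also have "\<dots> = 2 * pi * (x * G 0 - G (-1))"
    using P(2) by (simp add: perron_kernel_def)
  finally show "(LINT t|lborel. cnj (zlog (Complex (1 / 2 + a) t)) * perron_kernel x (Complex (1 / 2 + a) t))
       = 2 * pi * (x * cnj (zlog (of_real (1 + 2 * a))) - cnj (zlog (of_real (2 + 2 * a))))"
    unfolding G01 .
qed

text \<open>Half the sum of the two preceding integrals. In differences \<open>\<beta>\<close>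
  cancels always, while \<open>\<alpha>\<close> survives a single difference; hence a bound uniform
  in \<open>a\<close> is recorded for \<open>\<alpha>\<close> alone.\<close>

lemma explicit_formula:
  assumes RH: "riemann_hypothesis"
  obtains C where "C > 0"
    "\<And>a. 0 < a \<Longrightarrow> a \<le> 1 / 2 \<Longrightarrow> \<exists>\<alpha> \<beta> :: complex. norm \<alpha> \<le> C \<and> (\<forall>x\<ge>1.
       integrable lborel (\<lambda>t. of_real (Re (zlog (Complex (1 / 2 + a) t))) * perron_kernel x (Complex (1 / 2 + a) t)) \<and>
       (LINT t|lborel. of_real (Re (zlog (Complex (1 / 2 + a) t))) * perron_kernel x (Complex (1 / 2 + a) t))
         = pi * (\<alpha> * x - \<beta> - smoothed_psi_error x))"
proof -
  have "continuous_on {1..2} (\<lambda>r::real. zlog (of_real r))"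
    by (rule continuous_on_compose2[OF holomorphic_on_imp_continuous_on[OF zlog_holomorphic[OF RH]]])
       (auto intro!: continuous_intros)
  then have "bounded ((\<lambda>r::real. zlog (of_real r)) ` {1..2})"
    by (intro compact_imp_bounded compact_continuous_image) auto
  then obtain C where C: "C > 0" "\<And>r. r \<in> {1..2} \<Longrightarrow> norm (zlog (of_real r)) \<le> C"
    unfolding bounded_pos by auto
  show ?thesis
  proof (rule that[OF C(1)])
    fix a :: real assume a: "0 < a" "a \<le> 1 / 2"
    define \<alpha> where "\<alpha> = cnj (zlog (of_real (1 + 2 * a)))"
    define \<beta> where "\<beta> = cnj (zlog (of_real (2 + 2 * a)))"
    have "norm \<alpha> \<le> C" using C(2)[of "1 + 2 * a"] a by (simp add: \<alpha>_def)
    moreover have "integrable lborel (\<lambda>t. of_real (Re (zlog (Complex (1 / 2 + a) t))) * perron_kernel x (Complex (1 / 2 + a) t)) \<and>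
       (LINT t|lborel. of_real (Re (zlog (Complex (1 / 2 + a) t))) * perron_kernel x (Complex (1 / 2 + a) t))
         = pi * (\<alpha> * x - \<beta> - smoothed_psi_error x)" if x: "x \<ge> 1" for x
    proof -
      let ?z = "\<lambda>t. zlog (Complex (1 / 2 + a) t)" and ?k = "\<lambda>t. perron_kernel x (Complex (1 / 2 + a) t)"
      have e: "of_real (Re (?z t)) * ?k t = (?z t * ?k t + cnj (?z t) * ?k t) / 2" for t
        by (simp add: complex_add_cnj flip: distrib_right)
      note i1 = zlog_perron_integral[OF RH a x] and i2 = cnj_zlog_perron_integral[OF RH a x]
      have "(LINT t|lborel. of_real (Re (?z t)) * ?k t) = (- 2 * pi * smoothed_psi_error x + 2 * pi * (x * \<alpha> - \<beta>)) / 2"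
      proof -
        have "(LINT t|lborel. (?z t * ?k t + cnj (?z t) * ?k t) / 2) = ((LINT t|lborel. ?z t * ?k t) + (LINT t|lborel. cnj (?z t) * ?k t)) / 2"
          using i1(1) i2(1) by simp
        then show ?thesis unfolding e i1(2) i2(2) \<alpha>_def \<beta>_def .
      qed
      also have "\<dots> = pi * (\<alpha> * x - \<beta> - smoothed_psi_error x)" by (simp add: field_simps)
      finally show ?thesis unfolding e using i1(1) i2(1) by simp
    qed
    ultimately show "\<exists>\<alpha> \<beta> :: complex. norm \<alpha> \<le> C \<and> (\<forall>x\<ge>1.
       integrable lborel (\<lambda>t. of_real (Re (zlog (Complex (1 / 2 + a) t))) * perron_kernel x (Complex (1 / 2 + a) t)) \<and>
       (LINT t|lborel. of_real (Re (zlog (Complex (1 / 2 + a) t))) * perron_kernel x (Complex (1 / 2 + a) t))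
         = pi * (\<alpha> * x - \<beta> - smoothed_psi_error x))" by blast
  qed
qed

subsection \<open>Mean squares over dyadic intervals\<close>

text \<open>The substitution \<open>x = X e^v\<close> turns powers of \<open>x\<close> into
  exponentials and the range into \<open>-ln 2 \<le> v \<le> ln 3\<close>. There
  \<open>e^v \<le> 3\<close> and \<open>exp (- 2 |v|) \<ge> 1/9\<close>, whence the 27. The interval
  is larger than \<open>[X, 2 X]\<close> to leave room for shifts by 1 and by
  \<open>h\<close>.\<close>

lemma integral_mean_square_twisted:
  fixes p :: "real \<Rightarrow> real" and c :: "real \<Rightarrow> complex"
  assumes pm [measurable]: "p \<in> borel_measurable lborel" and cm [measurable]: "c \<in> borel_measurable lborel"
    and Lm [measurable]: "\<Lambda> \<in> borel_measurable lborel" and L0: "\<And>t. \<Lambda> t \<ge> 0"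
    and L: "\<And>t. (\<integral>\<^sup>+t'. ennreal (\<bar>p t'\<bar> * (4 / (4 + (t - t')\<^sup>2))) \<partial>lborel) \<le> ennreal (\<Lambda> t)"
    and icp: "integrable lborel (\<lambda>t. c t * p t)"
    and i2: "integrable lborel (\<lambda>t. (norm (c t))\<^sup>2 * \<bar>p t\<bar> * \<Lambda> t)"
    and X: "X > 0" and M: "\<And>x. X / 2 \<le> x \<Longrightarrow> x \<le> 3 * X \<Longrightarrow> x powr (2 * \<theta>) \<le> M"
  defines "G \<equiv> (\<lambda>x. LINT t|lborel. c t * p t * zterm x (- Complex \<theta> t))"
  shows "continuous_on {X/2..3*X} G"
    "integral {X/2..3*X} (\<lambda>x. (norm (G x))\<^sup>2) \<le> M * 27 * X * (LINT t|lborel. (norm (c t))\<^sup>2 * \<bar>p t\<bar> * \<Lambda> t)"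
proof -
  \<comment> \<open>The phase moves the origin of \<open>v\<close> to \<open>ln X\<close> and leaves
    all norms unchanged.\<close>
  define q where "q t = c t * p t * exp (\<i> * of_real (ln X * t))" for t
  have nq: "norm (q t) = norm (c t) * \<bar>p t\<bar>" for t by (simp add: q_def norm_mult)
  have qm [measurable]: "q \<in> borel_measurable lborel" unfolding q_def by measurable
  have q: "integrable lborel q"
    by (rule Bochner_Integration.integrable_bound[OF icp qm]) (simp add: nq norm_mult)
  define Z where "Z v = (LINT t|lborel. q t * exp (\<i> * of_real (v * t)))" for v
  note W = weighted_plancherel_bound[OF q, folded Z_def]
  define I where "I = (LINT t|lborel. (norm (c t))\<^sup>2 * \<bar>p t\<bar> * \<Lambda> t)"
  define Wv where "Wv = (LINT v|lborel. (norm (Z v))\<^sup>2 * exp (- 2 * \<bar>v\<bar>))"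
  have I0: "I \<ge> 0" unfolding I_def using L0 by (intro Bochner_Integration.integral_nonneg) auto
  have "ennreal Wv \<le> (\<integral>\<^sup>+t. \<integral>\<^sup>+t'. ennreal ((norm (c t) * \<bar>p t\<bar>) * (norm (c t') * \<bar>p t'\<bar>) * (4 / (4 + (t - t')\<^sup>2))) \<partial>lborel \<partial>lborel)"
    unfolding Wv_def using W(3) unfolding nq .
  also have "\<dots> \<le> (\<integral>\<^sup>+t. ennreal ((norm (c t))\<^sup>2 * \<bar>p t\<bar> * \<Lambda> t) \<partial>lborel)"
    by (rule kernel_symmetrization) (use L L0 in auto)
  also have "\<dots> = ennreal I"
    unfolding I_def by (rule nn_integral_eq_integral[OF i2]) (use L0 in auto)
  finally have WI: "Wv \<le> I" using I0 by simp
  have GZ: "G x = of_real (x powr \<theta>) * Z (ln (x / X))" if x: "x > 0" for x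
  proof -
    have "c t * p t * zterm x (- Complex \<theta> t) = of_real (x powr \<theta>) * (q t * exp (\<i> * of_real (ln (x / X) * t)))" for t
    proof -
      have "zterm x (- Complex \<theta> t) = exp (of_real (\<theta> * ln x) + \<i> * of_real (ln x * t))"
        by (simp add: zterm_def Complex_eq algebra_simps)
      also have "\<dots> = of_real (x powr \<theta>) * exp (\<i> * of_real (ln x * t))"
        using x by (simp add: exp_add powr_def exp_of_real[symmetric])
      also have "exp (\<i> * of_real (ln x * t)) = exp (\<i> * of_real (ln X * t)) * exp (\<i> * of_real (ln (x / X) * t))"
        using x X by (simp add: ln_div algebra_simps flip: exp_add)
      finally show ?thesis by (simp add: q_def mult_ac)
    qed
    then show ?thesis unfolding G_def Z_def by simp
  qed
  have cZ: "continuous_on {X/2..3*X} (\<lambda>x. Z (ln (x / X)))"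
    by (rule continuous_on_compose2[OF W(1)]) (use X in \<open>auto intro!: continuous_intros\<close>)
  have "continuous_on {X/2..3*X} (\<lambda>x. of_real (x powr \<theta>) * Z (ln (x / X)))"
    by (intro continuous_intros cZ) (use X in auto)
  then show cG: "continuous_on {X/2..3*X} G"
    by (rule continuous_on_eq) (use GZ X in auto)
  define f where "f x = (norm (Z (ln (x / X))))\<^sup>2" for x
  have cf: "continuous_on {X/2..3*X} f" unfolding f_def by (intro continuous_intros cZ)
  have M0: "M \<ge> 0" using order_trans[OF powr_ge_zero M[of X]] X by simp
  have s1: "integral {X/2..3*X} (\<lambda>x. (norm (G x))\<^sup>2) \<le> integral {X/2..3*X} (\<lambda>x. M * f x)"
  proof (rule integral_le)
    show "(\<lambda>x. (norm (G x))\<^sup>2) integrable_on {X/2..3*X}"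
      by (intro integrable_continuous_interval continuous_intros cG)
    show "(\<lambda>x. M * f x) integrable_on {X/2..3*X}"
      by (intro integrable_continuous_interval continuous_intros cf)
    fix x assume x: "x \<in> {X/2..3*X}"
    then have x0: "x > 0" using X by auto
    have "(norm (G x))\<^sup>2 = (x powr \<theta>)\<^sup>2 * f x" using x0 by (simp add: GZ norm_mult f_def power_mult_distrib)
    also have "(x powr \<theta>)\<^sup>2 = x powr (2 * \<theta>)" by (simp add: power2_eq_square flip: powr_add)
    also have "x powr (2 * \<theta>) * f x \<le> M * f x" using M[of x] x by (intro mult_right_mono) (auto simp: f_def)
    finally show "(norm (G x))\<^sup>2 \<le> M * f x" .
  qed
  have s2: "((\<lambda>v. (X * exp v) *\<^sub>R f (X * exp v)) has_integral (integral {X * exp (- ln 2)..X * exp (ln 3)} f)) {- ln 2..ln 3}"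
  proof (rule has_integral_substitution[where c = "X/2" and d = "3*X"])
    show "(\<lambda>v. X * exp v) ` {- ln 2..ln 3} \<subseteq> {X/2..3*X}"
    proof safe
      fix v :: real assume v: "v \<in> {- ln 2..ln 3}"
      have "exp (- ln 2) \<le> exp v" "exp v \<le> exp (ln 3)" using v by (simp_all only: exp_le_cancel_iff atLeastAtMost_iff)
      then show "X * exp v \<in> {X/2..3*X}" using X by (auto simp: exp_minus field_simps)
    qed
    show "X * exp (- ln 2) \<le> X * exp (ln 3)" using X by (simp add: exp_minus)
    have "ln (1/2::real) \<le> ln 3" by (subst ln_le_cancel_iff) auto
    then show "- ln 2 \<le> ln (3::real)" by (simp add: ln_div)
    show "continuous_on {X/2..3*X} f" by (rule cf)
    show "((\<lambda>v. X * exp v) has_real_derivative X * exp v) (at v within {- ln 2..ln 3})" for v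
      by (auto intro!: derivative_eq_intros)
  qed
  have ends: "X * exp (- ln 2) = X / 2" "X * exp (ln 3) = 3 * X" by (auto simp: exp_minus field_simps)
  have fz: "f (X * exp v) = (norm (Z v))\<^sup>2" for v using X by (simp add: f_def)
  have "integral {X/2..3*X} f = integral {- ln 2..ln 3} (\<lambda>v. (X * exp v) * (norm (Z v))\<^sup>2)"
    using integral_unique[OF s2] unfolding ends fz by simp
  also have "\<dots> \<le> integral {- ln 2..ln 3} (\<lambda>v. 27 * X * ((norm (Z v))\<^sup>2 * exp (- 2 * \<bar>v\<bar>)))"
  proof (rule integral_le)
    have cZ': "continuous_on A Z" for A using W(1) continuous_on_subset by blast
    show "(\<lambda>v. (X * exp v) * (norm (Z v))\<^sup>2) integrable_on {- ln 2..ln 3}"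
      by (intro integrable_continuous_interval continuous_intros cZ')
    show "(\<lambda>v. 27 * X * ((norm (Z v))\<^sup>2 * exp (- 2 * \<bar>v\<bar>))) integrable_on {- ln 2..ln 3}"
      by (intro integrable_continuous_interval continuous_intros cZ')
    fix v :: real assume v: "v \<in> {- ln 2..ln 3}"
    have l23: "ln 2 \<le> ln (3::real)" by simp
    have "exp v \<le> exp (ln 3)" using v by (simp only: exp_le_cancel_iff atLeastAtMost_iff)
    then have e1: "exp v \<le> 3" by simp
    have "\<bar>v\<bar> \<le> ln 3" using v l23 unfolding atLeastAtMost_iff by linarith
    then have "exp (- 2 * \<bar>v\<bar>) \<ge> exp (- 2 * ln 3)" by simp
    also have "exp (- 2 * ln 3) = (1 / 9 :: real)"
      by (simp add: exp_minus exp_double power2_eq_square)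
    finally have "exp v \<le> 27 * exp (- 2 * \<bar>v\<bar>)" using e1 by linarith
    then have "exp v * (X * (norm (Z v))\<^sup>2) \<le> 27 * exp (- 2 * \<bar>v\<bar>) * (X * (norm (Z v))\<^sup>2)"
      using X by (intro mult_right_mono) auto
    then show "(X * exp v) * (norm (Z v))\<^sup>2 \<le> 27 * X * ((norm (Z v))\<^sup>2 * exp (- 2 * \<bar>v\<bar>))" by (simp add: mult_ac)
  qed
  also have "\<dots> = 27 * X * integral {- ln 2..ln 3} (\<lambda>v. (norm (Z v))\<^sup>2 * exp (- 2 * \<bar>v\<bar>))"
    by simp
  also have "integral {- ln 2..ln 3} (\<lambda>v. (norm (Z v))\<^sup>2 * exp (- 2 * \<bar>v\<bar>)) \<le> Wv"
  proof -
    have si: "set_integrable lborel {- ln 2..ln 3} (\<lambda>v. (norm (Z v))\<^sup>2 * exp (- 2 * \<bar>v\<bar>))"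
      using W(2) unfolding set_integrable_def by (intro integrable_mult_indicator) auto
    have "integral {- ln 2..ln 3} (\<lambda>v. (norm (Z v))\<^sup>2 * exp (- 2 * \<bar>v\<bar>))
       = (LINT v|lborel. indicator {- ln 2..ln 3} v *\<^sub>R ((norm (Z v))\<^sup>2 * exp (- 2 * \<bar>v\<bar>)))"
      using set_borel_integral_eq_integral(2)[OF si] by (simp add: set_lebesgue_integral_def)
    also have "\<dots> \<le> Wv" unfolding Wv_def
      using si W(2) by (intro integral_mono) (auto simp: set_integrable_def indicator_def)
    finally show ?thesis .
  qed
  finally have s3: "integral {X/2..3*X} f \<le> 27 * X * Wv" using X by simp
  have "integral {X/2..3*X} (\<lambda>x. M * f x) = M * integral {X/2..3*X} f" by simp
  also have "\<dots> \<le> M * (27 * X * I)"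
    using s3 WI X M0 by (intro mult_left_mono order_trans[OF s3]) auto
  finally show "integral {X/2..3*X} (\<lambda>x. (norm (G x))\<^sup>2) \<le> M * 27 * X * (LINT t|lborel. (norm (c t))\<^sup>2 * \<bar>p t\<bar> * \<Lambda> t)"
    using s1 unfolding I_def by (simp add: mult.assoc)
qed

lemma vector_derivative_zterm_integral:
  fixes \<psi> e :: "real \<Rightarrow> complex"
  assumes \<psi>: "continuous_on {l..r} \<psi>" and e: "continuous_on {l..r} e" and x: "x > 0"
  shows "((\<lambda>x. integral {l..r} (\<lambda>t. \<psi> t * zterm x (- e t))) has_vector_derivative
     integral {l..r} (\<lambda>t. \<psi> t * (e t * zterm x (- (e t - 1))))) (at x)"
proof -
  have "((\<lambda>x. integral (cbox l r) (\<lambda>t. \<psi> t * zterm x (- e t))) has_vector_derivative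
     integral (cbox l r) (\<lambda>t. \<psi> t * (e t * zterm x (- (e t - 1))))) (at x within {0<..})"
  proof (rule leibniz_rule_vector_derivative)
    fix y t :: real assume y: "y \<in> {0<..}" and t: "t \<in> cbox l r"
    have "((\<lambda>u. zterm (0 + u) (- e t)) has_vector_derivative - (- e t) * zterm (0 + y) (- e t + 1)) (at y within {0<..})"
      by (rule zterm_deriv_x) (use y in auto)
    then have "((\<lambda>u. zterm u (- e t)) has_vector_derivative e t * zterm y (- (e t - 1))) (at y within {0<..})"
      by simp
    then show "((\<lambda>x. \<psi> t * zterm x (- e t)) has_vector_derivative \<psi> t * (e t * zterm y (- (e t - 1)))) (at y within {0<..})"
      by (rule has_vector_derivative_mult_right)
  next
    fix y :: real assume y: "y \<in> {0<..}"
    show "(\<lambda>t. \<psi> t * zterm y (- e t)) integrable_on cbox l r"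
      by (intro integrable_continuous) (use \<psi> e y in \<open>auto intro!: continuous_intros\<close>)
  next
    have c: "continuous_on ({0<..} \<times> cbox l r) (\<lambda>z. h (snd z))" if "continuous_on {l..r} h" for h :: "real \<Rightarrow> complex"
      by (rule continuous_on_compose2[OF that]) (auto intro!: continuous_intros)
    show "continuous_on ({0<..} \<times> cbox l r) (\<lambda>(y, t). \<psi> t * (e t * zterm y (- (e t - 1))))"
      unfolding case_prod_unfold
      by (intro continuous_intros c \<psi> e) auto
  qed (use x in auto)
  then show ?thesis using x by (simp add: at_within_open[of x "{0<..}"])
qed

lemma norm_integral_squared_le:
  fixes B :: "real \<Rightarrow> complex"
  assumes B: "continuous_on {x..y} B" and xy: "x \<le> y"
  shows "(norm (integral {x..y} B))\<^sup>2 \<le> (y - x) * integral {x..y} (\<lambda>u. (norm (B u))\<^sup>2)"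
proof (cases "x = y")
  case False
  define \<eta> where "\<eta> = y - x"
  have \<eta>: "\<eta> > 0" using False xy by (simp add: \<eta>_def)
  define J where "J = integral {x..y} (\<lambda>u. norm (B u))"
  define S where "S = integral {x..y} (\<lambda>u. (norm (B u))\<^sup>2)"
  have c1: "continuous_on {x..y} (\<lambda>u. norm (B u))" by (intro continuous_intros B)
  have nJ: "norm (integral {x..y} B) \<le> J"
    unfolding J_def by (rule integral_norm_bound_integral) (use B c1 in \<open>auto intro!: integrable_continuous_interval\<close>)
  \<comment> \<open>Cauchy-Schwarz as nonnegativity of the variance of \<open>norm B\<close> about
    its mean \<open>J / \<eta>\<close>.\<close>
  have "0 \<le> integral {x..y} (\<lambda>u. (norm (B u) - J / \<eta>)\<^sup>2)"
    by (intro Henstock_Kurzweil_Integration.integral_nonneg integrable_continuous_interval continuous_intros c1) auto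
  also have "integral {x..y} (\<lambda>u. (norm (B u) - J / \<eta>)\<^sup>2) =
      integral {x..y} (\<lambda>u. ((norm (B u))\<^sup>2 - (2 * J / \<eta>) * norm (B u)) + (J / \<eta>)\<^sup>2)"
    by (intro integral_cong) (simp add: power2_eq_square algebra_simps)
  also have "\<dots> = (S - (2 * J / \<eta>) * J) + (J / \<eta>)\<^sup>2 * \<eta>"
  proof -
    have i1: "(\<lambda>u. (norm (B u))\<^sup>2) integrable_on {x..y}" "(\<lambda>u. (2 * J / \<eta>) * norm (B u)) integrable_on {x..y}"
      by (intro integrable_continuous_interval continuous_intros c1)+
    have "integral {x..y} (\<lambda>u. ((norm (B u))\<^sup>2 - (2 * J / \<eta>) * norm (B u)) + (J / \<eta>)\<^sup>2)
      = integral {x..y} (\<lambda>u. (norm (B u))\<^sup>2) - integral {x..y} (\<lambda>u. (2 * J / \<eta>) * norm (B u)) + integral {x..y} (\<lambda>u. (J / \<eta>)\<^sup>2)"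
    proof -
      have "integral {x..y} (\<lambda>u. ((norm (B u))\<^sup>2 - (2 * J / \<eta>) * norm (B u)) + (J / \<eta>)\<^sup>2)
        = integral {x..y} (\<lambda>u. (norm (B u))\<^sup>2 - (2 * J / \<eta>) * norm (B u)) + integral {x..y} (\<lambda>u. (J / \<eta>)\<^sup>2)"
        by (rule Henstock_Kurzweil_Integration.integral_add[OF Henstock_Kurzweil_Integration.integrable_diff[OF i1]]) auto
      then show ?thesis unfolding Henstock_Kurzweil_Integration.integral_diff[OF i1] .
    qed
    also have "integral {x..y} (\<lambda>u. (2 * J / \<eta>) * norm (B u)) = (2 * J / \<eta>) * J"
      unfolding J_def by (rule Henstock_Kurzweil_Integration.integral_mult_right)
    also have "integral {x..y} (\<lambda>u. (J / \<eta>)\<^sup>2) = (J / \<eta>)\<^sup>2 * \<eta>"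
      using xy by (simp add: \<eta>_def)
    finally show ?thesis by (simp add: S_def)
  qed
  also have "\<dots> = S - J\<^sup>2 / \<eta>" using \<eta> by (simp add: power2_eq_square field_simps)
  finally have "J\<^sup>2 \<le> \<eta> * S" using \<eta> by (simp add: field_simps)
  moreover have "(norm (integral {x..y} B))\<^sup>2 \<le> J\<^sup>2" using nJ by (intro power_mono) auto
  ultimately show ?thesis by (simp add: \<eta>_def S_def)
qed simp

text \<open>The difference is the integral of \<open>B\<close> over a window of length
  \<open>\<eta>\<close>. Cauchy-Schwarz yields one factor \<open>\<eta>\<close>; the other arises
  because each point lies in windows of total measure at most \<open>\<eta>\<close>. Instead of
  exchanging integrals, the second factor is obtained from the antiderivative \<open>S\<close> by
  shifting its argument.\<close>

lemma integral_difference_squared_le: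
  fixes A B :: "real \<Rightarrow> complex"
  assumes D: "\<And>x. y1 \<le> x \<Longrightarrow> x \<le> y2 + \<eta> \<Longrightarrow> (A has_vector_derivative B x) (at x)"
    and B: "continuous_on {y1..y2+\<eta>} B" and y: "y1 \<le> y2" "\<eta> \<ge> 0"
  shows "integral {y1..y2} (\<lambda>x. (norm (A (x + \<eta>) - A x))\<^sup>2) \<le> \<eta>\<^sup>2 * integral {y1..y2+\<eta>} (\<lambda>x. (norm (B x))\<^sup>2)"
proof -
  define N where "N = (\<lambda>u. (norm (B u))\<^sup>2)"
  define S where "S x = integral {y1..x} N" for x
  have cN: "continuous_on {y1..y2+\<eta>} N" unfolding N_def by (intro continuous_intros B)
  have iN: "N integrable_on {u..v}" if "y1 \<le> u" "v \<le> y2 + \<eta>" for u v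
    by (rule integrable_continuous_interval[OF continuous_on_subset[OF cN]]) (use that in auto)
  have cS: "continuous_on {y1..y2+\<eta>} S"
    unfolding S_def by (rule indefinite_integral_continuous_1) (use iN y in auto)
  have cS': "continuous_on {u..v} S" if "y1 \<le> u" "v \<le> y2 + \<eta>" for u v
    by (rule continuous_on_subset[OF cS]) (use that in auto)
  have iS: "S integrable_on {u..v}" if "y1 \<le> u" "v \<le> y2 + \<eta>" for u v
    by (rule integrable_continuous_interval[OF cS'[OF that]])
  have N0: "N u \<ge> 0" for u by (simp add: N_def)
  have S0: "S x \<ge> 0" if "x \<le> y2 + \<eta>" for x
    unfolding S_def by (intro Henstock_Kurzweil_Integration.integral_nonneg iN) (use that N0 in auto)
  have Smono: "S x \<le> S (y2 + \<eta>)" if "x \<le> y2 + \<eta>" for x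
    unfolding S_def by (intro integral_subset_le iN) (use that N0 in auto)
  have cA: "continuous_on {y1..y2+\<eta>} A"
    by (intro continuous_at_imp_continuous_on ballI has_vector_derivative_continuous[OF D]) auto
  have csh: "continuous_on {y1..y2} (\<lambda>x. h (x + \<eta>))" if "continuous_on {y1..y2+\<eta>} h" for h :: "real \<Rightarrow> 'b :: topological_space"
    by (rule continuous_on_compose2[OF that]) (use y in \<open>auto intro!: continuous_intros\<close>)
  have "integral {y1..y2} (\<lambda>x. (norm (A (x + \<eta>) - A x))\<^sup>2) \<le> integral {y1..y2} (\<lambda>x. \<eta> * (S (x + \<eta>) - S x))"
  proof (rule integral_le)
    have "continuous_on {y1..y2} A" by (rule continuous_on_subset[OF cA]) (use y in auto)
    then show "(\<lambda>x. (norm (A (x + \<eta>) - A x))\<^sup>2) integrable_on {y1..y2}"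
      by (intro integrable_continuous_interval continuous_intros csh cA)
    show "(\<lambda>x. \<eta> * (S (x + \<eta>) - S x)) integrable_on {y1..y2}"
      by (intro integrable_continuous_interval continuous_intros csh cS cS') (use y in auto)
    fix x assume x: "x \<in> {y1..y2}"
    have "(B has_integral (A (x + \<eta>) - A x)) {x..x+\<eta>}"
      by (rule fundamental_theorem_of_calculus) (use x y D in \<open>auto intro: has_vector_derivative_at_within\<close>)
    then have "A (x + \<eta>) - A x = integral {x..x+\<eta>} B" by (simp add: integral_unique)
    moreover have "(norm (integral {x..x+\<eta>} B))\<^sup>2 \<le> (x + \<eta> - x) * integral {x..x+\<eta>} (\<lambda>u. (norm (B u))\<^sup>2)"
      by (rule norm_integral_squared_le[OF continuous_on_subset[OF B]]) (use x y in auto)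
    moreover have "integral {x..x+\<eta>} (\<lambda>u. (norm (B u))\<^sup>2) = S (x + \<eta>) - S x"
      using Henstock_Kurzweil_Integration.integral_combine[of y1 x "x + \<eta>" N] x y iN[of y1 "x + \<eta>"]
      by (simp add: S_def N_def)
    ultimately show "(norm (A (x + \<eta>) - A x))\<^sup>2 \<le> \<eta> * (S (x + \<eta>) - S x)" by simp
  qed
  also have "\<dots> = \<eta> * (integral {y1..y2} (\<lambda>x. S (x + \<eta>)) - integral {y1..y2} S)"
  proof -
    have "(\<lambda>x. S (x + \<eta>)) integrable_on {y1..y2}" by (intro integrable_continuous_interval csh cS)
    then show ?thesis using iS[of y1 y2] y by (simp add: Henstock_Kurzweil_Integration.integral_diff)
  qed
  also have "integral {y1..y2} (\<lambda>x. S (x + \<eta>)) = integral {y1+\<eta>..y2+\<eta>} S"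
    using integral_shift[of y1 \<eta> y2 S] cS'[of "y1 + \<eta>" "y2 + \<eta>"] y by (simp add: o_def)
  also have "integral {y1+\<eta>..y2+\<eta>} S - integral {y1..y2} S = integral {y2..y2+\<eta>} S - integral {y1..y1+\<eta>} S"
    using Henstock_Kurzweil_Integration.integral_combine[of y1 "y1 + \<eta>" "y2 + \<eta>" S]
      Henstock_Kurzweil_Integration.integral_combine[of y1 y2 "y2 + \<eta>" S] y iS[of y1 "y2 + \<eta>"] by simp
  also have "\<dots> \<le> \<eta> * S (y2 + \<eta>)"
  proof -
    have "integral {y2..y2+\<eta>} S \<le> integral {y2..y2+\<eta>} (\<lambda>_. S (y2 + \<eta>))"
      by (rule integral_le) (use y iS Smono in auto)
    moreover have "0 \<le> integral {y1..y1+\<eta>} S"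
      by (intro Henstock_Kurzweil_Integration.integral_nonneg iS) (use y S0 in auto)
    ultimately show ?thesis using y by simp
  qed
  finally have "integral {y1..y2} (\<lambda>x. (norm (A (x + \<eta>) - A x))\<^sup>2) \<le> \<eta> * (\<eta> * S (y2 + \<eta>))"
    using y by (simp add: mult_left_mono)
  then show ?thesis by (simp add: S_def N_def power2_eq_square)
qed

section \<open>Mean squares of the Perron integral restricted to frequency ranges\<close>

lemma zlog_line_continuous:
  assumes "riemann_hypothesis" "a > 0"
  shows "continuous_on A (\<lambda>t. Re (zlog (Complex (1 / 2 + a) t)))"
proof -
  have "continuous_on UNIV (\<lambda>t. zlog (Complex (1 / 2 + a) t))"
    by (rule continuous_on_compose2[OF holomorphic_on_imp_continuous_on[OF zlog_holomorphic[OF assms(1)]]])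
       (use assms in \<open>auto simp: Complex_eq intro!: continuous_intros\<close>)
  then have "continuous_on A (\<lambda>t. zlog (Complex (1 / 2 + a) t))" by (rule continuous_on_subset) auto
  then show ?thesis by (intro continuous_intros)
qed

text \<open>Here \<open>c\<close> is a frequency cutoff together with the rational factor of the
  kernel. In its first bound the logarithm is the average of \<open>|Re zlog|\<close> near
  \<open>t\<close>; the remaining weight \<open>1 / (b^2 + t^2)\<close> averages
  \<open>|Re zlog|\<close> once more and gives \<open>(ln 2 + ln b) / b\<close>. The second bound
  secures integrability and does not enter the estimate.\<close>

lemma zlog_twisted_mean_square:
  assumes RH: "riemann_hypothesis"
  obtains C where "C > 0"
    "\<And>(a::real) (c :: real \<Rightarrow> complex) (\<kappa>::real) (\<kappa>'::real) (b::real) (X::real) (\<theta>::real) (M::real).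
       \<lbrakk>0 < a; a \<le> 1 / 2; c \<in> borel_measurable lborel; b \<ge> 2; X > 0;
        \<And>t. (norm (c t))\<^sup>2 * ln (\<bar>t\<bar> + 2) \<le> \<kappa> / (b\<^sup>2 + t\<^sup>2);
        \<And>t. norm (c t) \<le> \<kappa>' / (b\<^sup>2 + t\<^sup>2);
        \<And>x. X / 2 \<le> x \<Longrightarrow> x \<le> 3 * X \<Longrightarrow> x powr (2 * \<theta>) \<le> M\<rbrakk> \<Longrightarrow>
       continuous_on {X/2..3*X} (\<lambda>x. LINT t|lborel. c t * of_real (Re (zlog (Complex (1 / 2 + a) t))) * zterm x (- Complex \<theta> t)) \<and>
       integral {X/2..3*X} (\<lambda>x. (norm (LINT t|lborel. c t * of_real (Re (zlog (Complex (1 / 2 + a) t))) * zterm x (- Complex \<theta> t)))\<^sup>2)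
         \<le> M * 27 * X * (C * \<kappa> * ((ln 2 + ln b) / b))"
proof -
  obtain C where C: "C > 0" and Ci: "\<And>a b t0. 0 < a \<Longrightarrow> a \<le> 1 / 2 \<Longrightarrow> b \<ge> 2 \<Longrightarrow>
       integrable lborel (\<lambda>t. \<bar>Re (zlog (Complex (1 / 2 + a) t))\<bar> / (b\<^sup>2 + (t - t0)\<^sup>2))"
    and Cb: "\<And>a b t0. 0 < a \<Longrightarrow> a \<le> 1 / 2 \<Longrightarrow> b \<ge> 2 \<Longrightarrow>
       (LINT t|lborel. \<bar>Re (zlog (Complex (1 / 2 + a) t))\<bar> / (b\<^sup>2 + (t - t0)\<^sup>2)) \<le> C * (ln (\<bar>t0\<bar> + 2) + ln b) / b"
    using abs_Re_zlog_kernel_bound[OF RH] by blast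
  show ?thesis
  proof (rule that[of "4 * C * C"])
    show "4 * C * C > 0" using C by simp
    fix a :: real and c :: "real \<Rightarrow> complex" and \<kappa> \<kappa>' b X \<theta> M :: real
    assume a: "0 < a" "a \<le> 1 / 2" and cm [measurable]: "c \<in> borel_measurable lborel" and b: "b \<ge> 2" and X: "X > 0"
      and c1: "\<And>t. (norm (c t))\<^sup>2 * ln (\<bar>t\<bar> + 2) \<le> \<kappa> / (b\<^sup>2 + t\<^sup>2)"
      and c2: "\<And>t. norm (c t) \<le> \<kappa>' / (b\<^sup>2 + t\<^sup>2)"
      and M: "\<And>x. X / 2 \<le> x \<Longrightarrow> x \<le> 3 * X \<Longrightarrow> x powr (2 * \<theta>) \<le> M"
    define p where "p t = Re (zlog (Complex (1 / 2 + a) t))" for t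
    \<comment> \<open>The kernel bound at \<open>b = 2\<close> gives
      \<open>4 C (ln (|t| + 2) + ln 2) / 2\<close>, and
      \<open>ln 2 \<le> ln (|t| + 2)\<close>.\<close>
    define \<Lambda> where "\<Lambda> t = 4 * C * ln (\<bar>t\<bar> + 2)" for t :: real
    have pm [measurable]: "p \<in> borel_measurable lborel"
      unfolding p_def[abs_def] using zlog_line_continuous[OF RH a(1)] by (auto intro: borel_measurable_continuous_onI)
    have Lm [measurable]: "\<Lambda> \<in> borel_measurable lborel" unfolding \<Lambda>_def by measurable
    have L0: "\<Lambda> t \<ge> 0" for t using C by (simp add: \<Lambda>_def)
    have L: "(\<integral>\<^sup>+t'. ennreal (\<bar>p t'\<bar> * (4 / (4 + (t - t')\<^sup>2))) \<partial>lborel) \<le> ennreal (\<Lambda> t)" for t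
    proof -
      have e: "\<bar>p t'\<bar> * (4 / (4 + (t - t')\<^sup>2)) = 4 * (\<bar>p t'\<bar> / (2\<^sup>2 + (t' - t)\<^sup>2))" for t'
        by (simp add: power2_commute)
      have i: "integrable lborel (\<lambda>t'. 4 * (\<bar>p t'\<bar> / (2\<^sup>2 + (t' - t)\<^sup>2)))"
        unfolding p_def by (intro integrable_mult_right Ci a) simp
      have "(\<integral>\<^sup>+t'. ennreal (\<bar>p t'\<bar> * (4 / (4 + (t - t')\<^sup>2))) \<partial>lborel) = ennreal (LINT t'|lborel. 4 * (\<bar>p t'\<bar> / (2\<^sup>2 + (t' - t)\<^sup>2)))"
        unfolding e by (rule nn_integral_eq_integral[OF i]) auto
      also have "(LINT t'|lborel. 4 * (\<bar>p t'\<bar> / (2\<^sup>2 + (t' - t)\<^sup>2))) \<le> 4 * (C * (ln (\<bar>t\<bar> + 2) + ln 2) / 2)"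
        unfolding integral_mult_right_zero p_def by (intro mult_left_mono Cb a) auto
      also have "\<dots> \<le> \<Lambda> t"
      proof -
        have "C * (ln (\<bar>t\<bar> + 2) + ln 2) \<le> C * (2 * ln (\<bar>t\<bar> + 2))" using C by (intro mult_left_mono) auto
        then show ?thesis by (simp add: \<Lambda>_def)
      qed
      finally show ?thesis by (simp add: ennreal_leI)
    qed
    have pb: "integrable lborel (\<lambda>t. \<bar>p t\<bar> / (b\<^sup>2 + t\<^sup>2))"
      "(LINT t|lborel. \<bar>p t\<bar> / (b\<^sup>2 + t\<^sup>2)) \<le> C * (ln 2 + ln b) / b"
      using Ci[OF a b, of 0] Cb[OF a b, of 0] unfolding p_def by simp_all
    have icp: "integrable lborel (\<lambda>t. c t * p t)"
    proof (rule Bochner_Integration.integrable_bound[OF integrable_mult_right[OF pb(1), of \<kappa>']])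
      show "AE t in lborel. norm (c t * p t) \<le> norm (\<kappa>' * (\<bar>p t\<bar> / (b\<^sup>2 + t\<^sup>2)))"
      proof (rule AE_I2)
        fix t
        have "norm (c t) * \<bar>p t\<bar> \<le> \<kappa>' / (b\<^sup>2 + t\<^sup>2) * \<bar>p t\<bar>" by (intro mult_right_mono c2) auto
        also have "\<dots> = \<kappa>' * (\<bar>p t\<bar> / (b\<^sup>2 + t\<^sup>2))" by simp
        also have "\<dots> \<le> norm (\<kappa>' * (\<bar>p t\<bar> / (b\<^sup>2 + t\<^sup>2)))" unfolding real_norm_def by (rule abs_ge_self)
        finally show "norm (c t * p t) \<le> norm (\<kappa>' * (\<bar>p t\<bar> / (b\<^sup>2 + t\<^sup>2)))" by (simp add: norm_mult)
      qed
    qed measurable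
    have pt: "(norm (c t))\<^sup>2 * \<bar>p t\<bar> * \<Lambda> t \<le> 4 * C * \<kappa> * (\<bar>p t\<bar> / (b\<^sup>2 + t\<^sup>2))" for t
    proof -
      have "((norm (c t))\<^sup>2 * ln (\<bar>t\<bar> + 2)) * (4 * C * \<bar>p t\<bar>) \<le> \<kappa> / (b\<^sup>2 + t\<^sup>2) * (4 * C * \<bar>p t\<bar>)"
        using C by (intro mult_right_mono c1) auto
      then show ?thesis by (simp add: \<Lambda>_def mult_ac)
    qed
    have nn: "0 \<le> (norm (c t))\<^sup>2 * \<bar>p t\<bar> * \<Lambda> t" for t using L0 by simp
    have i2: "integrable lborel (\<lambda>t. (norm (c t))\<^sup>2 * \<bar>p t\<bar> * \<Lambda> t)"
    proof (rule Bochner_Integration.integrable_bound[OF integrable_mult_right[OF pb(1), of "4 * C * \<kappa>"]])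
      show "AE t in lborel. norm ((norm (c t))\<^sup>2 * \<bar>p t\<bar> * \<Lambda> t) \<le> norm (4 * C * \<kappa> * (\<bar>p t\<bar> / (b\<^sup>2 + t\<^sup>2)))"
        using order_trans[OF pt abs_ge_self] nn by (intro AE_I2) (simp only: real_norm_def abs_of_nonneg)
    qed measurable
    have "\<kappa> / (b\<^sup>2 + 0\<^sup>2) \<ge> 0" using order_trans[OF _ c1[of 0]] by simp
    then have k0: "\<kappa> \<ge> 0" using b by (simp add: zero_le_divide_iff)
    note MS = integral_mean_square_twisted[OF pm cm Lm L0 L icp i2 X M]
    have "(LINT t|lborel. (norm (c t))\<^sup>2 * \<bar>p t\<bar> * \<Lambda> t) \<le> (LINT t|lborel. 4 * C * \<kappa> * (\<bar>p t\<bar> / (b\<^sup>2 + t\<^sup>2)))"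
      by (intro integral_mono i2 integrable_mult_right pb(1) pt)
    also have "\<dots> \<le> 4 * C * \<kappa> * (C * (ln 2 + ln b) / b)"
      unfolding integral_mult_right_zero using C k0 by (intro mult_left_mono pb(2)) auto
    also have "\<dots> = 4 * C * C * \<kappa> * ((ln 2 + ln b) / b)" by simp
    finally have le: "(LINT t|lborel. (norm (c t))\<^sup>2 * \<bar>p t\<bar> * \<Lambda> t) \<le> 4 * C * C * \<kappa> * ((ln 2 + ln b) / b)" .
    have "M \<ge> 0" using order_trans[OF powr_ge_zero M[of X]] X by simp
    then have "M * 27 * X * (LINT t|lborel. (norm (c t))\<^sup>2 * \<bar>p t\<bar> * \<Lambda> t) \<le> M * 27 * X * (4 * C * C * \<kappa> * ((ln 2 + ln b) / b))"
      using X by (intro mult_left_mono le) auto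
    then show "continuous_on {X/2..3*X} (\<lambda>x. LINT t|lborel. c t * of_real (Re (zlog (Complex (1 / 2 + a) t))) * zterm x (- Complex \<theta> t)) \<and>
       integral {X/2..3*X} (\<lambda>x. (norm (LINT t|lborel. c t * of_real (Re (zlog (Complex (1 / 2 + a) t))) * zterm x (- Complex \<theta> t)))\<^sup>2)
         \<le> M * 27 * X * (4 * C * C * \<kappa> * ((ln 2 + ln b) / b))"
      using MS unfolding p_def by linarith
  qed
qed

(* The part of the Perron integral with imaginary part between l and r: k = 2 is the integral
   itself, k = 1 and k = 0 (also any k > 2) its first and second derivatives in x. *)
definition strip_int :: "(real \<Rightarrow> real) \<Rightarrow> real \<Rightarrow> nat \<Rightarrow> real \<Rightarrow> real \<Rightarrow> real \<Rightarrow> complex" where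
  "strip_int p \<sigma> k l r x =
     integral {l..r} (\<lambda>t. p t * (if k = 2 then zterm x (- (Complex \<sigma> t + 1)) / (Complex \<sigma> t * (Complex \<sigma> t + 1))
        else if k = 1 then zterm x (- Complex \<sigma> t) / Complex \<sigma> t
        else zterm x (- (Complex \<sigma> t - 1))))"

lemma strip_int_derivs:
  assumes p: "continuous_on {l..r} p" and \<sigma>: "\<sigma> > 0" and x: "x > 0"
  shows "(strip_int p \<sigma> 2 l r has_vector_derivative strip_int p \<sigma> 1 l r x) (at x)"
    "(strip_int p \<sigma> 1 l r has_vector_derivative strip_int p \<sigma> 0 l r x) (at x)"
proof -
  have nz: "Complex \<sigma> t \<noteq> 0" "Complex \<sigma> t + 1 \<noteq> 0" for t
    using \<sigma> s_s1_nonzero[of "Complex \<sigma> t"] by auto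
  have cs: "continuous_on {l..r} (\<lambda>t. Complex \<sigma> t)"
    unfolding Complex_eq by (intro continuous_intros)
  have c2: "continuous_on {l..r} (\<lambda>t. p t / (Complex \<sigma> t * (Complex \<sigma> t + 1)))"
    by (intro continuous_intros cs p) (use nz in auto)
  have c1: "continuous_on {l..r} (\<lambda>t. p t / Complex \<sigma> t)"
    by (intro continuous_intros cs p) (use nz in auto)
  have e2: "strip_int p \<sigma> 2 l r = (\<lambda>x. integral {l..r} (\<lambda>t. p t / (Complex \<sigma> t * (Complex \<sigma> t + 1)) * zterm x (- (Complex \<sigma> t + 1))))"
    by (rule ext) (simp add: strip_int_def)
  have e1: "strip_int p \<sigma> 1 l r = (\<lambda>x. integral {l..r} (\<lambda>t. p t / Complex \<sigma> t * zterm x (- Complex \<sigma> t)))"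
    by (rule ext) (simp add: strip_int_def)
  have "(strip_int p \<sigma> 2 l r has_vector_derivative
     integral {l..r} (\<lambda>t. p t / (Complex \<sigma> t * (Complex \<sigma> t + 1)) * ((Complex \<sigma> t + 1) * zterm x (- (Complex \<sigma> t + 1 - 1))))) (at x)"
    unfolding e2 by (rule vector_derivative_zterm_integral[OF c2 _ x]) (intro continuous_intros cs)
  also have "integral {l..r} (\<lambda>t. p t / (Complex \<sigma> t * (Complex \<sigma> t + 1)) * ((Complex \<sigma> t + 1) * zterm x (- (Complex \<sigma> t + 1 - 1)))) = strip_int p \<sigma> 1 l r x"
    unfolding e1 using nz by (intro integral_cong) simp
  finally show "(strip_int p \<sigma> 2 l r has_vector_derivative strip_int p \<sigma> 1 l r x) (at x)" .
  have "(strip_int p \<sigma> 1 l r has_vector_derivative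
     integral {l..r} (\<lambda>t. p t / Complex \<sigma> t * (Complex \<sigma> t * zterm x (- (Complex \<sigma> t - 1))))) (at x)"
    unfolding e1 by (rule vector_derivative_zterm_integral[OF c1 _ x]) (intro continuous_intros cs)
  also have "integral {l..r} (\<lambda>t. p t / Complex \<sigma> t * (Complex \<sigma> t * zterm x (- (Complex \<sigma> t - 1)))) = strip_int p \<sigma> 0 l r x"
    using nz unfolding strip_int_def by (intro integral_cong) simp
  finally show "(strip_int p \<sigma> 1 l r has_vector_derivative strip_int p \<sigma> 0 l r x) (at x)" .
qed

lemma integral_eq_lborel_indicator:
  fixes f :: "real \<Rightarrow> complex"
  assumes "continuous_on {l..r} f"
  shows "integral {l..r} f = (LINT t|lborel. of_real (indicator {l..r} t) * f t)"
proof -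
  have si: "set_integrable lborel {l..r} f" by (rule borel_integrable_atLeastAtMost'[OF assms])
  from set_borel_integral_eq_integral(2)[OF this] show ?thesis
    by (simp add: set_lebesgue_integral_def scaleR_conv_of_real)
qed

lemma strip_int_lborel:
  assumes p: "continuous_on {l..r} p" and \<sigma>: "\<sigma> > 0" and x: "x > 0"
  shows "strip_int p \<sigma> 2 l r x = (LINT t|lborel. complex_of_real (indicator {l..r} t) * (complex_of_real (p t) * perron_kernel x (Complex \<sigma> t)))"
    "strip_int p \<sigma> 1 l r x = (LINT t|lborel. (complex_of_real (indicator {l..r} t) / Complex \<sigma> t) * complex_of_real (p t) * zterm x (- Complex \<sigma> t))"
    "strip_int p \<sigma> 0 l r x = (LINT t|lborel. complex_of_real (indicator {l..r} t) * complex_of_real (p t) * zterm x (- Complex (\<sigma> - 1) t))"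
proof -
  have nz: "Complex \<sigma> t \<noteq> 0" "Complex \<sigma> t + 1 \<noteq> 0" for t
    using \<sigma> s_s1_nonzero[of "Complex \<sigma> t"] by auto
  have cs: "continuous_on {l..r} (\<lambda>t. Complex \<sigma> t)"
    unfolding Complex_eq by (intro continuous_intros)
  have c2: "continuous_on {l..r} (\<lambda>t. p t * perron_kernel x (Complex \<sigma> t))"
    unfolding perron_kernel_def by (intro continuous_intros cs p) (use nz x in auto)
  show "strip_int p \<sigma> 2 l r x = (LINT t|lborel. complex_of_real (indicator {l..r} t) * (complex_of_real (p t) * perron_kernel x (Complex \<sigma> t)))"
    using integral_eq_lborel_indicator[OF c2] by (simp add: strip_int_def perron_kernel_def)
  have c1: "continuous_on {l..r} (\<lambda>t. p t * (zterm x (- Complex \<sigma> t) / Complex \<sigma> t))"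
    by (intro continuous_intros cs p) (use nz x in auto)
  show "strip_int p \<sigma> 1 l r x = (LINT t|lborel. (complex_of_real (indicator {l..r} t) / Complex \<sigma> t) * complex_of_real (p t) * zterm x (- Complex \<sigma> t))"
    using integral_eq_lborel_indicator[OF c1] by (simp add: strip_int_def mult_ac)
  have c0: "continuous_on {l..r} (\<lambda>t. p t * zterm x (- (Complex \<sigma> t - 1)))"
    by (intro continuous_intros cs p) (use x in auto)
  have e: "Complex \<sigma> t - 1 = Complex (\<sigma> - 1) t" for t by (simp add: complex_eq_iff)
  show "strip_int p \<sigma> 0 l r x = (LINT t|lborel. complex_of_real (indicator {l..r} t) * complex_of_real (p t) * zterm x (- Complex (\<sigma> - 1) t))"
    using integral_eq_lborel_indicator[OF c0] by (simp add: strip_int_def mult.assoc e)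
qed

lemma integral_shifted_le:
  fixes f :: "real \<Rightarrow> real"
  assumes f: "continuous_on {u..v} f" "\<And>x. f x \<ge> 0" and A: "u \<le> A + c" "B + c \<le> v" "A \<le> B"
  shows "integral {A..B} (\<lambda>x. f (x + c)) \<le> integral {u..v} f"
    "(\<lambda>x. f (x + c)) integrable_on {A..B}"
proof -
  have c: "continuous_on {A+c..B+c} f" by (rule continuous_on_subset[OF f(1)]) (use A in auto)
  have "continuous_on {A..B} (\<lambda>x. f (x + c))"
    by (rule continuous_on_compose2[OF c]) (auto intro!: continuous_intros)
  then show "(\<lambda>x. f (x + c)) integrable_on {A..B}" by (rule integrable_continuous_interval)
  have "integral {A..B} (\<lambda>x. f (x + c)) = integral {A+c..B+c} f"
    using integral_shift[OF c] by (simp add: o_def)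
  also have "\<dots> \<le> integral {u..v} f"
    by (rule integral_subset_le) (use A f c in \<open>auto intro!: integrable_continuous_interval\<close>)
  finally show "integral {A..B} (\<lambda>x. f (x + c)) \<le> integral {u..v} f" .
qed

lemma norm_sum_squared_le:
  fixes a b :: complex
  shows "(norm (a + b))\<^sup>2 \<le> 2 * (norm a)\<^sup>2 + 2 * (norm b)\<^sup>2"
proof -
  have "(norm (a + b))\<^sup>2 \<le> (norm a + norm b)\<^sup>2" by (intro power_mono norm_triangle_ineq) auto
  also have "\<dots> \<le> 2 * (norm a)\<^sup>2 + 2 * (norm b)\<^sup>2"
    using sum_squares_bound[of "norm a" "norm b"] by (simp add: power2_sum)
  finally show ?thesis .
qed

lemma norm_diff_squared_le:
  fixes a b :: complex
  shows "(norm (a - b))\<^sup>2 \<le> 2 * (norm a)\<^sup>2 + 2 * (norm b)\<^sup>2"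
  using norm_sum_squared_le[of a "- b"] by simp

text \<open>The reason for \<open>a = 1 / (i + 2)\<close>: on the block of size \<open>2^i\<close>
  one has \<open>x \<le> 2^(i+2)\<close>, so moving the line off 1/2 by \<open>a\<close> costs only
  a constant.\<close>

lemma dyadic_powr_le:
  fixes x :: real
  assumes x: "0 < x" "x \<le> 3 * 2 ^ i"
  shows "x powr (2 * (1 / (real i + 2))) \<le> 4"
proof -
  have "x \<le> 2 powr (real i + 2)" using x by (simp add: powr_add powr_realpow)
  then have "x powr (2 * (1 / (real i + 2))) \<le> (2 powr (real i + 2)) powr (2 * (1 / (real i + 2)))"
    using x by (intro powr_mono2) auto
  also have "\<dots> = 2 powr 2"
  proof -
    have "(real i + 2) * (2 * (1 / (real i + 2))) = 2" by (simp add: field_simps)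
    then show ?thesis by (simp only: powr_powr)
  qed
  finally show ?thesis by simp
qed

text \<open>The unit step is paid for with one derivative in both bounds. For the step
  \<open>h\<close> there is a choice: a second derivative and the factor \<open>h^2\<close>, good
  for low frequencies, or the trivial bound, good for high ones.\<close>

lemma strip_second_difference:
  assumes p: "continuous_on UNIV p" and \<sigma>: "\<sigma> > 0" and X: "X \<ge> 2" and h: "0 \<le> h" "h \<le> X / 2"
  shows "integral {X..2*X} (\<lambda>x. (norm ((strip_int p \<sigma> 2 l r (x + 1) - strip_int p \<sigma> 2 l r (x + 1 - h)) - (strip_int p \<sigma> 2 l r x - strip_int p \<sigma> 2 l r (x - h))))\<^sup>2)
      \<le> h\<^sup>2 * integral {X/2..3*X} (\<lambda>x. (norm (strip_int p \<sigma> 0 l r x))\<^sup>2)" (is "?I \<le> _")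
    and "integral {X..2*X} (\<lambda>x. (norm ((strip_int p \<sigma> 2 l r (x + 1) - strip_int p \<sigma> 2 l r (x + 1 - h)) - (strip_int p \<sigma> 2 l r x - strip_int p \<sigma> 2 l r (x - h))))\<^sup>2)
      \<le> 4 * integral {X/2..3*X} (\<lambda>x. (norm (strip_int p \<sigma> 1 l r x))\<^sup>2)"
proof -
  define W G H where "W = strip_int p \<sigma> 2 l r" and "G = strip_int p \<sigma> 1 l r" and "H = strip_int p \<sigma> 0 l r"
  have pc: "continuous_on {l..r} p" using p by (rule continuous_on_subset) auto
  have WG: "(W has_vector_derivative G x) (at x)" and GH: "(G has_vector_derivative H x) (at x)" if "x > 0" for x
    using strip_int_derivs[OF pc \<sigma> that] by (simp_all add: W_def G_def H_def)
  have cG: "continuous_on S G" if "S \<subseteq> {0<..}" for S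
    using that GH by (intro continuous_at_imp_continuous_on ballI has_vector_derivative_continuous) auto
  have cs: "continuous_on {l..r} (\<lambda>t. Complex \<sigma> t)"
    unfolding Complex_eq by (intro continuous_intros)
  have cH: "continuous_on S H" if "S \<subseteq> {0<..}" for S
  proof -
    have nz: "Complex \<sigma> t \<noteq> 0" for t using \<sigma> by (simp add: complex_eq_iff)
    have eH: "H = (\<lambda>x. integral {l..r} (\<lambda>t. p t * zterm x (- (Complex \<sigma> t - 1))))"
      by (rule ext) (simp add: H_def strip_int_def)
    have "isCont H x" if "x > 0" for x
      unfolding eH
      by (rule has_vector_derivative_continuous[OF vector_derivative_zterm_integral[OF _ _ that]])
         (intro continuous_intros cs pc)+
    then show ?thesis using that by (intro continuous_at_imp_continuous_on) auto
  qed
  have sh: "((\<lambda>x. f (x - h)) has_vector_derivative f' (x - h)) (at x)" if "(f has_vector_derivative f' (x - h)) (at (x - h))" for f f' :: "real \<Rightarrow> complex" and x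
  proof -
    have "((\<lambda>x. x - h) has_vector_derivative 1) (at x)" by (auto intro!: derivative_eq_intros)
    from vector_diff_chain_at[OF this that] show ?thesis by (simp add: o_def)
  qed
  have D1: "((\<lambda>x. W x - W (x - h)) has_vector_derivative G x - G (x - h)) (at x)" if "X \<le> x" for x
    by (intro has_vector_derivative_diff WG sh) (use that X h in auto)
  have cGd: "continuous_on {X..2*X+1} (\<lambda>x. G x - G (x - h))"
  proof -
    have "continuous_on {X..2*X+1} (\<lambda>x. G (x - h))"
      by (rule continuous_on_compose2[OF cG[of "{X-h..2*X+1-h}"]]) (use X h in \<open>auto intro!: continuous_intros\<close>)
    then show ?thesis by (intro continuous_intros cG) (use X in auto)
  qed
  have "integral {X..2*X} (\<lambda>x. (norm ((W (x + 1) - W (x + 1 - h)) - (W x - W (x - h))))\<^sup>2)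
      \<le> 1\<^sup>2 * integral {X..2*X+1} (\<lambda>x. (norm (G x - G (x - h)))\<^sup>2)"
    by (rule integral_difference_squared_le[of X "2*X" 1 "\<lambda>x. W x - W (x - h)" "\<lambda>x. G x - G (x - h)"])
       (use D1 cGd X in auto)
  then have 1: "integral {X..2*X} (\<lambda>x. (norm ((W (x + 1) - W (x + 1 - h)) - (W x - W (x - h))))\<^sup>2)
      \<le> integral {X..2*X+1} (\<lambda>x. (norm (G x - G (x - h)))\<^sup>2)" by simp
  have c: "continuous_on {X-h..2*X+1-h} (\<lambda>y. (norm (G (y + h) - G y))\<^sup>2)"
  proof -
    have "continuous_on {X-h..2*X+1-h} (\<lambda>y. G (y + h))"
      by (rule continuous_on_compose2[OF cG[of "{X..2*X+1}"]]) (use X h in \<open>auto intro!: continuous_intros\<close>)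
    then show ?thesis by (intro continuous_intros cG) (use X h in auto)
  qed
  have "integral {X..2*X+1} (\<lambda>x. (norm (G x - G (x - h)))\<^sup>2) = integral {X-h..2*X+1-h} (\<lambda>y. (norm (G (y + h) - G y))\<^sup>2)"
    using integral_shift[of X "- h" "2*X+1" "\<lambda>y. (norm (G (y + h) - G y))\<^sup>2"] c by (simp add: o_def)
  also have "\<dots> \<le> h\<^sup>2 * integral {X-h..2*X+1-h+h} (\<lambda>x. (norm (H x))\<^sup>2)"
  proof (rule integral_difference_squared_le)
    show "continuous_on {X-h..2*X+1-h+h} H" by (rule cH) (use X h in auto)
  qed (use GH X h in auto)
  also have "\<dots> \<le> h\<^sup>2 * integral {X/2..3*X} (\<lambda>x. (norm (H x))\<^sup>2)"
    by (intro mult_left_mono integral_subset_le integrable_continuous_interval continuous_intros cH)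
       (use X h in auto)
  finally show "?I \<le> h\<^sup>2 * integral {X/2..3*X} (\<lambda>x. (norm (strip_int p \<sigma> 0 l r x))\<^sup>2)"
    using 1 unfolding W_def H_def by linarith
  define N where "N = (\<lambda>x. (norm (G x))\<^sup>2)"
  have cN: "continuous_on {X/2..3*X} N" unfolding N_def
    by (intro continuous_intros cG) (use X in auto)
  have N0: "N x \<ge> 0" for x by (simp add: N_def)
  note s0 = integral_shifted_le[OF cN N0, of X 0 "2*X+1"] and s1 = integral_shifted_le[OF cN N0, of X "- h" "2*X+1"]
  have i0: "(\<lambda>x. 2 * N x) integrable_on {X..2*X+1}" "(\<lambda>x. 2 * N (x - h)) integrable_on {X..2*X+1}"
    using s0(2) s1(2) X h by (auto intro!: integrable_on_cmult_left)
  have "integral {X..2*X+1} (\<lambda>x. (norm (G x - G (x - h)))\<^sup>2) \<le> integral {X..2*X+1} (\<lambda>x. 2 * N x + 2 * N (x - h))"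
  proof (rule integral_le)
    show "(\<lambda>x. (norm (G x - G (x - h)))\<^sup>2) integrable_on {X..2*X+1}"
      by (intro integrable_continuous_interval continuous_on_power continuous_on_norm cGd)
    show "(\<lambda>x. 2 * N x + 2 * N (x - h)) integrable_on {X..2*X+1}"
      by (rule Henstock_Kurzweil_Integration.integrable_add[OF i0])
  qed (simp add: N_def norm_diff_squared_le)
  also have "\<dots> = 2 * integral {X..2*X+1} N + 2 * integral {X..2*X+1} (\<lambda>x. N (x - h))"
    using Henstock_Kurzweil_Integration.integral_add[OF i0] by simp
  also have "\<dots> \<le> 4 * integral {X/2..3*X} N" using s0(1) s1(1) X h by simp
  finally show "?I \<le> 4 * integral {X/2..3*X} (\<lambda>x. (norm (strip_int p \<sigma> 1 l r x))\<^sup>2)"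
    using 1 unfolding N_def G_def W_def by linarith
qed


text \<open>Two derivatives in \<open>x\<close> leave no decay in \<open>t\<close>, one derivative
  leaves \<open>1 / |t|\<close>, none leaves \<open>1 / t^2\<close>; the ranges are matched to this.
  In each case \<open>|c|^2\<close> is compared with a Poisson kernel whose scale \<open>b\<close>
  is twice the relevant cutoff, except that the full range \<open>|t| \<le> 2^i\<close> uses
  \<open>b = 2\<close>.\<close>

lemma zlog_strip_bounds:
  assumes RH: "riemann_hypothesis"
  obtains C where "C > 0"
    "\<And>i T a p. \<lbrakk>a = 1 / (real i + 2); p = (\<lambda>t. Re (zlog (Complex (1 / 2 + a) t))); 1 \<le> T; T \<le> 2 ^ i\<rbrakk> \<Longrightarrow>
       integral {2 ^ i / 2..3 * 2 ^ i} (\<lambda>x. (norm (strip_int p (1 / 2 + a) 0 (- T) T x))\<^sup>2) \<le> C * T * (ln (2 ^ i + 2))\<^sup>2"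
    "\<And>i T a p. \<lbrakk>a = 1 / (real i + 2); p = (\<lambda>t. Re (zlog (Complex (1 / 2 + a) t))); 1 \<le> T; T \<le> 2 ^ i\<rbrakk> \<Longrightarrow>
       integral {2 ^ i / 2..3 * 2 ^ i} (\<lambda>x. (norm (strip_int p (1 / 2 + a) 1 T (2 ^ i) x))\<^sup>2) \<le> C * (2 ^ i)\<^sup>2 * (ln (2 ^ i + 2))\<^sup>2 / T"
    "\<And>i T a p. \<lbrakk>a = 1 / (real i + 2); p = (\<lambda>t. Re (zlog (Complex (1 / 2 + a) t))); 1 \<le> T; T \<le> 2 ^ i\<rbrakk> \<Longrightarrow>
       integral {2 ^ i / 2..3 * 2 ^ i} (\<lambda>x. (norm (strip_int p (1 / 2 + a) 1 (- (2 ^ i)) (- T) x))\<^sup>2) \<le> C * (2 ^ i)\<^sup>2 * (ln (2 ^ i + 2))\<^sup>2 / T"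
    "\<And>i a p. \<lbrakk>a = 1 / (real i + 2); p = (\<lambda>t. Re (zlog (Complex (1 / 2 + a) t)))\<rbrakk> \<Longrightarrow>
       integral {2 ^ i / 2..3 * 2 ^ i} (\<lambda>x. (norm (strip_int p (1 / 2 + a) 1 (- (2 ^ i)) (2 ^ i) x))\<^sup>2) \<le> C * (2 ^ i)\<^sup>2 * (ln (2 ^ i + 2))\<^sup>2"
    "\<And>i a p W. \<lbrakk>a = 1 / (real i + 2); p = (\<lambda>t. Re (zlog (Complex (1 / 2 + a) t)));
        W = (\<lambda>x. LINT t|lborel. complex_of_real (indicator (- {- (2 ^ i)..2 ^ i}) t) * (of_real (p t) * perron_kernel x (Complex (1 / 2 + a) t)))\<rbrakk> \<Longrightarrow>
       continuous_on {2 ^ i / 2..3 * 2 ^ i} W \<and>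
       integral {2 ^ i / 2..3 * 2 ^ i} (\<lambda>x. (norm (W x))\<^sup>2) \<le> C * 2 ^ i * (ln (2 ^ i + 2))\<^sup>2"
proof -
  obtain C where C: "C > 0" and MS: "\<And>(a::real) (c :: real \<Rightarrow> complex) (\<kappa>::real) (\<kappa>'::real) (b::real) (X::real) (\<theta>::real) (M::real).
       \<lbrakk>0 < a; a \<le> 1 / 2; c \<in> borel_measurable lborel; b \<ge> 2; X > 0;
        \<And>t. (norm (c t))\<^sup>2 * ln (\<bar>t\<bar> + 2) \<le> \<kappa> / (b\<^sup>2 + t\<^sup>2);
        \<And>t. norm (c t) \<le> \<kappa>' / (b\<^sup>2 + t\<^sup>2);
        \<And>x. X / 2 \<le> x \<Longrightarrow> x \<le> 3 * X \<Longrightarrow> x powr (2 * \<theta>) \<le> M\<rbrakk> \<Longrightarrow>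
       continuous_on {X/2..3*X} (\<lambda>x. LINT t|lborel. c t * of_real (Re (zlog (Complex (1 / 2 + a) t))) * zterm x (- Complex \<theta> t)) \<and>
       integral {X/2..3*X} (\<lambda>x. (norm (LINT t|lborel. c t * of_real (Re (zlog (Complex (1 / 2 + a) t))) * zterm x (- Complex \<theta> t)))\<^sup>2)
         \<le> M * 27 * X * (C * \<kappa> * ((ln 2 + ln b) / b))"
    using zlog_twisted_mean_square[OF RH] by blast
  define X :: "nat \<Rightarrow> real" where "X i = 2 ^ i" for i
  define L where "L i = ln (X i + 2)" for i
  define a where "a i = 1 / (real i + 2)" for i :: nat
  define \<sigma> where "\<sigma> i = 1 / 2 + a i" for i
  define p where "p i = (\<lambda>t. Re (zlog (Complex (\<sigma> i) t)))" for i
  have a: "0 < a i" "a i \<le> 1 / 2" for i by (auto simp: a_def field_simps)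
  have X: "X i \<ge> 1" "X i > 0" for i by (auto simp: X_def)
  have L1: "1 \<le> L i" for i
  proof -
    have "exp 1 \<le> (3::real)" by (rule exp_le)
    also have "3 \<le> X i + 2" using X by simp
    finally have "ln (exp 1) \<le> ln (X i + 2)" using X by (subst ln_le_cancel_iff) (auto simp: add_pos_pos)
    then show ?thesis by (simp add: L_def)
  qed
  have Lt: "ln (\<bar>t\<bar> + 2) \<le> L i" if "\<bar>t\<bar> \<le> X i" for t i
    using that X[of i] unfolding L_def by (subst ln_le_cancel_iff) auto
  have lnT: "ln 2 + ln (2 * T) \<le> 2 * L i" if "1 \<le> T" "T \<le> X i" for T i
  proof -
    have "2 * (2 * T) \<le> (T + 2) * (T + 2)"
      using zero_le_square[of T] by (simp add: algebra_simps)
    have "ln 2 + ln (2 * T) = ln (2 * (2 * T))" using that by (subst ln_mult_pos[symmetric]) auto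
    also have "\<dots> \<le> ln ((T + 2) * (T + 2))"
      using \<open>2 * (2 * T) \<le> (T + 2) * (T + 2)\<close> that by (subst ln_le_cancel_iff) auto
    also have "\<dots> = 2 * ln (T + 2)" using that by (subst ln_mult_pos) auto
    also have "ln (T + 2) \<le> L i" using that Lt[of T i] by simp
    finally show ?thesis by simp
  qed
  have cp: "continuous_on A (p i)" for A i
    unfolding p_def \<sigma>_def by (rule zlog_line_continuous[OF RH a(1)])
  have \<sigma>: "\<sigma> i > 0" for i using a[of i] by (simp add: \<sigma>_def)
  have ns: "norm (Complex (\<sigma> i) t) \<ge> \<bar>t\<bar>" "norm (Complex (\<sigma> i) t + 1) \<ge> \<bar>t\<bar>" "norm (Complex (\<sigma> i) t) \<ge> 1 / 2" for i t
  proof -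
    show "norm (Complex (\<sigma> i) t) \<ge> \<bar>t\<bar>" using norm_Complex_ge(2)[of t "\<sigma> i"] .
    have "Complex (\<sigma> i) t + 1 = Complex (\<sigma> i + 1) t" by (simp add: complex_eq_iff)
    then show "norm (Complex (\<sigma> i) t + 1) \<ge> \<bar>t\<bar>" using norm_Complex_ge(2)[of t "\<sigma> i + 1"] by simp
    show "norm (Complex (\<sigma> i) t) \<ge> 1 / 2" using norm_Complex_ge(1)[of "\<sigma> i" t] a[of i] by (simp add: \<sigma>_def)
  qed
  have pw: "x powr (2 * (r + a i)) \<le> 4 * x powr (2 * r)" if "X i / 2 \<le> x" "x \<le> 3 * X i" for x r i
  proof -
    have x: "x > 0" using that X[of i] by linarith
    have "x powr (2 * (r + a i)) = x powr (2 * a i) * x powr (2 * r)" by (simp add: distrib_left add.commute flip: powr_add)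
    also have "\<dots> \<le> 4 * x powr (2 * r)"
      using dyadic_powr_le[of x i] x that by (intro mult_right_mono) (auto simp: a_def X_def)
    finally show ?thesis .
  qed
  have csig: "continuous_on A (\<lambda>t. Complex (\<sigma> i) t)" for A i
    unfolding Complex_eq by (intro continuous_intros)
  have nz: "Complex (\<sigma> i) t \<noteq> 0" "Complex (\<sigma> i) t + 1 \<noteq> 0" for i t
    using \<sigma>[of i] s_s1_nonzero[of "Complex (\<sigma> i) t"] by auto
  have m1: "(\<lambda>t. 1 / Complex (\<sigma> i) t) \<in> borel_measurable borel" for i
    by (intro borel_measurable_continuous_onI continuous_intros csig) (use nz in auto)
  have m2: "(\<lambda>t. 1 / (Complex (\<sigma> i) t * (Complex (\<sigma> i) t + 1))) \<in> borel_measurable borel" for i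
    by (intro borel_measurable_continuous_onI continuous_intros csig) (use nz in auto)
  have mi: "(\<lambda>t. complex_of_real (indicator {l..r} t) * f t) \<in> borel_measurable lborel"
    "(\<lambda>t. complex_of_real (indicator (- {l..r}) t) * f t) \<in> borel_measurable lborel"
    if "f \<in> borel_measurable borel" for l r :: real and f :: "real \<Rightarrow> complex"
    using that by measurable
  \<comment> \<open>For \<open>|t| \<ge> T\<close> the kernel denominator
    \<open>(2 T)^2 + t^2\<close> is at most \<open>5 t^2\<close>.\<close>
  have kb: "1 / t\<^sup>2 \<le> 5 / ((2 * T)\<^sup>2 + t\<^sup>2)" if "1 \<le> T" "T \<le> \<bar>t\<bar>" for T t :: real
  proof -
    have "T\<^sup>2 \<le> t\<^sup>2" using that power_mono[of T "\<bar>t\<bar>" 2] by simp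
    moreover have "t\<^sup>2 > 0" using that by (intro zero_less_power2[THEN iffD2]) auto
    ultimately have "(2 * T)\<^sup>2 + t\<^sup>2 \<le> 5 * t\<^sup>2" "(2 * T)\<^sup>2 + t\<^sup>2 > 0" "t \<noteq> 0"
      by (auto simp: power_mult_distrib intro: add_nonneg_pos)
    then have "5 / (5 * t\<^sup>2) \<le> 5 / ((2 * T)\<^sup>2 + t\<^sup>2)" by (intro divide_left_mono) auto
    then show ?thesis by simp
  qed
  have B1: "integral {X i/2..3*X i} (\<lambda>x. (norm (strip_int (p i) (\<sigma> i) 0 (- T) T x))\<^sup>2) \<le> 1080 * C * T * (L i)\<^sup>2"
    if T: "1 \<le> T" "T \<le> X i" for T i
  proof -
    define c where "c t = complex_of_real (indicator {-T..T} t)" for t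
    have k5: "1 \<le> 5 * T\<^sup>2 / ((2 * T)\<^sup>2 + t\<^sup>2)" if "\<bar>t\<bar> \<le> T" for t
    proof -
      have "t\<^sup>2 \<le> T\<^sup>2" using that power_mono[of "\<bar>t\<bar>" T 2] by simp
      moreover have "(2 * T)\<^sup>2 + t\<^sup>2 > 0" using T by (intro add_pos_nonneg) auto
      ultimately show ?thesis by (simp add: power_mult_distrib)
    qed
    have r0: "0 \<le> K / ((2 * T)\<^sup>2 + t\<^sup>2)" if "K \<ge> 0" for K t using that by simp
    have h1: "(norm (c t))\<^sup>2 * ln (\<bar>t\<bar> + 2) \<le> (5 * T\<^sup>2 * L i) / ((2 * T)\<^sup>2 + t\<^sup>2)" for t
    proof (cases "t \<in> {-T..T}")
      case True
      then have "1 * ln (\<bar>t\<bar> + 2) \<le> 5 * T\<^sup>2 / ((2 * T)\<^sup>2 + t\<^sup>2) * L i"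
        using T by (intro mult_mono k5 Lt r0) auto
      then show ?thesis using True by (simp add: c_def)
    next
      case False
      then show ?thesis using r0[of "5 * T\<^sup>2 * L i" t] L1[of i] by (simp add: c_def)
    qed
    have h2: "norm (c t) \<le> 5 * T\<^sup>2 / ((2 * T)\<^sup>2 + t\<^sup>2)" for t
      using k5[of t] r0[of "5 * T\<^sup>2" t] by (cases "t \<in> {-T..T}") (auto simp: c_def)
    \<comment> \<open>Two derivatives bring the exponent of \<open>x\<close> down to
      \<open>-1/2 + a\<close>; the bound of size \<open>1 / X\<close> then cancels the factor
      \<open>X\<close> from the length of the interval.\<close>
    have h3: "x powr (2 * (- (1 / 2) + a i)) \<le> 8 / X i" if x: "X i / 2 \<le> x" "x \<le> 3 * X i" for x
    proof -
      have "x > 0" using x X[of i] by linarith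
      have "4 * x powr (2 * (- (1 / 2))) = 4 / x" using \<open>x > 0\<close> by (simp add: powr_minus inverse_eq_divide)
      also have "\<dots> \<le> 4 / (X i / 2)" using x X[of i] by (intro frac_le) auto
      finally show ?thesis using pw[OF x, of "- (1 / 2)"] by simp
    qed
    have cm: "c \<in> borel_measurable lborel" unfolding c_def by measurable
    have T2: "2 \<le> 2 * T" using T by simp
    note M = MS[OF a(1)[of i] a(2)[of i] cm T2 X(2)[of i] h1 h2 h3]
    have e: "strip_int (p i) (\<sigma> i) 0 (- T) T x = (LINT t|lborel. c t * of_real (Re (zlog (Complex (1 / 2 + a i) t))) * zterm x (- Complex (- (1 / 2) + a i) t))"
      if "x \<in> {X i/2..3*X i}" for x
    proof -
      have "x > 0" using that X(2)[of i] by (simp only: atLeastAtMost_iff) linarith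
      have s: "\<sigma> i - 1 = - (1 / 2) + a i" by (simp add: \<sigma>_def)
      show ?thesis
        using strip_int_lborel(3)[where l = "-T" and r = "T" and p = "p i" and \<sigma> = "\<sigma> i" and x = x, OF cp \<sigma> \<open>x > 0\<close>] unfolding s by (simp only: c_def p_def \<sigma>_def)
    qed
    have "integral {X i/2..3*X i} (\<lambda>x. (norm (strip_int (p i) (\<sigma> i) 0 (- T) T x))\<^sup>2)
      \<le> 8 / X i * 27 * X i * (C * (5 * T\<^sup>2 * L i) * ((ln 2 + ln (2 * T)) / (2 * T)))"
      by (rule ord_eq_le_trans[OF integral_cong conjunct2[OF M]]) (simp only: e)
    also have "\<dots> \<le> 8 / X i * 27 * X i * (C * (5 * T\<^sup>2 * L i) * ((2 * L i) / (2 * T)))"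
      using X[of i] C T L1[of i] lnT[OF T] by (intro mult_left_mono divide_right_mono mult_nonneg_nonneg) auto
    also have "\<dots> = 1080 * C * T * (L i)\<^sup>2" using X(2)[of i] T by (simp add: field_simps power2_eq_square)
    finally show ?thesis .
  qed
  have B2: "integral {X i/2..3*X i} (\<lambda>x. (norm (strip_int (p i) (\<sigma> i) 1 l r x))\<^sup>2) \<le> 1620 * C * (X i)\<^sup>2 * (L i)\<^sup>2 / T"
    if T: "1 \<le> T" "T \<le> X i" and lr: "\<And>t. t \<in> {l..r} \<Longrightarrow> T \<le> \<bar>t\<bar> \<and> \<bar>t\<bar> \<le> X i" for T i l r
  proof -
    define c where "c t = complex_of_real (indicator {l..r} t) * (1 / Complex (\<sigma> i) t)" for t
    have r0: "0 \<le> K / ((2 * T)\<^sup>2 + t\<^sup>2)" if "K \<ge> 0" for K t using that by simp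
    have nc: "(norm (c t))\<^sup>2 \<le> 1 / t\<^sup>2" "norm (c t) \<le> X i * (1 / t\<^sup>2)" if t: "t \<in> {l..r}" for t
    proof -
      have t0: "\<bar>t\<bar> > 0" using lr[OF t] T by linarith
      have n: "norm (c t) \<le> 1 / \<bar>t\<bar>"
        using t ns(1)[of t i] t0 by (simp add: c_def norm_divide) (intro frac_le, auto)
      have "(norm (c t))\<^sup>2 \<le> (1 / \<bar>t\<bar>)\<^sup>2" using n by (intro power_mono) auto
      then show "(norm (c t))\<^sup>2 \<le> 1 / t\<^sup>2" by (simp add: power_divide)
      have "1 / \<bar>t\<bar> = \<bar>t\<bar> * (1 / t\<^sup>2)" using t0 by (simp add: power2_eq_square abs_mult_self_eq field_simps)
      also have "\<dots> \<le> X i * (1 / t\<^sup>2)" using lr[OF t] by (intro mult_right_mono) auto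
      finally show "norm (c t) \<le> X i * (1 / t\<^sup>2)" using n by linarith
    qed
    have h1: "(norm (c t))\<^sup>2 * ln (\<bar>t\<bar> + 2) \<le> (5 * L i) / ((2 * T)\<^sup>2 + t\<^sup>2)" for t
    proof (cases "t \<in> {l..r}")
      case True
      have "(norm (c t))\<^sup>2 * ln (\<bar>t\<bar> + 2) \<le> 5 / ((2 * T)\<^sup>2 + t\<^sup>2) * L i"
        using lr[OF True] T by (intro mult_mono order_trans[OF nc(1)[OF True] kb] Lt r0) auto
      then show ?thesis by simp
    next
      case False
      then show ?thesis using r0[of "5 * L i" t] L1[of i] by (simp add: c_def)
    qed
    have h2: "norm (c t) \<le> (X i * 5) / ((2 * T)\<^sup>2 + t\<^sup>2)" for t
    proof (cases "t \<in> {l..r}")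
      case True
      have "norm (c t) \<le> X i * (5 / ((2 * T)\<^sup>2 + t\<^sup>2))"
        using lr[OF True] T X[of i] by (intro order_trans[OF nc(2)[OF True]] mult_left_mono kb) auto
      then show ?thesis by simp
    next
      case False
      then show ?thesis using r0[of "X i * 5" t] X[of i] by (simp add: c_def)
    qed
    have h3: "x powr (2 * (1 / 2 + a i)) \<le> 12 * X i" if x: "X i / 2 \<le> x" "x \<le> 3 * X i" for x
    proof -
      have "x > 0" using x X[of i] by linarith
      then show ?thesis using pw[OF x, of "1 / 2"] x by simp
    qed
    have cm: "c \<in> borel_measurable lborel" unfolding c_def by (rule mi[OF m1])
    have T2: "2 \<le> 2 * T" using T by simp
    note M = MS[OF a(1)[of i] a(2)[of i] cm T2 X(2)[of i] h1 h2 h3]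
    have e: "strip_int (p i) (\<sigma> i) 1 l r x = (LINT t|lborel. c t * of_real (Re (zlog (Complex (1 / 2 + a i) t))) * zterm x (- Complex (1 / 2 + a i) t))"
      if "x \<in> {X i/2..3*X i}" for x
    proof -
      have "x > 0" using that X(2)[of i] by (simp only: atLeastAtMost_iff) linarith
      show ?thesis
        using strip_int_lborel(2)[where l = "l" and r = "r" and p = "p i" and \<sigma> = "\<sigma> i" and x = x, OF cp \<sigma> \<open>x > 0\<close>] by (simp add: c_def p_def \<sigma>_def)
    qed
    have "integral {X i/2..3*X i} (\<lambda>x. (norm (strip_int (p i) (\<sigma> i) 1 l r x))\<^sup>2)
      \<le> 12 * X i * 27 * X i * (C * (5 * L i) * ((ln 2 + ln (2 * T)) / (2 * T)))"
      by (rule ord_eq_le_trans[OF integral_cong conjunct2[OF M]]) (simp only: e)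
    also have "\<dots> \<le> 12 * X i * 27 * X i * (C * (5 * L i) * ((2 * L i) / (2 * T)))"
      using X[of i] C T L1[of i] lnT[OF T] by (intro mult_left_mono divide_right_mono mult_nonneg_nonneg) auto
    also have "\<dots> = 1620 * C * (X i)\<^sup>2 * (L i)\<^sup>2 / T" using T by (simp add: field_simps power2_eq_square)
    finally show ?thesis .
  qed
  have B3: "integral {X i/2..3*X i} (\<lambda>x. (norm (strip_int (p i) (\<sigma> i) 1 (- X i) (X i) x))\<^sup>2) \<le> 6480 * C * (X i)\<^sup>2 * (L i)\<^sup>2" for i
  proof -
    define c where "c t = complex_of_real (indicator {- X i..X i} t) * (1 / Complex (\<sigma> i) t)" for t
    have r0: "0 \<le> K / (2\<^sup>2 + t\<^sup>2)" if "K \<ge> 0" for K t :: real using that by simp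
    \<comment> \<open>The range contains \<open>t = 0\<close>, where only
      \<open>\<sigma> \<ge> 1/2\<close> helps:
      \<open>|s|^2 \<ge> 1/4 + t^2 \<ge> (4 + t^2) / 20\<close>.\<close>
    have k20: "(norm (1 / Complex (\<sigma> i) t))\<^sup>2 \<le> 20 / (2\<^sup>2 + t\<^sup>2)" for t
    proof -
      have "1 / 4 + t\<^sup>2 \<le> (norm (Complex (\<sigma> i) t))\<^sup>2"
        using a[of i] power_mono[of "1 / 2" "\<sigma> i" 2] by (simp add: cmod_power2 \<sigma>_def power_divide)
      then have "(2\<^sup>2 + t\<^sup>2) / 20 \<le> (norm (Complex (\<sigma> i) t))\<^sup>2"
        by (rule order_trans[rotated]) (simp add: field_simps)
      moreover have "(2\<^sup>2 + t\<^sup>2) / 20 > 0" by (intro divide_pos_pos add_pos_nonneg) auto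
      ultimately have "1 / (norm (Complex (\<sigma> i) t))\<^sup>2 \<le> 1 / ((2\<^sup>2 + t\<^sup>2) / 20)" by (intro frac_le) auto
      then show ?thesis by (simp add: norm_divide power_divide)
    qed
    have h1: "(norm (c t))\<^sup>2 * ln (\<bar>t\<bar> + 2) \<le> (20 * L i) / (2\<^sup>2 + t\<^sup>2)" for t
    proof (cases "t \<in> {- X i..X i}")
      case True
      have "(norm (1 / Complex (\<sigma> i) t))\<^sup>2 * ln (\<bar>t\<bar> + 2) \<le> 20 / (2\<^sup>2 + t\<^sup>2) * L i"
        using True by (intro mult_mono k20 Lt r0) auto
      then show ?thesis using True by (simp add: c_def)
    next
      case False
      then show ?thesis using r0[of "20 * L i" t] L1[of i] by (simp add: c_def)
    qed
    have h2: "norm (c t) \<le> (2 * (4 + (X i)\<^sup>2)) / (2\<^sup>2 + t\<^sup>2)" for t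
    proof (cases "t \<in> {- X i..X i}")
      case True
      have "t\<^sup>2 \<le> (X i)\<^sup>2" using True power_mono[of "\<bar>t\<bar>" "X i" 2] by auto
      moreover have p4: "4 + t\<^sup>2 > 0" by (intro add_pos_nonneg) auto
      ultimately have "2 \<le> (2 * (4 + (X i)\<^sup>2)) / (4 + t\<^sup>2)" by (simp add: le_divide_eq)
      moreover have "norm (1 / Complex (\<sigma> i) t) \<le> 1 / (1 / 2)"
        unfolding norm_divide norm_one by (rule frac_le) (use ns(3)[of i t] in auto)
      ultimately show ?thesis using True by (simp add: c_def)
    next
      case False
      then show ?thesis using r0[of "2 * (4 + (X i)\<^sup>2)" t] by (simp add: c_def)
    qed
    have h3: "x powr (2 * (1 / 2 + a i)) \<le> 12 * X i" if x: "X i / 2 \<le> x" "x \<le> 3 * X i" for x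
    proof -
      have "x > 0" using x X[of i] by linarith
      then show ?thesis using pw[OF x, of "1 / 2"] x by simp
    qed
    have cm: "c \<in> borel_measurable lborel" unfolding c_def by (rule mi[OF m1])
    note M = MS[OF a(1)[of i] a(2)[of i] cm order_refl X(2)[of i] h1 h2 h3]
    have e: "strip_int (p i) (\<sigma> i) 1 (- X i) (X i) x = (LINT t|lborel. c t * of_real (Re (zlog (Complex (1 / 2 + a i) t))) * zterm x (- Complex (1 / 2 + a i) t))"
      if "x \<in> {X i/2..3*X i}" for x
    proof -
      have "x > 0" using that X(2)[of i] by (simp only: atLeastAtMost_iff) linarith
      show ?thesis
        using strip_int_lborel(2)[where l = "- X i" and r = "X i" and p = "p i" and \<sigma> = "\<sigma> i" and x = x, OF cp \<sigma> \<open>x > 0\<close>] by (simp add: c_def p_def \<sigma>_def)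
    qed
    have "integral {X i/2..3*X i} (\<lambda>x. (norm (strip_int (p i) (\<sigma> i) 1 (- X i) (X i) x))\<^sup>2)
      \<le> 12 * X i * 27 * X i * (C * (20 * L i) * ((ln 2 + ln 2) / 2))"
      by (rule ord_eq_le_trans[OF integral_cong conjunct2[OF M]]) (simp only: e)
    also have "\<dots> \<le> 12 * X i * 27 * X i * (C * (20 * L i) * L i)"
      using X[of i] C L1[of i] ln_2_less_1 by (intro mult_left_mono mult_nonneg_nonneg) auto
    also have "\<dots> = 6480 * C * (X i)\<^sup>2 * (L i)\<^sup>2" by (simp add: power2_eq_square)
    finally show ?thesis .
  qed
  have B4: "continuous_on {X i/2..3*X i} W \<and> integral {X i/2..3*X i} (\<lambda>x. (norm (W x))\<^sup>2) \<le> 29160 * C * X i * (L i)\<^sup>2"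
    if W: "W = (\<lambda>x. LINT t|lborel. complex_of_real (indicator (- {- X i..X i}) t) * (of_real (p i t) * perron_kernel x (Complex (\<sigma> i) t)))" for i W
  proof -
    define c where "c t = complex_of_real (indicator (- {- X i..X i}) t) * (1 / (Complex (\<sigma> i) t * (Complex (\<sigma> i) t + 1)))" for t
    have r0: "0 \<le> K / ((2 * X i)\<^sup>2 + t\<^sup>2)" if "K \<ge> 0" for K t using that by simp
    have nc: "norm (c t) \<le> 1 / t\<^sup>2" if t: "X i \<le> \<bar>t\<bar>" for t
    proof -
      have t0: "t\<^sup>2 > 0" using t X[of i] by (intro zero_less_power2[THEN iffD2]) auto
      have "\<bar>t\<bar> * \<bar>t\<bar> \<le> norm (Complex (\<sigma> i) t) * norm (Complex (\<sigma> i) t + 1)"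
        by (intro mult_mono ns) auto
      then have "1 / (norm (Complex (\<sigma> i) t) * norm (Complex (\<sigma> i) t + 1)) \<le> 1 / t\<^sup>2"
        using t0 by (intro frac_le) (auto simp: power2_eq_square)
      then show ?thesis by (simp add: c_def norm_mult norm_divide indicator_def)
    qed
    have lnb: "ln (\<bar>t\<bar> + 2) \<le> 2 * L i * \<bar>t\<bar> / X i" if t: "X i \<le> \<bar>t\<bar>" for t
    proof -
      have q: "1 \<le> \<bar>t\<bar> / X i" using t X[of i] by simp
      have "\<bar>t\<bar> + 2 \<le> (X i + 2) * (\<bar>t\<bar> / X i)"
      proof -
        have "(X i + 2) * (\<bar>t\<bar> / X i) = \<bar>t\<bar> + 2 * (\<bar>t\<bar> / X i)" using X(2)[of i] by (simp add: field_simps)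
        then show ?thesis using q by linarith
      qed
      then have "ln (\<bar>t\<bar> + 2) \<le> ln ((X i + 2) * (\<bar>t\<bar> / X i))" by (subst ln_le_cancel_iff) (use X(2)[of i] q in auto)
      also have "\<dots> = L i + ln (\<bar>t\<bar> / X i)" unfolding L_def using X(2)[of i] q by (intro ln_mult_pos) auto
      also have "ln (\<bar>t\<bar> / X i) \<le> \<bar>t\<bar> / X i" using q ln_le_minus_one[of "\<bar>t\<bar> / X i"] by linarith
      also have "\<bar>t\<bar> / X i \<le> L i * (\<bar>t\<bar> / X i)" using q L1[of i] mult_right_mono[of 1 "L i" "\<bar>t\<bar> / X i"] by simp
      also have "L i + L i * (\<bar>t\<bar> / X i) \<le> L i * (\<bar>t\<bar> / X i) + L i * (\<bar>t\<bar> / X i)"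
        using q L1[of i] mult_left_mono[of 1 "\<bar>t\<bar> / X i" "L i"] by linarith
      finally show ?thesis by (simp add: mult_ac)
    qed
    \<comment> \<open>Here \<open>|c|^2\<close> decays like \<open>t^(-4)\<close>: one power pays
      for the growth of the logarithm beyond \<open>X\<close>, one is turned into
      \<open>1 / X\<close>, and two form the kernel.\<close>
    have h1: "(norm (c t))\<^sup>2 * ln (\<bar>t\<bar> + 2) \<le> (10 * L i / (X i)\<^sup>2) / ((2 * X i)\<^sup>2 + t\<^sup>2)" for t
    proof (cases "t \<in> {- X i..X i}")
      case False
      then have t: "X i \<le> \<bar>t\<bar>" by auto
      have tp: "\<bar>t\<bar> > 0" using t X[of i] by linarith
      have "(norm (c t))\<^sup>2 * ln (\<bar>t\<bar> + 2) \<le> (1 / t\<^sup>2)\<^sup>2 * (2 * L i * \<bar>t\<bar> / X i)"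
        by (intro mult_mono power_mono nc lnb t) auto
      also have "\<dots> = (2 * L i / X i * (1 / \<bar>t\<bar>)) * (1 / t\<^sup>2)"
      proof -
        define u where "u = \<bar>t\<bar>"
        have t2: "t\<^sup>2 = u * u" by (simp add: u_def power2_eq_square)
        have "u > 0" using tp by (simp add: u_def)
        then show ?thesis unfolding t2 u_def[symmetric] by (simp add: field_simps power2_eq_square)
      qed
      also have "\<dots> \<le> (2 * L i / X i * (1 / X i)) * (5 / ((2 * X i)\<^sup>2 + t\<^sup>2))"
        using t X[of i] L1[of i] by (intro mult_mono kb frac_le) auto
      also have "\<dots> = (10 * L i / (X i)\<^sup>2) / ((2 * X i)\<^sup>2 + t\<^sup>2)" by (simp add: power2_eq_square)
      finally show ?thesis .
    next
      case True
      then show ?thesis using r0[of "10 * L i / (X i)\<^sup>2" t] L1[of i] by (simp add: c_def)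
    qed
    have h2: "norm (c t) \<le> 5 / ((2 * X i)\<^sup>2 + t\<^sup>2)" for t
    proof (cases "t \<in> {- X i..X i}")
      case False
      then have t: "X i \<le> \<bar>t\<bar>" by auto
      show ?thesis using order_trans[OF nc[OF t] kb[OF X(1) t]] .
    next
      case True
      then show ?thesis using r0[of 5 t] by (simp add: c_def)
    qed
    have h3: "x powr (2 * (3 / 2 + a i)) \<le> 108 * (X i) ^ 3" if x: "X i / 2 \<le> x" "x \<le> 3 * X i" for x
    proof -
      have "x > 0" using x X[of i] by linarith
      then have "x powr (2 * (3 / 2)) = x ^ 3" by (simp add: powr_numeral)
      also have "\<dots> \<le> (3 * X i) ^ 3" using x \<open>x > 0\<close> by (intro power_mono) auto
      also have "\<dots> = 27 * (X i) ^ 3" by (simp add: power_mult_distrib)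
      finally show ?thesis using pw[OF x, of "3 / 2"] by simp
    qed
    have cm: "c \<in> borel_measurable lborel" unfolding c_def by (rule mi[OF m2])
    have X2: "2 \<le> 2 * X i" using X[of i] by simp
    note M = MS[OF a(1)[of i] a(2)[of i] cm X2 X(2)[of i] h1 h2 h3]
    have e: "W = (\<lambda>x. LINT t|lborel. c t * of_real (Re (zlog (Complex (1 / 2 + a i) t))) * zterm x (- Complex (3 / 2 + a i) t))"
    proof -
      have "Complex (\<sigma> i) t + 1 = Complex (3 / 2 + a i) t" for t by (simp add: complex_eq_iff \<sigma>_def)
      then show ?thesis unfolding W c_def perron_kernel_def p_def \<sigma>_def by (simp add: mult_ac)
    qed
    have "integral {X i/2..3*X i} (\<lambda>x. (norm (W x))\<^sup>2)
      \<le> 108 * (X i) ^ 3 * 27 * X i * (C * (10 * L i / (X i)\<^sup>2) * ((ln 2 + ln (2 * X i)) / (2 * X i)))"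
      using M unfolding e by blast
    also have "\<dots> \<le> 108 * (X i) ^ 3 * 27 * X i * (C * (10 * L i / (X i)\<^sup>2) * ((2 * L i) / (2 * X i)))"
      using X[of i] C L1[of i] lnT[OF X(1) order_refl] by (intro mult_left_mono divide_right_mono mult_nonneg_nonneg) auto
    also have "\<dots> = 29160 * C * X i * (L i)\<^sup>2"
      using X(2)[of i] by (simp add: field_simps power2_eq_square power3_eq_cube)
    finally show ?thesis using M unfolding e by blast
  qed
  define D where "D = 29160 * C"
  have D: "D > 0" "1080 * C \<le> D" "1620 * C \<le> D" "6480 * C \<le> D" using C by (auto simp: D_def)
  have sub: "c1 * y \<le> D * y" if "c1 \<le> D" "0 \<le> y" for c1 y using that by (intro mult_right_mono) auto
  show ?thesis
  proof (rule that[OF D(1)])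
    fix i T a' p' assume *: "a' = 1 / (real i + 2)" "p' = (\<lambda>t. Re (zlog (Complex (1 / 2 + a') t)))" and T: "1 \<le> (T::real)" "T \<le> 2 ^ i"
    have e: "p' = p i" "1 / 2 + a' = \<sigma> i" "2 ^ i = X i" "ln (X i + 2) = L i"
      using * by (auto simp: a_def p_def \<sigma>_def X_def L_def)
    have TX: "T \<le> X i" using T by (simp add: X_def)
    show "integral {2 ^ i / 2..3 * 2 ^ i} (\<lambda>x. (norm (strip_int p' (1 / 2 + a') 0 (- T) T x))\<^sup>2) \<le> D * T * (ln (2 ^ i + 2))\<^sup>2"
      unfolding e by (rule order_trans[OF B1[OF T(1) TX]]) (use sub[OF D(2), of "T * (L i)\<^sup>2"] T in \<open>simp add: mult.assoc del: mult_le_cancel_left\<close>)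
    have s2: "1620 * C * (X i)\<^sup>2 * (L i)\<^sup>2 / T \<le> D * (X i)\<^sup>2 * (L i)\<^sup>2 / T"
      using sub[OF D(3), of "(X i)\<^sup>2 * (L i)\<^sup>2"] T by (intro divide_right_mono) (auto simp: mult.assoc)
    show "integral {2 ^ i / 2..3 * 2 ^ i} (\<lambda>x. (norm (strip_int p' (1 / 2 + a') 1 T (2 ^ i) x))\<^sup>2) \<le> D * (2 ^ i)\<^sup>2 * (ln (2 ^ i + 2))\<^sup>2 / T"
      unfolding e by (rule order_trans[OF B2[OF T(1) TX] s2]) (use T in auto)
    show "integral {2 ^ i / 2..3 * 2 ^ i} (\<lambda>x. (norm (strip_int p' (1 / 2 + a') 1 (- (2 ^ i)) (- T) x))\<^sup>2) \<le> D * (2 ^ i)\<^sup>2 * (ln (2 ^ i + 2))\<^sup>2 / T"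
      unfolding e by (rule order_trans[OF B2[OF T(1) TX] s2]) (use T in auto)
  next
    fix i a' p' assume *: "a' = 1 / (real i + 2)" "p' = (\<lambda>t. Re (zlog (Complex (1 / 2 + a') t)))"
    have e: "p' = p i" "1 / 2 + a' = \<sigma> i" "2 ^ i = X i" "ln (X i + 2) = L i"
      using * by (auto simp: a_def p_def \<sigma>_def X_def L_def)
    show "integral {2 ^ i / 2..3 * 2 ^ i} (\<lambda>x. (norm (strip_int p' (1 / 2 + a') 1 (- (2 ^ i)) (2 ^ i) x))\<^sup>2) \<le> D * (2 ^ i)\<^sup>2 * (ln (2 ^ i + 2))\<^sup>2"
      unfolding e using B3[of i] sub[OF D(4), of "(X i)\<^sup>2 * (L i)\<^sup>2"] by (simp add: mult.assoc)
    fix W assume W: "W = (\<lambda>x. LINT t|lborel. complex_of_real (indicator (- {- (2 ^ i)..2 ^ i}) t) * (of_real (p' t) * perron_kernel x (Complex (1 / 2 + a') t)))"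
    show "continuous_on {2 ^ i / 2..3 * 2 ^ i} W \<and>
       integral {2 ^ i / 2..3 * 2 ^ i} (\<lambda>x. (norm (W x))\<^sup>2) \<le> D * 2 ^ i * (ln (2 ^ i + 2))\<^sup>2"
      using B4[OF W[unfolded e]] unfolding e D_def .
  qed
qed

text \<open>A mixed difference with steps 1 and \<open>h\<close>: the unit step undoes the
  smoothing, and the step \<open>h\<close> is the one that the dyadic identity calls for.\<close>

definition second_diff :: "real \<Rightarrow> (real \<Rightarrow> 'a::real_normed_vector) \<Rightarrow> real \<Rightarrow> 'a" where
  "second_diff h f x = (f (x + 1) - f (x + 1 - h)) - (f x - f (x - h))"

lemma continuous_on_shift_real:
  fixes f :: "real \<Rightarrow> 'a::real_normed_vector"
  assumes "continuous_on {u..v} f" "u \<le> A + c" "B + c \<le> v"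
  shows "continuous_on {A..B} (\<lambda>x. f (x + c))"
  by (rule continuous_on_compose2[OF assms(1)]) (use assms in \<open>auto intro!: continuous_intros\<close>)

lemma second_diff_continuous:
  fixes f :: "real \<Rightarrow> 'a::real_normed_vector"
  assumes f: "continuous_on {X/2..3*X} f" and X: "X \<ge> 2" and h: "0 \<le> h" "h \<le> X / 2"
  shows "continuous_on {X..2*X} (second_diff h f)"
proof -
  have "continuous_on {X..2*X} (\<lambda>x. (f (x + 1) - f (x + (1 - h))) - (f (x + 0) - f (x + (- h))))"
    by (intro continuous_intros continuous_on_shift_real[OF f]) (use X h in auto)
  then show ?thesis by (simp add: second_diff_def[abs_def] add_diff_eq)
qed

text \<open>Meant for the frequencies beyond \<open>X\<close>, where the kernel decays fast enough
  that no cancellation is required. Four shifted copies, each with a factor 4, make 16.\<close>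

lemma second_diff_mean_square:
  fixes f :: "real \<Rightarrow> complex"
  assumes f: "continuous_on {X/2..3*X} f" and X: "X \<ge> 2" and h: "0 \<le> h" "h \<le> X / 2"
  shows "integral {X..2*X} (\<lambda>x. (norm (second_diff h f x))\<^sup>2) \<le> 16 * integral {X/2..3*X} (\<lambda>x. (norm (f x))\<^sup>2)"
proof -
  define N where "N = (\<lambda>x. (norm (f x))\<^sup>2)"
  have cN: "continuous_on {X/2..3*X} N" unfolding N_def by (intro continuous_intros f)
  have N0: "N x \<ge> 0" for x by (simp add: N_def)
  define U where "U c = (\<lambda>x. 4 * N (x + c))" for c
  have s: "integral {X..2*X} (U c) \<le> 4 * integral {X/2..3*X} N" "U c integrable_on {X..2*X}"
    if "- (X / 2) \<le> c" "c \<le> X" for c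
  proof -
    note S = integral_shifted_le[OF cN N0, of X c "2*X"]
    show "integral {X..2*X} (U c) \<le> 4 * integral {X/2..3*X} N"
      unfolding U_def using S(1) that X by simp
    show "U c integrable_on {X..2*X}" unfolding U_def using integrable_on_cmult_left[OF S(2), of 4] that X by simp
  qed
  have i: "(\<lambda>x. U 1 x + U (1 - h) x) integrable_on {X..2*X}" "(\<lambda>x. U 0 x + U (- h) x) integrable_on {X..2*X}"
    by (intro Henstock_Kurzweil_Integration.integrable_add s; use X h in simp)+
  have "integral {X..2*X} (\<lambda>x. (norm (second_diff h f x))\<^sup>2)
      \<le> integral {X..2*X} (\<lambda>x. (U 1 x + U (1 - h) x) + (U 0 x + U (- h) x))"
  proof (rule integral_le)
    show "(\<lambda>x. (norm (second_diff h f x))\<^sup>2) integrable_on {X..2*X}"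
      by (intro integrable_continuous_interval continuous_intros second_diff_continuous assms)
    show "(\<lambda>x. (U 1 x + U (1 - h) x) + (U 0 x + U (- h) x)) integrable_on {X..2*X}"
      by (intro Henstock_Kurzweil_Integration.integrable_add i)
    fix x
    show "(norm (second_diff h f x))\<^sup>2 \<le> (U 1 x + U (1 - h) x) + (U 0 x + U (- h) x)"
      using norm_diff_squared_le[of "f (x + 1) - f (x + 1 - h)" "f x - f (x - h)"]
        norm_diff_squared_le[of "f (x + 1)" "f (x + 1 - h)"] norm_diff_squared_le[of "f x" "f (x - h)"]
      by (simp add: second_diff_def U_def N_def add_diff_eq)
  qed
  also have "\<dots> = (integral {X..2*X} (U 1) + integral {X..2*X} (U (1 - h))) + (integral {X..2*X} (U 0) + integral {X..2*X} (U (- h)))"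
    using i s X h by (simp add: Henstock_Kurzweil_Integration.integral_add)
  also have "\<dots> \<le> 16 * integral {X/2..3*X} N"
    using s(1)[of 1] s(1)[of "1 - h"] s(1)[of 0] s(1)[of "- h"] X h by simp
  finally show ?thesis by (simp add: N_def)
qed

text \<open>With \<open>max 0\<close> in place of the cut at \<open>x\<close> the range of summation
  no longer depends on \<open>x\<close>, and continuity becomes visible.\<close>

lemma smoothed_psi_error_eq:
  assumes "0 \<le> x" "x \<le> real M"
  shows "smoothed_psi_error x = (\<Sum>k<M. mangoldt (Suc k) * max 0 (x - real (Suc k))) - (x - 1)\<^sup>2 / 2"
proof -
  have "(\<Sum>n<nat \<lfloor>x\<rfloor>. mangoldt (Suc n) * (x - real (Suc n))) = (\<Sum>k<M. mangoldt (Suc k) * max 0 (x - real (Suc k)))"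
  proof (rule sum.mono_neutral_cong_left)
    show "{..<nat \<lfloor>x\<rfloor>} \<subseteq> {..<M}" using assms by (auto; linarith)
    show "\<forall>i\<in>{..<M} - {..<nat \<lfloor>x\<rfloor>}. mangoldt (Suc i) * max 0 (x - real (Suc i)) = 0"
    proof
      fix k assume "k \<in> {..<M} - {..<nat \<lfloor>x\<rfloor>}"
      then have "x - real (Suc k) \<le> 0" using assms by (auto; linarith)
      then show "mangoldt (Suc k) * max 0 (x - real (Suc k)) = 0" by simp
    qed
    fix k assume "k \<in> {..<nat \<lfloor>x\<rfloor>}"
    then have "real (Suc k) \<le> x" using assms by (auto; linarith)
    then show "mangoldt (Suc k) * (x - real (Suc k)) = mangoldt (Suc k) * max 0 (x - real (Suc k))" by simp
  qed auto
  then show ?thesis by (simp add: smoothed_psi_error_def)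
qed

lemma smoothed_psi_error_continuous:
  assumes "u \<ge> 0"
  shows "continuous_on {u..v} smoothed_psi_error"
proof -
  obtain M where M: "v \<le> real M" using real_arch_simple by blast
  have "continuous_on {u..v} (\<lambda>x. (\<Sum>k<M. mangoldt (Suc k) * max 0 (x - real (Suc k))) - (x - 1)\<^sup>2 / 2)"
    by (intro continuous_intros) auto
  then show ?thesis
    by (rule continuous_on_cong[THEN iffD1, rotated -1]) (use M assms in \<open>simp_all add: smoothed_psi_error_eq[of _ M]\<close>)
qed

lemma strip_int_split:
  assumes p: "continuous_on UNIV p" and \<sigma>: "\<sigma> > 0" and x: "x > 0" and T: "0 \<le> T" "T \<le> X"
  shows "strip_int p \<sigma> 2 (- X) X x = strip_int p \<sigma> 2 (- X) (- T) x + strip_int p \<sigma> 2 (- T) T x + strip_int p \<sigma> 2 T X x"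
proof -
  define f where "f t = p t * (zterm x (- (Complex \<sigma> t + 1)) / (Complex \<sigma> t * (Complex \<sigma> t + 1)))" for t
  have nz: "Complex \<sigma> t \<noteq> 0" "Complex \<sigma> t + 1 \<noteq> 0" for t
    using \<sigma> s_s1_nonzero[of "Complex \<sigma> t"] by auto
  have cs: "continuous_on UNIV (\<lambda>t. Complex \<sigma> t)"
    unfolding Complex_eq by (intro continuous_intros)
  have "continuous_on UNIV f" unfolding f_def
    by (intro continuous_intros cs p) (use nz x in auto)
  then have i: "f integrable_on {l..r}" for l r
    by (intro integrable_continuous_interval) (rule continuous_on_subset, auto)
  have e: "strip_int p \<sigma> 2 l r x = integral {l..r} f" for l r
    by (simp add: strip_int_def f_def[abs_def])
  have "integral {- X..X} f = integral {- X..- T} f + integral {- T..X} f"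
    "integral {- T..X} f = integral {- T..T} f + integral {T..X} f"
    using T by (auto intro!: Henstock_Kurzweil_Integration.integral_combine[symmetric] i)
  then show ?thesis unfolding e by (simp only: add.assoc)
qed

lemma integral_norm_sum_squared_le:
  fixes f g :: "real \<Rightarrow> complex"
  assumes "continuous_on {a..b} f" "continuous_on {a..b} g"
  shows "integral {a..b} (\<lambda>x. (norm (f x + g x))\<^sup>2)
      \<le> 2 * integral {a..b} (\<lambda>x. (norm (f x))\<^sup>2) + 2 * integral {a..b} (\<lambda>x. (norm (g x))\<^sup>2)"
proof -
  have i: "(\<lambda>x. 2 * (norm (f x))\<^sup>2) integrable_on {a..b}" "(\<lambda>x. 2 * (norm (g x))\<^sup>2) integrable_on {a..b}"
    by (intro integrable_continuous_interval continuous_intros assms)+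
  have "integral {a..b} (\<lambda>x. (norm (f x + g x))\<^sup>2) \<le> integral {a..b} (\<lambda>x. 2 * (norm (f x))\<^sup>2 + 2 * (norm (g x))\<^sup>2)"
    by (intro integral_le Henstock_Kurzweil_Integration.integrable_add i integrable_continuous_interval continuous_intros assms norm_sum_squared_le)
  also have "\<dots> = 2 * integral {a..b} (\<lambda>x. (norm (f x))\<^sup>2) + 2 * integral {a..b} (\<lambda>x. (norm (g x))\<^sup>2)"
    using i by (simp add: Henstock_Kurzweil_Integration.integral_add)
  finally show ?thesis .
qed

lemma strip_int_continuous:
  assumes p: "continuous_on UNIV p" and \<sigma>: "\<sigma> > 0" and S: "S \<subseteq> {0<..}"
  shows "continuous_on S (strip_int p \<sigma> 2 l r)" "continuous_on S (strip_int p \<sigma> 1 l r)"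
proof -
  have pc: "continuous_on {l..r} p" using p by (rule continuous_on_subset) auto
  show "continuous_on S (strip_int p \<sigma> 2 l r)" "continuous_on S (strip_int p \<sigma> 1 l r)"
    using S strip_int_derivs[OF pc \<sigma>]
    by (auto intro!: continuous_at_imp_continuous_on has_vector_derivative_continuous)
qed

text \<open>The explicit formula is cut into frequency ranges. The mixed difference removes the
  linear polynomial entirely; the plain unit difference keeps \<open>\<alpha>\<close>, which is
  bounded and contributes only a multiple of the length of the interval.\<close>

lemma smoothed_psi_error_mean_squares:
  assumes RH: "riemann_hypothesis"
  obtains C where "C > 0"
    "\<And>i j. j < i \<Longrightarrow> integral {2 ^ i..2 * 2 ^ i} (\<lambda>x. (second_diff (2 ^ j) smoothed_psi_error x)\<^sup>2) \<le> C * 2 ^ j * 2 ^ i * (ln (2 ^ i + 2))\<^sup>2"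
    "\<And>i. integral {2 ^ i..2 * 2 ^ i} (\<lambda>x. (smoothed_psi_error (x + 1) - smoothed_psi_error x)\<^sup>2) \<le> C * (2 ^ i)\<^sup>2 * (ln (2 ^ i + 2))\<^sup>2"
proof (rule zlog_strip_bounds[OF RH], rule explicit_formula[OF RH], goal_cases)
  case (1 C C')
  note C = 1(2) and B0 = 1(3) and B1 = 1(4) and B2 = 1(5) and B3 = 1(6) and B4 = 1(7) and C' = 1(8) and EF = 1(9)
  define V where "V x = complex_of_real (smoothed_psi_error x)" for x
  define Y :: "nat \<Rightarrow> real" where "Y i = 2 ^ i" for i
  define a where "a i = 1 / (real i + 2)" for i :: nat
  define p where "p i = (\<lambda>t. Re (zlog (Complex (1 / 2 + a i) t)))" for i
  define S where "S i l r = strip_int (p i) (1 / 2 + a i) 2 l r" for i l r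
  define W where "W i = (\<lambda>x. LINT t|lborel. complex_of_real (indicator (- {- (2 ^ i)..2 ^ i}) t) * (of_real (p i t) * perron_kernel x (Complex (1 / 2 + a i) t)))" for i
  have a: "0 < a i" "a i \<le> 1 / 2" for i by (auto simp: a_def field_simps)
  have \<sigma>: "1 / 2 + a i > 0" for i using a[of i] by simp
  have Y: "Y i \<ge> 1" "Y i > 0" for i by (auto simp: Y_def)
  have cp: "continuous_on A (p i)" for A i
    unfolding p_def by (rule zlog_line_continuous[OF RH a(1)])
  have W: "continuous_on {Y i / 2..3 * Y i} (W i)"
    "integral {Y i / 2..3 * Y i} (\<lambda>x. (norm (W i x))\<^sup>2) \<le> C * Y i * (ln (Y i + 2))\<^sup>2" for i
    using B4[OF a_def p_def W_def] unfolding Y_def by auto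
  have cS: "continuous_on A (S i l r)" if "A \<subseteq> {0<..}" for A i l r
    unfolding S_def by (rule strip_int_continuous(1)[OF cp \<sigma> that])
  have "\<exists>\<alpha> \<beta>. norm \<alpha> \<le> C' \<and> (\<forall>x\<ge>1. V x = \<alpha> * x - \<beta> - (S i (- Y i) (Y i) x + W i x) / pi)" for i
  proof -
    obtain \<alpha> \<beta> :: complex where \<alpha>: "norm \<alpha> \<le> C'" and
      ef: "\<And>x. x \<ge> 1 \<Longrightarrow> integrable lborel (\<lambda>t. of_real (p i t) * perron_kernel x (Complex (1 / 2 + a i) t)) \<and>
       (LINT t|lborel. of_real (p i t) * perron_kernel x (Complex (1 / 2 + a i) t)) = pi * (\<alpha> * x - \<beta> - V x)"
      using EF[OF a, of i] unfolding p_def V_def by blast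
    have "V x = \<alpha> * x - \<beta> - (S i (- Y i) (Y i) x + W i x) / pi" if x: "x \<ge> 1" for x
    proof -
      define f where "f t = complex_of_real (p i t) * perron_kernel x (Complex (1 / 2 + a i) t)" for t
      have fi: "integrable lborel f" and fe: "(LINT t|lborel. f t) = pi * (\<alpha> * x - \<beta> - V x)"
        using ef[OF x] unfolding f_def by auto
      have ii: "integrable lborel (\<lambda>t. complex_of_real (indicator A t) * f t)" if "A \<in> sets lborel" for A
        using integrable_mult_indicator[OF that fi] by (simp add: scaleR_conv_of_real)
      have x0: "x > 0" using x by simp
      have "S i (- Y i) (Y i) x + W i x = (LINT t|lborel. complex_of_real (indicator {- Y i..Y i} t) * f t) + (LINT t|lborel. complex_of_real (indicator (- {- Y i..Y i}) t) * f t)"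
        unfolding S_def W_def strip_int_lborel(1)[OF cp \<sigma> x0] f_def Y_def ..
      also have "\<dots> = (LINT t|lborel. complex_of_real (indicator {- Y i..Y i} t) * f t + complex_of_real (indicator (- {- Y i..Y i}) t) * f t)"
        by (rule Bochner_Integration.integral_add[symmetric]; rule ii) auto
      also have "\<dots> = (LINT t|lborel. f t)"
        by (rule Bochner_Integration.integral_cong) (auto simp: indicator_def)
      finally show ?thesis unfolding fe by simp
    qed
    then show ?thesis using \<alpha> by blast
  qed
  then obtain \<alpha> \<beta> where \<alpha>: "\<And>i. norm (\<alpha> i) \<le> C'" and V: "\<And>i x. x \<ge> 1 \<Longrightarrow> V x = \<alpha> i * x - \<beta> i - (S i (- Y i) (Y i) x + W i x) / pi"
    by metis
  have pi1: "1 \<le> pi" using pi_gt3 by simp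
  have short: "integral {Y i..2 * Y i} (\<lambda>x. (second_diff (Y j) smoothed_psi_error x)\<^sup>2) \<le> (100 * C) * Y j * Y i * (ln (Y i + 2))\<^sup>2"
    if ij: "j < i" for i j
  proof -
    \<comment> \<open>The choice \<open>T = X / h\<close> balances the two alternatives of
      \<open>strip_second_difference\<close>: \<open>h^2 T\<close> from the low frequencies and
      \<open>X^2 / T\<close> from the high ones both equal \<open>h X\<close>.\<close>
    define X h T :: real where "X = Y i" and "h = Y j" and "T = 2 ^ (i - j)"
    have hT: "h * T = X" using ij by (simp add: h_def T_def X_def Y_def flip: power_add)
    have "2 ^ 1 \<le> (2::real) ^ (i - j)" using ij by (intro power_increasing) auto
    then have T2: "T \<ge> 2" by (simp add: T_def)
    have h1: "h \<ge> 1" using Y by (simp add: h_def)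
    have TX: "T \<le> X" using mult_right_mono[OF h1, of T] T2 hT by simp
    have X2: "X \<ge> 2" using TX T2 by simp
    have hX: "h \<le> X / 2" using mult_left_mono[OF T2, of h] h1 hT by simp
    have h0: "0 \<le> h" using h1 by simp
    \<comment> \<open>Pieces 0 and 2 are the high frequencies, piece 1 the low ones, piece 3 the
      tail beyond \<open>X\<close>.\<close>
    define f where "f k = (if k = 0 then S i (- X) (- T) else if k = 1 then S i (- T) T else if k = 2 then S i T X else W i)" for k :: nat
    have cf: "continuous_on {X/2..3*X} (f k)" for k
      unfolding f_def using W(1)[of i] X2 by (auto simp: X_def intro!: cS)
    have VV: "V x = \<alpha> i * x - \<beta> i - ((f 0 x + f 1 x) + (f 2 x + f 3 x)) / pi" if "x \<ge> 1" for x
      using V[OF that, of i] strip_int_split[OF cp \<sigma>, of x T X i i] that T2 TX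
      by (simp add: f_def S_def X_def add.assoc)
    have dd: "(second_diff h smoothed_psi_error x)\<^sup>2 \<le> (norm ((second_diff h (f 0) x + second_diff h (f 1) x) + (second_diff h (f 2) x + second_diff h (f 3) x)))\<^sup>2"
      if x: "x \<in> {X..2*X}" for x
    proof -
      have g: "x + 1 \<ge> 1" "x + 1 - h \<ge> 1" "x \<ge> 1" "x - h \<ge> 1" using x X2 hX by auto
      define Z where "Z = (second_diff h (f 0) x + second_diff h (f 1) x) + (second_diff h (f 2) x + second_diff h (f 3) x)"
      have "complex_of_real (second_diff h smoothed_psi_error x) = second_diff h V x"
        by (simp add: second_diff_def V_def)
      also have "\<dots> = - Z / pi"
        unfolding second_diff_def VV[OF g(1)] VV[OF g(2)] VV[OF g(3)] VV[OF g(4)] Z_def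
        by (simp add: field_simps)
      finally have "\<bar>second_diff h smoothed_psi_error x\<bar> = norm Z / pi"
        by (metis norm_divide norm_minus_cancel norm_of_real abs_of_pos pi_gt_zero)
      also have "\<dots> \<le> norm Z" using pi1 by (simp add: divide_le_eq mult_le_cancel_left1)
      finally show ?thesis unfolding Z_def by (rule power2_le_iff_abs_le[THEN iffD2, rotated]) simp
    qed
    have cd: "continuous_on {X..2*X} (second_diff h (f k))" for k
      by (rule second_diff_continuous[OF cf X2 h0 hX])
    have cV: "continuous_on {X..2*X} (second_diff h smoothed_psi_error)"
      by (rule second_diff_continuous[OF smoothed_psi_error_continuous X2 h0 hX]) (use X2 in simp)
    define I where "I k = integral {X..2*X} (\<lambda>x. (norm (second_diff h (f k) x))\<^sup>2)" for k
    have "integral {X..2*X} (\<lambda>x. (second_diff h smoothed_psi_error x)\<^sup>2)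
        \<le> integral {X..2*X} (\<lambda>x. (norm ((second_diff h (f 0) x + second_diff h (f 1) x) + (second_diff h (f 2) x + second_diff h (f 3) x)))\<^sup>2)"
      by (intro integral_le dd integrable_continuous_interval continuous_intros cd cV)
    also have "\<dots> \<le> 2 * integral {X..2*X} (\<lambda>x. (norm (second_diff h (f 0) x + second_diff h (f 1) x))\<^sup>2)
        + 2 * integral {X..2*X} (\<lambda>x. (norm (second_diff h (f 2) x + second_diff h (f 3) x))\<^sup>2)"
      by (intro integral_norm_sum_squared_le continuous_intros cd)
    also have "\<dots> \<le> 2 * (2 * I 0 + 2 * I 1) + 2 * (2 * I 2 + 2 * I 3)"
      unfolding I_def by (intro add_mono mult_left_mono integral_norm_sum_squared_le cd) auto
    finally have le: "integral {X..2*X} (\<lambda>x. (second_diff h smoothed_psi_error x)\<^sup>2) \<le> 4 * I 0 + 4 * I 1 + 4 * I 2 + 4 * I 3" by simp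
    define K where "K = C * h * X * (ln (X + 2))\<^sup>2"
    have sT: "C * X\<^sup>2 * (ln (X + 2))\<^sup>2 / T = K"
      using hT T2 by (auto simp: K_def power2_eq_square field_simps)
    have T1: "1 \<le> T" using T2 by simp
    have TX': "T \<le> 2 ^ i" using TX by (simp add: X_def Y_def)
    have k0: "I 0 \<le> 4 * K"
    proof -
      have "I 0 \<le> 4 * integral {X/2..3*X} (\<lambda>x. (norm (strip_int (p i) (1 / 2 + a i) 1 (- X) (- T) x))\<^sup>2)"
        unfolding I_def f_def second_diff_def S_def
        using strip_second_difference(2)[OF cp \<sigma> X2 h0 hX, of i i "- X" "- T"] by simp
      also have "\<dots> \<le> 4 * K"
        using B2[OF a_def p_def T1 TX'] unfolding sT[symmetric] by (simp add: X_def Y_def)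
      finally show ?thesis .
    qed
    have k2: "I 2 \<le> 4 * K"
    proof -
      have "I 2 \<le> 4 * integral {X/2..3*X} (\<lambda>x. (norm (strip_int (p i) (1 / 2 + a i) 1 T X x))\<^sup>2)"
        unfolding I_def f_def second_diff_def S_def
        using strip_second_difference(2)[OF cp \<sigma> X2 h0 hX, of i i T X] by simp
      also have "\<dots> \<le> 4 * K"
        using B1[OF a_def p_def T1 TX'] unfolding sT[symmetric] by (simp add: X_def Y_def)
      finally show ?thesis .
    qed
    have k1: "I 1 \<le> K"
    proof -
      have "I 1 \<le> h\<^sup>2 * integral {X/2..3*X} (\<lambda>x. (norm (strip_int (p i) (1 / 2 + a i) 0 (- T) T x))\<^sup>2)"
        unfolding I_def f_def second_diff_def S_def
        using strip_second_difference(1)[OF cp \<sigma> X2 h0 hX, of i i "- T" T] by simp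
      also have "\<dots> \<le> h\<^sup>2 * (C * T * (ln (X + 2))\<^sup>2)"
        using B0[OF a_def p_def T1 TX'] by (intro mult_left_mono) (simp_all add: X_def Y_def)
      also have "\<dots> = K" unfolding K_def hT[symmetric] by (simp add: power2_eq_square)
      finally show ?thesis .
    qed
    have k3: "I 3 \<le> 16 * K"
    proof -
      have "I 3 \<le> 16 * integral {X/2..3*X} (\<lambda>x. (norm (W i x))\<^sup>2)"
        using second_diff_mean_square[OF cf X2 h0 hX, of 3] by (simp add: I_def f_def)
      also have "\<dots> \<le> 16 * (C * X * (ln (X + 2))\<^sup>2)" using W(2)[of i] by (simp add: X_def)
      also have "\<dots> \<le> 16 * K"
      proof -
        have "1 * (C * X * (ln (X + 2))\<^sup>2) \<le> h * (C * X * (ln (X + 2))\<^sup>2)"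
          using C X2 by (intro mult_right_mono h1) auto
        then show ?thesis by (simp add: K_def mult_ac)
      qed
      finally show ?thesis .
    qed
    show ?thesis using le k0 k1 k2 k3 by (simp add: K_def X_def h_def)
  qed
  \<comment> \<open>\<open>20 C = 4 C + 16 C\<close> accounts for the frequencies below and above
    \<open>X\<close>; the other summand covers \<open>\<alpha>\<close>.\<close>
  define D where "D = 2 * C'\<^sup>2 * 4 + 20 * C"
  have long: "integral {Y i..2 * Y i} (\<lambda>x. (smoothed_psi_error (x + 1) - smoothed_psi_error x)\<^sup>2) \<le> D * (Y i)\<^sup>2 * (ln (Y i + 2))\<^sup>2" for i
  proof -
    define X where "X = Y i"
    have X1: "X \<ge> 1" using Y by (simp add: X_def)
    define d where "d f x = f (x + 1) - f x" for f :: "real \<Rightarrow> complex" and x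
    define Si where "Si = S i (- X) X"
    define G where "G = strip_int (p i) (1 / 2 + a i) 1 (- X) X"
    have cG: "continuous_on A G" if "A \<subseteq> {0<..}" for A
      unfolding G_def by (rule strip_int_continuous(2)[OF cp \<sigma> that])
    have cd: "continuous_on {X..2*X} (d f)" if "continuous_on {X/2..3*X} f" for f
    proof -
      have "continuous_on {X..2*X} (\<lambda>x. f (x + 1) - f (x + 0))"
        by (intro continuous_intros continuous_on_shift_real[OF that]) (use X1 in auto)
      then show ?thesis by (simp add: d_def[abs_def])
    qed
    have c1: "continuous_on {X..2*X} (d Si)" unfolding Si_def by (intro cd cS) (use X1 in auto)
    have c2: "continuous_on {X..2*X} (d (W i))" using W(1)[of i] by (intro cd) (simp add: X_def)
    have cV: "continuous_on {X..2*X} (\<lambda>x. smoothed_psi_error (x + 1) - smoothed_psi_error x)"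
      by (intro continuous_intros continuous_on_shift_real[OF smoothed_psi_error_continuous[of X "3*X"]] smoothed_psi_error_continuous)
         (use X1 in auto)
    have pw: "(smoothed_psi_error (x + 1) - smoothed_psi_error x)\<^sup>2 \<le> 2 * (norm (d Si x + d (W i) x))\<^sup>2 + 2 * C'\<^sup>2"
      if x: "x \<in> {X..2*X}" for x
    proof -
      have g: "x + 1 \<ge> 1" "x \<ge> 1" using x X1 by auto
      define Z where "Z = d Si x + d (W i) x"
      have "complex_of_real (smoothed_psi_error (x + 1) - smoothed_psi_error x) = V (x + 1) - V x"
        by (simp add: V_def)
      also have "\<dots> = \<alpha> i - Z / pi"
        unfolding V[OF g(1), of i] V[OF g(2), of i] Z_def d_def Si_def X_def
        by (simp add: field_simps)
      finally have "(smoothed_psi_error (x + 1) - smoothed_psi_error x)\<^sup>2 = (norm (\<alpha> i - Z / pi))\<^sup>2"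
        by (metis norm_of_real power2_abs)
      also have "\<dots> \<le> 2 * (norm (\<alpha> i))\<^sup>2 + 2 * (norm (Z / pi))\<^sup>2" by (rule norm_diff_squared_le)
      also have "\<dots> \<le> 2 * C'\<^sup>2 + 2 * (norm Z)\<^sup>2"
      proof -
        have "norm (Z / pi) \<le> norm Z" using pi1 by (simp add: norm_divide divide_le_eq mult_le_cancel_left1)
        then show ?thesis using \<alpha>[of i] by (intro add_mono mult_left_mono power_mono) auto
      qed
      finally show ?thesis unfolding Z_def by simp
    qed
    have b1: "integral {X..2*X} (\<lambda>x. (norm (d Si x))\<^sup>2) \<le> C * X\<^sup>2 * (ln (X + 2))\<^sup>2"
    proof -
      have "integral {X..2*X} (\<lambda>x. (norm (d Si x))\<^sup>2) \<le> 1\<^sup>2 * integral {X..2*X+1} (\<lambda>x. (norm (G x))\<^sup>2)"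
        unfolding d_def
      proof (rule integral_difference_squared_le)
        show "(Si has_vector_derivative G x) (at x)" if "X \<le> x" for x
          unfolding Si_def S_def G_def by (rule strip_int_derivs(1)[OF cp \<sigma>]) (use that X1 in auto)
        show "continuous_on {X..2*X+1} G" by (rule cG) (use X1 in auto)
      qed (use X1 in auto)
      also have "\<dots> \<le> integral {X/2..3*X} (\<lambda>x. (norm (G x))\<^sup>2)"
        unfolding power_one mult_1_left
        by (intro integral_subset_le integrable_continuous_interval continuous_intros cG) (use X1 in auto)
      also have "\<dots> \<le> C * X\<^sup>2 * (ln (X + 2))\<^sup>2" using B3[OF a_def p_def] by (simp add: G_def X_def Y_def)
      finally show ?thesis .
    qed
    have ln1: "1 \<le> ln (X + 2)"
    proof -
      have "exp 1 \<le> (3::real)" by (rule exp_le)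
      also have "3 \<le> X + 2" using X1 by simp
      finally show ?thesis using X1 by (simp add: ln_ge_iff)
    qed
    have X2: "X \<le> X\<^sup>2 * (ln (X + 2))\<^sup>2"
    proof -
      have "X * (1 * 1) \<le> (X * X) * (ln (X + 2))\<^sup>2" using X1 ln1
        by (intro mult_mono) (auto simp: one_le_power)
      then show ?thesis by (simp add: power2_eq_square)
    qed
    have b2: "integral {X..2*X} (\<lambda>x. (norm (d (W i) x))\<^sup>2) \<le> 4 * (C * X\<^sup>2 * (ln (X + 2))\<^sup>2)"
    proof -
      define N where "N = (\<lambda>x. 2 * (norm (W i x))\<^sup>2)"
      have cN: "continuous_on {X/2..3*X} N" unfolding N_def X_def by (intro continuous_intros W)
      have N0: "N x \<ge> 0" for x by (simp add: N_def)
      note s1 = integral_shifted_le[OF cN N0, of X 1 "2*X"] and s0 = integral_shifted_le[OF cN N0, of X 0 "2*X"]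
      have i: "(\<lambda>x. N (x + 1)) integrable_on {X..2*X}" "N integrable_on {X..2*X}" using s1(2) s0(2) X1 by auto
      have "integral {X..2*X} (\<lambda>x. (norm (d (W i) x))\<^sup>2) \<le> integral {X..2*X} (\<lambda>x. N (x + 1) + N x)"
        by (intro integral_le Henstock_Kurzweil_Integration.integrable_add i integrable_continuous_interval continuous_intros c2)
           (use norm_diff_squared_le in \<open>auto simp: N_def d_def\<close>)
      also have "\<dots> = integral {X..2*X} (\<lambda>x. N (x + 1)) + integral {X..2*X} N"
        by (rule Henstock_Kurzweil_Integration.integral_add[OF i])
      also have "\<dots> \<le> 2 * integral {X/2..3*X} N" using s1(1) s0(1) X1 by simp
      also have "\<dots> = 4 * integral {X/2..3*X} (\<lambda>x. (norm (W i x))\<^sup>2)" by (simp add: N_def)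
      also have "\<dots> \<le> 4 * (C * X * (ln (X + 2))\<^sup>2)" using W(2)[of i] by (simp add: X_def)
      also have "\<dots> \<le> 4 * (C * X\<^sup>2 * (ln (X + 2))\<^sup>2)"
        using C X1 by (intro mult_left_mono mult_right_mono) (auto simp: power2_eq_square)
      finally show ?thesis .
    qed
    define J where "J = (\<lambda>x. 2 * (norm (d Si x + d (W i) x))\<^sup>2)"
    have iJ: "J integrable_on {X..2*X}" unfolding J_def by (intro integrable_continuous_interval continuous_intros c1 c2)
    have "integral {X..2*X} (\<lambda>x. (smoothed_psi_error (x + 1) - smoothed_psi_error x)\<^sup>2) \<le> integral {X..2*X} (\<lambda>x. J x + 2 * C'\<^sup>2)"
      using pw by (intro integral_le Henstock_Kurzweil_Integration.integrable_add iJ integrable_continuous_interval continuous_intros cV) (auto simp: J_def)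
    also have "\<dots> = integral {X..2*X} J + integral {X..2*X} (\<lambda>x. 2 * C'\<^sup>2)"
      by (rule Henstock_Kurzweil_Integration.integral_add[OF iJ]) (intro integrable_continuous_interval continuous_intros)
    also have "integral {X..2*X} (\<lambda>x. 2 * C'\<^sup>2) = 2 * C'\<^sup>2 * X" using X1 by simp
    also have "integral {X..2*X} J \<le> 2 * (2 * (C * X\<^sup>2 * (ln (X + 2))\<^sup>2) + 2 * (4 * (C * X\<^sup>2 * (ln (X + 2))\<^sup>2)))"
      using integral_norm_sum_squared_le[OF c1 c2] b1 b2 unfolding J_def by simp
    also have "2 * (2 * (C * X\<^sup>2 * (ln (X + 2))\<^sup>2) + 2 * (4 * (C * X\<^sup>2 * (ln (X + 2))\<^sup>2))) + 2 * C'\<^sup>2 * X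
        \<le> 20 * (C * (X\<^sup>2 * (ln (X + 2))\<^sup>2)) + 2 * C'\<^sup>2 * (X\<^sup>2 * (ln (X + 2))\<^sup>2)"
      using mult_left_mono[OF X2, of "2 * C'\<^sup>2"] by (simp add: mult.assoc)
    also have "\<dots> \<le> D * X\<^sup>2 * (ln (X + 2))\<^sup>2"
    proof -
      have "0 \<le> C'\<^sup>2 * (X\<^sup>2 * (ln (X + 2))\<^sup>2)" by simp
      then show ?thesis unfolding D_def by (simp add: algebra_simps)
    qed
    finally show ?thesis by (simp add: X_def)
  qed
  define E where "E = 100 * C + D"
  have DE: "D \<ge> 0" "100 * C \<le> E" "D \<le> E" "E > 0" using C by (auto simp: D_def E_def add_pos_nonneg)
  show ?case
  proof (rule 1(1)[OF DE(4)])
    fix i j :: nat assume "j < i"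
    have "(100 * C) * Y j * Y i * (ln (Y i + 2))\<^sup>2 \<le> E * Y j * Y i * (ln (Y i + 2))\<^sup>2"
      using Y[of i] Y[of j] DE by (intro mult_right_mono) auto
    then show "integral {2 ^ i..2 * 2 ^ i} (\<lambda>x. (second_diff (2 ^ j) smoothed_psi_error x)\<^sup>2) \<le> E * 2 ^ j * 2 ^ i * (ln (2 ^ i + 2))\<^sup>2"
      using short[OF \<open>j < i\<close>] unfolding Y_def by linarith
  next
    fix i
    have "D * (Y i)\<^sup>2 * (ln (Y i + 2))\<^sup>2 \<le> E * (Y i)\<^sup>2 * (ln (Y i + 2))\<^sup>2"
      using DE by (intro mult_right_mono) auto
    then show "integral {2 ^ i..2 * 2 ^ i} (\<lambda>x. (smoothed_psi_error (x + 1) - smoothed_psi_error x)\<^sup>2) \<le> E * (2 ^ i)\<^sup>2 * (ln (2 ^ i + 2))\<^sup>2"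
      using long[of i] unfolding Y_def by linarith
  qed
qed

subsection \<open>Sums over integers\<close>

definition psi_err :: "nat \<Rightarrow> real" where
  "psi_err n = (\<Sum>k<n. mangoldt (Suc k)) - real n"

lemma psi_err_0 [simp]: "psi_err 0 = 0" by (simp add: psi_err_def)

lemma smoothed_psi_error_on_unit_interval:
  assumes "real n \<le> x" "x \<le> real n + 1"
  shows "smoothed_psi_error x = (\<Sum>k<n. mangoldt (Suc k) * (x - real (Suc k))) - (x - 1)\<^sup>2 / 2"
proof -
  have "(\<Sum>k<n. mangoldt (Suc k) * max 0 (x - real (Suc k))) = (\<Sum>k<n. mangoldt (Suc k) * (x - real (Suc k)))"
    using assms by (intro sum.cong) (auto simp: max_def)
  then show ?thesis
    using smoothed_psi_error_eq[of x "Suc n"] assms by (simp add: max_def)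
qed

text \<open>The left side is the integral of \<open>psi\<close> over \<open>[x, x + 1]\<close> minus
  \<open>x - 1/2\<close>. Only the values of \<open>psi\<close> at \<open>n\<close> and
  \<open>n + 1\<close> occur in that window, weighted by the position of \<open>x\<close>, which
  gives a linear interpolation. The constant 1/2 cancels in a further difference.\<close>

lemma smoothed_psi_error_diff:
  assumes "real n \<le> x" "x \<le> real n + 1"
  shows "smoothed_psi_error (x + 1) - smoothed_psi_error x = (1 - (x - real n)) * psi_err n + (x - real n) * psi_err (Suc n) + 1 / 2"
proof -
  define A where "A = (\<Sum>k<n. mangoldt (Suc k) :: real)"
  define B where "B = (\<Sum>k<n. mangoldt (Suc k) * (x - real (Suc k)))"
  have 1: "smoothed_psi_error x = B - (x - 1)\<^sup>2 / 2"
    using smoothed_psi_error_on_unit_interval[OF assms] by (simp add: B_def)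
  have "(\<Sum>k<n. mangoldt (Suc k) * (x + 1 - real (Suc k))) = (\<Sum>k<n. mangoldt (Suc k) * (x - real (Suc k)) + mangoldt (Suc k))"
    by (intro sum.cong) (auto simp: algebra_simps)
  also have "\<dots> = B + A" by (simp add: sum.distrib A_def B_def)
  finally have 2: "smoothed_psi_error (x + 1) = B + A + mangoldt (Suc n) * (x - real n) - x\<^sup>2 / 2"
    using smoothed_psi_error_on_unit_interval[of "Suc n" "x + 1"] assms by simp
  have 3: "psi_err n = A - real n" "psi_err (Suc n) = A + mangoldt (Suc n) - real n - 1"
    by (simp_all add: psi_err_def A_def)
  show ?thesis unfolding 1 2 3 by (simp add: field_simps power2_eq_square)
qed

lemma has_integral_linear_interpolation_squared:
  "((\<lambda>x. ((1 - (x - c)) * e + (x - c) * e')\<^sup>2) has_integral (e\<^sup>2 + e * e' + e'\<^sup>2) / 3) {c..c + 1 :: real}"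
proof -
  define k where "k = (e' - e)\<^sup>2 / 3"
  have k: "3 * k = (e' - e)\<^sup>2" by (simp add: k_def)
  define F where "F x = e\<^sup>2 * (x - c) + e * (e' - e) * (x - c)\<^sup>2 + k * (x - c) ^ 3" for x
  have "((\<lambda>x. ((1 - (x - c)) * e + (x - c) * e')\<^sup>2) has_integral F (c + 1) - F c) {c..c + 1}"
  proof (rule fundamental_theorem_of_calculus)
    fix x
    have "(F has_real_derivative e\<^sup>2 + e * (e' - e) * (2 * (x - c)) + 3 * k * (x - c)\<^sup>2) (at x within {c..c + 1})"
      unfolding F_def by (auto intro!: derivative_eq_intros)
    also have "e\<^sup>2 + e * (e' - e) * (2 * (x - c)) + 3 * k * (x - c)\<^sup>2 = ((1 - (x - c)) * e + (x - c) * e')\<^sup>2"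
      unfolding k by (simp add: algebra_simps power2_eq_square)
    finally have "(F has_real_derivative ((1 - (x - c)) * e + (x - c) * e')\<^sup>2) (at x within {c..c + 1})" .
    then show "(F has_vector_derivative ((1 - (x - c)) * e + (x - c) * e')\<^sup>2) (at x within {c..c + 1})"
      by (simp add: has_real_derivative_iff_has_vector_derivative)
  qed simp
  moreover have "F (c + 1) - F c = (e\<^sup>2 + e * e' + e'\<^sup>2) / 3"
    by (simp add: F_def k_def field_simps power2_eq_square)
  ultimately show ?thesis by simp
qed

text \<open>On a unit interval the interpolant of \<open>e\<close> and \<open>e'\<close> has mean
  square \<open>(e^2 + e e' + e'^2) / 3\<close>, which exceeds \<open>e^2 / 4\<close> by
  \<open>(e + 2 e')^2 / 12\<close>; hence the factor 4.\<close>

lemma sum_squares_le_integral: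
  fixes e :: "nat \<Rightarrow> real" and g :: "real \<Rightarrow> real"
  assumes "a \<le> b" and g: "continuous_on {real a..real b} g"
    and eq: "\<And>n x. \<lbrakk>a \<le> n; n < b; real n \<le> x; x \<le> real n + 1\<rbrakk> \<Longrightarrow> g x = (1 - (x - real n)) * e n + (x - real n) * e (Suc n)"
  shows "(\<Sum>n=a..<b. (e n)\<^sup>2) \<le> 4 * integral {real a..real b} (\<lambda>x. (g x)\<^sup>2)"
  using assms
proof (induction b rule: dec_induct)
  case base
  then show ?case by simp
next
  case (step b)
  define G where "G = (\<lambda>x. (g x)\<^sup>2)"
  have gi: "G integrable_on {real a..real (Suc b)}"
    unfolding G_def by (intro integrable_continuous_interval continuous_intros step.prems(1))
  have "G integrable_on {real b..real b + 1} \<and> integral {real b..real b + 1} G = ((e b)\<^sup>2 + e b * e (Suc b) + (e (Suc b))\<^sup>2) / 3"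
  proof -
    have "(G has_integral ((e b)\<^sup>2 + e b * e (Suc b) + (e (Suc b))\<^sup>2) / 3) {real b..real b + 1}"
      by (rule has_integral_eq[OF _ has_integral_linear_interpolation_squared])
         (use step.prems(2)[of b] step.hyps in \<open>auto simp: G_def\<close>)
    then show ?thesis by (auto simp: integral_unique)
  qed
  moreover have "(e b)\<^sup>2 \<le> 4 * (((e b)\<^sup>2 + e b * e (Suc b) + (e (Suc b))\<^sup>2) / 3)"
    using zero_le_power2[of "e b + 2 * e (Suc b)"] by (simp add: power2_eq_square algebra_simps)
  ultimately have 1: "(e b)\<^sup>2 \<le> 4 * integral {real b..real (Suc b)} G" by (simp add: add.commute)
  have "(\<Sum>n=a..<b. (e n)\<^sup>2) \<le> 4 * integral {real a..real b} G"
    unfolding G_def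
  proof (rule step.IH)
    show "continuous_on {real a..real b} g" by (rule continuous_on_subset[OF step.prems(1)]) auto
  qed (use step.prems(2) in auto)
  moreover have "integral {real a..real b} G + integral {real b..real (Suc b)} G = integral {real a..real (Suc b)} G"
    using step.hyps by (intro Henstock_Kurzweil_Integration.integral_combine gi) auto
  ultimately show ?case using 1 step.hyps by (simp add: G_def)
qed

lemma ln_dyadic_le: "ln (2 ^ i + 2) \<le> real i + 2"
proof -
  have "(1::real) \<le> 2 ^ i" by simp
  moreover have "(2::real) ^ (i + 2) = 4 * 2 ^ i" by (simp add: power_add)
  ultimately have "(2::real) ^ i + 2 \<le> 2 ^ (i + 2)" by linarith
  then have "ln (2 ^ i + 2) \<le> ln ((2::real) ^ (i + 2))"
    by (subst ln_le_cancel_iff) (auto intro: add_pos_pos)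
  also have "\<dots> = (real i + 2) * ln 2" by (subst ln_realpow) auto
  also have "\<dots> \<le> (real i + 2) * 1" using ln_2_less_1 by (intro mult_left_mono) auto
  finally show ?thesis by simp
qed

lemma psi_err_block_bounds:
  assumes RH: "riemann_hypothesis"
  obtains C where "C > 0"
    "\<And>i j. j < i \<Longrightarrow> (\<Sum>n=2^i..<2^Suc i. (psi_err n - psi_err (n - 2 ^ j))\<^sup>2) \<le> C * 2 ^ j * 2 ^ i * (real i + 2)\<^sup>2"
    "\<And>i. (\<Sum>n=2^i..<2^Suc i. (psi_err n)\<^sup>2) \<le> C * (2 ^ i)\<^sup>2 * (real i + 2)\<^sup>2"
proof (rule smoothed_psi_error_mean_squares[OF RH], goal_cases)
  case (1 C)
  note C = 1(2) and short = 1(3) and long = 1(4)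
  have L: "(ln (2 ^ i + 2))\<^sup>2 \<le> (real i + 2)\<^sup>2" for i
  proof -
    have "(1::real) \<le> 2 ^ i" by simp
    then have "0 \<le> ln (2 ^ i + (2::real))" by (intro ln_ge_zero) linarith
    then show ?thesis by (intro power_mono ln_dyadic_le)
  qed
  show ?case
  \<comment> \<open>Equal to \<open>4 (2 C + 1/2)\<close>, as the second bound requires; the first
    one needs only \<open>4 C\<close>.\<close>
  proof (rule 1(1)[of "8 * C + 2"])
    show "8 * C + 2 > 0" using C by simp
    fix i j :: nat assume ji: "j < i"
    have p: "2 * 2 ^ j \<le> (2::nat) ^ i" using ji power_increasing[of "Suc j" i "2::nat"] by simp
    define X h :: real where "X = 2 ^ i" and "h = 2 ^ j"
    have pr: "2 * h \<le> X" using of_nat_mono[OF p, where 'a = real] by (simp add: X_def h_def)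
    have h1: "h \<ge> 1" by (simp add: h_def)
    define e where "e n = psi_err n - psi_err (n - 2 ^ j)" for n
    define g where "g = second_diff h smoothed_psi_error"
    have "(\<Sum>n=2^i..<2^Suc i. (e n)\<^sup>2) \<le> 4 * integral {real (2 ^ i)..real (2 ^ Suc i)} (\<lambda>x. (g x)\<^sup>2)"
    proof (rule sum_squares_le_integral)
      have "continuous_on {X..2*X} g" unfolding g_def
        by (rule second_diff_continuous[OF smoothed_psi_error_continuous]) (use pr h1 in auto)
      then show "continuous_on {real (2 ^ i)..real (2 ^ Suc i)} g" by (simp add: X_def)
      fix n :: nat and x assume n: "2 ^ i \<le> n" and x: "real n \<le> x" "x \<le> real n + 1"
      \<comment> \<open>As \<open>n \<ge> 2^i \<ge> 2 * 2^j\<close>, nothing is truncated and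
        \<open>real m = real n - h\<close>.\<close>
      define m where "m = n - 2 ^ j"
      have nm: "n = m + 2 ^ j" using n p by (simp add: m_def)
      have m: "real m = real n - h" by (simp add: nm h_def)
      have m': "real m \<le> x - h" "x - h \<le> real m + 1" using x m by auto
      \<comment> \<open>Regrouped into two unit differences; since \<open>h\<close> is an integer
        both interpolate at the same fractional part, and their constants 1/2 cancel.\<close>
      have "g x = (smoothed_psi_error (x + 1) - smoothed_psi_error x) - (smoothed_psi_error (x - h + 1) - smoothed_psi_error (x - h))"
        by (simp add: g_def second_diff_def diff_add_eq)
      also have "\<dots> = (1 - (x - real n)) * (psi_err n - psi_err m) + (x - real n) * (psi_err (Suc n) - psi_err (Suc m))"
        unfolding smoothed_psi_error_diff[OF x] smoothed_psi_error_diff[OF m'] m by (simp add: algebra_simps)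
      finally show "g x = (1 - (x - real n)) * e n + (x - real n) * e (Suc n)"
        by (simp add: e_def nm flip: add_Suc)
    qed simp
    also have "integral {real (2 ^ i)..real (2 ^ Suc i)} (\<lambda>x. (g x)\<^sup>2) \<le> C * 2 ^ j * 2 ^ i * (ln (2 ^ i + 2))\<^sup>2"
      using short[OF ji] by (simp add: g_def h_def)
    also have "4 * (C * 2 ^ j * 2 ^ i * (ln (2 ^ i + 2))\<^sup>2) \<le> 4 * (C * 2 ^ j * 2 ^ i * (real i + 2)\<^sup>2)"
      using C by (intro mult_left_mono L) auto
    also have "\<dots> \<le> (8 * C + 2) * 2 ^ j * 2 ^ i * (real i + 2)\<^sup>2"
    proof -
      have "(4 * C) * (2 ^ j * 2 ^ i * (real i + 2)\<^sup>2) \<le> (8 * C + 2) * (2 ^ j * 2 ^ i * (real i + 2)\<^sup>2)"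
        using C by (intro mult_right_mono) auto
      then show ?thesis by (simp only: mult.assoc)
    qed
    finally show "(\<Sum>n=2^i..<2^Suc i. (psi_err n - psi_err (n - 2 ^ j))\<^sup>2) \<le> (8 * C + 2) * 2 ^ j * 2 ^ i * (real i + 2)\<^sup>2"
      by (simp add: e_def)
  next
    fix i :: nat
    define X :: real where "X = 2 ^ i"
    have X1: "X \<ge> 1" by (simp add: X_def)
    define d where "d x = smoothed_psi_error (x + 1) - smoothed_psi_error x" for x
    have cd: "continuous_on {X..2*X} d" unfolding d_def
      by (intro continuous_intros continuous_on_shift_real[OF smoothed_psi_error_continuous[of X "3*X"]] smoothed_psi_error_continuous)
         (use X1 in auto)
    have i1: "(\<lambda>x. 2 * (d x)\<^sup>2) integrable_on {X..2*X}"
      by (intro integrable_continuous_interval continuous_intros cd)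
    have "(\<Sum>n=2^i..<2^Suc i. (psi_err n)\<^sup>2) \<le> 4 * integral {real (2 ^ i)..real (2 ^ Suc i)} (\<lambda>x. (d x - 1 / 2)\<^sup>2)"
    proof (rule sum_squares_le_integral)
      show "continuous_on {real (2 ^ i)..real (2 ^ Suc i)} (\<lambda>x. d x - 1 / 2)"
        using cd by (intro continuous_intros) (simp add: X_def)
    qed (use smoothed_psi_error_diff in \<open>auto simp: d_def\<close>)
    also have "integral {real (2 ^ i)..real (2 ^ Suc i)} (\<lambda>x. (d x - 1 / 2)\<^sup>2) = integral {X..2*X} (\<lambda>x. (d x - 1 / 2)\<^sup>2)"
      by (simp add: X_def)
    also have "\<dots> \<le> integral {X..2*X} (\<lambda>x. 2 * (d x)\<^sup>2 + 1 / 2)"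
    proof (rule integral_le)
      show "(\<lambda>x. 2 * (d x)\<^sup>2 + 1 / 2) integrable_on {X..2*X}" "(\<lambda>x. (d x - 1 / 2)\<^sup>2) integrable_on {X..2*X}"
        by (intro integrable_continuous_interval continuous_intros cd)+
      fix x
      show "(d x - 1 / 2)\<^sup>2 \<le> 2 * (d x)\<^sup>2 + 1 / 2"
        using zero_le_power2[of "d x + 1 / 2"] by (simp add: power2_eq_square algebra_simps)
    qed
    also have "\<dots> = 2 * integral {X..2*X} (\<lambda>x. (d x)\<^sup>2) + integral {X..2*X} (\<lambda>x. 1 / 2)"
      using Henstock_Kurzweil_Integration.integral_add[OF i1, of "\<lambda>x. 1 / 2"] by (simp add: integrable_const_ivl)
    also have "\<dots> \<le> 2 * (C * X\<^sup>2 * (ln (X + 2))\<^sup>2) + X / 2"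
      using long[of i] X1 by (simp add: d_def X_def)
    also have "\<dots> \<le> 2 * (C * X\<^sup>2 * (real i + 2)\<^sup>2) + X\<^sup>2 * (real i + 2)\<^sup>2 / 2"
    proof (intro add_mono divide_right_mono)
      show "2 * (C * X\<^sup>2 * (ln (X + 2))\<^sup>2) \<le> 2 * (C * X\<^sup>2 * (real i + 2)\<^sup>2)"
        unfolding X_def using C by (intro mult_left_mono L) auto
      have "X * (1 * 1) \<le> (X * X) * (real i + 2)\<^sup>2"
        using X1 by (intro mult_mono) (auto simp: one_le_power)
      then show "X \<le> X\<^sup>2 * (real i + 2)\<^sup>2" by (simp add: power2_eq_square)
    qed simp
    finally have "(\<Sum>n=2^i..<2^Suc i. (psi_err n)\<^sup>2) \<le> 4 * (2 * (C * X\<^sup>2 * (real i + 2)\<^sup>2) + X\<^sup>2 * (real i + 2)\<^sup>2 / 2)" by simp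
    also have "\<dots> = (8 * C + 2) * X\<^sup>2 * (real i + 2)\<^sup>2" by (simp add: algebra_simps)
    finally show "(\<Sum>n=2^i..<2^Suc i. (psi_err n)\<^sup>2) \<le> (8 * C + 2) * (2 ^ i)\<^sup>2 * (real i + 2)\<^sup>2"
      by (simp add: X_def)
  qed
qed

lemma sum_lessThan_dyadic_Suc:
  fixes f :: "nat \<Rightarrow> real"
  shows "(\<Sum>x<2 ^ Suc J. f x) = (\<Sum>x<2 ^ J. f x) + (\<Sum>n=2^J..<2^Suc J. f n)"
  using sum.atLeastLessThan_concat[of 0 "2 ^ J" "2 ^ Suc J" f] by (simp add: atLeast0LessThan)

text \<open>Dyadic blocks are added up. Below \<open>2^(j+1)\<close> the step is comparable with the
  argument, so the bound for \<open>psi_err\<close> itself suffices; from there on each doubling at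
  least doubles the right-hand side, which absorbs the new block.\<close>

lemma psi_err_mean_squares:
  assumes RH: "riemann_hypothesis"
  obtains C where "C > 0"
    "\<And>J j. j < J \<Longrightarrow> (\<Sum>x<2 ^ J. (psi_err x - psi_err (x - 2 ^ j))\<^sup>2) \<le> C * 2 ^ j * 2 ^ J * (real J + 1)\<^sup>2"
    "\<And>J. (\<Sum>x<2 ^ J. (psi_err x)\<^sup>2) \<le> C * (2 ^ J)\<^sup>2 * (real J + 1)\<^sup>2"
proof (rule psi_err_block_bounds[OF RH], goal_cases)
  case (1 C)
  note C = 1(2) and short = 1(3) and long = 1(4)
  have A: "(\<Sum>x<2 ^ J. (psi_err x)\<^sup>2) \<le> C * (2 ^ J)\<^sup>2 * (real J + 1)\<^sup>2" for J
  proof (induction J)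
    case 0
    then show ?case using C by (simp add: lessThan_Suc)
  next
    case (Suc J)
    have "(\<Sum>x<2 ^ Suc J. (psi_err x)\<^sup>2) \<le> C * (2 ^ J)\<^sup>2 * (real J + 1)\<^sup>2 + C * (2 ^ J)\<^sup>2 * (real J + 2)\<^sup>2"
      unfolding sum_lessThan_dyadic_Suc by (intro add_mono Suc.IH long)
    also have "\<dots> \<le> C * (2 ^ J)\<^sup>2 * (real J + 2)\<^sup>2 + C * (2 ^ J)\<^sup>2 * (real J + 2)\<^sup>2"
      using C by (intro add_mono mult_left_mono power_mono) auto
    also have "\<dots> \<le> 4 * (C * (2 ^ J)\<^sup>2 * (real J + 2)\<^sup>2)" using C by simp
    also have "\<dots> = C * (2 ^ Suc J)\<^sup>2 * (real (Suc J) + 1)\<^sup>2" by (simp add: power_mult_distrib add_ac)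
    finally show ?case .
  qed
  have B: "(\<Sum>x<2 ^ J. (psi_err x - psi_err (x - 2 ^ j))\<^sup>2) \<le> (8 * C) * 2 ^ j * 2 ^ J * (real J + 1)\<^sup>2" if "Suc j \<le> J" for j J
    using that
  proof (induction J rule: dec_induct)
    case base
    have "(\<Sum>x<2 ^ Suc j. (psi_err x - psi_err (x - 2 ^ j))\<^sup>2) \<le> (\<Sum>x<2 ^ Suc j. 2 * (psi_err x)\<^sup>2 + 2 * (psi_err (x - 2 ^ j))\<^sup>2)"
    proof (rule sum_mono)
      fix x
      show "(psi_err x - psi_err (x - 2 ^ j))\<^sup>2 \<le> 2 * (psi_err x)\<^sup>2 + 2 * (psi_err (x - 2 ^ j))\<^sup>2"
        using zero_le_power2[of "psi_err x + psi_err (x - 2 ^ j)"] by (simp add: power2_eq_square algebra_simps)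
    qed
    also have "\<dots> = 2 * (\<Sum>x<2 ^ Suc j. (psi_err x)\<^sup>2) + 2 * (\<Sum>x<2 ^ Suc j. (psi_err (x - 2 ^ j))\<^sup>2)"
      by (simp add: sum.distrib sum_distrib_left)
    also have "(\<Sum>x<2 ^ Suc j. (psi_err (x - 2 ^ j))\<^sup>2) = (\<Sum>n=2^j..<2^Suc j. (psi_err (n - 2 ^ j))\<^sup>2)"
      unfolding sum_lessThan_dyadic_Suc by simp
    also have "\<dots> = (\<Sum>x<2 ^ j. (psi_err x)\<^sup>2)"
      by (rule sum.reindex_bij_witness[of _ "\<lambda>x. x + 2 ^ j" "\<lambda>n. n - 2 ^ j"]) auto
    also have "(\<Sum>x<2 ^ j. (psi_err x)\<^sup>2) \<le> (\<Sum>x<2 ^ Suc j. (psi_err x)\<^sup>2)"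
      by (rule sum_mono2) auto
    also have "2 * (\<Sum>x<2 ^ Suc j. (psi_err x)\<^sup>2) + 2 * (\<Sum>x<2 ^ Suc j. (psi_err x)\<^sup>2) \<le> 4 * (C * (2 ^ Suc j)\<^sup>2 * (real (Suc j) + 1)\<^sup>2)"
      using A[of "Suc j"] by simp
    also have "\<dots> = (8 * C) * 2 ^ j * 2 ^ Suc j * (real (Suc j) + 1)\<^sup>2" by (simp add: power2_eq_square)
    finally show ?case by simp
  next
    case (step J)
    have "(\<Sum>x<2 ^ Suc J. (psi_err x - psi_err (x - 2 ^ j))\<^sup>2) \<le> (8 * C) * 2 ^ j * 2 ^ J * (real J + 1)\<^sup>2 + C * 2 ^ j * 2 ^ J * (real J + 2)\<^sup>2"
      unfolding sum_lessThan_dyadic_Suc using step.hyps by (intro add_mono step.IH short) auto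
    also have "\<dots> \<le> (8 * C) * 2 ^ j * 2 ^ J * (real J + 2)\<^sup>2 + (8 * C) * 2 ^ j * 2 ^ J * (real J + 2)\<^sup>2"
      using C by (intro add_mono mult_left_mono mult_right_mono power_mono) auto
    also have "\<dots> = (8 * C) * 2 ^ j * 2 ^ Suc J * (real (Suc J) + 1)\<^sup>2" by (simp add: add_ac)
    finally show ?case .
  qed
  show ?case
  proof (rule 1(1)[of "8 * C"])
    show "8 * C > 0" using C by simp
    fix J
    have "C * ((2 ^ J)\<^sup>2 * (real J + 1)\<^sup>2) \<le> (8 * C) * ((2 ^ J)\<^sup>2 * (real J + 1)\<^sup>2)"
      using C by (intro mult_right_mono) auto
    then show "(\<Sum>x<2 ^ J. (psi_err x)\<^sup>2) \<le> (8 * C) * (2 ^ J)\<^sup>2 * (real J + 1)\<^sup>2"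
      using A[of J] by (simp only: mult.assoc)
  qed (use B in auto)
qed

text \<open>The value 0 at 0 restricts convolutions to positive integers and meets the condition
  \<open>b 0 = 0\<close> of \<open>dyadic_convolution_identity\<close>.\<close>

definition mangoldt_minus_one :: "nat \<Rightarrow> real" where
  "mangoldt_minus_one n = (if n = 0 then 0 else mangoldt n - 1)"

lemma psi_err_eq_sum: "psi_err n = (\<Sum>i\<le>n. mangoldt_minus_one i)"
proof (induction n)
  case (Suc n)
  have "psi_err (Suc n) = psi_err n + (mangoldt (Suc n) - 1)" by (simp add: psi_err_def)
  with Suc show ?case by (simp add: mangoldt_minus_one_def)
qed (simp add: mangoldt_minus_one_def)

lemma dyadic_log_bound:
  assumes N: "N \<ge> 2"
  obtains J where "N < 2 ^ J" "2 ^ J \<le> 2 * real N" "real J + 1 \<le> 5 * ln (real N)"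
proof -
  obtain n where n: "2 ^ n \<le> N" "N < 2 ^ Suc n"
    using ex_power_ivl1[of 2 N] N by auto
  have n': "2 ^ n \<le> real N" using of_nat_mono[OF n(1), where 'a = real] by simp
  have "real n * ln 2 = ln (2 ^ n)" by (simp add: ln_realpow)
  also have "\<dots> \<le> ln (real N)" using n' N by (subst ln_le_cancel_iff) auto
  finally have 1: "real n * ln 2 \<le> ln (real N)" .
  have 2: "ln 2 \<le> ln (real N)" using N by (subst ln_le_cancel_iff) auto
  \<comment> \<open>From \<open>(n + 2) ln 2 \<le> 3 ln N\<close> and \<open>ln 2 \<ge> 3/5\<close>
    one gets \<open>n + 2 \<le> 5 ln N\<close>, where \<open>n + 2\<close> is
    \<open>J + 1\<close>.\<close>
  have "(real n + 2) * (3 / 5) \<le> (real n + 2) * ln 2"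
    using ln2_ge_two_thirds by (intro mult_left_mono) auto
  then have "real (Suc n) + 1 \<le> 5 * ln (real N)" using 1 2 by (simp add: distrib_right)
  moreover have "2 ^ Suc n \<le> 2 * real N" using n' by simp
  ultimately show ?thesis using that n(2) by blast
qed

text \<open>At scale \<open>2^j\<close> the weight \<open>2^(-j)\<close> offsets the factor
  \<open>2^j\<close> of the mean square, so every scale costs the same \<open>K\<close> and the last
  term costs \<open>2 K\<close>; what is lost over a single scale is the number \<open>J\<close> of
  them.\<close>

lemma mangoldt_minus_one_convolution_bound:
  assumes RH: "riemann_hypothesis"
  obtains C where "C > 0" "\<And>N k. 2 \<le> N \<Longrightarrow> k \<le> N \<Longrightarrow>
     \<bar>\<Sum>n\<le>k. \<Sum>i\<le>n. mangoldt_minus_one i * mangoldt_minus_one (n - i)\<bar> \<le> C * real N * ln (real N) ^ 3"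
proof (rule psi_err_mean_squares[OF RH], goal_cases)
  case (1 C)
  note C = 1(2) and short = 1(3) and long = 1(4)
  show ?case
  proof (rule 1(1)[of "2000 * C"])
    show "2000 * C > 0" using C by simp
    fix N k :: nat assume N: "2 \<le> N" and k: "k \<le> N"
    obtain J where J: "N < 2 ^ J" "2 ^ J \<le> 2 * real N" "real J + 1 \<le> 5 * ln (real N)"
      using dyadic_log_bound[OF N] .
    define S where "S = (\<Sum>n\<le>k. \<Sum>i\<le>n. mangoldt_minus_one i * mangoldt_minus_one (n - i))"
    define K where "K = C * 2 ^ J * (real J + 1)\<^sup>2"
    have k2: "k < 2 ^ J" using k J(1) by simp
    have conv: "\<bar>\<Sum>x\<le>k. u x * u (k - x)\<bar> \<le> (\<Sum>x<2 ^ J. (u x)\<^sup>2)" for u :: "nat \<Rightarrow> real"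
      by (rule order_trans[OF abs_self_convolution_le sum_mono2]) (use k2 in auto)
    define Q where "Q j = (\<Sum>x\<le>k. (psi_err x - psi_err (x - 2 ^ j)) * (psi_err (k - x) - psi_err (k - x - 2 ^ j)))" for j :: nat
    define R where "R = (\<Sum>x\<le>k. psi_err x * psi_err (k - x))"
    have "2 * S = (\<Sum>j<J. (1/2) ^ j * Q j) + 2 * (1/2) ^ J * R"
      unfolding S_def Q_def R_def by (rule dyadic_convolution_identity[OF _ psi_err_eq_sum k2]) (simp add: mangoldt_minus_one_def)
    then have "2 * \<bar>S\<bar> = \<bar>(\<Sum>j<J. (1/2) ^ j * Q j) + 2 * (1/2) ^ J * R\<bar>" by simp
    also have "\<dots> \<le> (\<Sum>j<J. \<bar>(1/2) ^ j * Q j\<bar>) + \<bar>2 * (1/2) ^ J * R\<bar>"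
      by (rule order_trans[OF abs_triangle_ineq add_right_mono[OF sum_abs]])
    also have "\<dots> \<le> (\<Sum>j<J. K) + 2 * K"
    proof (intro add_mono sum_mono)
      fix j assume "j \<in> {..<J}"
      then have "\<bar>Q j\<bar> \<le> C * 2 ^ j * 2 ^ J * (real J + 1)\<^sup>2"
        unfolding Q_def using order_trans[OF conv[of "\<lambda>x. psi_err x - psi_err (x - 2 ^ j)"] short] by simp
      then have "(1/2) ^ j * \<bar>Q j\<bar> \<le> (1/2) ^ j * (C * 2 ^ j * 2 ^ J * (real J + 1)\<^sup>2)"
        by (intro mult_left_mono) auto
      also have "\<dots> = K" by (simp add: K_def power_divide)
      finally show "\<bar>(1/2) ^ j * Q j\<bar> \<le> K" by (simp add: abs_mult)
    next
      have "\<bar>R\<bar> \<le> C * (2 ^ J)\<^sup>2 * (real J + 1)\<^sup>2"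
        unfolding R_def by (rule order_trans[OF conv long])
      then have "2 * (1/2) ^ J * \<bar>R\<bar> \<le> 2 * (1/2) ^ J * (C * (2 ^ J)\<^sup>2 * (real J + 1)\<^sup>2)"
        by (intro mult_left_mono) auto
      also have "\<dots> = 2 * K" by (simp add: K_def power_divide power2_eq_square)
      finally show "\<bar>2 * (1/2) ^ J * R\<bar> \<le> 2 * K" by (simp add: abs_mult)
    qed
    also have "\<dots> \<le> 2 * ((real J + 1) * K)"
    proof -
      have "K \<ge> 0" using C by (simp add: K_def)
      then have "0 \<le> real J * K" by simp
      then show ?thesis by (simp add: algebra_simps)
    qed
    finally have "\<bar>S\<bar> \<le> (real J + 1) * K" by simp
    also have "\<dots> = C * 2 ^ J * (real J + 1) ^ 3" by (simp add: K_def power2_eq_square power3_eq_cube)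
    also have "\<dots> \<le> C * (2 * real N) * (5 * ln (real N)) ^ 3"
      using C J by (intro mult_mono power_mono) auto
    also have "\<dots> = 250 * (C * real N * ln (real N) ^ 3)" by (simp add: power_mult_distrib)
    also have "\<dots> \<le> 2000 * (C * real N * ln (real N) ^ 3)"
      using C N by (intro mult_right_mono) auto
    finally show "\<bar>S\<bar> \<le> 2000 * C * real N * ln (real N) ^ 3" by (simp only: mult.assoc)
  qed
qed

section \<open>The Goldbach sum and the exponential weights\<close>

lemma chebyshev_psi_eq: "chebyshev_psi (real n) = (\<Sum>i\<le>n. mangoldt i)"
proof -
  have "chebyshev_psi (real n) = (\<Sum>i\<in>{1..n}. mangoldt i)"
    unfolding chebyshev_psi_def by (rule sum.cong) auto
  also have "\<dots> = (\<Sum>i\<le>n. mangoldt i)" by (rule sum.mono_neutral_left) (auto simp: Suc_le_eq)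
  finally show ?thesis .
qed

text \<open>The trivial estimate is enough: \<open>psi\<close> enters the final sum only as a
  correction, where a factor \<open>ln N\<close> is affordable.\<close>

lemma chebyshev_psi_le:
  assumes "k \<le> N"
  shows "chebyshev_psi (real k) \<le> real N * ln (real N)"
proof -
  have "chebyshev_psi (real k) = (\<Sum>i\<in>{1..k}. mangoldt i)"
    unfolding chebyshev_psi_def by (rule sum.cong) auto
  also have "\<dots> \<le> (\<Sum>i\<in>{1..N}. mangoldt i)"
    using assms by (intro sum_mono2) (auto simp: mangoldt_nonneg)
  also have "\<dots> \<le> (\<Sum>i\<in>{1..N}. ln (real N))"
  proof (rule sum_mono)
    fix i assume i: "i \<in> {1..N}"
    then have "mangoldt i \<le> ln (real i)" by (intro mangoldt_le) auto
    also have "\<dots> \<le> ln (real N)" using i by (subst ln_le_cancel_iff) auto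
    finally show "mangoldt i \<le> ln (real N)" .
  qed
  finally show ?thesis by simp
qed

lemma goldbach_R_eq: "goldbach_R n = (\<Sum>i\<le>n. mangoldt i * mangoldt (n - i))"
proof -
  have "goldbach_R n = (\<Sum>i\<in>{1..<n}. mangoldt i * mangoldt (n - i))"
    unfolding goldbach_R_def
    by (rule sum.reindex_bij_witness[of _ "\<lambda>i. (i, n - i)" fst]) auto
  also have "\<dots> = (\<Sum>i\<le>n. mangoldt i * mangoldt (n - i))"
    by (rule sum.mono_neutral_left) (auto simp: Suc_le_eq not_less)
  finally show ?thesis .
qed

text \<open>The convolution of \<open>mangoldt\<close> with the indicator \<open>q\<close> of the
  positive integers stops before \<open>n\<close> and gives \<open>psi(n) - mangoldt n\<close>,
  while \<open>q\<close> convolved with itself counts \<open>n - 1\<close> pairs; these two shifts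
  produce the correction \<open>- 2 mangoldt n + 1\<close>.\<close>

lemma goldbach_error_eq:
  assumes n: "n \<ge> 1"
  shows "goldbach_R n - (2 * chebyshev_psi (real n) - real n)
    = (\<Sum>i\<le>n. mangoldt_minus_one i * mangoldt_minus_one (n - i)) - 2 * mangoldt n + 1"
proof -
  define q :: "nat \<Rightarrow> real" where "q i = (if i = 0 then 0 else 1)" for i
  have b: "mangoldt_minus_one i = mangoldt i - q i" for i by (simp add: mangoldt_minus_one_def q_def)
  have s: "(\<Sum>i\<le>n. f (n - i)) = (\<Sum>i\<le>n. f i)" for f :: "nat \<Rightarrow> real"
    using sum.nat_diff_reindex[of f "Suc n"] by (simp add: lessThan_Suc_atMost)
  have mq: "(\<Sum>i\<le>n. mangoldt i * q (n - i)) = chebyshev_psi (real n) - mangoldt n"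
  proof -
    have "(\<Sum>i\<le>n. mangoldt i * q (n - i)) = (\<Sum>i<n. mangoldt i)"
      using n by (intro sum.mono_neutral_cong_right) (auto simp: q_def)
    also have "\<dots> = (\<Sum>i\<le>n. mangoldt i) - mangoldt n" by (simp flip: lessThan_Suc_atMost)
    finally show ?thesis by (simp add: chebyshev_psi_eq)
  qed
  have qm: "(\<Sum>i\<le>n. q i * mangoldt (n - i)) = (\<Sum>i\<le>n. mangoldt i * q (n - i))"
    using s[of "\<lambda>i. mangoldt i * q (n - i)"] by (simp add: mult.commute)
  have qq: "(\<Sum>i\<le>n. q i * q (n - i)) = real n - 1"
  proof -
    have "(\<Sum>i\<le>n. q i * q (n - i)) = (\<Sum>i\<in>{1..<n}. 1)"
      by (intro sum.mono_neutral_cong_right) (auto simp: q_def)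
    then show ?thesis using n by simp
  qed
  have "(\<Sum>i\<le>n. mangoldt_minus_one i * mangoldt_minus_one (n - i))
    = (\<Sum>i\<le>n. mangoldt i * mangoldt (n - i)) - (\<Sum>i\<le>n. mangoldt i * q (n - i)) - (\<Sum>i\<le>n. q i * mangoldt (n - i)) + (\<Sum>i\<le>n. q i * q (n - i))"
    unfolding b by (simp add: algebra_simps sum.distrib sum_subtractf)
  then show ?thesis unfolding qm mq qq goldbach_R_eq[symmetric] by simp
qed

text \<open>Abel summation in inductive form: the gap between the weighted sum and the last partial
  sum times \<open>w n\<close> grows by at most \<open>B (w n - w (n + 1))\<close> per step, so it
  never exceeds \<open>B\<close> times the total decrease of \<open>w\<close>.\<close>

lemma weighted_sum_bound:
  fixes c w :: "nat \<Rightarrow> real"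
  assumes w: "antimono w" "\<And>n. 0 \<le> w n" and B: "\<And>n. n \<le> k \<Longrightarrow> \<bar>\<Sum>i\<le>n. c i\<bar> \<le> B"
  shows "\<bar>\<Sum>i\<le>k. c i * w i\<bar> \<le> B * w 0"
proof -
  have *: "\<bar>(\<Sum>i\<le>n. c i * w i) - (\<Sum>i\<le>n. c i) * w n\<bar> \<le> B * (w 0 - w n)" if "n \<le> k" for n
    using that
  proof (induction n)
    case (Suc n)
    define s where "s = (\<Sum>i\<le>n. c i)"
    have d: "w (Suc n) \<le> w n" using w(1) by (simp add: antimonoD)
    have "(\<Sum>i\<le>Suc n. c i * w i) - (\<Sum>i\<le>Suc n. c i) * w (Suc n) = ((\<Sum>i\<le>n. c i * w i) - s * w n) + s * (w n - w (Suc n))"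
      by (simp add: s_def algebra_simps)
    also have "\<bar>\<dots>\<bar> \<le> B * (w 0 - w n) + B * (w n - w (Suc n))"
    proof (rule order_trans[OF abs_triangle_ineq add_mono])
      show "\<bar>(\<Sum>i\<le>n. c i * w i) - s * w n\<bar> \<le> B * (w 0 - w n)" using Suc by (simp add: s_def)
      show "\<bar>s * (w n - w (Suc n))\<bar> \<le> B * (w n - w (Suc n))"
        unfolding abs_mult using B[of n] Suc.prems d by (intro mult_mono) (auto simp: s_def)
    qed
    finally show ?case by (simp add: algebra_simps)
  qed simp
  have "\<bar>(\<Sum>i\<le>k. c i) * w k\<bar> \<le> B * w k"
    unfolding abs_mult using B[of k] w(2)[of k] by (intro mult_mono) auto
  with *[of k] show ?thesis by (simp add: algebra_simps)
qed

theorem theorem2: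
  assumes "riemann_hypothesis"
  shows "\<exists>C::real. C > 0 \<and> (\<forall>N::nat. N \<ge> 2 \<longrightarrow>
    (MAX y\<in>{2..real N}.
       \<bar>\<Sum>n\<in>{n::nat. 1 \<le> n \<and> real n \<le> y}.
          (goldbach_R n - (2 * chebyshev_psi (real n) - real n)) * exp (- real n / real N)\<bar>)
    \<le> C * real N * ln (real N) ^ 3)"
proof (rule mangoldt_minus_one_convolution_bound[OF assms], goal_cases)
  case (1 C)
  note conv = 1(2) and C = 1(1)
  define c where "c n = goldbach_R n - (2 * chebyshev_psi (real n) - real n)" for n :: nat
  \<comment> \<open>Lets the sums start at 0, as in \<open>weighted_sum_bound\<close>.\<close>
  have c0: "c 0 = 0" using chebyshev_psi_eq[of 0] by (simp add: c_def goldbach_R_eq)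
  show ?case
  \<comment> \<open>The convolution accounts for \<open>C\<close>; the corrections
    \<open>2 psi(k)\<close> and \<open>k\<close> add at most 8 and 4 times \<open>N L^3\<close>,
    well within 24.\<close>
  proof (intro exI[of _ "C + 24"] conjI allI impI)
    show "C + 24 > 0" using C by simp
    fix N :: nat assume N: "N \<ge> 2"
    define L where "L = ln (real N)"
    define f where "f k = \<bar>\<Sum>n\<le>k. c n * exp (- real n / real N)\<bar>" for k :: nat
    have "2 / 3 \<le> L" unfolding L_def
      by (rule order_trans[OF ln2_ge_two_thirds]) (use N in \<open>subst ln_le_cancel_iff, auto\<close>)
    \<comment> \<open>As \<open>L \<ge> 2/3\<close>, both \<open>L^2\<close> and \<open>L^3\<close>
      exceed 1/4, so lower powers of \<open>L\<close> are absorbed by \<open>4 L^3\<close>.\<close>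
    have L1: "L \<le> 4 * L ^ 3" and L3: "1 \<le> 4 * L ^ 3"
    proof -
      have "(2 / 3) ^ 2 \<le> L ^ 2" using \<open>2 / 3 \<le> L\<close> by (intro power_mono) auto
      then have "4 / 9 \<le> L ^ 2" by (simp add: power2_eq_square)
      then have "L * (1 / 4) \<le> L * L ^ 2" using \<open>2 / 3 \<le> L\<close> by (intro mult_left_mono) auto
      then show "L \<le> 4 * L ^ 3" by (simp add: power3_eq_cube power2_eq_square)
      have "(2 / 3) ^ 3 \<le> L ^ 3" using \<open>2 / 3 \<le> L\<close> by (intro power_mono) auto
      then show "1 \<le> 4 * L ^ 3" by (simp add: power3_eq_cube)
    qed
    have part: "\<bar>\<Sum>n\<le>k. c n\<bar> \<le> (C + 24) * real N * L ^ 3" if k: "k \<le> N" for k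
    proof -
      define S where "S = (\<Sum>n\<le>k. \<Sum>i\<le>n. mangoldt_minus_one i * mangoldt_minus_one (n - i))"
      have "(\<Sum>n\<le>k. c n) = S - 2 * chebyshev_psi (real k) + real k"
      proof -
        have "c n = (\<Sum>i\<le>n. mangoldt_minus_one i * mangoldt_minus_one (n - i)) - 2 * mangoldt n + (if n = 0 then 0 else 1)" for n
          using goldbach_error_eq[of n] c0 by (cases "n = 0") (auto simp: c_def mangoldt_minus_one_def)
        moreover have "(\<Sum>n\<le>k. if n = 0 then 0 else 1) = real k" by (induction k) auto
        ultimately show ?thesis
          by (simp only: sum.distrib sum_subtractf S_def chebyshev_psi_eq sum_distrib_left)
      qed
      moreover have "\<bar>S\<bar> \<le> C * real N * L ^ 3" unfolding S_def L_def by (rule conv[OF N k])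
      moreover have "0 \<le> chebyshev_psi (real k)" unfolding chebyshev_psi_eq by (intro sum_nonneg mangoldt_nonneg)
      moreover have "chebyshev_psi (real k) \<le> real N * (4 * L ^ 3)"
        using chebyshev_psi_le[OF k] mult_left_mono[OF L1, of "real N"] by (simp add: L_def)
      moreover have "real k \<le> real N * (4 * L ^ 3)"
        using k mult_left_mono[OF L3, of "real N"] by linarith
      moreover have "0 \<le> real N * L ^ 3" using \<open>2 / 3 \<le> L\<close> by simp
      ultimately show ?thesis by (simp add: distrib_right)
    qed
    have fk: "f k \<le> (C + 24) * real N * L ^ 3" if "k \<le> N" for k
    proof -
      have "f k \<le> (C + 24) * real N * L ^ 3 * exp (- real 0 / real N)"
        unfolding f_def using N that
        by (intro weighted_sum_bound part) (auto simp: antimono_def divide_right_mono)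
      then show ?thesis by simp
    qed
    \<comment> \<open>The sum sees only the integer part of \<open>y\<close>, so it takes finitely
      many values on the interval; without this the value of \<open>MAX\<close> over an infinite set
      would be unspecified.\<close>
    have e: "\<bar>\<Sum>n\<in>{n::nat. 1 \<le> n \<and> real n \<le> y}. (goldbach_R n - (2 * chebyshev_psi (real n) - real n)) * exp (- real n / real N)\<bar>
        = f (nat \<lfloor>y\<rfloor>)" if y: "y \<in> {2..real N}" for y
    proof -
      have "(\<Sum>n\<in>{n::nat. 1 \<le> n \<and> real n \<le> y}. c n * exp (- real n / real N)) = (\<Sum>n\<le>nat \<lfloor>y\<rfloor>. c n * exp (- real n / real N))"
      proof (rule sum.mono_neutral_left)
        show "{n. 1 \<le> n \<and> real n \<le> y} \<subseteq> {..nat \<lfloor>y\<rfloor>}" by (auto simp: le_nat_floor)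
        show "\<forall>i\<in>{..nat \<lfloor>y\<rfloor>} - {n. 1 \<le> n \<and> real n \<le> y}. c i * exp (- real i / real N) = 0"
        proof
          fix i assume "i \<in> {..nat \<lfloor>y\<rfloor>} - {n. 1 \<le> n \<and> real n \<le> y}"
          moreover have "real (nat \<lfloor>y\<rfloor>) \<le> y" using y by simp
          ultimately have "i = 0" by (auto; linarith)
          then show "c i * exp (- real i / real N) = 0" using c0 by simp
        qed
      qed simp
      then show ?thesis by (simp add: f_def c_def)
    qed
    have lt: "nat \<lfloor>y\<rfloor> \<le> N" if "y \<in> {2..real N}" for y
      using that by (auto simp: nat_le_iff floor_le_iff)
    have "(MAX y\<in>{2..real N}. f (nat \<lfloor>y\<rfloor>)) \<le> (C + 24) * real N * L ^ 3"
    proof (rule Max.boundedI)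
      have "(\<lambda>y. f (nat \<lfloor>y\<rfloor>)) ` {2..real N} \<subseteq> f ` {..N}" using lt by auto
      then show "finite ((\<lambda>y. f (nat \<lfloor>y\<rfloor>)) ` {2..real N})" by (rule finite_subset) simp
      show "(\<lambda>y. f (nat \<lfloor>y\<rfloor>)) ` {2..real N} \<noteq> {}" using N by simp
    qed (use fk lt in auto)
    moreover have "(\<lambda>y. \<bar>\<Sum>n\<in>{n::nat. 1 \<le> n \<and> real n \<le> y}. (goldbach_R n - (2 * chebyshev_psi (real n) - real n)) * exp (- real n / real N)\<bar>) ` {2..real N}
        = (\<lambda>y. f (nat \<lfloor>y\<rfloor>)) ` {2..real N}"
      using e by (intro image_cong) auto
    ultimately show "(MAX y\<in>{2..real N}.
       \<bar>\<Sum>n\<in>{n::nat. 1 \<le> n \<and> real n \<le> y}.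
          (goldbach_R n - (2 * chebyshev_psi (real n) - real n)) * exp (- real n / real N)\<bar>)
      \<le> (C + 24) * real N * ln (real N) ^ 3"
      by (simp only: L_def)
  qed
qed

end
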